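(* Let $\frac12<H<1$. For all $t\ge0$ and $a\in\mathbb R$, $$ \mathcal C^H_t(a)=\lim_{\varepsilon\downarrow0}\int_{\mathbb R}1_{\{|x-a|\ge\varepsilon\}}\frac{\mathscr L^H(x,t)}{x-a}\,dx\ \ \text{in }L^2(\Omega),\qquad\text{i.e.}\quad \mathcal C^H_t(a)=\mathrm{v.p.}\int_{\mathbb R}\frac{\mathscr L^H(x,t)}{x-a}\,dx=\pi\big(\mathscr H\mathscr L^H(\cdot,t)\big)(a), $$ where $\mathcal C^H_t(a)=2\big(F(B^H_t-a)-F(-a)-\int_0^t\log|B^H_s-a|\,\delta B^H_s\big)$ with $F(x)=x\log|x|-x$, and the following fractional version of Yamada's formula holds: $$ (B^H_t-a)\log|B^H_t-a|-(B^H_t-a)=-a\log|a|+a+\int_0^t\log|B^H_s-a|\,\delta B^H_s+\frac12\,\mathrm{v.p.}\int_{\mathbb R}\frac{\mathscr L^H(x,t)}{x-a}\,dx . $$ Here $0\log 0=0$ and $\mathscr Hf(a)=\frac1\pi\lim_{\varepsilon\downarrow0}\int_{\{|x-a|\ge\varepsilon\}}\frac{f(x)}{x-a}\,dx$.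
   Context: $B^H=\{B^H_t\}$ is a fractional Brownian motion: a centered Gaussian process with $E[B^H_tB^H_s]=\frac12(t^{2H}+s^{2H}-|t-s|^{2H})$; $T>0$ is an arbitrary time horizon and all times lie in $[0,T]$. $\mathcal L^H(x,t)$ is the jointly continuous local time of $B^H$, characterized by $\int_0^t\Phi(B^H_s)ds=\int_{\mathbb R}\Phi(x)\mathcal L^H(x,t)dx$ for nonnegative bounded Borel $\Phi$, and $\mathscr L^H(x,t)=2H\int_0^ts^{2H-1}\mathcal L^H(x,ds)$ is the weighted local time (Hölder continuous with compact support in $x$). $\mathcal H$ is the completion of the span of the indicators $1_{[0,t]}$ for $\langle 1_{[0,s]},1_{[0,t]}\rangle_{\mathcal H}=E[B^H_sB^H_t]$, and $\varphi\mapsto B^H(\varphi)$ is the isometric extension of $1_{[0,t]}\mapsto B^H_t$. For smooth functionals $G=f(B^H(\varphi_1),\dots,B^H(\varphi_n))$, $f\in C_b^\infty(\mathbb R^n)$, $D^HG=\sum_j\partial_jf(\cdot)\varphi_j$. The divergence $\delta^H$ is its adjoint: $u\in L^2(\Omega;\mathcal H)$ is in $\mathrm{Dom}(\delta^H)$ if $E|\langle D^HG,u\rangle_{\mathcal H}|\le c\|G\|_{L^2(\Omega)}$ for all smooth $G$, and then $E[G\delta^H(u)]=E\langle D^HG,u\rangle_{\mathcal H}$. The Skorohod integral is $\int_0^tu_s\,\delta B^H_s=\delta^H(u1_{[0,t]})$. For $\frac12<H<1$ the integral $\int_0^t\log|B^H_s-a|\,\delta B^H_s$ exists in $L^2(\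Omega)$.
   Formalization: The domain of the divergence is taken with |E⟨D^H G,u⟩| ≤ c‖G‖ instead of the printed E|⟨D^H G,u⟩| ≤ c‖G‖, since the printed condition fails for every nonzero u (take G = sin(kB^H(φ)), k→∞), so the Skorohod integral would not exist. *)

theory Defs
  imports "HOL-Probability.Probability"
begin

section \<open>Fractional Brownian motion and its local time\<close>

definition centered_gaussian :: "'a measure \<Rightarrow> ('a \<Rightarrow> real) \<Rightarrow> bool" where
  "centered_gaussian M X \<longleftrightarrow>
     (\<exists>\<sigma>>0. distributed M lborel X (normal_density 0 \<sigma>)) \<or>
     (X \<in> borel_measurable M \<and> (AE \<omega> in M. X \<omega> = 0))"

text \<open>As usual, fractional Brownian motion means a version with almost surely continuous paths.\<close>

definition fractional_brownian_motion ::
    "'a measure \<Rightarrow> real \<Rightarrow> real \<Rightarrow> (real \<Rightarrow> 'a \<Rightarrow> real) \<Rightarrow> bool" where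
  "fractional_brownian_motion M T H B \<longleftrightarrow>
     (\<forall>t\<in>{0..T}. B t \<in> borel_measurable M) \<and>
     (\<forall>I c. finite I \<and> I \<subseteq> {0..T} \<longrightarrow> centered_gaussian M (\<lambda>\<omega>. \<Sum>t\<in>I. c t * B t \<omega>)) \<and>
     (\<forall>t\<in>{0..T}. \<forall>s\<in>{0..T}. integral\<^sup>L M (\<lambda>\<omega>. B t \<omega> * B s \<omega>) =
        (t powr (2*H) + s powr (2*H) - \<bar>t - s\<bar> powr (2*H)) / 2) \<and>
     (AE \<omega> in M. continuous_on {0..T} (\<lambda>t. B t \<omega>))"

definition joint_local_time ::
    "'a measure \<Rightarrow> real \<Rightarrow> (real \<Rightarrow> 'a \<Rightarrow> real) \<Rightarrow> (real \<Rightarrow> real \<Rightarrow> 'a \<Rightarrow> real) \<Rightarrow> bool" where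
  "joint_local_time M T B L \<longleftrightarrow>
     (\<forall>x. \<forall>t\<in>{0..T}. L x t \<in> borel_measurable M) \<and>
     (AE \<omega> in M.
        continuous_on (UNIV \<times> {0..T}) (\<lambda>(x, t). L x t \<omega>) \<and>
        (\<forall>t\<in>{0..T}. \<forall>\<Phi>::real \<Rightarrow> real.
           \<Phi> \<in> borel_measurable borel \<and> (\<forall>x. 0 \<le> \<Phi> x) \<and> bounded (range \<Phi>) \<longrightarrow>
           (LINT s:{0..t}|lborel. \<Phi> (B s \<omega>)) = (LINT x|lborel. \<Phi> x * L x t \<omega>)))"

text \<open>The integral against \<open>L x (ds) \<omega>\<close> is the Lebesgue--Stieltjes integral of the nondecreasing
  continuous function \<open>s \<mapsto> L x s \<omega>\<close> on \<open>[0,T]\<close>, extended to the real line by constants.\<close>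

definition weighted_local_time ::
    "real \<Rightarrow> real \<Rightarrow> (real \<Rightarrow> real \<Rightarrow> 'a \<Rightarrow> real) \<Rightarrow> real \<Rightarrow> real \<Rightarrow> 'a \<Rightarrow> real" where
  "weighted_local_time T H L x t \<omega> =
     2 * H * (LINT s:{0..t}|interval_measure (\<lambda>s. L x (max 0 (min s T)) \<omega>). s powr (2*H - 1))"


section \<open>The Hilbert space of indicators\<close>

text \<open>The completion of the span of the indicators is described up to isometric isomorphism: a
  complete inner product space with a family \<open>e t\<close>, standing for the indicator of \<open>[0,t]\<close>, that has
  the prescribed inner products and a dense span.\<close>

definition indicator_completion ::
    "'a measure \<Rightarrow> real \<Rightarrow> (real \<Rightarrow> 'a \<Rightarrow> real) \<Rightarrow>
     (real \<Rightarrow> 'h::{real_inner, complete_space, second_countable_topology}) \<Rightarrow> bool" where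
  "indicator_completion M T B e \<longleftrightarrow>
     (\<forall>s\<in>{0..T}. \<forall>t\<in>{0..T}. inner (e s) (e t) = integral\<^sup>L M (\<lambda>\<omega>. B s \<omega> * B t \<omega>)) \<and>
     closure (span (e ` {0..T})) = UNIV"

definition isometric_extension ::
    "'a measure \<Rightarrow> real \<Rightarrow> (real \<Rightarrow> 'a \<Rightarrow> real) \<Rightarrow> (real \<Rightarrow> 'h::real_inner) \<Rightarrow> ('h \<Rightarrow> 'a \<Rightarrow> real) \<Rightarrow> bool"
  where
  "isometric_extension M T B e W \<longleftrightarrow>
     (\<forall>\<phi>. W \<phi> \<in> borel_measurable M \<and> integrable M (\<lambda>\<omega>. (W \<phi> \<omega>)\<^sup>2)) \<and>
     (\<forall>a b \<phi> \<psi>. AE \<omega> in M. W (a *\<^sub>R \<phi> + b *\<^sub>R \<psi>) \<omega> = a * W \<phi> \<omega> + b * W \<psi> \<omega>) \<and>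
     (\<forall>\<phi> \<psi>. integral\<^sup>L M (\<lambda>\<omega>. W \<phi> \<omega> * W \<psi> \<omega>) = inner \<phi> \<psi>) \<and>
     (\<forall>t\<in>{0..T}. AE \<omega> in M. W (e t) \<omega> = B t \<omega>)"

text \<open>For \<open>H > 1/2\<close> the inner product of two step functions on \<open>[0,T]\<close> is their integral against the
  kernel \<open>H (2H - 1) \<bar>s - r\<bar> powr (2H - 2)\<close>. A measurable function \<open>\<phi>\<close> for which the double
  integral of its absolute value against the kernel is finite is identified with the element \<open>h\<close>
  whose inner products with the indicators are given by the same formula; \<open>h\<close> is unique because
  the indicators have a dense span.\<close>

definition kernel_inner :: "real \<Rightarrow> real \<Rightarrow> (real \<Rightarrow> real) \<Rightarrow> (real \<Rightarrow> real) \<Rightarrow> real" where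
  "kernel_inner T H \<phi> \<psi> =
     H * (2*H - 1) *
     (LINT s:{0..T}|lborel. LINT r:{0..T}|lborel. \<phi> s * \<psi> r * \<bar>s - r\<bar> powr (2*H - 2))"

definition kernel_integrable :: "real \<Rightarrow> real \<Rightarrow> (real \<Rightarrow> real) \<Rightarrow> bool" where
  "kernel_integrable T H \<phi> \<longleftrightarrow>
     set_borel_measurable lborel {0..T} \<phi> \<and>
     set_integrable (lborel \<Otimes>\<^sub>M lborel) ({0..T} \<times> {0..T})
       (\<lambda>(s, r). \<bar>\<phi> s\<bar> * \<bar>\<phi> r\<bar> * \<bar>s - r\<bar> powr (2*H - 2))"

definition represents ::
    "real \<Rightarrow> real \<Rightarrow> (real \<Rightarrow> 'h::real_inner) \<Rightarrow> (real \<Rightarrow> real) \<Rightarrow> 'h \<Rightarrow> bool" where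
  "represents T H e \<phi> h \<longleftrightarrow>
     kernel_integrable T H \<phi> \<and>
     (\<forall>r\<in>{0..T}. inner h (e r) = kernel_inner T H \<phi> (indicator {0..r}))"


section \<open>Malliavin derivative, divergence and Skorohod integral\<close>

text \<open>Functions on \<open>\<real>\<^sup>n\<close>, with \<open>n\<close> varying, are functions of a sequence that depend only on its
  first \<open>n\<close> entries.\<close>

definition partial_deriv :: "nat \<Rightarrow> ((nat \<Rightarrow> real) \<Rightarrow> real) \<Rightarrow> (nat \<Rightarrow> real) \<Rightarrow> real" where
  "partial_deriv i f x = deriv (\<lambda>s. f (x(i := s))) (x i)"

definition Cb_infinity :: "nat \<Rightarrow> ((nat \<Rightarrow> real) \<Rightarrow> real) \<Rightarrow> bool" where
  "Cb_infinity n f \<longleftrightarrow>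
     (\<forall>x y. (\<forall>i<n. x i = y i) \<longrightarrow> f x = f y) \<and>
     (\<forall>js. set js \<subseteq> {..<n} \<longrightarrow>
        (let g = foldr partial_deriv js f in
           continuous_on UNIV g \<and> bounded (range g) \<and>
           (\<forall>i<n. \<forall>x. (\<lambda>s. g (x(i := s))) differentiable (at (x i)))))"

definition smooth_functional ::
    "('h \<Rightarrow> 'a \<Rightarrow> real) \<Rightarrow> ((nat \<Rightarrow> real) \<Rightarrow> real) \<Rightarrow> (nat \<Rightarrow> 'h) \<Rightarrow> 'a \<Rightarrow> real" where
  "smooth_functional W f \<phi> \<omega> = f (\<lambda>j. W (\<phi> j) \<omega>)"

definition malliavin_deriv ::
    "('h \<Rightarrow> 'a \<Rightarrow> real) \<Rightarrow> nat \<Rightarrow> ((nat \<Rightarrow> real) \<Rightarrow> real) \<Rightarrow> (nat \<Rightarrow> 'h::real_vector) \<Rightarrow> 'a \<Rightarrow> 'h" where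
  "malliavin_deriv W n f \<phi> \<omega> = (\<Sum>j<n. partial_deriv j f (\<lambda>i. W (\<phi> i) \<omega>) *\<^sub>R \<phi> j)"

text \<open>The bound is on \<open>\<bar>E\<langle>DG,u\<rangle>\<bar>\<close>, with the modulus outside the expectation, as is needed for an
  adjoint: with the modulus inside it fails already for constant \<open>u = \<phi> \<noteq> 0\<close>, as
  \<open>G = sin (k * W \<phi>)\<close> shows for \<open>k \<rightarrow> \<infinity>\<close>.\<close>

definition divergence_domain ::
    "'a measure \<Rightarrow> ('h \<Rightarrow> 'a \<Rightarrow> real) \<Rightarrow> ('a \<Rightarrow> 'h::{real_inner, second_countable_topology}) set" where
  "divergence_domain M W =
     {u. u \<in> borel_measurable M \<and> integrable M (\<lambda>\<omega>. (norm (u \<omega>))\<^sup>2) \<and>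
         (\<exists>c. \<forall>n f \<phi>. Cb_infinity n f \<longrightarrow>
            \<bar>integral\<^sup>L M (\<lambda>\<omega>. inner (malliavin_deriv W n f \<phi> \<omega>) (u \<omega>))\<bar>
              \<le> c * sqrt (integral\<^sup>L M (\<lambda>\<omega>. (smooth_functional W f \<phi> \<omega>)\<^sup>2)))}"

definition generated_algebra ::
    "'a measure \<Rightarrow> real \<Rightarrow> (real \<Rightarrow> 'a \<Rightarrow> real) \<Rightarrow> 'a measure" where
  "generated_algebra M T B =
     sigma (space M) {B s -` A \<inter> space M | s A. s \<in> {0..T} \<and> A \<in> sets borel}"

text \<open>The duality with smooth functionals sees only the \<open>\<sigma>\<close>-algebra generated by \<open>B\<close>, so
  measurability with respect to it is needed for the divergence to be unique almost surely.\<close>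

definition is_divergence ::
    "'a measure \<Rightarrow> real \<Rightarrow> (real \<Rightarrow> 'a \<Rightarrow> real) \<Rightarrow> ('h::real_inner \<Rightarrow> 'a \<Rightarrow> real) \<Rightarrow>
     ('a \<Rightarrow> 'h) \<Rightarrow> ('a \<Rightarrow> real) \<Rightarrow> bool" where
  "is_divergence M T B W u Z \<longleftrightarrow>
     Z \<in> borel_measurable (generated_algebra M T B) \<and>
     integrable M (\<lambda>\<omega>. (Z \<omega>)\<^sup>2) \<and>
     (\<forall>n f \<phi>. Cb_infinity n f \<longrightarrow>
        integral\<^sup>L M (\<lambda>\<omega>. smooth_functional W f \<phi> \<omega> * Z \<omega>) =
        integral\<^sup>L M (\<lambda>\<omega>. inner (malliavin_deriv W n f \<phi> \<omega>) (u \<omega>)))"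

definition process_element ::
    "'a measure \<Rightarrow> real \<Rightarrow> real \<Rightarrow> (real \<Rightarrow> 'h::real_inner) \<Rightarrow> (real \<Rightarrow> 'a \<Rightarrow> real) \<Rightarrow> real \<Rightarrow>
     ('a \<Rightarrow> 'h) \<Rightarrow> bool" where
  "process_element M T H e v t u \<longleftrightarrow>
     (AE \<omega> in M. represents T H e (\<lambda>s. v s \<omega> * indicator {0..t} s) (u \<omega>))"

definition skorohod_integrable ::
    "'a measure \<Rightarrow> real \<Rightarrow> real \<Rightarrow> (real \<Rightarrow> 'h::{real_inner, second_countable_topology}) \<Rightarrow>
     ('h \<Rightarrow> 'a \<Rightarrow> real) \<Rightarrow> (real \<Rightarrow> 'a \<Rightarrow> real) \<Rightarrow> real \<Rightarrow> bool" where
  "skorohod_integrable M T H e W v t \<longleftrightarrow> (\<exists>u \<in> divergence_domain M W. process_element M T H e v t u)"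

definition skorohod_integral ::
    "'a measure \<Rightarrow> real \<Rightarrow> real \<Rightarrow> (real \<Rightarrow> 'a \<Rightarrow> real) \<Rightarrow>
     (real \<Rightarrow> 'h::{real_inner, second_countable_topology}) \<Rightarrow> ('h \<Rightarrow> 'a \<Rightarrow> real) \<Rightarrow>
     (real \<Rightarrow> 'a \<Rightarrow> real) \<Rightarrow> real \<Rightarrow> 'a \<Rightarrow> real" where
  "skorohod_integral M T H B e W v t =
     (SOME Z. \<exists>u \<in> divergence_domain M W. process_element M T H e v t u \<and> is_divergence M T B W u Z)"


section \<open>Principal values and Yamada's functional\<close>

definition truncated_integral :: "(real \<Rightarrow> real) \<Rightarrow> real \<Rightarrow> real \<Rightarrow> real" where
  "truncated_integral f a \<epsilon> = (LINT x:{x. \<epsilon> \<le> \<bar>x - a\<bar>}|lborel. f x / (x - a))"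

definition pv_exists :: "(real \<Rightarrow> real) \<Rightarrow> real \<Rightarrow> bool" where
  "pv_exists f a \<longleftrightarrow>
     (\<forall>\<epsilon>>0. set_integrable lborel {x. \<epsilon> \<le> \<bar>x - a\<bar>} (\<lambda>x. f x / (x - a))) \<and>
     (\<exists>l. (truncated_integral f a \<longlongrightarrow> l) (at_right 0))"

definition pv_integral :: "(real \<Rightarrow> real) \<Rightarrow> real \<Rightarrow> real" where
  "pv_integral f a = Lim (at_right 0) (truncated_integral f a)"

definition hilbert_transform :: "(real \<Rightarrow> real) \<Rightarrow> real \<Rightarrow> real" where
  "hilbert_transform f a = 1 / pi * Lim (at_right 0) (truncated_integral f a)"

definition log_primitive :: "real \<Rightarrow> real" where
  "log_primitive x = x * ln \<bar>x\<bar> - x"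

definition yamada_functional ::
    "'a measure \<Rightarrow> real \<Rightarrow> real \<Rightarrow> (real \<Rightarrow> 'a \<Rightarrow> real) \<Rightarrow>
     (real \<Rightarrow> 'h::{real_inner, second_countable_topology}) \<Rightarrow> ('h \<Rightarrow> 'a \<Rightarrow> real) \<Rightarrow>
     real \<Rightarrow> real \<Rightarrow> 'a \<Rightarrow> real" where
  "yamada_functional M T H B e W t a \<omega> =
     2 * (log_primitive (B t \<omega> - a) - log_primitive (- a)
          - skorohod_integral M T H B e W (\<lambda>s \<omega>. ln \<bar>B s \<omega> - a\<bar>) t \<omega>)"

text \<open>Since \<open>M\<close> need not be complete, random variables that are defined only almost surely are
  taken to be measurable with respect to the completion.\<close>

definition square_integrable :: "'a measure \<Rightarrow> ('a \<Rightarrow> real) \<Rightarrow> bool" where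
  "square_integrable M X \<longleftrightarrow>
     X \<in> borel_measurable (completion M) \<and> (\<integral>\<^sup>+\<omega>. ennreal ((X \<omega>)\<^sup>2) \<partial>completion M) < \<infinity>"

definition L2_limit_at_zero :: "'a measure \<Rightarrow> (real \<Rightarrow> 'a \<Rightarrow> real) \<Rightarrow> ('a \<Rightarrow> real) \<Rightarrow> bool" where
  "L2_limit_at_zero M X Y \<longleftrightarrow>
     square_integrable M Y \<and> (\<forall>\<epsilon>>0. square_integrable M (X \<epsilon>)) \<and>
     ((\<lambda>\<epsilon>. \<integral>\<^sup>+\<omega>. ennreal ((X \<epsilon> \<omega> - Y \<omega>)\<^sup>2) \<partial>completion M) \<longlongrightarrow> 0) (at_right 0)"

end

theory Submission
  imports Defs "HOL-Real_Asymp.Real_Asymp"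
begin

text \<open>Regularize \<open>ln \<bar>x\<bar>\<close> to \<open>ln (x\<^sup>2 + \<epsilon>\<^sup>2) / 2\<close>. For the regularized integrand an Ito formula in
  duality form follows from a Taylor expansion along a partition and Gaussian integration by parts
  against smooth functionals; its correction term, by the occupation formula, is half the integral of
  the weighted local time against the odd kernel \<open>(x - a) / ((x - a)\<^sup>2 + \<epsilon>\<^sup>2)\<close>. Such an integral is
  governed by the odd difference \<open>y \<mapsto> \<L>(a + y) - \<L>(a - y)\<close>, whose second moment is
  \<open>O(y powr ((1 - H) / (2 * H)))\<close> by a two-point density estimate. Hence the odd difference divided by \<open>y\<close> is
  integrable near \<open>0\<close> with square integrable integral, and it dominates both the regularized and the
  truncated kernels. Letting \<open>\<epsilon> \<rightarrow> 0\<close> identifies the divergence of the logarithm; it is unique because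
  trigonometric functionals determine variables measurable with respect to the path.\<close>

text \<open>The Skorohod integral is defined by duality, so the Ito formula is established only
  after multiplication by a smooth functional, where each Gaussian increment can be integrated by
  parts. H > 1/2 enters twice: quadratic variation vanishes, so that the only correction comes from
  the correlation of X with its own increment, and increments are nonnegatively correlated, which
  bounds the Hilbert norm of an integrand by its L2 norm in time. The principal value is a
  borderline singular integral. At a fixed level it suffices to gain a power y^alpha in the second
  moment of the odd difference. The gain comes from alpha-Hoelder continuity of the Gaussian density
  of X s given X r, whose deviation is at least of order (s - r)^H. Its price is the factor (s -
  r)^(-H(1+alpha)), integrable in time only for alpha < (1 - H)/H; half of this value is taken. B
  and L are continuous only almost surely, hence the detour through everywhere continuous paths and
  jointly measurable versions.\<close>

abbreviation eps :: "nat \<Rightarrow> real" where "eps n \<equiv> 1 / real (Suc n)"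

abbreviation L2sq :: "'a measure \<Rightarrow> ('a \<Rightarrow> real) \<Rightarrow> ennreal" where
  "L2sq M f \<equiv> \<integral>\<^sup>+\<omega>. ennreal ((f \<omega>)\<^sup>2) \<partial>M"

abbreviation seq_borel :: "(nat \<Rightarrow> real) measure" where
  "seq_borel \<equiv> PiM UNIV (\<lambda>_. borel)"

section \<open>Fourier uniqueness\<close>

text \<open>A signed weight has no law, so V is split into its positive and negative parts.
  Normalized, they become densities under which X has two laws with the same characteristic
  function, and Levy's uniqueness theorem identifies these laws.\<close>

lemma (in prob_space) integral_times_indicator_eq_0_if_fourier:
  fixes X V :: "'a \<Rightarrow> real"
  assumes [measurable]: "X \<in> borel_measurable M" "A \<in> sets borel"
    and V: "integrable M V"
    and cos0: "\<And>l. expectation (\<lambda>\<omega>. V \<omega> * cos (l * X \<omega>)) = 0"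
    and sin0: "\<And>l. expectation (\<lambda>\<omega>. V \<omega> * sin (l * X \<omega>)) = 0"
  shows "expectation (\<lambda>\<omega>. V \<omega> * indicator A (X \<omega>)) = 0"
proof -
  have [measurable]: "V \<in> borel_measurable M" using V by auto
  define P N where "P = (\<lambda>\<omega>. max 0 (V \<omega>))" and "N = (\<lambda>\<omega>. max 0 (- V \<omega>))"
  have V_eq: "V = (\<lambda>\<omega>. P \<omega> - N \<omega>)" by (auto simp: P_def N_def)
  have Pnn: "0 \<le> P \<omega>" "0 \<le> N \<omega>" for \<omega> by (auto simp: P_def N_def)
  have [measurable]: "P \<in> borel_measurable M" "N \<in> borel_measurable M"
    unfolding P_def N_def by measurable
  have Pi: "integrable M P" "integrable M N"
    unfolding P_def N_def using V by auto
  define m where "m = expectation P"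
  \<comment> \<open>Frequency 0 says that V has mean zero, so both parts have the same mass and one
    constant normalizes both.\<close>
  have mN: "expectation N = m"
    using cos0[of 0] Pi by (simp add: V_eq m_def)
  have bd: "integrable M (\<lambda>\<omega>. f \<omega> * g \<omega>)" if "integrable M f" "g \<in> borel_measurable M" "\<And>\<omega>. \<bar>g \<omega>\<bar> \<le> 1"
    for f g :: "'a \<Rightarrow> real"
    using that by (intro Bochner_Integration.integrable_bound[OF that(1)])
      (auto simp: abs_mult intro!: mult_left_le)
  show ?thesis
  proof (cases "m = 0")
    case True
    have "AE \<omega> in M. P \<omega> = 0" "AE \<omega> in M. N \<omega> = 0"
      using True mN Pi Pnn by (simp_all add: m_def integral_nonneg_eq_0_iff_AE[symmetric])
    then have "AE \<omega> in M. V \<omega> * indicator A (X \<omega>) = 0"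
      by eventually_elim (simp add: V_eq)
    then show ?thesis by (simp add: integral_eq_zero_AE)
  next
    case False
    have "m \<ge> 0" unfolding m_def by (intro Bochner_Integration.integral_nonneg) (auto simp: Pnn)
    with False have m: "m > 0" by simp
    define \<mu> where "\<mu> f = distr (density M (\<lambda>\<omega>. ennreal (f \<omega> / m))) borel X" for f :: "'a \<Rightarrow> real"
    have int_\<mu>: "(\<integral>x. g x \<partial>\<mu> f) = (1/m) *\<^sub>R (\<integral>\<omega>. f \<omega> *\<^sub>R g (X \<omega>) \<partial>M)"
      if [measurable]: "f \<in> borel_measurable M" "g \<in> borel_measurable borel" and "\<And>\<omega>. 0 \<le> f \<omega>"
      for f and g :: "real \<Rightarrow> 'b::{banach, second_countable_topology}"
      unfolding \<mu>_def using m that(3)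
      by (simp add: integral_distr integral_density divide_inverse mult.commute[of _ "inverse m"]
          flip: scaleR_scaleR)
    have rd: "real_distribution (\<mu> f)"
      if [measurable]: "f \<in> borel_measurable M" and "integrable M f" "\<And>\<omega>. 0 \<le> f \<omega>" "expectation f = m" for f
    proof -
      have "emeasure (density M (\<lambda>\<omega>. ennreal (f \<omega> / m))) (space M) = 1"
        using that m by (simp add: emeasure_density nn_integral_eq_integral cong: nn_integral_cong_simp)
      then interpret p: prob_space "density M (\<lambda>\<omega>. ennreal (f \<omega> / m))"
        by (intro prob_spaceI) simp
      show ?thesis unfolding \<mu>_def by (rule p.real_distribution_distr) simp
    qed
    have cint: "(\<integral>\<omega>. f \<omega> *\<^sub>R iexp (l * X \<omega>) \<partial>M) =
        Complex (expectation (\<lambda>\<omega>. f \<omega> * cos (l * X \<omega>))) (expectation (\<lambda>\<omega>. f \<omega> * sin (l * X \<omega>)))"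
      if f: "integrable M f" for f l
    proof -
      have [measurable]: "f \<in> borel_measurable M" using f by auto
      have i: "integrable M (\<lambda>\<omega>. f \<omega> *\<^sub>R iexp (l * X \<omega>))"
        by (rule Bochner_Integration.integrable_bound[OF f]) auto
      show ?thesis
        unfolding complex_eq_iff
        by (simp del: of_real_mult add: integral_Re[OF i, symmetric] integral_Im[OF i, symmetric] Re_exp Im_exp)
    qed
    have "char (\<mu> P) = char (\<mu> N)"
    proof
      fix l
      have "expectation (\<lambda>\<omega>. P \<omega> * cos (l * X \<omega>)) = expectation (\<lambda>\<omega>. N \<omega> * cos (l * X \<omega>))"
        using cos0[of l] Pi by (simp add: V_eq left_diff_distrib bd)
      moreover have "expectation (\<lambda>\<omega>. P \<omega> * sin (l * X \<omega>)) = expectation (\<lambda>\<omega>. N \<omega> * sin (l * X \<omega>))"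
        using sin0[of l] Pi by (simp add: V_eq left_diff_distrib bd)
      ultimately show "char (\<mu> P) l = char (\<mu> N) l"
        unfolding char_def using cint[OF Pi(1)] cint[OF Pi(2)]
        by (subst (1 2) int_\<mu>) (auto simp: Pnn)
    qed
    then have eq: "\<mu> P = \<mu> N"
      by (intro Levy_uniqueness rd) (auto simp: Pi Pnn mN m_def[symmetric])
    have "expectation (\<lambda>\<omega>. P \<omega> * indicator A (X \<omega>)) = expectation (\<lambda>\<omega>. N \<omega> * indicator A (X \<omega>))"
    proof -
      have "(\<integral>x. indicator A x \<partial>\<mu> f) = (1/m) * expectation (\<lambda>\<omega>. f \<omega> * indicator A (X \<omega>))"
        if "f \<in> borel_measurable M" "\<And>\<omega>. 0 \<le> f \<omega>" for f
        using int_\<mu>[OF that(1) _ that(2), of "indicator A :: real \<Rightarrow> real"] by simp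
      from this[of P] this[of N] show ?thesis using m Pnn eq by simp
    qed
    then show ?thesis
      using Pi by (simp add: V_eq left_diff_distrib bd indicator_def)
  qed
qed

text \<open>Coordinates are converted one at a time from a character into an indicator. The
  statement therefore mixes indicators on K with a cosine in the variables of J, and J absorbs the
  next coordinate when the induction hypothesis is applied. The free phase c makes the cosines cover
  the sines as well.\<close>

lemma (in prob_space) integral_times_box_eq_0_if_fourier:
  fixes X :: "'i \<Rightarrow> 'a \<Rightarrow> real" and V :: "'a \<Rightarrow> real"
  assumes "finite K" "\<And>i. i \<in> K \<Longrightarrow> X i \<in> borel_measurable M" "\<And>i. i \<in> K \<Longrightarrow> A i \<in> sets borel"
    and "finite J" "\<And>i. i \<in> J \<Longrightarrow> X i \<in> borel_measurable M" "J \<inter> K = {}"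
    and "integrable M V"
    and "\<And>l c. expectation (\<lambda>\<omega>. V \<omega> * cos ((\<Sum>i\<in>K \<union> J. l i * X i \<omega>) + c)) = 0"
  shows "expectation (\<lambda>\<omega>. V \<omega> * (\<Prod>i\<in>K. indicator (A i) (X i \<omega>)) * cos ((\<Sum>i\<in>J. l i * X i \<omega>) + c)) = 0"
  using assms
proof (induction K arbitrary: J l c rule: finite_induct)
  case empty
  then show ?case by simp
next
  case (insert k K)
  have [measurable]: "V \<in> borel_measurable M" using insert.prems by auto
  have [measurable]: "X k \<in> borel_measurable M" "A k \<in> sets borel" using insert.prems by auto
  have JX: "X i \<in> borel_measurable M" if "i \<in> J" for i using insert.prems that by auto
  have pm [measurable]: "(\<lambda>\<omega>. \<Prod>i\<in>K. indicator (A i) (X i \<omega>) :: real) \<in> borel_measurable M"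
    using insert.prems
    by (intro borel_measurable_prod) (auto intro!: borel_measurable_indicator' simp: measurable_sets)
  have sm [measurable]: "(\<lambda>\<omega>. \<Sum>i\<in>J. l i * X i \<omega>) \<in> borel_measurable M" for l
    using JX by measurable
  define V1 where "V1 \<omega> = V \<omega> * (\<Prod>i\<in>K. indicator (A i) (X i \<omega>))" for \<omega>
  have V1m [measurable]: "V1 \<in> borel_measurable M" unfolding V1_def by measurable
  have V1: "integrable M V1"
    unfolding V1_def
    by (rule Bochner_Integration.integrable_bound[OF insert.prems(6)])
      (auto simp: abs_mult abs_prod intro!: mult_left_le prod_le_1 split: split_indicator)
  have kJ: "k \<notin> J" "k \<notin> K" using insert by auto
  have IH: "expectation (\<lambda>\<omega>. V1 \<omega> * cos ((\<Sum>i\<in>insert k J. l i * X i \<omega>) + c)) = 0" for l c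
    unfolding V1_def
  proof (rule insert.IH)
    have "insert k K \<union> J = K \<union> insert k J" by auto
    then show "\<And>l c. expectation (\<lambda>\<omega>. V \<omega> * cos ((\<Sum>i\<in>K \<union> insert k J. l i * X i \<omega>) + c)) = 0"
      using insert.prems(7) by simp
  qed (use insert in auto)
  define R where "R \<omega> = (\<Sum>i\<in>J. l i * X i \<omega>)" for \<omega>
  have [measurable]: "R \<in> borel_measurable M" unfolding R_def by measurable
  have IH2: "expectation (\<lambda>\<omega>. V1 \<omega> * cos (\<mu> * X k \<omega> + R \<omega> + c)) = 0" for \<mu> c
  proof -
    have "(\<Sum>i\<in>J. (l(k := \<mu>)) i * X i \<omega>) = R \<omega>" for \<omega>
      unfolding R_def using kJ by (intro sum.cong) auto
    then show ?thesis using IH[of "l(k := \<mu>)" c] insert.prems kJ by (simp add: add.assoc)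
  qed
  have bdd: "integrable M (\<lambda>\<omega>. V1 \<omega> * f \<omega>)" if "f \<in> borel_measurable M" "\<And>\<omega>. \<bar>f \<omega>\<bar> \<le> 1" for f
    using that by (intro Bochner_Integration.integrable_bound[OF V1])
      (auto simp: abs_mult intro!: mult_left_le)
  define V2 where "V2 \<omega> = V1 \<omega> * cos (R \<omega> + c)" for \<omega>
  \<comment> \<open>Product-to-sum formulas: multiplying by a character of the new coordinate k
    turns the cosine into two cosines in which k has frequency plus or minus \<mu>, and the
    induction hypothesis applies to both.\<close>
  have product: "v * cos b * cos x = (v * cos (x + b) + v * cos (b - x)) / 2"
    "v * cos b * sin x = (v * sin (x + b) - v * sin (b - x)) / 2" for v b x :: real
    by (simp_all add: cos_add cos_diff sin_add sin_diff algebra_simps)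
  have "expectation (\<lambda>\<omega>. V2 \<omega> * indicator (A k) (X k \<omega>)) = 0"
  proof (rule integral_times_indicator_eq_0_if_fourier)
    show "integrable M V2" unfolding V2_def by (rule bdd) auto
    fix \<mu>
    have e: "V2 \<omega> * cos (\<mu> * X k \<omega>) =
        (V1 \<omega> * cos (\<mu> * X k \<omega> + R \<omega> + c) + V1 \<omega> * cos (- \<mu> * X k \<omega> + R \<omega> + c)) / 2" for \<omega>
    proof -
      have "cos (\<mu> * X k \<omega> + R \<omega> + c) = cos (\<mu> * X k \<omega> + (R \<omega> + c))"
        "cos (- \<mu> * X k \<omega> + R \<omega> + c) = cos ((R \<omega> + c) - \<mu> * X k \<omega>)"
        by (simp_all add: algebra_simps)
      then show ?thesis
        unfolding V2_def using product[of "V1 \<omega>" "R \<omega> + c" "\<mu> * X k \<omega>"] by (simp only:)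
    qed
    show "expectation (\<lambda>\<omega>. V2 \<omega> * cos (\<mu> * X k \<omega>)) = 0"
      unfolding e using IH2[of \<mu> c] IH2[of "-\<mu>" c]
      by (subst Bochner_Integration.integral_divide_zero, subst Bochner_Integration.integral_add)
        (auto intro!: bdd)
    have e: "V2 \<omega> * sin (\<mu> * X k \<omega>) =
        (V1 \<omega> * cos (\<mu> * X k \<omega> + R \<omega> + (c - pi/2)) - V1 \<omega> * cos (- \<mu> * X k \<omega> + R \<omega> + (c - pi/2))) / 2" for \<omega>
    proof -
      have "cos (y - pi/2) = sin y" for y :: real by (simp add: cos_diff)
      from this[of "\<mu> * X k \<omega> + R \<omega> + c"] this[of "- \<mu> * X k \<omega> + R \<omega> + c"]
      have "cos (\<mu> * X k \<omega> + R \<omega> + (c - pi/2)) = sin (\<mu> * X k \<omega> + (R \<omega> + c))"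
        "cos (- \<mu> * X k \<omega> + R \<omega> + (c - pi/2)) = sin ((R \<omega> + c) - \<mu> * X k \<omega>)"
        by (simp_all add: algebra_simps)
      then show ?thesis
        unfolding V2_def using product(2)[of "V1 \<omega>" "R \<omega> + c" "\<mu> * X k \<omega>"] by (simp only:)
    qed
    show "expectation (\<lambda>\<omega>. V2 \<omega> * sin (\<mu> * X k \<omega>)) = 0"
      unfolding e using IH2[of \<mu> "c - pi/2"] IH2[of "-\<mu>" "c - pi/2"]
      by (subst Bochner_Integration.integral_divide_zero, subst Bochner_Integration.integral_diff)
        (auto intro!: bdd)
  qed auto
  then show ?case
    unfolding V2_def V1_def R_def using insert.hyps by (simp add: mult_ac)
qed

text \<open>Finite-dimensional boxes form a generator stable under intersections, so the identity
  extends by Dynkin's argument. On a box it is \<open>integral_times_box_eq_0_if_fourier\<close>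
  with no character left over.\<close>

lemma (in prob_space) integral_times_cylinder_eq_0_if_fourier:
  fixes X :: "'i \<Rightarrow> 'a \<Rightarrow> real" and V :: "'a \<Rightarrow> real"
  assumes X: "\<And>i. i \<in> I \<Longrightarrow> X i \<in> borel_measurable M"
    and V: "integrable M V"
    and fourier: "\<And>J l c. finite J \<Longrightarrow> J \<subseteq> I \<Longrightarrow>
       expectation (\<lambda>\<omega>. V \<omega> * cos ((\<Sum>i\<in>J. l i * X i \<omega>) + c)) = 0"
    and S: "S \<in> sets (PiM I (\<lambda>_. borel))"
  shows "expectation (\<lambda>\<omega>. V \<omega> * indicator S (\<lambda>i\<in>I. X i \<omega>)) = 0"
proof -
  have [measurable]: "V \<in> borel_measurable M" using V by auto
  have Xm [measurable]: "(\<lambda>\<omega>. \<lambda>i\<in>I. X i \<omega>) \<in> measurable M (PiM I (\<lambda>_. borel))"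
    using X by (intro measurable_restrict) auto
  define I0 where "I0 S = expectation (\<lambda>\<omega>. V \<omega> * indicator S (\<lambda>i\<in>I. X i \<omega>))" for S
  have bd: "integrable M (\<lambda>\<omega>. V \<omega> * indicator S (\<lambda>i\<in>I. X i \<omega>))" if "S \<in> sets (PiM I (\<lambda>_. borel))" for S
    using that by (intro Bochner_Integration.integrable_bound[OF V])
      (auto simp: abs_mult intro!: mult_left_le split: split_indicator)
  let ?\<Omega> = "\<Pi>\<^sub>E i\<in>I. space (borel :: real measure)"
  have sets_eq: "sigma_sets ?\<Omega> (prod_algebra I (\<lambda>_. borel)) = sets (PiM I (\<lambda>_. borel :: real measure))"
    by (simp add: sets_PiM)
  have V0: "expectation V = 0"
    using fourier[of "{}" undefined 0] by simp
  have in_\<Omega>: "(\<lambda>i\<in>I. X i \<omega>) \<in> ?\<Omega>" for \<omega> by auto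
  have "I0 S = 0"
    using Int_stable_prod_algebra prod_algebra_sets_into_space S[folded sets_eq]
  proof (induction rule: sigma_sets_induct_disjoint)
    case (basic A)
    then obtain J E where A: "A = prod_emb I (\<lambda>_. borel) J (\<Pi>\<^sub>E j\<in>J. E j)"
      and J: "finite J" "J \<subseteq> I" and E: "\<And>i. i \<in> J \<Longrightarrow> E i \<in> sets borel"
      by (rule prod_algebraE) auto
    have e: "indicator A (\<lambda>i\<in>I. X i \<omega>) = (\<Prod>j\<in>J. indicator (E j) (X j \<omega>) :: real)" for \<omega>
    proof (cases "\<forall>j\<in>J. X j \<omega> \<in> E j")
      case True
      then have "(\<Prod>j\<in>J. indicator (E j) (X j \<omega>) :: real) = 1" by (intro prod.neutral) auto
      moreover have "(\<lambda>i\<in>I. X i \<omega>) \<in> A"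
        unfolding A using J True by (auto simp: prod_emb_def PiE_iff)
      ultimately show ?thesis by simp
    next
      case False
      then have "(\<Prod>j\<in>J. indicator (E j) (X j \<omega>) :: real) = 0" using J by (intro prod_zero) (auto simp: indicator_def)
      moreover have "(\<lambda>i\<in>I. X i \<omega>) \<notin> A"
        unfolding A using J False by (auto simp: prod_emb_def PiE_iff)
      ultimately show ?thesis by simp
    qed
    have "expectation (\<lambda>\<omega>. V \<omega> * (\<Prod>i\<in>J. indicator (E i) (X i \<omega>)) * cos ((\<Sum>i\<in>{}. undefined i * X i \<omega>) + 0)) = 0"
      by (rule integral_times_box_eq_0_if_fourier) (use J E X V fourier in \<open>auto simp: subset_iff\<close>)
    then show ?case by (simp add: I0_def e)
  next
    case empty
    then show ?case by (simp add: I0_def)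
  next
    case (compl A)
    then have "A \<in> sets (PiM I (\<lambda>_. borel))" by (simp only: sets_eq)
    moreover have "indicator (?\<Omega> - A) (\<lambda>i\<in>I. X i \<omega>) = 1 - (indicator A (\<lambda>i\<in>I. X i \<omega>) :: real)" for \<omega>
      using in_\<Omega>[of \<omega>] by (auto split: split_indicator)
    ultimately show ?case
      using compl V0 V bd[of A] by (simp add: I0_def right_diff_distrib)
  next
    case (union F)
    have Fm: "F n \<in> sets (PiM I (\<lambda>_. borel))" for n using union(2) sets_eq by auto
    have "(\<lambda>n. \<integral>\<omega>. (\<Sum>k<n. V \<omega> * indicator (F k) (\<lambda>i\<in>I. X i \<omega>)) \<partial>M) \<longlonglongrightarrow> I0 (\<Union>n. F n)"
      unfolding I0_def
    \<comment> \<open>Disjointness keeps every partial sum of indicators at most 1, so |V| is a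
      majorant.\<close>
    proof (rule integral_dominated_convergence[where w="\<lambda>\<omega>. \<bar>V \<omega>\<bar>"])
      have "(\<lambda>n. \<Sum>k<n. indicator (F k) x) \<longlonglongrightarrow> (indicator (\<Union>n. F n) x :: real)" for x
        using indicator_sums[of F x] union.hyps(1)
        by (simp add: disjoint_family_on_def sums_def)
      then have "(\<lambda>n. V \<omega> * (\<Sum>k<n. indicator (F k) (\<lambda>i\<in>I. X i \<omega>))) \<longlonglongrightarrow> V \<omega> * indicator (\<Union>n. F n) (\<lambda>i\<in>I. X i \<omega>)" for \<omega>
        by (intro tendsto_mult tendsto_const)
      then show "AE \<omega> in M. (\<lambda>n. \<Sum>k<n. V \<omega> * indicator (F k) (\<lambda>i\<in>I. X i \<omega>)) \<longlonglongrightarrow> V \<omega> * indicator (\<Union>n. F n) (\<lambda>i\<in>I. X i \<omega>)"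
        by (simp add: sum_distrib_left)
      fix n
      show "AE \<omega> in M. norm (\<Sum>k<n. V \<omega> * indicator (F k) (\<lambda>i\<in>I. X i \<omega>)) \<le> \<bar>V \<omega>\<bar>"
      proof (rule AE_I2)
        fix \<omega>
        have "disjoint_family_on F {..<n}" using union.hyps(1) by (auto simp: disjoint_family_on_def)
        then have "(\<Sum>k<n. indicator (F k) (\<lambda>i\<in>I. X i \<omega>)) = (indicator (\<Union>k<n. F k) (\<lambda>i\<in>I. X i \<omega>) :: real)"
          by (simp add: indicator_UN_disjoint)
        then show "norm (\<Sum>k<n. V \<omega> * indicator (F k) (\<lambda>i\<in>I. X i \<omega>)) \<le> \<bar>V \<omega>\<bar>"
          by (simp flip: sum_distrib_left split: split_indicator)
      qed
    next
      have [measurable]: "(\<Union>n. F n) \<in> sets (PiM I (\<lambda>_. borel))" using Fm by auto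
      show "(\<lambda>\<omega>. V \<omega> * indicator (\<Union>n. F n) (\<lambda>i\<in>I. X i \<omega>)) \<in> borel_measurable M" by measurable
    qed (use V Fm in auto)
    moreover have "(\<integral>\<omega>. (\<Sum>k<n. V \<omega> * indicator (F k) (\<lambda>i\<in>I. X i \<omega>)) \<partial>M) = 0" for n
      using union bd[OF Fm] by (subst Bochner_Integration.integral_sum) (auto simp: I0_def)
    ultimately show ?case by (simp add: LIMSEQ_const_iff)
  qed
  then show ?thesis by (simp add: I0_def)
qed

section \<open>Gaussian integration by parts\<close>

text \<open>Partial derivatives alone give no chain rule; their continuity does. The coordinates are
  set in motion one after the other: \<open>p k\<close> moves the first k of them, and adding
  coordinate k means differentiating a function of two parameters along the diagonal, where only the
  derivative in the new parameter has to be continuous.\<close>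

lemma chain_rule_partial_deriv:
  fixes f :: "(nat \<Rightarrow> real) \<Rightarrow> real"
  assumes dep: "\<And>x y. (\<And>i. i < n \<Longrightarrow> x i = y i) \<Longrightarrow> f x = f y"
    and diff: "\<And>i x. i < n \<Longrightarrow> (\<lambda>s. f (x(i := s))) differentiable (at (x i))"
    and cont: "\<And>i. i < n \<Longrightarrow> continuous_on UNIV (partial_deriv i f)"
  shows "((\<lambda>y. f (\<lambda>i. x i + c i * y)) has_real_derivative
      (\<Sum>j<n. c j * partial_deriv j f (\<lambda>i. x i + c i * y))) (at y)"
proof -
  define p where "p k x y i = (if i < k then x i + c i * y else x i)" for k x y and i :: nat
  have "((\<lambda>y. f (p k x y)) has_real_derivative (\<Sum>j<k. c j * partial_deriv j f (p k x y))) (at y)"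
    if "k \<le> n" for k x y
    using that
  proof (induction k arbitrary: x y)
    case 0
    then show ?case by (simp add: p_def[abs_def])
  next
    case (Suc k)
    \<comment> \<open>The first k coordinates follow the parameter y, while coordinate k follows its
      own parameter z.\<close>
    define q where "q y z = p k (x(k := x k + c k * z)) y" for y z
    have q_eq: "q y y = p (Suc k) x y" for y
      by (auto simp: q_def p_def fun_eq_iff less_Suc_eq)
    have q_upd: "q y z = (q y z0)(k := x k + c k * z)" for y z z0
      by (auto simp: q_def p_def fun_eq_iff)
    have qk: "q y z k = x k + c k * z" for y z by (simp add: q_def p_def)
    have contq: "continuous_on UNIV (\<lambda>(y, z). q y z)"
      unfolding case_prod_unfold
    proof (rule continuous_on_coordinatewise_then_product)
      fix i
      consider "i < k" | "i = k" | "i > k" by linarith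
      then show "continuous_on UNIV (\<lambda>yz. q (fst yz) (snd yz) i)"
        by cases (simp_all add: q_def p_def continuous_intros)
    qed
    have dz: "((\<lambda>z. f (q y z)) has_real_derivative c k * partial_deriv k f (q y z)) (at z)" for y z
    proof -
      let ?x = "q y z"
      have "((\<lambda>s. f (?x(k := s))) has_real_derivative partial_deriv k f ?x) (at (?x k))"
        using diff[of k ?x] Suc.prems unfolding partial_deriv_def
        by (simp add: DERIV_deriv_iff_real_differentiable)
      then have "((\<lambda>z'. f (?x(k := x k + c k * z'))) has_real_derivative partial_deriv k f ?x * c k) (at z)"
        by (intro DERIV_chain2[where f="\<lambda>s. f (?x(k := s))" and g="\<lambda>z'. x k + c k * z'"])
           (simp add: qk, auto intro!: derivative_eq_intros)
      then show ?thesis unfolding q_upd[of y _ z, symmetric] by (simp add: mult.commute)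
    qed
    define D1 where "D1 = (\<Sum>j<k. c j * partial_deriv j f (q y y))"
    have "((\<lambda>(y, z). f (q y z)) has_derivative
        (\<lambda>(ty, tz). D1 * ty + blinfun_mult_right (c k * partial_deriv k f (q y y)) tz)) (at (y, y) within UNIV \<times> UNIV)"
    proof (rule has_derivative_partialsI[where fx="(*) D1" and fy="\<lambda>y z. blinfun_mult_right (c k * partial_deriv k f (q y z))"])
      show "((\<lambda>y'. f (q y' y)) has_derivative (*) D1) (at y within UNIV)"
        using Suc.IH[of "x(k := x k + c k * y)" y] Suc.prems
        unfolding D1_def q_def has_field_derivative_def by simp
      show "((\<lambda>z. f (q y z)) has_derivative blinfun_apply (blinfun_mult_right (c k * partial_deriv k f (q y z)))) (at z within UNIV)" for y z
        using dz[of y z] by (simp add: has_field_derivative_def)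
      have "continuous_on UNIV (\<lambda>yz. partial_deriv k f ((\<lambda>(y, z). q y z) yz))"
        using Suc.prems by (intro continuous_on_compose2[OF cont contq]) auto
      then have "continuous_on UNIV (\<lambda>(y, z). blinfun_mult_right (c k * partial_deriv k f (q y z)))"
        by (auto simp: case_prod_unfold intro!: continuous_intros bounded_linear.continuous_on[OF bounded_linear_blinfun_mult_right])
      then show "continuous (at (y, y) within UNIV \<times> UNIV) (\<lambda>(y, z). blinfun_mult_right (c k * partial_deriv k f (q y z)))"
        by (simp add: continuous_on_eq_continuous_at)
    qed auto
    then have d: "((\<lambda>(y, z). f (q y z)) has_derivative
        (\<lambda>(ty, tz). D1 * ty + c k * partial_deriv k f (q y y) * tz)) (at (y, y))"
      by simp
    have "((\<lambda>y. (y, y)) has_derivative (\<lambda>t. (t, t))) (at y)"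
      by (auto intro!: derivative_eq_intros)
    from has_derivative_compose[OF this d]
    have "((\<lambda>y. f (q y y)) has_derivative (\<lambda>t. D1 * t + c k * partial_deriv k f (q y y) * t)) (at y)"
      by simp
    moreover have "(\<lambda>t. D1 * t + c k * partial_deriv k f (q y y) * t) = (*) (D1 + c k * partial_deriv k f (q y y))"
      by (auto simp: algebra_simps)
    ultimately have "((\<lambda>y. f (q y y)) has_derivative (*) (D1 + c k * partial_deriv k f (q y y))) (at y)"
      by simp
    then show ?case
      unfolding has_field_derivative_def q_eq D1_def by simp
  qed
  note p_deriv = this[of n x y]
  show ?thesis
  proof -
    have "f (\<lambda>i. x i + c i * y) = f (p n x y)" for y by (rule dep) (simp add: p_def)
    moreover have "partial_deriv j f (\<lambda>i. x i + c i * y) = partial_deriv j f (p n x y)" if "j < n" for j y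
      unfolding partial_deriv_def using that
      by (intro arg_cong2[where f=deriv] ext dep) (auto simp: p_def)
    ultimately show ?thesis using p_deriv by simp
  qed
qed

lemma normal_density_deriv:
  assumes "\<sigma> > 0"
  shows "(normal_density 0 \<sigma> has_real_derivative - (y / \<sigma>\<^sup>2) * normal_density 0 \<sigma> y) (at y)"
  unfolding normal_density_def[abs_def] using assms
  by (auto intro!: derivative_eq_intros simp: field_simps power2_eq_square)

text \<open>Stein's identity: the derivative of \<open>h\<close> times the density integrates to
  zero over the line, because quadratic growth loses against the Gaussian tail at both ends.\<close>

lemma gaussian_integration_by_parts:
  fixes h h' :: "real \<Rightarrow> real"
  assumes \<sigma>: "\<sigma> > 0"
    and h: "\<And>y. (h has_real_derivative h' y) (at y)" and cont: "continuous_on UNIV h'"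
    and bh: "\<And>y. \<bar>h y\<bar> \<le> A * (1 + y\<^sup>2)" and bh': "\<And>y. \<bar>h' y\<bar> \<le> A * (1 + y\<^sup>2)"
  shows "(\<integral>y. normal_density 0 \<sigma> y * (h y * y) \<partial>lborel) = \<sigma>\<^sup>2 * (\<integral>y. normal_density 0 \<sigma> y * h' y \<partial>lborel)"
proof -
  let ?n = "normal_density 0 \<sigma>"
  have conth: "continuous_on UNIV h" using h by (meson DERIV_isCont continuous_at_imp_continuous_on)
  have [measurable]: "h \<in> borel_measurable borel" "h' \<in> borel_measurable borel"
    using conth cont by (auto intro: borel_measurable_continuous_onI)
  have i1: "integrable lborel (\<lambda>y. ?n y * (h y * y))"
  proof (rule Bochner_Integration.integrable_bound)
    show "integrable lborel (\<lambda>y. A * (?n y * \<bar>y - 0\<bar>^1) + A * (?n y * \<bar>y - 0\<bar>^3))"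
      by (intro Bochner_Integration.integrable_add integrable_mult_right integrable_normal_moment_abs \<sigma>)
    have "\<bar>h y * y\<bar> \<le> A * (\<bar>y\<bar> + \<bar>y\<bar>^3)" for y
      using mult_right_mono[OF bh[of y], of "\<bar>y\<bar>"] by (simp add: abs_mult algebra_simps power2_eq_square power3_eq_cube)
    then have "\<bar>?n y * (h y * y)\<bar> \<le> ?n y * (A * (\<bar>y\<bar> + \<bar>y\<bar>^3))" for y
      by (subst abs_mult) (auto intro!: mult_mono)
    also have "?n y * (A * (\<bar>y\<bar> + \<bar>y\<bar>^3)) = A * (?n y * \<bar>y - 0\<bar>^1) + A * (?n y * \<bar>y - 0\<bar>^3)" for y
      by (simp add: algebra_simps)
    finally show "AE y in lborel. norm (?n y * (h y * y)) \<le> norm (A * (?n y * \<bar>y - 0\<bar>^1) + A * (?n y * \<bar>y - 0\<bar>^3))"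
      unfolding real_norm_def by (intro AE_I2 order_trans[OF _ abs_ge_self])
  qed measurable
  have i2: "integrable lborel (\<lambda>y. ?n y * h' y)"
  proof (rule Bochner_Integration.integrable_bound)
    show "integrable lborel (\<lambda>y. A * (?n y) + A * (?n y * \<bar>y - 0\<bar>^2))"
      by (intro Bochner_Integration.integrable_add integrable_mult_right integrable_normal_moment_abs integrable_normal_density \<sigma>)
    show "AE y in lborel. norm (?n y * h' y) \<le> norm (A * (?n y) + A * (?n y * \<bar>y - 0\<bar>^2))"
    proof (rule AE_I2)
      fix y
      have "norm (?n y * h' y) \<le> ?n y * (A * (1 + y\<^sup>2))"
        using bh'[of y] by (simp add: abs_mult mult_left_mono)
      also have "\<dots> = A * (?n y) + A * (?n y * \<bar>y - 0\<bar>^2)" by (simp add: algebra_simps)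
      finally show "norm (?n y * h' y) \<le> norm (A * (?n y) + A * (?n y * \<bar>y - 0\<bar>^2))" by simp
    qed
  qed measurable
  have lim: "((\<lambda>y. A * (1 + y\<^sup>2) * ?n y) \<longlongrightarrow> 0) at_top"
    "((\<lambda>y. A * (1 + y\<^sup>2) * ?n y) \<longlongrightarrow> 0) at_bot"
    unfolding normal_density_def using \<sigma> by real_asymp+
  have limh: "((\<lambda>y. h y * ?n y) \<longlongrightarrow> 0) F" if "((\<lambda>y. A * (1 + y\<^sup>2) * ?n y) \<longlongrightarrow> 0) F" for F
    by (intro Lim_null_comparison[OF _ that] always_eventually) (auto simp: abs_mult intro!: mult_right_mono bh)
  have "(LBINT y=-\<infinity>..\<infinity>. ?n y * h' y - ?n y * (h y * y) / \<sigma>\<^sup>2) = 0 - 0"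
  proof (rule interval_integral_FTC_integrable[where F="\<lambda>y. h y * ?n y"])
    show "((\<lambda>y. h y * ?n y) has_vector_derivative ?n y * h' y - ?n y * (h y * y) / \<sigma>\<^sup>2) (at y)" for y
      unfolding has_real_derivative_iff_has_vector_derivative[symmetric]
      using \<sigma> by (auto intro!: derivative_eq_intros h normal_density_deriv simp: field_simps)
    show "isCont (\<lambda>y. ?n y * h' y - ?n y * (h y * y) / \<sigma>\<^sup>2) y" for y
      using cont conth \<sigma> unfolding normal_density_def
      by (intro continuous_intros) (auto simp: continuous_on_eq_continuous_at)
    show "set_integrable lborel (einterval (- \<infinity>) \<infinity>) (\<lambda>y. ?n y * h' y - ?n y * (h y * y) / \<sigma>\<^sup>2)"
      using i1 i2 by (simp add: set_integrable_def einterval_def)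
    show "(((\<lambda>y. h y * ?n y) \<circ> real_of_ereal) \<longlongrightarrow> 0) (at_right (- \<infinity>))"
      "(((\<lambda>y. h y * ?n y) \<circ> real_of_ereal) \<longlongrightarrow> 0) (at_left \<infinity>)"
      using limh[OF lim(1)] limh[OF lim(2)] by (simp_all add: ereal_tendsto_simps)
  qed auto
  then have "(\<integral>y. ?n y * h' y - ?n y * (h y * y) / \<sigma>\<^sup>2 \<partial>lborel) = 0"
    by (simp add: interval_lebesgue_integral_def set_lebesgue_integral_def einterval_def)
  then have "(\<integral>y. ?n y * h' y \<partial>lborel) - (\<integral>y. ?n y * (h y * y) \<partial>lborel) / \<sigma>\<^sup>2 = 0"
    using i1 i2 by simp
  then show ?thesis using \<sigma> by (simp add: field_simps)
qed

locale fbm_setup = prob_space M for M :: "'a measure" +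
  fixes H T :: real and B :: "real \<Rightarrow> 'a \<Rightarrow> real"
    and e :: "real \<Rightarrow> 'h::{real_inner, complete_space, second_countable_topology}"
    and W :: "'h \<Rightarrow> 'a \<Rightarrow> real"
  assumes H: "1/2 < H" "H < 1" and T: "0 < T"
    and fbm: "fractional_brownian_motion M T H B"
    and indicators: "indicator_completion M T B e"
    and isometry: "isometric_extension M T B e W"
begin

lemma W_measurable [measurable]: "W \<phi> \<in> borel_measurable M"
  using isometry by (simp add: isometric_extension_def)

lemma W_square_integrable: "integrable M (\<lambda>\<omega>. (W \<phi> \<omega>)\<^sup>2)"
  using isometry by (simp add: isometric_extension_def)

lemma W_linear: "AE \<omega> in M. W (a *\<^sub>R \<phi> + b *\<^sub>R \<psi>) \<omega> = a * W \<phi> \<omega> + b * W \<psi> \<omega>"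
  using isometry by (simp add: isometric_extension_def)

lemma W_inner: "expectation (\<lambda>\<omega>. W \<phi> \<omega> * W \<psi> \<omega>) = inner \<phi> \<psi>"
  using isometry by (simp add: isometric_extension_def)

lemma W_e: "t \<in> {0..T} \<Longrightarrow> AE \<omega> in M. W (e t) \<omega> = B t \<omega>"
  using isometry by (simp add: isometric_extension_def)

lemma B_measurable: "t \<in> {0..T} \<Longrightarrow> B t \<in> borel_measurable M"
  using fbm by (simp add: fractional_brownian_motion_def)

lemma B_gaussian: "finite I \<Longrightarrow> I \<subseteq> {0..T} \<Longrightarrow> centered_gaussian M (\<lambda>\<omega>. \<Sum>t\<in>I. c t * B t \<omega>)"
  using fbm by (simp add: fractional_brownian_motion_def)

lemma B_continuous: "AE \<omega> in M. continuous_on {0..T} (\<lambda>t. B t \<omega>)"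
  using fbm by (simp add: fractional_brownian_motion_def)

lemma W_0: "AE \<omega> in M. W 0 \<omega> = 0"
  using W_linear[of 0 0 0 0] by simp

lemma W_scaleR: "AE \<omega> in M. W (a *\<^sub>R \<phi>) \<omega> = a * W \<phi> \<omega>"
  using W_linear[of a \<phi> 0 0] by simp

lemma W_diff: "AE \<omega> in M. W (\<phi> - \<psi>) \<omega> = W \<phi> \<omega> - W \<psi> \<omega>"
  using W_linear[of 1 \<phi> "-1" \<psi>] by simp

lemma W_sum:
  assumes "finite J"
  shows "AE \<omega> in M. W (\<Sum>i\<in>J. c i *\<^sub>R \<phi> i) \<omega> = (\<Sum>i\<in>J. c i * W (\<phi> i) \<omega>)"
  using assms
proof (induction J rule: finite_induct)
  case empty
  then show ?case using W_0 by simp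
next
  case (insert i J)
  show ?case
    using insert.IH W_linear[of "c i" "\<phi> i" 1 "\<Sum>i\<in>J. c i *\<^sub>R \<phi> i"]
    by eventually_elim (simp add: insert.hyps)
qed

lemma W_integrable: "integrable M (W \<phi>)"
  by (rule square_integrable_imp_integrable[OF _ W_square_integrable]) simp

lemma W_mult_integrable: "integrable M (\<lambda>\<omega>. W \<phi> \<omega> * W \<psi> \<omega>)"
proof (rule Bochner_Integration.integrable_bound
      [OF Bochner_Integration.integrable_add[OF W_square_integrable[of \<phi>] W_square_integrable[of \<psi>]]])
  have "\<bar>x * y\<bar> \<le> x\<^sup>2 + y\<^sup>2" for x y :: real
    using sum_squares_bound[of "\<bar>x\<bar>" "\<bar>y\<bar>"] abs_ge_zero[of "x * y"] unfolding abs_mult power2_abs by linarith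
  then show "AE \<omega> in M. norm (W \<phi> \<omega> * W \<psi> \<omega>) \<le> norm ((W \<phi> \<omega>)\<^sup>2 + (W \<psi> \<omega>)\<^sup>2)"
    by simp
qed simp

lemma W_norm: "expectation (\<lambda>\<omega>. (W \<phi> \<omega>)\<^sup>2) = (norm \<phi>)\<^sup>2"
  using W_inner[of \<phi> \<phi>] by (simp add: power2_eq_square dot_square_norm power2_norm_eq_inner[symmetric])

lemma W_abs_le: "expectation (\<lambda>\<omega>. \<bar>W \<phi> \<omega>\<bar>) \<le> norm \<phi>"
proof (rule power2_le_imp_le)
  have i: "integrable M (\<lambda>\<omega>. \<bar>W \<phi> \<omega>\<bar>)" using W_integrable by simp
  have "0 \<le> variance (\<lambda>\<omega>. \<bar>W \<phi> \<omega>\<bar>)" by (rule variance_positive)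
  also have "\<dots> = (norm \<phi>)\<^sup>2 - (expectation (\<lambda>\<omega>. \<bar>W \<phi> \<omega>\<bar>))\<^sup>2"
    using i W_square_integrable[of \<phi>] by (subst variance_eq) (auto simp: W_norm)
  finally show "(expectation (\<lambda>\<omega>. \<bar>W \<phi> \<omega>\<bar>))\<^sup>2 \<le> (norm \<phi>)\<^sup>2" by simp
qed simp

lemma expectation_cos_normal:
  assumes X: "distributed M lborel X (normal_density 0 \<sigma>)" and \<sigma>: "\<sigma> > 0"
  shows "expectation (\<lambda>\<omega>. cos (X \<omega> + c)) = cos c * exp (- \<sigma>\<^sup>2 / 2)"
proof -
  have [measurable]: "X \<in> borel_measurable M" using distributed_measurable[OF X] by simp
  define Y where "Y \<omega> = X \<omega> / \<sigma>" for \<omega>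
  have [measurable]: "Y \<in> borel_measurable M" unfolding Y_def by measurable
  have "distributed M lborel Y std_normal_density"
    using normal_standard_normal_convert[OF \<sigma>, of X 0] X unfolding Y_def by simp
  then have "distr M borel Y = std_normal_distribution"
    by (simp add: distributed_def cong: distr_cong)
  then have "char (distr M borel Y) \<sigma> = exp (- \<sigma>\<^sup>2 / 2)"
    by (simp add: char_std_normal_distribution)
  moreover have "char (distr M borel Y) \<sigma> = (\<integral>\<omega>. iexp (X \<omega>) \<partial>M)"
    unfolding char_def using \<sigma> by (subst integral_distr) (auto simp: Y_def)
  ultimately have c: "(\<integral>\<omega>. iexp (X \<omega>) \<partial>M) = of_real (exp (- \<sigma>\<^sup>2 / 2))" by simp
  have i: "integrable M (\<lambda>\<omega>. iexp (X \<omega>))" by (rule integrable_iexp) auto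
  have cs: "expectation (\<lambda>\<omega>. cos (X \<omega>)) = exp (- \<sigma>\<^sup>2 / 2)" "expectation (\<lambda>\<omega>. sin (X \<omega>)) = 0"
    using c[THEN arg_cong[where f=Re]] c[THEN arg_cong[where f=Im]]
    by (simp_all add: integral_Re[OF i, symmetric] integral_Im[OF i, symmetric] Re_exp Im_exp)
  have "integrable M (\<lambda>\<omega>. cos (X \<omega>))" "integrable M (\<lambda>\<omega>. sin (X \<omega>))"
    by (auto intro!: integrable_const_bound[where B=1])
  then show ?thesis using cs by (simp add: cos_add)
qed

text \<open>Gaussianity is assumed only for finite combinations of B, that is, on the span of the
  indicators. It passes to the completion because the cosine is 1-Lipschitz and W is an isometry.
  The phase c encodes both parts of the characteristic function.\<close>

lemma expectation_cos_W: "expectation (\<lambda>\<omega>. cos (W \<phi> \<omega> + c)) = cos c * exp (- (norm \<phi>)\<^sup>2 / 2)"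
proof -
  have on_span: "expectation (\<lambda>\<omega>. cos (W \<phi> \<omega> + c)) = cos c * exp (- (norm \<phi>)\<^sup>2 / 2)"
    if \<phi>: "\<phi> \<in> span (e ` {0..T})" for \<phi>
  proof -
    obtain S r where S: "finite S" "S \<subseteq> e ` {0..T}" "\<phi> = (\<Sum>a\<in>S. r a *\<^sub>R a)"
      using \<phi> unfolding span_explicit by auto
    \<comment> \<open>The generators are indexed injectively by times, so that the combination of B
      runs over a finite set of times, as in the definition of fractional Brownian motion.\<close>
    obtain I where I: "I \<subseteq> {0..T}" "inj_on e I" "S = e ` I"
      using S(2) by (meson subset_image_inj)
    have finI: "finite I" using I S(1) by (simp add: finite_image_iff)
    define X where "X \<omega> = (\<Sum>s\<in>I. r (e s) * B s \<omega>)" for \<omega>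
    have "\<phi> = (\<Sum>s\<in>I. r (e s) *\<^sub>R e s)" using S I by (simp add: sum.reindex)
    then have "AE \<omega> in M. W \<phi> \<omega> = (\<Sum>s\<in>I. r (e s) * W (e s) \<omega>)"
      using W_sum[OF finI] by simp
    moreover have "AE \<omega> in M. \<forall>s\<in>I. W (e s) \<omega> = B s \<omega>"
      using finI I W_e by (subst AE_finite_all) auto
    ultimately have WX: "AE \<omega> in M. W \<phi> \<omega> = X \<omega>"
      by eventually_elim (simp add: X_def)
    have Xm [measurable]: "X \<in> borel_measurable M"
      unfolding X_def using I by (intro borel_measurable_sum borel_measurable_times B_measurable) auto
    have X2: "expectation (\<lambda>\<omega>. (X \<omega>)\<^sup>2) = (norm \<phi>)\<^sup>2"
      unfolding W_norm[symmetric] using WX by (intro integral_cong_AE) auto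
    have EX: "expectation (\<lambda>\<omega>. cos (W \<phi> \<omega> + c)) = expectation (\<lambda>\<omega>. cos (X \<omega> + c))"
      using WX by (intro integral_cong_AE) auto
    have "centered_gaussian M X"
      unfolding X_def by (rule B_gaussian[OF finI I(1)])
    then consider \<sigma> where "\<sigma> > 0" "distributed M lborel X (normal_density 0 \<sigma>)"
      | "AE \<omega> in M. X \<omega> = 0" unfolding centered_gaussian_def by auto
    then show ?thesis
    proof cases
      case 1
      have "\<sigma>\<^sup>2 = (norm \<phi>)\<^sup>2"
        using normal_distributed_variance[OF 1] normal_distributed_expectation[OF 1] X2 by simp
      then show ?thesis using expectation_cos_normal[OF 1(2,1)] EX by simp
    next
      case 2
      have "expectation (\<lambda>\<omega>. (X \<omega>)\<^sup>2) = expectation (\<lambda>\<omega>. 0)"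
        using 2 by (intro integral_cong_AE) auto
      moreover have "expectation (\<lambda>\<omega>. cos (X \<omega> + c)) = expectation (\<lambda>\<omega>. cos c)"
        using 2 by (intro integral_cong_AE) auto
      ultimately show ?thesis using X2 EX by (simp add: prob_space)
    qed
  qed
  have "\<phi> \<in> closure (span (e ` {0..T}))"
    using indicators by (simp add: indicator_completion_def)
  then obtain \<phi>n where \<phi>n: "\<And>n. \<phi>n n \<in> span (e ` {0..T})" "\<phi>n \<longlonglongrightarrow> \<phi>"
    unfolding closure_sequential by auto
  have "(\<lambda>n. expectation (\<lambda>\<omega>. cos (W (\<phi>n n) \<omega> + c))) \<longlonglongrightarrow> expectation (\<lambda>\<omega>. cos (W \<phi> \<omega> + c))"
  proof (rule LIM_zero_cancel, rule Lim_null_comparison)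
    show "(\<lambda>n. norm (\<phi>n n - \<phi>)) \<longlonglongrightarrow> 0"
      using \<phi>n(2) by (simp add: LIM_zero tendsto_norm_zero)
    have ic: "integrable M (\<lambda>\<omega>. cos (W \<psi> \<omega> + c))" for \<psi>
      by (auto intro!: integrable_const_bound[where B=1])
    have lip: "\<bar>cos x - cos y\<bar> \<le> \<bar>x - y\<bar>" for x y :: real
    proof -
      have "\<bar>cos x - cos y\<bar> = 2 * \<bar>sin ((x + y) / 2)\<bar> * \<bar>sin ((y - x) / 2)\<bar>"
        by (simp add: cos_diff_cos abs_mult)
      also have "\<dots> \<le> 2 * 1 * \<bar>(y - x) / 2\<bar>"
        by (intro mult_mono abs_sin_x_le_abs_x) auto
      finally show ?thesis by simp
    qed
    show "\<forall>\<^sub>F n in sequentially. norm (expectation (\<lambda>\<omega>. cos (W (\<phi>n n) \<omega> + c)) -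
        expectation (\<lambda>\<omega>. cos (W \<phi> \<omega> + c))) \<le> norm (\<phi>n n - \<phi>)"
    proof (rule always_eventually, rule allI)
      fix n
      have "norm (expectation (\<lambda>\<omega>. cos (W (\<phi>n n) \<omega> + c)) - expectation (\<lambda>\<omega>. cos (W \<phi> \<omega> + c)))
          = norm (expectation (\<lambda>\<omega>. cos (W (\<phi>n n) \<omega> + c) - cos (W \<phi> \<omega> + c)))"
        using ic by simp
      also have "\<dots> \<le> expectation (\<lambda>\<omega>. \<bar>cos (W (\<phi>n n) \<omega> + c) - cos (W \<phi> \<omega> + c)\<bar>)"
        by (rule order_trans[OF integral_norm_bound]) simp
      also have "\<dots> \<le> expectation (\<lambda>\<omega>. \<bar>W (\<phi>n n - \<phi>) \<omega>\<bar>)"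
      proof (rule integral_mono_AE)
        show "AE \<omega> in M. \<bar>cos (W (\<phi>n n) \<omega> + c) - cos (W \<phi> \<omega> + c)\<bar> \<le> \<bar>W (\<phi>n n - \<phi>) \<omega>\<bar>"
          using W_diff[of "\<phi>n n" \<phi>]
        proof eventually_elim
          case (elim \<omega>)
          then show ?case using lip[of "W (\<phi>n n) \<omega> + c" "W \<phi> \<omega> + c"] by simp
        qed
      qed (use ic W_integrable in auto)
      also have "\<dots> \<le> norm (\<phi>n n - \<phi>)" by (rule W_abs_le)
      finally show "norm (expectation (\<lambda>\<omega>. cos (W (\<phi>n n) \<omega> + c)) -
        expectation (\<lambda>\<omega>. cos (W \<phi> \<omega> + c))) \<le> norm (\<phi>n n - \<phi>)" .
    qed
  qed
  moreover have "(\<lambda>n. cos c * exp (- (norm (\<phi>n n))\<^sup>2 / 2)) \<longlonglongrightarrow> cos c * exp (- (norm \<phi>)\<^sup>2 / 2)"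
    by (intro tendsto_intros \<phi>n(2)) auto
  ultimately show ?thesis
    using on_span[OF \<phi>n(1)] by (intro LIMSEQ_unique) auto
qed

lemma expectation_cos_W_orthogonal:
  assumes "inner \<eta> \<psi> = 0"
  shows "expectation (\<lambda>\<omega>. cos (W \<eta> \<omega> + l * W \<psi> \<omega> + c)) = cos c * exp (- ((norm \<eta>)\<^sup>2 + l\<^sup>2 * (norm \<psi>)\<^sup>2) / 2)"
proof -
  have "AE \<omega> in M. W (1 *\<^sub>R \<eta> + l *\<^sub>R \<psi>) \<omega> = W \<eta> \<omega> + l * W \<psi> \<omega>"
    using W_linear[of 1 \<eta> l \<psi>] by simp
  then have "expectation (\<lambda>\<omega>. cos (W \<eta> \<omega> + l * W \<psi> \<omega> + c)) = expectation (\<lambda>\<omega>. cos (W (1 *\<^sub>R \<eta> + l *\<^sub>R \<psi>) \<omega> + c))"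
    by (intro integral_cong_AE) auto
  moreover have "(norm (1 *\<^sub>R \<eta> + l *\<^sub>R \<psi>))\<^sup>2 = (norm \<eta>)\<^sup>2 + l\<^sup>2 * (norm \<psi>)\<^sup>2"
    using assms unfolding power2_norm_eq_inner
    by (simp add: inner_add_left inner_add_right inner_commute power2_eq_square)
  ultimately show ?thesis by (simp only: expectation_cos_W)
qed

text \<open>Orthogonality means independence in a Gaussian family. The Fourier lemmas are used in
  both directions: a centred cosine of the sequence is uncorrelated with every character of
  \<open>W \<psi>\<close>, hence with the indicator of A; so the centred indicator of A is
  uncorrelated with every cosine of the sequence, hence with the indicator of S.\<close>

lemma W_factorize:
  fixes \<phi> :: "nat \<Rightarrow> 'h"
  assumes orth: "\<And>i. inner (\<phi> i) \<psi> = 0" and A[measurable]: "A \<in> sets borel"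
    and S[measurable]: "S \<in> sets seq_borel"
  shows "expectation (\<lambda>\<omega>. indicator A (W \<psi> \<omega>) * indicator S (\<lambda>i. W (\<phi> i) \<omega>)) =
    expectation (\<lambda>\<omega>. indicator A (W \<psi> \<omega>)) * (expectation (\<lambda>\<omega>. indicator S (\<lambda>i. W (\<phi> i) \<omega>)) :: real)"
proof -
  define p :: real where "p = expectation (\<lambda>\<omega>. indicator A (W \<psi> \<omega>))"
  define V :: "'a \<Rightarrow> real" where "V \<omega> = (indicator A (W \<psi> \<omega>) :: real) - p" for \<omega>
  have iA: "integrable M (\<lambda>\<omega>. indicator A (W \<psi> \<omega>) :: real)"
    by (auto intro!: integrable_const_bound[where B=1])
  have V: "integrable M V" unfolding V_def using iA by simp
  have Vm [measurable]: "V \<in> borel_measurable M" unfolding V_def by measurable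
  have "expectation (\<lambda>\<omega>. V \<omega> * indicator S (\<lambda>i\<in>UNIV. W (\<phi> i) \<omega>)) = 0"
  proof (rule integral_times_cylinder_eq_0_if_fourier)
    fix J :: "nat set" and l :: "nat \<Rightarrow> real" and c :: real
    assume J: "finite J"
    define \<eta> where "\<eta> = (\<Sum>i\<in>J. l i *\<^sub>R \<phi> i)"
    have o: "inner \<eta> \<psi> = 0" by (simp add: \<eta>_def inner_sum_left orth)
    define \<kappa> where "\<kappa> = expectation (\<lambda>\<omega>. cos (W \<eta> \<omega> + c))"
    define V0 where "V0 \<omega> = cos (W \<eta> \<omega> + c) - \<kappa>" for \<omega>
    have ic: "integrable M (\<lambda>\<omega>. cos (f \<omega>))" if "f \<in> borel_measurable M" for f :: "'a \<Rightarrow> real"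
      using that by (auto intro!: integrable_const_bound[where B=1])
    have \<kappa>: "\<kappa> = cos c * exp (- (norm \<eta>)\<^sup>2 / 2)" by (simp add: \<kappa>_def expectation_cos_W)
    have e0: "expectation (\<lambda>\<omega>. cos (m * W \<psi> \<omega> + d)) = cos d * exp (- (m\<^sup>2 * (norm \<psi>)\<^sup>2) / 2)" for m d
    proof -
      have "AE \<omega> in M. cos (W 0 \<omega> + m * W \<psi> \<omega> + d) = cos (m * W \<psi> \<omega> + d)"
        using W_0 by eventually_elim simp
      then have "expectation (\<lambda>\<omega>. cos (m * W \<psi> \<omega> + d)) = expectation (\<lambda>\<omega>. cos (W 0 \<omega> + m * W \<psi> \<omega> + d))"
        by (intro integral_cong_AE) auto
      then show ?thesis using expectation_cos_W_orthogonal[of 0 \<psi> m d] by simp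
    qed
    have E: "expectation (\<lambda>\<omega>. V0 \<omega> * cos (m * W \<psi> \<omega> + d)) = 0" for m d
    proof -
      have "V0 \<omega> * cos (m * W \<psi> \<omega> + d) =
          (cos (W \<eta> \<omega> + m * W \<psi> \<omega> + (c + d)) + cos (W \<eta> \<omega> + (- m) * W \<psi> \<omega> + (c - d))) / 2 - \<kappa> * cos (m * W \<psi> \<omega> + d)" for \<omega>
      proof -
        have "cos (W \<eta> \<omega> + m * W \<psi> \<omega> + (c + d)) = cos ((W \<eta> \<omega> + c) + (m * W \<psi> \<omega> + d))"
          "cos (W \<eta> \<omega> + (- m) * W \<psi> \<omega> + (c - d)) = cos ((W \<eta> \<omega> + c) - (m * W \<psi> \<omega> + d))"
          by (simp_all add: algebra_simps)
        then show ?thesis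
          unfolding V0_def cos_add[of "W \<eta> \<omega> + c"] cos_diff[of "W \<eta> \<omega> + c"] by (simp add: algebra_simps)
      qed
      then have "expectation (\<lambda>\<omega>. V0 \<omega> * cos (m * W \<psi> \<omega> + d)) =
          (cos (c + d) * exp (- ((norm \<eta>)\<^sup>2 + m\<^sup>2 * (norm \<psi>)\<^sup>2) / 2) +
           cos (c - d) * exp (- ((norm \<eta>)\<^sup>2 + (-m)\<^sup>2 * (norm \<psi>)\<^sup>2) / 2)) / 2 - \<kappa> * (cos d * exp (- (m\<^sup>2 * (norm \<psi>)\<^sup>2) / 2))"
        unfolding e0[symmetric] expectation_cos_W_orthogonal[OF o, symmetric]
        by (simp only:) (subst Bochner_Integration.integral_diff; simp add: ic)
      also have "\<dots> = 0"
      proof -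
        have "exp (- ((norm \<eta>)\<^sup>2 + m\<^sup>2 * (norm \<psi>)\<^sup>2) / 2) = exp (- (norm \<eta>)\<^sup>2 / 2) * exp (- (m\<^sup>2 * (norm \<psi>)\<^sup>2) / 2)"
          unfolding exp_add[symmetric] by (simp add: add_divide_distrib)
        then show ?thesis unfolding \<kappa> power2_minus cos_add cos_diff by (simp add: algebra_simps)
      qed
      finally show ?thesis .
    qed
    have "expectation (\<lambda>\<omega>. V0 \<omega> * indicator A (W \<psi> \<omega>)) = 0"
    proof (rule integral_times_indicator_eq_0_if_fourier)
      show "integrable M V0" unfolding V0_def by (simp add: ic)
      show "expectation (\<lambda>\<omega>. V0 \<omega> * cos (m * W \<psi> \<omega>)) = 0" for m using E[of m 0] by simp
      have "cos (x - pi / 2) = sin x" for x :: real by (simp add: cos_diff)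
      then show "expectation (\<lambda>\<omega>. V0 \<omega> * sin (m * W \<psi> \<omega>)) = 0" for m using E[of m "- (pi/2)"] by simp
    qed auto
    then have *: "expectation (\<lambda>\<omega>. indicator A (W \<psi> \<omega>) * cos (W \<eta> \<omega> + c)) = p * \<kappa>"
    proof -
      have i: "integrable M (\<lambda>\<omega>. indicator A (W \<psi> \<omega>) * cos (W \<eta> \<omega> + c))"
        by (auto intro!: integrable_const_bound[where B=1] simp: abs_mult split: split_indicator)
      have "V0 \<omega> * indicator A (W \<psi> \<omega>) = indicator A (W \<psi> \<omega>) * cos (W \<eta> \<omega> + c) - \<kappa> * indicator A (W \<psi> \<omega>)" for \<omega>
        by (simp add: V0_def algebra_simps)
      then have "expectation (\<lambda>\<omega>. V0 \<omega> * indicator A (W \<psi> \<omega>)) = expectation (\<lambda>\<omega>. indicator A (W \<psi> \<omega>) * cos (W \<eta> \<omega> + c)) - \<kappa> * p"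
        using i iA by (simp add: p_def)
      then show ?thesis using \<open>expectation (\<lambda>\<omega>. V0 \<omega> * indicator A (W \<psi> \<omega>)) = 0\<close> by simp
    qed
    have "AE \<omega> in M. V \<omega> * cos ((\<Sum>i\<in>J. l i * W (\<phi> i) \<omega>) + c) = V \<omega> * cos (W \<eta> \<omega> + c)"
      using W_sum[OF J, of l \<phi>] unfolding \<eta>_def by eventually_elim simp
    then have "expectation (\<lambda>\<omega>. V \<omega> * cos ((\<Sum>i\<in>J. l i * W (\<phi> i) \<omega>) + c)) = expectation (\<lambda>\<omega>. V \<omega> * cos (W \<eta> \<omega> + c))"
      by (intro integral_cong_AE) auto
    also have "\<dots> = expectation (\<lambda>\<omega>. indicator A (W \<psi> \<omega>) * cos (W \<eta> \<omega> + c)) - p * \<kappa>"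
    proof -
      have i: "integrable M (\<lambda>\<omega>. indicator A (W \<psi> \<omega>) * cos (W \<eta> \<omega> + c))"
        by (auto intro!: integrable_const_bound[where B=1] simp: abs_mult split: split_indicator)
      show ?thesis unfolding V_def \<kappa>_def using i by (simp add: left_diff_distrib ic)
    qed
    finally show "expectation (\<lambda>\<omega>. V \<omega> * cos ((\<Sum>i\<in>J. l i * W (\<phi> i) \<omega>) + c)) = 0"
      using * by simp
  qed (use V in auto)
  then have "expectation (\<lambda>\<omega>. V \<omega> * indicator S (\<lambda>i. W (\<phi> i) \<omega>)) = 0" by (simp add: restrict_UNIV)
  moreover have "(\<lambda>\<omega>. \<lambda>i. W (\<phi> i) \<omega>) \<in> measurable M seq_borel"
    by (rule measurable_PiM_single') (auto simp: space_PiM)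
  note [measurable] = this
  have "integrable M (\<lambda>\<omega>. indicator A (W \<psi> \<omega>) * indicator S (\<lambda>i. W (\<phi> i) \<omega>) :: real)"
    "integrable M (\<lambda>\<omega>. indicator S (\<lambda>i. W (\<phi> i) \<omega>) :: real)"
    by (auto intro!: integrable_const_bound[where B=1] split: split_indicator)
  ultimately show ?thesis
    by (simp add: V_def left_diff_distrib p_def)
qed

lemma W_joint_distr:
  fixes \<phi> :: "nat \<Rightarrow> 'h"
  assumes orth: "\<And>i. inner (\<phi> i) \<psi> = 0"
  shows "distr M borel (W \<psi>) \<Otimes>\<^sub>M distr M seq_borel (\<lambda>\<omega> i. W (\<phi> i) \<omega>) =
    distr M (borel \<Otimes>\<^sub>M seq_borel) (\<lambda>\<omega>. (W \<psi> \<omega>, \<lambda>i. W (\<phi> i) \<omega>))"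
proof -
  have [measurable]: "(\<lambda>\<omega>. \<lambda>i. W (\<phi> i) \<omega>) \<in> measurable M seq_borel"
    by (rule measurable_PiM_single') (auto simp: space_PiM)
  interpret P: prob_space "distr M borel (W \<psi>)" by (rule prob_space_distr) simp
  interpret Q: prob_space "distr M seq_borel (\<lambda>\<omega> i. W (\<phi> i) \<omega>)" by (rule prob_space_distr) simp
  show ?thesis
  proof (rule pair_measure_eqI)
    fix A S assume "A \<in> sets (distr M borel (W \<psi>))"
      "S \<in> sets (distr M seq_borel (\<lambda>\<omega> i. W (\<phi> i) \<omega>))"
    then have [measurable]: "A \<in> sets borel" "S \<in> sets seq_borel" by auto
    have ind: "measure M (f -` U \<inter> space M) = expectation (\<lambda>\<omega>. indicator U (f \<omega>))" for f :: "'a \<Rightarrow> 'b" and U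
    proof -
      have "expectation (\<lambda>\<omega>. indicator U (f \<omega>) :: real) = expectation (indicator (f -` U \<inter> space M))"
        by (intro Bochner_Integration.integral_cong) (auto simp: indicator_def)
      then show ?thesis by simp
    qed
    have "expectation (\<lambda>\<omega>. indicator (A \<times> S) (W \<psi> \<omega>, \<lambda>i. W (\<phi> i) \<omega>) :: real) =
       expectation (\<lambda>\<omega>. indicator A (W \<psi> \<omega>) * indicator S (\<lambda>i. W (\<phi> i) \<omega>))"
      by (simp add: indicator_times)
    then have "measure M ((\<lambda>\<omega>. (W \<psi> \<omega>, \<lambda>i. W (\<phi> i) \<omega>)) -` (A \<times> S) \<inter> space M) =
      measure M (W \<psi> -` A \<inter> space M) * measure M ((\<lambda>\<omega>. \<lambda>i. W (\<phi> i) \<omega>) -` S \<inter> space M)"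
      unfolding ind using W_factorize[OF orth, of A S] by simp
    then show "emeasure (distr M borel (W \<psi>)) A * emeasure (distr M seq_borel (\<lambda>\<omega> i. W (\<phi> i) \<omega>)) S =
        emeasure (distr M (borel \<Otimes>\<^sub>M seq_borel) (\<lambda>\<omega>. (W \<psi> \<omega>, \<lambda>i. W (\<phi> i) \<omega>))) (A \<times> S)"
      by (simp add: emeasure_distr emeasure_eq_measure ennreal_mult[symmetric])
  qed (auto intro: P.sigma_finite_measure_axioms Q.sigma_finite_measure_axioms)
qed

lemma W_distr:
  assumes "\<phi> \<noteq> 0"
  shows "distr M borel (W \<phi>) = density lborel (normal_density 0 (norm \<phi>))"
proof -
  define \<sigma> where "\<sigma> = norm \<phi>"
  have \<sigma>: "\<sigma> > 0" using assms by (simp add: \<sigma>_def)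
  define Y where "Y \<omega> = W \<phi> \<omega> / \<sigma>" for \<omega>
  have [measurable]: "Y \<in> borel_measurable M" unfolding Y_def by measurable
  have "distr M borel Y = std_normal_distribution"
  proof (rule Levy_uniqueness)
    show "char (distr M borel Y) = char std_normal_distribution"
    proof
      fix t
      have i: "integrable M (\<lambda>\<omega>. iexp (t * Y \<omega>))" by (rule integrable_iexp) auto
      have E: "expectation (\<lambda>\<omega>. cos (t * Y \<omega> + c)) = cos c * exp (- t\<^sup>2 / 2)" for c
      proof -
        have "AE \<omega> in M. cos (W ((t / \<sigma>) *\<^sub>R \<phi>) \<omega> + c) = cos (t * Y \<omega> + c)"
          using W_scaleR[of "t / \<sigma>" \<phi>] by eventually_elim (simp add: Y_def)
        then have "expectation (\<lambda>\<omega>. cos (t * Y \<omega> + c)) = expectation (\<lambda>\<omega>. cos (W ((t / \<sigma>) *\<^sub>R \<phi>) \<omega> + c))"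
          by (intro integral_cong_AE) auto
        then show ?thesis using \<sigma> by (simp add: expectation_cos_W \<sigma>_def)
      qed
      have "cos (x - pi / 2) = sin x" for x :: real by (simp add: cos_diff)
      then have cs: "expectation (\<lambda>\<omega>. cos (t * Y \<omega>)) = exp (- t\<^sup>2 / 2)" "expectation (\<lambda>\<omega>. sin (t * Y \<omega>)) = 0"
        using E[of 0] E[of "- (pi/2)"] by simp_all
      have "char (distr M borel Y) t = (\<integral>\<omega>. iexp (t * Y \<omega>) \<partial>M)"
        unfolding char_def by (subst integral_distr) auto
      also have "\<dots> = of_real (exp (- t\<^sup>2 / 2))"
        unfolding complex_eq_iff
        by (simp del: of_real_mult add: integral_Re[OF i, symmetric] integral_Im[OF i, symmetric] Re_exp Im_exp cs)
      finally show "char (distr M borel Y) t = char std_normal_distribution t"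
        by (simp add: char_std_normal_distribution)
    qed
  qed (auto intro: real_dist_normal_dist)
  then have "distributed M lborel Y std_normal_density"
    by (simp add: distributed_def cong: distr_cong)
  then have "distributed M lborel (W \<phi>) (normal_density 0 \<sigma>)"
    using normal_standard_normal_convert[OF \<sigma>, of "W \<phi>" 0] unfolding Y_def by simp
  then show ?thesis by (simp add: distributed_def \<sigma>_def cong: distr_cong)
qed

lemma W_sequence_measurable [measurable]:
  "(\<lambda>\<omega>. \<lambda>i::nat. W (\<phi> i) \<omega>) \<in> measurable M seq_borel"
  by (rule measurable_PiM_single') (auto simp: space_PiM)

text \<open>Each \<open>\<phi> i\<close> is split into a multiple of \<psi> and an orthogonal rest.
  Given the rests, which are independent of \<open>W \<psi>\<close>, the functional depends on one
  Gaussian variable along a line, and Stein's identity applies there; the variance times the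
  coefficient \<open>c i\<close> is the inner product with \<psi>. The derivatives are given as
  separate functions of linear growth because the application multiplies a bounded smooth function
  by an unbounded one.\<close>

lemma W_gaussian_integration_by_parts:
  fixes \<phi> :: "nat \<Rightarrow> 'h" and \<Psi> :: "(nat \<Rightarrow> real) \<Rightarrow> real"
  assumes \<Psi>m [measurable]: "\<Psi> \<in> borel_measurable seq_borel"
    and D\<Psi>m: "\<And>j. j < m \<Longrightarrow> D\<Psi> j \<in> borel_measurable seq_borel"
    and \<Psi>_le: "\<And>x. \<bar>\<Psi> x\<bar> \<le> K * (1 + (\<Sum>i<m. \<bar>x i\<bar>))"
    and D\<Psi>_le: "\<And>x j. j < m \<Longrightarrow> \<bar>D\<Psi> j x\<bar> \<le> K * (1 + (\<Sum>i<m. \<bar>x i\<bar>))"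
    and chain: "\<And>x c y. ((\<lambda>y. \<Psi> (\<lambda>i. x i + c i * y)) has_real_derivative
        (\<Sum>j<m. c j * D\<Psi> j (\<lambda>i. x i + c i * y))) (at y)"
    and cont: "\<And>x c j. j < m \<Longrightarrow> continuous_on UNIV (\<lambda>y. D\<Psi> j (\<lambda>i. x i + c i * y))"
  shows "expectation (\<lambda>\<omega>. \<Psi> (\<lambda>i. W (\<phi> i) \<omega>) * W \<psi> \<omega>) =
    (\<Sum>j<m. inner (\<phi> j) \<psi> * expectation (\<lambda>\<omega>. D\<Psi> j (\<lambda>i. W (\<phi> i) \<omega>)))"
proof (cases "\<psi> = 0")
  case True
  have "expectation (\<lambda>\<omega>. \<Psi> (\<lambda>i. W (\<phi> i) \<omega>) * W \<psi> \<omega>) = expectation (\<lambda>\<omega>. 0)"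
    using W_0 True by (intro integral_cong_AE) auto
  then show ?thesis using True by simp
next
  case False
  define \<sigma> where "\<sigma> = norm \<psi>"
  have \<sigma>: "\<sigma> > 0" using False by (simp add: \<sigma>_def)
  define c where "c i = inner (\<phi> i) \<psi> / \<sigma>\<^sup>2" for i
  define \<phi>' where "\<phi>' i = \<phi> i - c i *\<^sub>R \<psi>" for i
  have orth: "inner (\<phi>' i) \<psi> = 0" for i
    using \<sigma> by (simp add: \<phi>'_def c_def inner_diff_left \<sigma>_def power2_norm_eq_inner)
  have K0: "K \<ge> 0"
    using \<Psi>_le[of "\<lambda>_. 0"] by simp
  have AEW: "AE \<omega> in M. \<forall>i. W (\<phi> i) \<omega> = W (\<phi>' i) \<omega> + c i * W \<psi> \<omega>"
    unfolding AE_all_countable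
  proof
    fix i
    show "AE \<omega> in M. W (\<phi> i) \<omega> = W (\<phi>' i) \<omega> + c i * W \<psi> \<omega>"
      using W_linear[of 1 "\<phi> i" "- c i" \<psi>] by eventually_elim (simp add: \<phi>'_def)
  qed
  define P where "P = distr M borel (W \<psi>)"
  define Q where "Q = distr M seq_borel (\<lambda>\<omega> i. W (\<phi>' i) \<omega>)"
  have joint: "P \<Otimes>\<^sub>M Q = distr M (borel \<Otimes>\<^sub>M seq_borel) (\<lambda>\<omega>. (W \<psi> \<omega>, \<lambda>i. W (\<phi>' i) \<omega>))"
    unfolding P_def Q_def by (rule W_joint_distr) (rule orth)
  interpret P: prob_space P unfolding P_def by (rule prob_space_distr) simp
  interpret Q: prob_space Q unfolding Q_def by (rule prob_space_distr) simp
  interpret PQ: pair_sigma_finite P Q ..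
  \<comment> \<open>Reassembles the original sequence from the Gaussian coordinate and the
    independent rests.\<close>
  define S where "S = (\<lambda>(y, x). \<lambda>i::nat. x i + c i * y :: real)"
  have Sm [measurable]: "S \<in> measurable (borel \<Otimes>\<^sub>M seq_borel) seq_borel"
    unfolding S_def by (rule measurable_PiM_single') (auto simp: space_PiM case_prod_unfold)
  have SW: "AE \<omega> in M. (\<lambda>i. W (\<phi> i) \<omega>) = S (W \<psi> \<omega>, \<lambda>i. W (\<phi>' i) \<omega>)"
    using AEW by eventually_elim (simp add: S_def)
  have transfer: "expectation (\<lambda>\<omega>. F (\<lambda>i. W (\<phi> i) \<omega>) (W \<psi> \<omega>)) = (\<integral>z. F (S z) (fst z) \<partial>(P \<Otimes>\<^sub>M Q))"
    and transfer_i: "integrable M (\<lambda>\<omega>. F (\<lambda>i. W (\<phi> i) \<omega>) (W \<psi> \<omega>)) \<Longrightarrow> integrable (P \<Otimes>\<^sub>M Q) (\<lambda>z. F (S z) (fst z))"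
    if [measurable]: "(\<lambda>(x, y). F x y) \<in> borel_measurable (seq_borel \<Otimes>\<^sub>M borel)"
    for F :: "(nat \<Rightarrow> real) \<Rightarrow> real \<Rightarrow> real"
  proof -
    have m1 [measurable]: "(\<lambda>z. F (S z) (fst z)) \<in> borel_measurable (borel \<Otimes>\<^sub>M seq_borel)"
      by measurable
    have ae: "AE \<omega> in M. F (\<lambda>i. W (\<phi> i) \<omega>) (W \<psi> \<omega>) = F (S (W \<psi> \<omega>, \<lambda>i. W (\<phi>' i) \<omega>)) (W \<psi> \<omega>)"
      using SW by eventually_elim simp
    have m2: "(\<lambda>\<omega>. F (S (W \<psi> \<omega>, \<lambda>i. W (\<phi>' i) \<omega>)) (W \<psi> \<omega>)) \<in> borel_measurable M" by measurable
    show "expectation (\<lambda>\<omega>. F (\<lambda>i. W (\<phi> i) \<omega>) (W \<psi> \<omega>)) = (\<integral>z. F (S z) (fst z) \<partial>(P \<Otimes>\<^sub>M Q))"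
      unfolding joint using ae m2 by (subst integral_distr) (auto intro!: integral_cong_AE)
    show "integrable M (\<lambda>\<omega>. F (\<lambda>i. W (\<phi> i) \<omega>) (W \<psi> \<omega>)) \<Longrightarrow> integrable (P \<Otimes>\<^sub>M Q) (\<lambda>z. F (S z) (fst z))"
      unfolding joint using ae m2 by (subst integrable_distr_eq) (auto intro: integrable_cong_AE_imp)
  qed
  have i1: "integrable M (\<lambda>\<omega>. \<Psi> (\<lambda>i. W (\<phi> i) \<omega>) * W \<psi> \<omega>)"
  proof (rule Bochner_Integration.integrable_bound)
    show "integrable M (\<lambda>\<omega>. K * (\<bar>W \<psi> \<omega>\<bar> + (\<Sum>i<m. \<bar>W (\<phi> i) \<omega> * W \<psi> \<omega>\<bar>)))"
      using W_integrable W_mult_integrable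
      by (intro integrable_mult_right Bochner_Integration.integrable_add Bochner_Integration.integrable_sum integrable_abs)
    have "\<bar>\<Psi> (\<lambda>i. W (\<phi> i) \<omega>) * W \<psi> \<omega>\<bar> \<le> K * (\<bar>W \<psi> \<omega>\<bar> + (\<Sum>i<m. \<bar>W (\<phi> i) \<omega> * W \<psi> \<omega>\<bar>))" for \<omega>
      using mult_right_mono[OF \<Psi>_le[of "\<lambda>i. W (\<phi> i) \<omega>"], of "\<bar>W \<psi> \<omega>\<bar>"]
      by (simp add: abs_mult algebra_simps sum_distrib_left sum_distrib_right)
    then show "AE \<omega> in M. norm (\<Psi> (\<lambda>i. W (\<phi> i) \<omega>) * W \<psi> \<omega>) \<le> norm (K * (\<bar>W \<psi> \<omega>\<bar> + (\<Sum>i<m. \<bar>W (\<phi> i) \<omega> * W \<psi> \<omega>\<bar>)))"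
      unfolding real_norm_def by (intro AE_I2 order_trans[OF _ abs_ge_self])
  qed simp
  have i2: "integrable M (\<lambda>\<omega>. D\<Psi> j (\<lambda>i. W (\<phi> i) \<omega>))" if "j < m" for j
  proof (rule Bochner_Integration.integrable_bound)
    note [measurable] = D\<Psi>m[OF that]
    show "integrable M (\<lambda>\<omega>. K * (1 + (\<Sum>i<m. \<bar>W (\<phi> i) \<omega>\<bar>)))"
      using W_integrable
      by (intro integrable_mult_right Bochner_Integration.integrable_add Bochner_Integration.integrable_sum integrable_abs) auto
    show "AE \<omega> in M. norm (D\<Psi> j (\<lambda>i. W (\<phi> i) \<omega>)) \<le> norm (K * (1 + (\<Sum>i<m. \<bar>W (\<phi> i) \<omega>\<bar>)))"
      unfolding real_norm_def using D\<Psi>_le[OF that]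
      by (intro AE_I2 order_trans[OF _ abs_ge_self])
    show "(\<lambda>\<omega>. D\<Psi> j (\<lambda>i. W (\<phi> i) \<omega>)) \<in> borel_measurable M" by measurable
  qed
  have inner_int: "(\<integral>y. \<Psi> (S (y, x)) * y \<partial>P) = (\<integral>y. \<sigma>\<^sup>2 * (\<Sum>j<m. c j * D\<Psi> j (S (y, x))) \<partial>P)" for x
  proof -
    define h where "h y = \<Psi> (\<lambda>i. x i + c i * y)" for y
    define h' where "h' y = (\<Sum>j<m. c j * D\<Psi> j (\<lambda>i. x i + c i * y))" for y
    have h: "(h has_real_derivative h' y) (at y)" for y
      unfolding h_def h'_def by (rule chain)
    have conth': "continuous_on UNIV h'"
      unfolding h'_def by (intro continuous_intros cont) auto
    have conth: "continuous_on UNIV h"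
      using h by (meson DERIV_isCont continuous_at_imp_continuous_on)
    have [measurable]: "h \<in> borel_measurable borel" "h' \<in> borel_measurable borel"
      using conth conth' by (auto intro: borel_measurable_continuous_onI)
    define A0 where "A0 = K * ((1 + (\<Sum>i<m. \<bar>x i\<bar>)) + (\<Sum>i<m. \<bar>c i\<bar>))"
    have A0: "A0 \<ge> 0" unfolding A0_def using K0 by (intro mult_nonneg_nonneg add_nonneg_nonneg sum_nonneg) auto
    \<comment> \<open>Linear growth in many coordinates becomes, along the line, a bound in y of the
      quadratic form required by the one-dimensional identity.\<close>
    have bd: "K * (1 + (\<Sum>i<m. \<bar>x i + c i * y\<bar>)) \<le> A0 * (1 + y\<^sup>2)" for y
    proof -
      have y: "\<bar>y\<bar> \<le> 1 + y\<^sup>2"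
      proof -
        have "0 \<le> (\<bar>y\<bar> - 1)\<^sup>2" by simp
        then have "2 * \<bar>y\<bar> \<le> 1 + y\<^sup>2" unfolding power2_diff by simp
        then show ?thesis by linarith
      qed
      have "1 + (\<Sum>i<m. \<bar>x i + c i * y\<bar>) \<le> (1 + (\<Sum>i<m. \<bar>x i\<bar>)) + (\<Sum>i<m. \<bar>c i\<bar>) * \<bar>y\<bar>"
        unfolding sum_distrib_right using sum_mono[of "{..<m}" "\<lambda>i. \<bar>x i + c i * y\<bar>" "\<lambda>i. \<bar>x i\<bar> + \<bar>c i\<bar> * \<bar>y\<bar>"]
        by (simp add: sum.distrib abs_triangle_ineq[THEN order_trans] abs_mult)
      also have "\<dots> \<le> (1 + (\<Sum>i<m. \<bar>x i\<bar>)) * (1 + y\<^sup>2) + (\<Sum>i<m. \<bar>c i\<bar>) * (1 + y\<^sup>2)"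
      proof (intro add_mono mult_left_mono y)
        have "0 \<le> 1 + (\<Sum>i<m. \<bar>x i\<bar>)" by (intro add_nonneg_nonneg sum_nonneg) auto
        then show "1 + (\<Sum>i<m. \<bar>x i\<bar>) \<le> (1 + (\<Sum>i<m. \<bar>x i\<bar>)) * (1 + y\<^sup>2)"
          using mult_left_mono[of 1 "1 + y\<^sup>2"] by fastforce
      qed (auto intro: sum_nonneg)
      finally show ?thesis using K0 unfolding A0_def
        by (simp add: mult_left_mono distrib_right[symmetric] mult.assoc)
    qed
    have "(\<integral>y. \<Psi> (S (y, x)) * y \<partial>P) = (\<integral>y. h y * y \<partial>P)"
      by (simp add: S_def h_def)
    also have "\<dots> = (\<integral>y. normal_density 0 \<sigma> y * (h y * y) \<partial>lborel)"
      unfolding P_def W_distr[OF False] \<sigma>_def by (subst integral_density) auto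
    also have "\<dots> = \<sigma>\<^sup>2 * (\<integral>y. normal_density 0 \<sigma> y * h' y \<partial>lborel)"
    proof (rule gaussian_integration_by_parts[OF \<sigma> h conth'])
      show "\<bar>h y\<bar> \<le> (A0 * (1 + (\<Sum>i<m. \<bar>c i\<bar>))) * (1 + y\<^sup>2)" for y
      proof -
        have "\<bar>h y\<bar> \<le> A0 * (1 + y\<^sup>2)"
          unfolding h_def by (rule order_trans[OF \<Psi>_le bd])
        also have "\<dots> \<le> (A0 * (1 + y\<^sup>2)) * (1 + (\<Sum>i<m. \<bar>c i\<bar>))"
          using mult_left_mono[of 1 "1 + (\<Sum>i<m. \<bar>c i\<bar>)" "A0 * (1 + y\<^sup>2)"] A0 by (simp add: sum_nonneg)
        finally show ?thesis by (simp add: mult_ac)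
      qed
      show "\<bar>h' y\<bar> \<le> (A0 * (1 + (\<Sum>i<m. \<bar>c i\<bar>))) * (1 + y\<^sup>2)" for y
      proof -
        have "\<bar>h' y\<bar> \<le> (\<Sum>j<m. \<bar>c j\<bar> * (A0 * (1 + y\<^sup>2)))"
          unfolding h'_def
        proof (rule order_trans[OF sum_abs sum_mono])
          fix j assume "j \<in> {..<m}"
          then have "\<bar>D\<Psi> j (\<lambda>i. x i + c i * y)\<bar> \<le> A0 * (1 + y\<^sup>2)"
            using D\<Psi>_le[of j "\<lambda>i. x i + c i * y"] bd[of y] by simp
          then show "\<bar>c j * D\<Psi> j (\<lambda>i. x i + c i * y)\<bar> \<le> \<bar>c j\<bar> * (A0 * (1 + y\<^sup>2))"
            unfolding abs_mult by (intro mult_left_mono) auto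
        qed
        also have "\<dots> = (\<Sum>i<m. \<bar>c i\<bar>) * (A0 * (1 + y\<^sup>2))" by (simp add: sum_distrib_right)
        also have "\<dots> \<le> (1 + (\<Sum>i<m. \<bar>c i\<bar>)) * (A0 * (1 + y\<^sup>2))"
          using A0 by (intro mult_right_mono) auto
        finally show ?thesis by (simp add: mult_ac)
      qed
    qed
    also have "\<dots> = \<sigma>\<^sup>2 * (\<integral>y. h' y \<partial>P)"
      unfolding P_def W_distr[OF False] \<sigma>_def by (subst integral_density) auto
    also have "\<dots> = (\<integral>y. \<sigma>\<^sup>2 * (\<Sum>j<m. c j * D\<Psi> j (S (y, x))) \<partial>P)"
      by (simp add: S_def h'_def)
    finally show ?thesis .
  qed
  have sets_eq: "sets (P \<Otimes>\<^sub>M Q) = sets (borel \<Otimes>\<^sub>M seq_borel)"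
    by (simp add: P_def Q_def cong: sets_pair_measure_cong)
  have i3: "integrable M (\<lambda>\<omega>. \<sigma>\<^sup>2 * (\<Sum>j<m. c j * D\<Psi> j (\<lambda>i. W (\<phi> i) \<omega>)))"
    using i2 by (intro integrable_mult_right Bochner_Integration.integrable_sum) auto
  have m3: "(\<lambda>(x, y). \<sigma>\<^sup>2 * (\<Sum>j<m. c j * D\<Psi> j x)) \<in> borel_measurable (seq_borel \<Otimes>\<^sub>M (borel :: real measure))"
  proof -
    have "(\<lambda>z. D\<Psi> j (fst z)) \<in> borel_measurable (seq_borel \<Otimes>\<^sub>M (borel :: real measure))" if "j < m" for j
      using D\<Psi>m[OF that] by measurable
    then show ?thesis unfolding case_prod_unfold
      by (intro borel_measurable_times borel_measurable_sum) auto
  qed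
  have m4: "(\<lambda>(x, y). \<Psi> x * y) \<in> borel_measurable (seq_borel \<Otimes>\<^sub>M borel)"
    by measurable
  have "expectation (\<lambda>\<omega>. \<Psi> (\<lambda>i. W (\<phi> i) \<omega>) * W \<psi> \<omega>) = (\<integral>z. \<Psi> (S z) * fst z \<partial>(P \<Otimes>\<^sub>M Q))"
    by (rule transfer[OF m4])
  also have "\<dots> = (\<integral>x. (\<integral>y. \<Psi> (S (y, x)) * y \<partial>P) \<partial>Q)"
    using transfer_i[OF m4 i1] by (subst PQ.integral_snd) (simp_all add: case_prod_unfold)
  also have "\<dots> = (\<integral>x. (\<integral>y. \<sigma>\<^sup>2 * (\<Sum>j<m. c j * D\<Psi> j (S (y, x))) \<partial>P) \<partial>Q)"
    by (simp only: inner_int)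
  also have "\<dots> = (\<integral>z. \<sigma>\<^sup>2 * (\<Sum>j<m. c j * D\<Psi> j (S z)) \<partial>(P \<Otimes>\<^sub>M Q))"
    using transfer_i[OF m3 i3] by (subst PQ.integral_snd) (simp_all add: case_prod_unfold)
  also have "\<dots> = expectation (\<lambda>\<omega>. \<sigma>\<^sup>2 * (\<Sum>j<m. c j * D\<Psi> j (\<lambda>i. W (\<phi> i) \<omega>)))"
    by (rule transfer[OF m3, symmetric])
  also have "\<dots> = (\<Sum>j<m. inner (\<phi> j) \<psi> * expectation (\<lambda>\<omega>. D\<Psi> j (\<lambda>i. W (\<phi> i) \<omega>)))"
    using i2 \<sigma> by (simp add: Bochner_Integration.integral_sum sum_distrib_left c_def)
  finally show ?thesis .
qed

end

section \<open>Powers of distances and Riemann-Stieltjes sums\<close>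

lemma abs_powr_deriv:
  fixes p x r :: real
  assumes p: "p > 1"
  shows "((\<lambda>x. \<bar>x - r\<bar> powr p) has_real_derivative p * (sgn (x - r) * \<bar>x - r\<bar> powr (p - 1))) (at x)"
proof -
  consider "x > r" | "x < r" | "x = r" by linarith
  then show ?thesis
  proof cases
    case 1
    have "((\<lambda>x. (x - r) powr p) has_real_derivative p * (sgn (x - r) * \<bar>x - r\<bar> powr (p - 1))) (at x)"
      using 1 by (auto intro!: derivative_eq_intros)
    moreover have "\<forall>\<^sub>F y in nhds x. (y - r) powr p = \<bar>y - r\<bar> powr p"
      using eventually_nhds_in_open[of "{r<..}" x] 1 by (auto elim!: eventually_mono)
    ultimately show ?thesis by (subst DERIV_cong_ev) (auto elim!: eventually_mono)
  next
    case 2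
    have "((\<lambda>x. (r - x) powr p) has_real_derivative p * (sgn (x - r) * \<bar>x - r\<bar> powr (p - 1))) (at x)"
      using 2 by (auto intro!: derivative_eq_intros)
    moreover have "\<forall>\<^sub>F y in nhds x. (r - y) powr p = \<bar>y - r\<bar> powr p"
      using eventually_nhds_in_open[of "{..<r}" x] 2 by (auto elim!: eventually_mono)
    ultimately show ?thesis by (subst DERIV_cong_ev) (auto elim!: eventually_mono)
  next
    case 3
    have "((\<lambda>h. \<bar>h\<bar> powr (p - 1)) \<longlongrightarrow> 0) (at 0)"
      using p by (auto intro!: tendsto_eq_intros)
    moreover have "\<bar>\<bar>h\<bar> powr p / h\<bar> = \<bar>h\<bar> powr (p - 1)" if "h \<noteq> 0" for h :: real
      using that by (simp add: powr_diff)
    ultimately have "((\<lambda>h. \<bar>h\<bar> powr p / h) \<longlongrightarrow> 0) (at 0)"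
      by (intro tendsto_rabs_zero_cancel[where f="\<lambda>h. \<bar>h\<bar> powr p / h"])
        (auto elim!: Lim_transform_eventually simp: eventually_at_filter)
    then show ?thesis using 3 p by (simp add: DERIV_def)
  qed
qed

lemma signed_powr_mono:
  fixes x y q :: real
  assumes "x \<le> y" "q \<ge> 0"
  shows "sgn x * \<bar>x\<bar> powr q \<le> sgn y * \<bar>y\<bar> powr q"
proof -
  consider "x \<ge> 0" | "y \<le> 0" | "x < 0" "y > 0" by linarith
  then show ?thesis
  proof cases
    case 1
    then show ?thesis using assms by (cases "x = 0") (auto simp: sgn_if intro!: powr_mono2)
  next
    case 2
    then show ?thesis using assms by (cases "y = 0") (auto simp: sgn_if intro!: powr_mono2)
  next
    case 3
    then show ?thesis by (simp add: sgn_if) (meson order_trans neg_le_0_iff_le powr_ge_zero)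
  qed
qed

text \<open>Each increment of A is the integral of \<open>a\<close> over its cell, so replacing
  \<phi> by its value at the right end point costs at most the oscillation of \<phi> times the
  supremum of |a| times the mesh. These costs add up over the first m cells, which is the induction
  in \<open>key\<close>.\<close>

lemma riemann_stieltjes_sum_tendsto:
  fixes \<phi> a A :: "real \<Rightarrow> real"
  assumes t: "0 \<le> t" and \<phi>: "continuous_on {0..t} \<phi>" and a: "continuous_on {0..t} a"
    and A: "\<And>x. x \<in> {0..t} \<Longrightarrow> (A has_real_derivative a x) (at x within {0..t})"
  shows "(\<lambda>n. \<Sum>k<Suc n. \<phi> (t * real (Suc k) / real (Suc n)) *
      (A (t * real (Suc k) / real (Suc n)) - A (t * real k / real (Suc n))))
    \<longlonglongrightarrow> integral {0..t} (\<lambda>s. \<phi> s * a s)"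
proof -
  obtain C where C: "C > 0" "\<And>s. s \<in> {0..t} \<Longrightarrow> \<bar>a s\<bar> \<le> C"
  proof -
    have "bounded (a ` {0..t})" using a by (intro compact_imp_bounded compact_continuous_image) auto
    then show ?thesis using that by (auto simp: bounded_pos)
  qed
  have key: "\<bar>(\<Sum>k<m. \<phi> (t * real (Suc k) / real n) * (A (t * real (Suc k) / real n) - A (t * real k / real n)))
      - integral {0..t * real m / real n} (\<lambda>s. \<phi> s * a s)\<bar> \<le> \<epsilon> * C * (t * real m / real n)"
    if n: "n > 0" and \<epsilon>: "\<And>x y. x \<in> {0..t} \<Longrightarrow> y \<in> {0..t} \<Longrightarrow> \<bar>x - y\<bar> \<le> t / real n \<Longrightarrow> \<bar>\<phi> x - \<phi> y\<bar> \<le> \<epsilon>"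
      and "m \<le> n" for n m :: nat and \<epsilon>
    using \<open>m \<le> n\<close>
  proof (induction m)
    case 0
    then show ?case by simp
  next
    case (Suc m)
    let ?x = "t * real m / real n" and ?y = "t * real (Suc m) / real n"
    have xy: "0 \<le> ?x" "?x \<le> ?y" using t by (auto intro!: divide_right_mono mult_left_mono)
    have "t * real (Suc m) \<le> t * real n" using t Suc.prems by (intro mult_left_mono) auto
    then have yt: "?y \<le> t" using n by (simp add: divide_le_eq)
    have yx: "?y - ?x = t / real n" by (simp add: distrib_left add_divide_distrib)
    have sub: "{?x..?y} \<subseteq> {0..t}" using xy yt by auto
    have \<phi>a: "continuous_on {0..t} (\<lambda>s. \<phi> s * a s)" by (intro continuous_intros \<phi> a)
    have I: "integral {0..?y} (\<lambda>s. \<phi> s * a s) = integral {0..?x} (\<lambda>s. \<phi> s * a s) + integral {?x..?y} (\<lambda>s. \<phi> s * a s)"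
      using xy yt by (intro Henstock_Kurzweil_Integration.integral_combine[symmetric] integrable_continuous_interval
          continuous_on_subset[OF \<phi>a]) auto
    have "(a has_integral A ?y - A ?x) {?x..?y}"
    proof (rule fundamental_theorem_of_calculus[OF xy(2)])
      fix x assume "x \<in> {?x..?y}"
      then have "(A has_vector_derivative a x) (at x within {0..t})"
        using A[of x] sub by (auto simp: has_real_derivative_iff_has_vector_derivative)
      then show "(A has_vector_derivative a x) (at x within {?x..?y})"
        by (rule has_vector_derivative_within_subset[OF _ sub])
    qed
    then have "((\<lambda>s. \<phi> ?y * a s) has_integral \<phi> ?y * (A ?y - A ?x)) {?x..?y}"
      by (rule has_integral_mult_right)
    then have "((\<lambda>s. \<phi> ?y * a s - \<phi> s * a s) has_integral
        \<phi> ?y * (A ?y - A ?x) - integral {?x..?y} (\<lambda>s. \<phi> s * a s)) {?x..?y}"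
      using sub by (intro has_integral_diff integrable_integral integrable_continuous_interval
          continuous_on_subset[OF \<phi>a]) auto
    then have P: "norm (\<phi> ?y * (A ?y - A ?x) - integral {?x..?y} (\<lambda>s. \<phi> s * a s)) \<le> (\<epsilon> * C) * measure lborel (cbox ?x ?y)"
      unfolding cbox_interval
    proof (rule has_integral_bound_real[where S="{}", rotated 2])
      have "\<bar>\<phi> ?y - \<phi> ?y\<bar> \<le> \<epsilon>" using xy yt t by (intro \<epsilon>) auto
      then show "0 \<le> \<epsilon> * C" using C by simp
      fix s assume "s \<in> {?x..?y} - {}"
      then have s: "s \<in> {?x..?y}" by simp
      have "\<bar>\<phi> ?y - \<phi> s\<bar> \<le> \<epsilon>" using s sub xy yt yx by (intro \<epsilon>) auto
      moreover have "\<bar>a s\<bar> \<le> C" using s sub by (intro C) auto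
      ultimately show "norm (\<phi> ?y * a s - \<phi> s * a s) \<le> \<epsilon> * C"
        unfolding left_diff_distrib[symmetric] real_norm_def abs_mult by (intro mult_mono) auto
    qed simp
    have m: "measure lborel (cbox ?x ?y) = ?y - ?x" using xy by simp
    have gen: "\<bar>S - I1\<bar> \<le> u \<Longrightarrow> \<bar>P - I2\<bar> \<le> v \<Longrightarrow> I = I1 + I2 \<Longrightarrow> \<bar>S + P - I\<bar> \<le> u + v"
      for S P I1 I2 I u v :: real by linarith
    have "m \<le> n" using Suc.prems by simp
    have e: "\<epsilon> * C * ?y = \<epsilon> * C * ?x + \<epsilon> * C * (?y - ?x)"
      by (simp only: distrib_left[symmetric]) simp
    show ?case
      unfolding sum.lessThan_Suc e
      by (rule gen[OF Suc.IH[OF \<open>m \<le> n\<close>] P[unfolded m real_norm_def] I])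
  qed
  show ?thesis
  proof (rule LIMSEQ_I)
    fix r :: real assume r: "r > 0"
    \<comment> \<open>The summand 1 keeps the denominator positive when t = 0.\<close>
    define \<epsilon> where "\<epsilon> = r / (2 * (C * (t + 1)))"
    have Ct: "C * (t + 1) > 0" using C t by simp
    then have \<epsilon>: "\<epsilon> > 0" using r by (simp add: \<epsilon>_def del: zero_less_mult_iff)
    have "uniformly_continuous_on {0..t} \<phi>" using \<phi> by (simp add: compact_uniformly_continuous)
    then obtain d where d: "d > 0" "\<And>x y. x \<in> {0..t} \<Longrightarrow> y \<in> {0..t} \<Longrightarrow> \<bar>x - y\<bar> < d \<Longrightarrow> \<bar>\<phi> x - \<phi> y\<bar> < \<epsilon>"
      using \<epsilon> unfolding uniformly_continuous_on_def dist_real_def by (metis abs_minus_commute)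
    obtain n0 :: nat where n0: "t / d < real n0" using reals_Archimedean2 by blast
    show "\<exists>no. \<forall>n\<ge>no. norm ((\<Sum>k<Suc n. \<phi> (t * real (Suc k) / real (Suc n)) *
      (A (t * real (Suc k) / real (Suc n)) - A (t * real k / real (Suc n)))) - integral {0..t} (\<lambda>s. \<phi> s * a s)) < r"
    proof (intro exI[of _ n0] allI impI)
      fix n assume "n \<ge> n0"
      then have "t / d < real (Suc n)" using n0 by linarith
      then have tn: "t / real (Suc n) < d" using d(1) by (simp add: field_simps)
      have "norm ((\<Sum>k<Suc n. \<phi> (t * real (Suc k) / real (Suc n)) *
        (A (t * real (Suc k) / real (Suc n)) - A (t * real k / real (Suc n)))) - integral {0..t} (\<lambda>s. \<phi> s * a s)) \<le> \<epsilon> * C * t"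
        using key[of "Suc n" \<epsilon> "Suc n"] d(2) tn by (auto simp: less_imp_le)
      also have "\<dots> \<le> \<epsilon> * C * (t + 1)" using \<epsilon> C by (intro mult_left_mono) auto
      also have "\<dots> = r / 2" using less_imp_neq[OF Ct] unfolding \<epsilon>_def mult.assoc by (simp del: mult_eq_0_iff)
      also have "\<dots> < r" using r by simp
      finally show "norm ((\<Sum>k<Suc n. \<phi> (t * real (Suc k) / real (Suc n)) *
        (A (t * real (Suc k) / real (Suc n)) - A (t * real k / real (Suc n)))) - integral {0..t} (\<lambda>s. \<phi> s * a s)) < r" .
    qed
  qed
qed

section \<open>Covariance of increments and Hilbert space elements of continuous integrands\<close>

context fbm_setup
begin

text \<open>The absolute values extend the covariance to all real arguments, where it is
  differentiable in s; no one-sided derivatives occur at the ends of [0,T].\<close>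

definition cov :: "real \<Rightarrow> real \<Rightarrow> real" where
  "cov s r = (\<bar>s\<bar> powr (2*H) + \<bar>r\<bar> powr (2*H) - \<bar>s - r\<bar> powr (2*H)) / 2"

text \<open>For r \<ge> 0 this is 2H - 1 times the integral of the kernel |s - q| powr (2H - 2) over
  q in [0,r]; H times it is the derivative of \<open>cov\<close> in s.\<close>

definition kap :: "real \<Rightarrow> real \<Rightarrow> real" where
  "kap s r = sgn s * \<bar>s\<bar> powr (2*H - 1) + sgn (r - s) * \<bar>r - s\<bar> powr (2*H - 1)"

lemma inner_e: "s \<in> {0..T} \<Longrightarrow> r \<in> {0..T} \<Longrightarrow> inner (e s) (e r) = cov s r"
  using indicators fbm by (simp add: indicator_completion_def fractional_brownian_motion_def cov_def)

lemma cov_deriv: "((\<lambda>s. cov s r) has_real_derivative H * kap s r) (at s)"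
proof -
  have "2 * H > 1" using H by simp
  have "((\<lambda>s. \<bar>s - 0\<bar> powr (2*H)) has_real_derivative (2*H) * (sgn (s - 0) * \<bar>s - 0\<bar> powr (2*H - 1))) (at s)"
    "((\<lambda>s. \<bar>s - r\<bar> powr (2*H)) has_real_derivative (2*H) * (sgn (s - r) * \<bar>s - r\<bar> powr (2*H - 1))) (at s)"
    by (rule abs_powr_deriv[OF \<open>2 * H > 1\<close>])+
  note d = this
  have e: "sgn (r - s) = - sgn (s - r)" "\<bar>r - s\<bar> = \<bar>s - r\<bar>" by (auto simp: sgn_if)
  show ?thesis
    unfolding cov_def[abs_def] kap_def e
    by (rule DERIV_cong, rule DERIV_cdivide, rule DERIV_diff[OF DERIV_add[OF d(1)[simplified] DERIV_const] d(2)])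
      (simp add: field_simps)
qed

lemma kap_continuous: "continuous_on UNIV (\<lambda>s. kap s r)"
proof -
  have "continuous_on UNIV (\<lambda>x. sgn x * \<bar>x\<bar> powr (2*H-1))"
    unfolding continuous_on_eq_continuous_at[OF open_UNIV]
  proof
    fix x :: real
    show "isCont (\<lambda>x. sgn x * \<bar>x\<bar> powr (2*H-1)) x"
    proof (cases "x = 0")
      case True
      have "((\<lambda>x. \<bar>x\<bar> powr (2*H-1)) \<longlongrightarrow> 0) (at (0::real))"
        using H by (auto intro!: tendsto_eq_intros)
      then have "((\<lambda>x. sgn x * \<bar>x\<bar> powr (2*H-1)) \<longlongrightarrow> 0) (at (0::real))"
        by (rule Lim_null_comparison[rotated]) (auto simp: abs_mult abs_sgn_eq intro!: always_eventually)
      then show ?thesis using True by (simp add: isCont_def)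
    next
      case False
      then show ?thesis by (intro continuous_intros) auto
    qed
  qed
  note c = this
  show ?thesis
    unfolding kap_def
    by (intro continuous_on_add c continuous_on_compose2[OF c, of _ "\<lambda>s. r - s"] continuous_intros) auto
qed

lemma kap_nonneg_le: "0 \<le> s \<Longrightarrow> s \<le> T \<Longrightarrow> 0 \<le> r \<Longrightarrow> r \<le> T \<Longrightarrow> 0 \<le> kap s r \<and> kap s r \<le> 2 * T powr (2*H-1)"
proof -
  assume a: "0 \<le> s" "s \<le> T" "0 \<le> r" "r \<le> T"
  have q: "2*H - 1 \<ge> 0" using H by simp
  have "sgn (- s) * \<bar>- s\<bar> powr (2*H-1) \<le> sgn (r - s) * \<bar>r - s\<bar> powr (2*H-1)"
    by (rule signed_powr_mono) (use a q in auto)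
  moreover have "sgn (r - s) * \<bar>r - s\<bar> powr (2*H-1) \<le> sgn T * \<bar>T\<bar> powr (2*H-1)"
    by (rule signed_powr_mono) (use a q in auto)
  moreover have "sgn s * \<bar>s\<bar> powr (2*H-1) \<le> sgn T * \<bar>T\<bar> powr (2*H-1)"
    by (rule signed_powr_mono) (use a q in auto)
  ultimately show ?thesis using T by (simp add: kap_def sgn_minus)
qed

text \<open>The bound for H * \<open>kap\<close> when both arguments lie in [0,T], hence a Lipschitz
  constant of the covariance in one argument.\<close>

definition CH :: real where "CH = 2 * H * T powr (2*H-1)"

lemma CH_pos: "CH > 0" using H T by (simp add: CH_def)

lemma cov_diff_bounds:
  assumes "0 \<le> a" "a \<le> b" "b \<le> T" "0 \<le> r" "r \<le> T"
  shows "0 \<le> cov b r - cov a r" "cov b r - cov a r \<le> CH * (b - a)"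
proof -
  have H0: "H \<ge> 0" using H by simp
  have "cov a r \<le> cov b r"
    by (rule DERIV_nonneg_imp_nondecreasing[OF assms(2)])
      (use assms kap_nonneg_le H0 cov_deriv in \<open>meson mult_nonneg_nonneg order_trans\<close>)
  then show "0 \<le> cov b r - cov a r" by simp
  have "CH * a - cov a r \<le> CH * b - cov b r"
  proof (rule DERIV_nonneg_imp_nondecreasing[OF assms(2)])
    fix x assume x: "a \<le> x" "x \<le> b"
    have "H * kap x r \<le> H * (2 * T powr (2*H-1))"
      using kap_nonneg_le[of x r] x assms H0 by (intro mult_left_mono) auto
    moreover have "((\<lambda>x. CH * x - cov x r) has_real_derivative CH - H * kap x r) (at x)"
      by (auto intro!: derivative_eq_intros cov_deriv)
    ultimately show "\<exists>y. ((\<lambda>x. CH * x - cov x r) has_real_derivative y) (at x) \<and> 0 \<le> y"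
      by (intro exI[of _ "CH - H * kap x r"]) (auto simp: CH_def)
  qed
  then show "cov b r - cov a r \<le> CH * (b - a)" by (simp add: algebra_simps)
qed

text \<open>For H > 1/2 increments over any two intervals are nonnegatively correlated, because
  \<open>kap\<close> increases in its second argument. This positivity lets plain row sums replace
  absolute row sums in the norm estimate for step functions.\<close>

lemma inner_increments_nonneg:
  assumes "0 \<le> a" "a \<le> b" "b \<le> T" "0 \<le> c" "c \<le> d" "d \<le> T"
  shows "0 \<le> inner (e b - e a) (e d - e c)"
proof -
  have "cov a d - cov a c \<le> cov b d - cov b c"
  proof (rule DERIV_nonneg_imp_nondecreasing[OF assms(2)])
    fix x assume x: "a \<le> x" "x \<le> b"
    have "sgn (c - x) * \<bar>c - x\<bar> powr (2*H-1) \<le> sgn (d - x) * \<bar>d - x\<bar> powr (2*H-1)"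
      by (rule signed_powr_mono) (use assms H in auto)
    then have "H * kap x c \<le> H * kap x d" using H by (intro mult_left_mono) (auto simp: kap_def)
    moreover have "((\<lambda>x. cov x d - cov x c) has_real_derivative H * kap x d - H * kap x c) (at x)"
      by (auto intro!: derivative_eq_intros cov_deriv)
    ultimately show "\<exists>y. ((\<lambda>x. cov x d - cov x c) has_real_derivative y) (at x) \<and> 0 \<le> y"
      by (intro exI[of _ "H * kap x d - H * kap x c"]) auto
  qed
  then show ?thesis using assms by (simp add: inner_diff_left inner_diff_right inner_e)
qed

lemma e_0: "e 0 = 0"
  using inner_e[of 0 0] T by (simp add: cov_def)

definition grid :: "real \<Rightarrow> nat \<Rightarrow> nat \<Rightarrow> real" where
  "grid t n k = t * real k / real n"

definition De :: "real \<Rightarrow> nat \<Rightarrow> nat \<Rightarrow> 'h" where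
  "De t n k = e (grid t n (Suc k)) - e (grid t n k)"

definition U :: "real \<Rightarrow> nat \<Rightarrow> (real \<Rightarrow> real) \<Rightarrow> 'h" where
  "U t n \<phi> = (\<Sum>k<n. \<phi> (grid t n (Suc k)) *\<^sub>R De t n k)"

lemma grid_mono: "0 \<le> t \<Longrightarrow> k \<le> l \<Longrightarrow> grid t n k \<le> grid t n l"
  by (auto simp: grid_def intro!: divide_right_mono mult_left_mono)

lemma grid_nonneg: "0 \<le> t \<Longrightarrow> 0 \<le> grid t n k"
  by (auto simp: grid_def)

lemma grid_n: "n > 0 \<Longrightarrow> grid t n n = t"
  by (auto simp: grid_def)

lemma grid_0: "grid t n 0 = 0"
  by (auto simp: grid_def)

lemma grid_le: "0 \<le> t \<Longrightarrow> k \<le> n \<Longrightarrow> grid t n k \<le> t"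
  using grid_mono[of t k n n] grid_n[of n t] by (cases n) (auto simp: grid_def)

lemma grid_Suc: "grid t n (Suc k) - grid t n k = t / real n"
  by (simp add: grid_def distrib_left add_divide_distrib)

lemma sum_De: "(\<Sum>k<m. De t n k) = e (grid t n m)"
  unfolding De_def by (subst sum_lessThan_telescope) (simp add: grid_0 e_0)

text \<open>Schur test. The Gram matrix of the increments has nonnegative entries, so bounding c k *
  c l by half the sum of the squares reduces the quadratic form to its row sums. A row sum
  telescopes to a difference of covariances, at most \<open>CH\<close> times the mesh. In effect the
  Hilbert norm of a step function is bounded by its L2 norm in time.\<close>

lemma norm_sum_De:
  assumes t: "0 \<le> t" "t \<le> T" and n: "n > 0"
  shows "(norm (\<Sum>k<n. c k *\<^sub>R De t n k))\<^sup>2 \<le> CH * (t / n) * (\<Sum>k<n. (c k)\<^sup>2)"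
proof -
  have rng: "0 \<le> grid t n k" "grid t n k \<le> T" if "k \<le> n" for k
    using grid_nonneg[OF t(1)] grid_le[OF t(1) that, THEN order_trans, OF t(2)] by auto
  have ge: "0 \<le> inner (De t n k) (De t n l)" if "k < n" "l < n" for k l
    unfolding De_def using that rng grid_mono[OF t(1)] by (intro inner_increments_nonneg) auto
  have "(norm (\<Sum>k<n. c k *\<^sub>R De t n k))\<^sup>2 = (\<Sum>k<n. \<Sum>l<n. c k * c l * inner (De t n k) (De t n l))"
    unfolding power2_norm_eq_inner inner_sum_left inner_sum_right by (simp add: mult_ac inner_commute)
  also have "\<dots> \<le> (\<Sum>k<n. \<Sum>l<n. ((c k)\<^sup>2 / 2 + (c l)\<^sup>2 / 2) * inner (De t n k) (De t n l))"
  proof (intro sum_mono mult_right_mono)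
    fix k l
    show "c k * c l \<le> (c k)\<^sup>2 / 2 + (c l)\<^sup>2 / 2"
      using sum_squares_bound[of "c k" "c l"] by (simp add: field_simps)
  qed (auto intro: ge)
  also have "\<dots> = (\<Sum>k<n. \<Sum>l<n. (c k)\<^sup>2 / 2 * inner (De t n k) (De t n l)) + (\<Sum>k<n. \<Sum>l<n. (c l)\<^sup>2 / 2 * inner (De t n k) (De t n l))"
    by (simp add: distrib_right sum.distrib)
  also have "(\<Sum>k<n. \<Sum>l<n. (c l)\<^sup>2 / 2 * inner (De t n k) (De t n l)) = (\<Sum>k<n. \<Sum>l<n. (c k)\<^sup>2 / 2 * inner (De t n k) (De t n l))"
    by (subst sum.swap) (simp add: inner_commute)
  also have "(\<Sum>k<n. \<Sum>l<n. (c k)\<^sup>2 / 2 * inner (De t n k) (De t n l)) + (\<Sum>k<n. \<Sum>l<n. (c k)\<^sup>2 / 2 * inner (De t n k) (De t n l))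
      = (\<Sum>k<n. (c k)\<^sup>2 * inner (De t n k) (\<Sum>l<n. De t n l))"
    unfolding inner_sum_right sum_distrib_left sum.distrib[symmetric] by (intro sum.cong) (auto simp: field_simps)
  also have "\<dots> \<le> (\<Sum>k<n. (c k)\<^sup>2 * (CH * (t / n)))"
  proof (intro sum_mono mult_left_mono)
    fix k assume k: "k \<in> {..<n}"
    have "inner (De t n k) (\<Sum>l<n. De t n l) = cov (grid t n (Suc k)) t - cov (grid t n k) t"
      unfolding sum_De unfolding De_def inner_diff_left using k rng[of k] rng[of "Suc k"] t n
      by (simp add: inner_e grid_n)
    also have "\<dots> \<le> CH * (grid t n (Suc k) - grid t n k)"
      using k rng[of k] rng[of "Suc k"] t grid_mono[OF t(1), of k "Suc k"] by (intro cov_diff_bounds) auto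
    finally show "inner (De t n k) (\<Sum>l<n. De t n l) \<le> CH * (t / n)" by (simp add: grid_Suc)
  qed auto
  also have "\<dots> = CH * (t / n) * (\<Sum>k<n. (c k)\<^sup>2)" by (simp add: sum_distrib_left mult_ac)
  finally show ?thesis .
qed

text \<open>The coarse step function is rewritten on the finer grid, where cell j lies in the coarse
  cell j div m; the difference is then again a step function on a single grid.\<close>

lemma U_refine:
  assumes t: "0 \<le> t" "t \<le> T" and n: "n > 0" and m: "m > 0"
  shows "(norm (U t n \<phi> - U t (n * m) \<phi>))\<^sup>2 \<le>
    CH * (t / real (n * m)) * (\<Sum>j<n*m. (\<phi> (grid t n (Suc (j div m))) - \<phi> (grid t (n * m) (Suc j)))\<^sup>2)"
proof -
  have g: "grid t (n * m) (k * m) = grid t n k" for k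
    using n m by (simp add: grid_def field_simps)
  have De_sum: "De t n k = (\<Sum>j\<in>{k*m..<k*m+m}. De t (n * m) j)" for k
  proof -
    have "(\<Sum>j\<in>{k*m..<k*m+m}. De t (n * m) j) = e (grid t (n*m) (k * m + m)) - e (grid t (n*m) (k * m))"
      unfolding De_def by (subst sum_Suc_diff') auto
    also have "grid t (n*m) (k * m + m) = grid t n (Suc k)" using g[of "Suc k"] by (simp add: add.commute)
    finally show ?thesis unfolding g De_def by simp
  qed
  have "U t n \<phi> = (\<Sum>k<n. \<Sum>j\<in>{k*m..<k*m+m}. \<phi> (grid t n (Suc (j div m))) *\<^sub>R De t (n * m) j)"
    unfolding U_def
  proof (intro sum.cong refl)
    fix k
    have "j div m = k" if "j \<in> {k*m..<k*m+m}" for j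
      using that m by (intro div_nat_eqI) (auto simp: mult.commute)
    then show "\<phi> (grid t n (Suc k)) *\<^sub>R De t n k = (\<Sum>j\<in>{k*m..<k*m+m}. \<phi> (grid t n (Suc (j div m))) *\<^sub>R De t (n * m) j)"
      unfolding De_sum[of k] scaleR_sum_right by (intro sum.cong) auto
  qed
  also have "\<dots> = (\<Sum>j<n*m. \<phi> (grid t n (Suc (j div m))) *\<^sub>R De t (n * m) j)"
    by (rule sum.nat_group)
  finally have "U t n \<phi> - U t (n * m) \<phi> =
      (\<Sum>j<n*m. (\<phi> (grid t n (Suc (j div m))) - \<phi> (grid t (n * m) (Suc j))) *\<^sub>R De t (n * m) j)"
    by (simp add: U_def sum_subtractf scaleR_diff_left)
  then show ?thesis using norm_sum_De[OF t, of "n * m"] n m by simp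
qed

lemma grid_refine_close:
  assumes t: "0 \<le> t" and n: "n > 0" and m: "m > 0" and j: "j < n * m"
  shows "grid t n (Suc (j div m)) \<in> {0..t}" "grid t (n * m) (Suc j) \<in> {0..t}"
    "\<bar>grid t n (Suc (j div m)) - grid t (n * m) (Suc j)\<bar> \<le> t / real n"
proof -
  have jd: "j div m < n" using j m by (simp add: div_less_iff_less_mult)
  show "grid t n (Suc (j div m)) \<in> {0..t}" "grid t (n * m) (Suc j) \<in> {0..t}"
    using jd j t grid_nonneg grid_le[of t "Suc (j div m)" n] grid_le[of t "Suc j" "n * m"] by auto
  have g: "grid t (n * m) (k * m) = grid t n k" for k
    using n m by (simp add: grid_def field_simps)
  have "j div m * m \<le> j" by simp
  then have a: "j div m * m \<le> Suc j" by linarith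
  have "j < Suc (j div m) * m" using m by (simp add: dividend_less_div_times)
  then have b: "Suc j \<le> Suc (j div m) * m" by simp
  have "grid t n (j div m) \<le> grid t (n * m) (Suc j)" "grid t (n * m) (Suc j) \<le> grid t n (Suc (j div m))"
    using grid_mono[OF t a, of "n * m"] grid_mono[OF t b, of "n * m"] unfolding g by auto
  then show "\<bar>grid t n (Suc (j div m)) - grid t (n * m) (Suc j)\<bar> \<le> t / real n"
    using grid_Suc[of t n "j div m"] by linarith
qed

text \<open>Two arbitrary partitions are compared through their common refinement, whose number of
  cells is the product; uniform continuity controls each of the two comparisons.\<close>

lemma U_Cauchy:
  assumes t: "0 \<le> t" "t \<le> T" and \<phi>: "continuous_on {0..t} \<phi>"
  shows "Cauchy (\<lambda>n. U t (Suc n) \<phi>)"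
proof (rule metric_CauchyI)
  fix r :: real assume r: "r > 0"
  \<comment> \<open>One third of r for each of the two comparisons leaves room for the strict
    inequality; t + 1 keeps the root positive when t = 0.\<close>
  define \<epsilon> where "\<epsilon> = r / (3 * sqrt (CH * (t + 1)))"
  have s: "sqrt (CH * (t + 1)) > 0" using CH_pos t by simp
  have \<epsilon>: "\<epsilon> > 0" using r s by (simp add: \<epsilon>_def)
  have "uniformly_continuous_on {0..t} \<phi>" using \<phi> by (simp add: compact_uniformly_continuous)
  then obtain d where d: "d > 0" "\<And>x y. x \<in> {0..t} \<Longrightarrow> y \<in> {0..t} \<Longrightarrow> \<bar>x - y\<bar> < d \<Longrightarrow> \<bar>\<phi> x - \<phi> y\<bar> < \<epsilon>"
    using \<epsilon> unfolding uniformly_continuous_on_def dist_real_def by (metis abs_minus_commute)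
  obtain n0 :: nat where n0: "t / d < real n0" using reals_Archimedean2 by blast
  have step: "norm (U t n \<phi> - U t (n * m) \<phi>) \<le> r / 3" if n: "n > n0" and m: "m > 0" for n m
  proof -
    have "t / d < real n" using n0 n by simp
    then have tn: "t / real n < d" using d(1) n by (simp add: field_simps)
    have "(norm (U t n \<phi> - U t (n * m) \<phi>))\<^sup>2 \<le>
        CH * (t / real (n * m)) * (\<Sum>j<n*m. (\<phi> (grid t n (Suc (j div m))) - \<phi> (grid t (n * m) (Suc j)))\<^sup>2)"
      using n m by (intro U_refine t) auto
    also have "\<dots> \<le> CH * (t / real (n * m)) * (\<Sum>j<n*m. \<epsilon>\<^sup>2)"
    proof (intro mult_left_mono sum_mono)
      fix j assume "j \<in> {..<n*m}"
      then have "\<bar>\<phi> (grid t n (Suc (j div m))) - \<phi> (grid t (n * m) (Suc j))\<bar> < \<epsilon>"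
        using grid_refine_close[OF t(1), of n m j] n m tn by (intro d(2)) auto
      then show "(\<phi> (grid t n (Suc (j div m))) - \<phi> (grid t (n * m) (Suc j)))\<^sup>2 \<le> \<epsilon>\<^sup>2"
        by (intro power2_le_iff_abs_le[THEN iffD2]) (use \<epsilon> in auto)
    qed (use CH_pos t in auto)
    also have "\<dots> = CH * t * \<epsilon>\<^sup>2" using n m by (simp add: field_simps)
    also have "\<dots> \<le> (CH * (t + 1)) * \<epsilon>\<^sup>2" using CH_pos by (intro mult_right_mono mult_left_mono) auto
    also have "\<dots> = (sqrt (CH * (t + 1)) * \<epsilon>)\<^sup>2" using CH_pos t by (simp add: power_mult_distrib)
    also have "sqrt (CH * (t + 1)) * \<epsilon> = r / 3" unfolding \<epsilon>_def using less_imp_neq[OF s] by (simp del: real_sqrt_mult)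
    finally show ?thesis using r by (intro power2_le_imp_le[of "norm _"]) auto
  qed
  show "\<exists>K. \<forall>m\<ge>K. \<forall>n\<ge>K. dist (U t (Suc m) \<phi>) (U t (Suc n) \<phi>) < r"
  proof (intro exI[of _ n0] allI impI)
    fix m n assume "m \<ge> n0" "n \<ge> n0"
    then have "norm (U t (Suc m) \<phi> - U t (Suc m * Suc n) \<phi>) \<le> r / 3"
      "norm (U t (Suc n) \<phi> - U t (Suc n * Suc m) \<phi>) \<le> r / 3"
      by (intro step; simp)+
    then show "dist (U t (Suc m) \<phi>) (U t (Suc n) \<phi>) < r"
      unfolding dist_norm using r norm_triangle_ineq4[of "U t (Suc m) \<phi> - U t (Suc m * Suc n) \<phi>" "U t (Suc n) \<phi> - U t (Suc n * Suc m) \<phi>"]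
      by (simp add: mult.commute[of "Suc n" "Suc m"] del: mult_Suc mult_Suc_right)
  qed
qed

text \<open>Stands for \<phi> times the indicator of [0,t]. It is built as a limit of step functions
  because the Hilbert space is abstract and its elements are not functions.\<close>

definition J :: "real \<Rightarrow> (real \<Rightarrow> real) \<Rightarrow> 'h" where
  "J t \<phi> = lim (\<lambda>n. U t (Suc n) \<phi>)"

lemma U_tendsto_J:
  assumes "0 \<le> t" "t \<le> T" "continuous_on {0..t} \<phi>"
  shows "(\<lambda>n. U t (Suc n) \<phi>) \<longlonglongrightarrow> J t \<phi>"
  using U_Cauchy[OF assms] unfolding J_def by (simp add: Cauchy_convergent_iff convergent_LIMSEQ_iff)

text \<open>Pairing a step function with \<open>e r\<close> turns the increments of indicators into
  increments of the covariance, that is, into a Riemann-Stieltjes sum whose integrator has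
  derivative H * \<open>kap\<close>.\<close>

lemma inner_J:
  assumes t: "0 \<le> t" "t \<le> T" and \<phi>: "continuous_on {0..t} \<phi>" and r: "r \<in> {0..T}"
  shows "inner (J t \<phi>) (e r) = H * integral {0..t} (\<lambda>s. \<phi> s * kap s r)"
proof -
  have "(\<lambda>n. inner (U t (Suc n) \<phi>) (e r)) \<longlonglongrightarrow> inner (J t \<phi>) (e r)"
    by (intro tendsto_intros U_tendsto_J assms)
  moreover have "inner (U t (Suc n) \<phi>) (e r) = (\<Sum>k<Suc n. \<phi> (t * real (Suc k) / real (Suc n)) *
      (cov (t * real (Suc k) / real (Suc n)) r - cov (t * real k / real (Suc n)) r))" for n
    unfolding U_def inner_sum_left
  proof (intro sum.cong refl)
    fix k assume k: "k \<in> {..<Suc n}"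
    have "grid t (Suc n) i \<in> {0..T}" if "i \<le> Suc n" for i
      using grid_nonneg[OF t(1)] grid_le[OF t(1) that, THEN order_trans, OF t(2)] by auto
    then show "inner (\<phi> (grid t (Suc n) (Suc k)) *\<^sub>R De t (Suc n) k) (e r) = \<phi> (t * real (Suc k) / real (Suc n)) *
      (cov (t * real (Suc k) / real (Suc n)) r - cov (t * real k / real (Suc n)) r)"
      using k r unfolding De_def by (simp add: inner_diff_left inner_e) (simp add: grid_def)
  qed
  moreover have "(\<lambda>n. \<Sum>k<Suc n. \<phi> (t * real (Suc k) / real (Suc n)) *
      (cov (t * real (Suc k) / real (Suc n)) r - cov (t * real k / real (Suc n)) r))
      \<longlonglongrightarrow> integral {0..t} (\<lambda>s. \<phi> s * (H * kap s r))"
    using cov_deriv[of r]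
    by (intro riemann_stieltjes_sum_tendsto[OF t(1) \<phi>] continuous_intros continuous_on_subset[OF kap_continuous])
      (auto intro: DERIV_subset)
  ultimately have "inner (J t \<phi>) (e r) = integral {0..t} (\<lambda>s. \<phi> s * (H * kap s r))"
    by (simp add: LIMSEQ_unique)
  also have "\<dots> = H * integral {0..t} (\<lambda>s. \<phi> s * kap s r)"
    by (subst integral_mult_right[symmetric]) (simp add: mult_ac)
  finally show ?thesis .
qed

lemma norm_J_diff:
  assumes t: "0 \<le> t" "t \<le> T" and \<phi>: "continuous_on {0..t} \<phi>" and \<psi>: "continuous_on {0..t} \<psi>"
  shows "(norm (J t \<phi> - J t \<psi>))\<^sup>2 \<le> CH * integral {0..t} (\<lambda>s. (\<phi> s - \<psi> s)\<^sup>2)"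
proof (rule LIMSEQ_le)
  show "(\<lambda>n. (norm (U t (Suc n) \<phi> - U t (Suc n) \<psi>))\<^sup>2) \<longlonglongrightarrow> (norm (J t \<phi> - J t \<psi>))\<^sup>2"
    by (intro tendsto_intros U_tendsto_J assms)
  \<comment> \<open>With the identity as integrator, the bound of \<open>norm_sum_De\<close> is
    itself a Riemann sum, and its limit is the L2 norm in time.\<close>
  have "(\<lambda>n. \<Sum>k<Suc n. (\<phi> (t * real (Suc k) / real (Suc n)) - \<psi> (t * real (Suc k) / real (Suc n)))\<^sup>2 *
      (t * real (Suc k) / real (Suc n) - t * real k / real (Suc n)))
      \<longlonglongrightarrow> integral {0..t} (\<lambda>s. (\<phi> s - \<psi> s)\<^sup>2 * 1)"
    by (intro riemann_stieltjes_sum_tendsto[OF t(1), where A="\<lambda>x. x"] continuous_intros \<phi> \<psi>) (auto intro: DERIV_subset)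
  from tendsto_mult_left[OF this, of CH]
  show "(\<lambda>n. CH * (\<Sum>k<Suc n. (\<phi> (grid t (Suc n) (Suc k)) - \<psi> (grid t (Suc n) (Suc k)))\<^sup>2 *
      (grid t (Suc n) (Suc k) - grid t (Suc n) k))) \<longlonglongrightarrow> CH * integral {0..t} (\<lambda>s. (\<phi> s - \<psi> s)\<^sup>2)"
    by (simp add: grid_def)
  show "\<exists>N. \<forall>n\<ge>N. (norm (U t (Suc n) \<phi> - U t (Suc n) \<psi>))\<^sup>2 \<le> CH * (\<Sum>k<Suc n. (\<phi> (grid t (Suc n) (Suc k)) - \<psi> (grid t (Suc n) (Suc k)))\<^sup>2 *
      (grid t (Suc n) (Suc k) - grid t (Suc n) k))"
  proof (intro exI allI impI)
    fix n
    have "U t (Suc n) \<phi> - U t (Suc n) \<psi> = (\<Sum>k<Suc n. (\<phi> (grid t (Suc n) (Suc k)) - \<psi> (grid t (Suc n) (Suc k))) *\<^sub>R De t (Suc n) k)"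
      by (simp add: U_def sum_subtractf scaleR_diff_left del: sum.lessThan_Suc)
    then show "(norm (U t (Suc n) \<phi> - U t (Suc n) \<psi>))\<^sup>2 \<le> CH * (\<Sum>k<Suc n. (\<phi> (grid t (Suc n) (Suc k)) - \<psi> (grid t (Suc n) (Suc k)))\<^sup>2 *
      (grid t (Suc n) (Suc k) - grid t (Suc n) k))"
      using norm_sum_De[OF t, of "Suc n" "\<lambda>k. \<phi> (grid t (Suc n) (Suc k)) - \<psi> (grid t (Suc n) (Suc k))"]
      unfolding grid_Suc sum_distrib_right[symmetric] by (simp add: mult_ac del: sum.lessThan_Suc)
  qed
qed

end

section \<open>Measurability and bounds for path functionals and smooth functionals\<close>

lemma caratheodory_measurable:
  fixes f :: "real \<Rightarrow> 'a \<Rightarrow> real"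
  assumes f: "\<And>s. f s \<in> borel_measurable M"
    and cont: "\<And>\<omega>. \<omega> \<in> space M \<Longrightarrow> continuous_on UNIV (\<lambda>s. f s \<omega>)"
  shows "(\<lambda>(s, \<omega>). f s \<omega>) \<in> borel_measurable (borel \<Otimes>\<^sub>M M)"
proof -
  \<comment> \<open>Rounding the time down to a multiple of 1 / (n + 1) leaves countably many time
    values, so measurability at each fixed time suffices; continuity recovers the limit.\<close>
  define q :: "nat \<Rightarrow> real \<Rightarrow> int" where "q n s = \<lfloor>real (Suc n) * s\<rfloor>" for n s
  define g where "g n z = f (real_of_int (q n (fst z)) / real (Suc n)) (snd z)" for n and z :: "real \<times> 'a"
  show ?thesis
  proof (rule borel_measurable_LIMSEQ_real)
    fix n
    have [measurable]: "(\<lambda>z::real \<times> 'a. q n (fst z)) \<in> measurable (borel \<Otimes>\<^sub>M M) (count_space UNIV)"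
      unfolding q_def by measurable
    note f[measurable]
    show "g n \<in> borel_measurable (borel \<Otimes>\<^sub>M M)"
      unfolding g_def by (rule measurable_compose_countable) measurable
  next
    fix z :: "real \<times> 'a" assume "z \<in> space (borel \<Otimes>\<^sub>M M)"
    then have z: "snd z \<in> space M" by (auto simp: space_pair_measure)
    have "(\<lambda>n. real_of_int (q n (fst z)) / real (Suc n)) \<longlonglongrightarrow> fst z"
    proof (rule LIM_zero_cancel, rule Lim_null_comparison)
      show "(\<lambda>n. eps n) \<longlonglongrightarrow> 0" using LIMSEQ_inverse_real_of_nat by (simp add: inverse_eq_divide)
      have "\<bar>real_of_int (q n (fst z)) / real (Suc n) - fst z\<bar> \<le> eps n" for n
      proof -
        have "\<bar>real_of_int (q n (fst z)) - real (Suc n) * fst z\<bar> \<le> 1"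
          unfolding q_def by linarith
        then have "\<bar>real_of_int (q n (fst z)) - real (Suc n) * fst z\<bar> / real (Suc n) \<le> eps n"
          by (intro divide_right_mono) auto
        moreover have "\<bar>real_of_int (q n (fst z)) - real (Suc n) * fst z\<bar> / real (Suc n) =
            \<bar>(real_of_int (q n (fst z)) - real (Suc n) * fst z) / real (Suc n)\<bar>" by (simp add: abs_divide)
        moreover have "(real_of_int (q n (fst z)) - real (Suc n) * fst z) / real (Suc n) = real_of_int (q n (fst z)) / real (Suc n) - fst z"
          by (simp add: diff_divide_distrib)
        ultimately show ?thesis by (simp only:)
      qed
      then show "\<forall>\<^sub>F n in sequentially. norm (real_of_int (q n (fst z)) / real (Suc n) - fst z) \<le> eps n"
        by simp
    qed
    moreover have "isCont (\<lambda>s. f s (snd z)) (fst z)"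
      using cont[OF z] by (simp add: continuous_on_eq_continuous_at)
    ultimately show "(\<lambda>n. g n z) \<longlonglongrightarrow> (case z of (s, \<omega>) \<Rightarrow> f s \<omega>)"
      unfolding g_def case_prod_unfold by (rule isCont_tendsto_compose[rotated])
  qed
qed

lemma Cb_infinity_dep: "Cb_infinity n g \<Longrightarrow> (\<And>i. i < n \<Longrightarrow> x i = y i) \<Longrightarrow> g x = g y"
  by (simp add: Cb_infinity_def)

lemma Cb_infinity_props:
  assumes "Cb_infinity n g"
  shows "continuous_on UNIV g" "bounded (range g)"
    "\<And>i x. i < n \<Longrightarrow> (\<lambda>s. g (x(i := s))) differentiable (at (x i))"
    "\<And>i. i < n \<Longrightarrow> continuous_on UNIV (partial_deriv i g)"
    "\<And>i. i < n \<Longrightarrow> bounded (range (partial_deriv i g))"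
proof -
  have *: "continuous_on UNIV (foldr partial_deriv js g)" "bounded (range (foldr partial_deriv js g))"
    "\<And>i x. i < n \<Longrightarrow> (\<lambda>s. foldr partial_deriv js g (x(i := s))) differentiable (at (x i))" if "set js \<subseteq> {..<n}" for js
    using assms that by (auto simp: Cb_infinity_def Let_def)
  from *[of "[]"] show "continuous_on UNIV g" "bounded (range g)"
    "\<And>i x. i < n \<Longrightarrow> (\<lambda>s. g (x(i := s))) differentiable (at (x i))" by auto
  show "\<And>i. i < n \<Longrightarrow> continuous_on UNIV (partial_deriv i g)"
    "\<And>i. i < n \<Longrightarrow> bounded (range (partial_deriv i g))"
    using *[of "[_]"] by auto
qed

lemma Cb_infinity_bound:
  assumes "Cb_infinity n g"
  obtains K where "K \<ge> 0" "\<And>x. \<bar>g x\<bar> \<le> K" "\<And>j x. j < n \<Longrightarrow> \<bar>partial_deriv j g x\<bar> \<le> K"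
proof -
  note gp = Cb_infinity_props[OF assms]
  have "\<exists>b. \<forall>x. \<bar>partial_deriv j g x\<bar> \<le> b" if "j < n" for j
    using gp(5)[OF that] by (auto simp: bounded_iff)
  then obtain b where b: "\<And>j x. j < n \<Longrightarrow> \<bar>partial_deriv j g x\<bar> \<le> b j" by metis
  obtain b0 where b0: "\<And>x. \<bar>g x\<bar> \<le> b0" using gp(2) by (auto simp: bounded_iff)
  have bn: "0 \<le> b j" if "j < n" for j using b[OF that, of undefined] by simp
  have b0n: "0 \<le> b0" using b0[of undefined] by simp
  show ?thesis
  proof (rule that[of "b0 + (\<Sum>j<n. b j)"])
    show "0 \<le> b0 + (\<Sum>j<n. b j)" using bn b0n by (auto intro!: add_nonneg_nonneg sum_nonneg)
    show "\<bar>g x\<bar> \<le> b0 + (\<Sum>j<n. b j)" for x using b0[of x] bn by (auto intro!: add_increasing2 sum_nonneg)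
    show "\<bar>partial_deriv j g x\<bar> \<le> b0 + (\<Sum>j<n. b j)" if "j < n" for j x
      using b[OF that, of x] b0n member_le_sum[of j "{..<n}" b] bn that by fastforce
  qed
qed

text \<open>With countably many real coordinates the product sigma-algebra is the Borel algebra of
  the product topology.\<close>

lemma continuous_product_measurable:
  fixes g :: "(nat \<Rightarrow> real) \<Rightarrow> real"
  assumes "continuous_on UNIV g"
  shows "g \<in> borel_measurable seq_borel"
proof -
  have "g \<in> borel_measurable borel" using assms by (rule borel_measurable_continuous_onI)
  then show ?thesis
    using sets_PiM_equal_borel measurable_cong_sets by blast
qed

section \<open>A version with continuous paths, and the Ito formula in duality form\<close>

locale fbm_version = fbm_setup M H T B e W
  for M :: "'a measure" and H T :: real and B :: "real \<Rightarrow> 'a \<Rightarrow> real"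
    and e :: "real \<Rightarrow> 'h::{real_inner, complete_space, second_countable_topology}"
    and W :: "'h \<Rightarrow> 'a \<Rightarrow> real" +
  fixes X :: "real \<Rightarrow> 'a \<Rightarrow> real"
  assumes X_measurable [measurable]: "X s \<in> borel_measurable M"
    and X_cont: "continuous_on UNIV (\<lambda>s. X s \<omega>)"
    and X_B: "AE \<omega> in M. \<forall>s\<in>{0..T}. X s \<omega> = B s \<omega>"
begin

lemma X_cont': "continuous_on A (\<lambda>s. X s \<omega>)"
  using X_cont continuous_on_subset by blast

lemma X_joint [measurable]: "(\<lambda>(s, \<omega>). X s \<omega>) \<in> borel_measurable (borel \<Otimes>\<^sub>M M)"
  by (rule caratheodory_measurable) (auto intro: X_cont)

lemma W_e_X:
  assumes s: "s \<in> {0..T}"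
  shows "AE \<omega> in M. W (e s) \<omega> = X s \<omega>"
  using W_e[OF s] X_B by eventually_elim (use s in auto)

lemma W_De:
  assumes "s \<in> {0..T}" "r \<in> {0..T}"
  shows "AE \<omega> in M. W (e s - e r) \<omega> = X s \<omega> - X r \<omega>"
  using W_diff[of "e s" "e r"] W_e_X[OF assms(1)] W_e_X[OF assms(2)] by eventually_elim simp

lemma norm_increment:
  assumes "s \<in> {0..T}" "r \<in> {0..T}"
  shows "(norm (e s - e r))\<^sup>2 = \<bar>s - r\<bar> powr (2*H)"
  using assms unfolding power2_norm_eq_inner
  by (simp add: inner_diff_left inner_diff_right inner_e cov_def abs_minus_commute field_simps)

lemma X_increment:
  assumes "s \<in> {0..T}" "r \<in> {0..T}"
  shows "integrable M (\<lambda>\<omega>. (X s \<omega> - X r \<omega>)\<^sup>2)" "expectation (\<lambda>\<omega>. (X s \<omega> - X r \<omega>)\<^sup>2) = \<bar>s - r\<bar> powr (2*H)"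
proof -
  have ae: "AE \<omega> in M. (W (e s - e r) \<omega>)\<^sup>2 = (X s \<omega> - X r \<omega>)\<^sup>2"
    using W_De[OF assms] by eventually_elim simp
  show "integrable M (\<lambda>\<omega>. (X s \<omega> - X r \<omega>)\<^sup>2)"
    by (rule integrable_cong_AE_imp[OF W_square_integrable[of "e s - e r"] _ ae]) simp
  have "expectation (\<lambda>\<omega>. (X s \<omega> - X r \<omega>)\<^sup>2) = expectation (\<lambda>\<omega>. (W (e s - e r) \<omega>)\<^sup>2)"
    using ae by (intro integral_cong_AE) auto
  then show "expectation (\<lambda>\<omega>. (X s \<omega> - X r \<omega>)\<^sup>2) = \<bar>s - r\<bar> powr (2*H)"
    by (simp add: W_norm norm_increment[OF assms])
qed

lemma X_0: "AE \<omega> in M. X 0 \<omega> = 0"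
proof -
  have "AE \<omega> in M. W (e 0) \<omega> = X 0 \<omega>" using T by (intro W_e_X) auto
  then show ?thesis using W_0 unfolding e_0 by eventually_elim simp
qed

lemma U_measurable [measurable]:
  assumes [measurable]: "h \<in> borel_measurable borel"
  shows "(\<lambda>\<omega>. U t n (\<lambda>s. h (X s \<omega>))) \<in> borel_measurable M"
  unfolding U_def by measurable

lemma J_measurable:
  assumes t: "0 \<le> t" "t \<le> T" and h: "continuous_on UNIV h"
  shows "(\<lambda>\<omega>. J t (\<lambda>s. h (X s \<omega>))) \<in> borel_measurable M"
proof (rule borel_measurable_LIMSEQ_metric)
  have [measurable]: "h \<in> borel_measurable borel" using h by (rule borel_measurable_continuous_onI)
  show "(\<lambda>\<omega>. U t (Suc n) (\<lambda>s. h (X s \<omega>))) \<in> borel_measurable M" for n by measurable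
  show "(\<lambda>n. U t (Suc n) (\<lambda>s. h (X s \<omega>))) \<longlonglongrightarrow> J t (\<lambda>s. h (X s \<omega>))" for \<omega>
    by (intro U_tendsto_J t continuous_on_compose2[OF h X_cont']) auto
qed

lemma lipschitz_increment:
  assumes "\<And>x y. \<bar>h x - h y\<bar> \<le> K * \<bar>x - y\<bar>" and [measurable]: "h \<in> borel_measurable borel"
    and "s \<in> {0..T}" "r \<in> {0..T}" and d: "\<bar>s - r\<bar> \<le> d"
  shows "L2sq M (\<lambda>\<omega>. h (X s \<omega>) - h (X r \<omega>)) \<le> ennreal (K\<^sup>2 * d powr (2*H))"
proof -
  have "L2sq M (\<lambda>\<omega>. h (X s \<omega>) - h (X r \<omega>)) \<le> (\<integral>\<^sup>+\<omega>. ennreal (K\<^sup>2 * (X s \<omega> - X r \<omega>)\<^sup>2) \<partial>M)"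
  proof (intro nn_integral_mono ennreal_leI)
    fix \<omega>
    have "\<bar>h (X s \<omega>) - h (X r \<omega>)\<bar>\<^sup>2 \<le> (K * \<bar>X s \<omega> - X r \<omega>\<bar>)\<^sup>2"
      by (intro power_mono assms) auto
    then show "(h (X s \<omega>) - h (X r \<omega>))\<^sup>2 \<le> K\<^sup>2 * (X s \<omega> - X r \<omega>)\<^sup>2"
      by (simp add: power_mult_distrib)
  qed
  also have "\<dots> = ennreal (K\<^sup>2 * \<bar>s - r\<bar> powr (2*H))"
    using X_increment[OF assms(3,4)] by (subst nn_integral_eq_integral) auto
  also have "\<dots> \<le> ennreal (K\<^sup>2 * d powr (2*H))"
    using d H by (intro ennreal_leI mult_left_mono powr_mono2) auto
  finally show ?thesis .
qed

text \<open>The mean square distance to the refinement with n * m cells is bounded uniformly in m,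
  since the integrand is Lipschitz in X and the increments of X have known variance; Fatou's lemma
  lets m tend to infinity.\<close>

lemma U_J_L2:
  assumes t: "0 \<le> t" "t \<le> T" and h: "\<And>x y. \<bar>h x - h y\<bar> \<le> K * \<bar>x - y\<bar>" and ch: "continuous_on UNIV h" and n: "n > 0"
  shows "L2sq M (\<lambda>\<omega>. norm (U t n (\<lambda>s. h (X s \<omega>)) - J t (\<lambda>s. h (X s \<omega>))))
    \<le> ennreal (CH * t * (K\<^sup>2 * (t / n) powr (2*H)))"
proof -
  have [measurable]: "h \<in> borel_measurable borel" using ch by (rule borel_measurable_continuous_onI)
  let ?U = "\<lambda>n \<omega>. U t n (\<lambda>s. h (X s \<omega>))" and ?J = "\<lambda>\<omega>. J t (\<lambda>s. h (X s \<omega>))"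
  have chX: "continuous_on {0..t} (\<lambda>s. h (X s \<omega>))" for \<omega>
    by (intro continuous_on_compose2[OF ch X_cont']) auto
  have sub: "(\<lambda>m. ?U (n * Suc m) \<omega>) \<longlonglongrightarrow> ?J \<omega>" for \<omega>
  proof -
    \<comment> \<open>\<open>J\<close> is the limit along partitions into Suc k cells, so n * Suc m
      cells are reached at the index n * Suc m - 1.\<close>
    have "strict_mono (\<lambda>m. n * Suc m - 1)"
      using n by (intro strict_monoI) (metis Suc_less_eq diff_less_mono mult_less_cancel1 nat_0_less_mult_iff zero_less_Suc Suc_leI One_nat_def)
    from LIMSEQ_subseq_LIMSEQ[OF U_tendsto_J[OF t chX[of \<omega>]] this]
    have "(\<lambda>m. ?U (Suc (n * Suc m - 1)) \<omega>) \<longlonglongrightarrow> ?J \<omega>" by (simp add: o_def)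
    moreover have "Suc (n * Suc m - 1) = n * Suc m" for m using n by simp
    ultimately show ?thesis by (simp only:)
  qed
  have lim: "(\<lambda>m. ennreal ((norm (?U n \<omega> - ?U (n * Suc m) \<omega>))\<^sup>2)) \<longlonglongrightarrow> ennreal ((norm (?U n \<omega> - ?J \<omega>))\<^sup>2)" for \<omega>
    by (intro tendsto_intros sub)
  have bound: "L2sq M (\<lambda>\<omega>. norm (?U n \<omega> - ?U (n * Suc m) \<omega>)) \<le> ennreal (CH * t * (K\<^sup>2 * (t / n) powr (2*H)))" for m
  proof -
    let ?m = "Suc m" let ?N = "n * Suc m"
    let ?d = "\<lambda>\<omega> j. (h (X (grid t n (Suc (j div ?m))) \<omega>) - h (X (grid t ?N (Suc j)) \<omega>))\<^sup>2"
    have c0: "0 \<le> CH * (t / real ?N)" using CH_pos t by simp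
    have "L2sq M (\<lambda>\<omega>. norm (?U n \<omega> - ?U ?N \<omega>)) \<le>
        (\<integral>\<^sup>+\<omega>. ennreal (CH * (t / real ?N)) * (\<Sum>j<?N. ennreal (?d \<omega> j)) \<partial>M)"
    proof (intro nn_integral_mono)
      fix \<omega>
      have "ennreal ((norm (?U n \<omega> - ?U ?N \<omega>))\<^sup>2) \<le> ennreal (CH * (t / real ?N) * (\<Sum>j<?N. ?d \<omega> j))"
        using U_refine[OF t n, of ?m "\<lambda>s. h (X s \<omega>)"] by (intro ennreal_leI) simp
      also have "\<dots> = ennreal (CH * (t / real ?N)) * (\<Sum>j<?N. ennreal (?d \<omega> j))"
        using c0 by (subst sum_ennreal, simp, subst ennreal_mult) (auto intro!: sum_nonneg)
      finally show "ennreal ((norm (?U n \<omega> - ?U ?N \<omega>))\<^sup>2) \<le> ennreal (CH * (t / real ?N)) * (\<Sum>j<?N. ennreal (?d \<omega> j))" .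
    qed
    also have "\<dots> = ennreal (CH * (t / real ?N)) * (\<Sum>j<?N. \<integral>\<^sup>+\<omega>. ennreal (?d \<omega> j) \<partial>M)"
      by (subst nn_integral_cmult, simp, subst nn_integral_sum) auto
    also have "\<dots> \<le> ennreal (CH * (t / real ?N)) * (\<Sum>j<?N. ennreal (K\<^sup>2 * (t / n) powr (2*H)))"
    proof (intro mult_left_mono sum_mono)
      fix j assume j: "j \<in> {..<?N}"
      note g = grid_refine_close[OF t(1) n, of ?m j]
      show "(\<integral>\<^sup>+\<omega>. ennreal (?d \<omega> j) \<partial>M) \<le> ennreal (K\<^sup>2 * (t / n) powr (2*H))"
        using g j t by (intro lipschitz_increment[OF h]) (auto simp del: mult_Suc_right)
    qed simp
    also have "\<dots> = ennreal (CH * (t / real ?N) * (real ?N * (K\<^sup>2 * (t / n) powr (2*H))))"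
    proof -
      have c: "(\<Sum>j<?N. ennreal c) = ennreal (real ?N * c)" if "c \<ge> 0" for c
        using that by (simp only: sum_constant card_lessThan ennreal_mult[OF of_nat_0_le_iff] ennreal_of_nat_eq_real_of_nat)
      show ?thesis
        by (subst c, simp, subst ennreal_mult[OF c0]) auto
    qed
    also have "CH * (t / real ?N) * (real ?N * (K\<^sup>2 * (t / n) powr (2*H))) = CH * t * (K\<^sup>2 * (t / n) powr (2*H))"
      using n by (simp del: mult_Suc_right)
    finally show ?thesis .
  qed
  note [measurable] = J_measurable[OF t ch]
  have "L2sq M (\<lambda>\<omega>. norm (?U n \<omega> - ?J \<omega>)) =
      (\<integral>\<^sup>+\<omega>. liminf (\<lambda>m. ennreal ((norm (?U n \<omega> - ?U (n * Suc m) \<omega>))\<^sup>2)) \<partial>M)"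
    by (intro nn_integral_cong lim_imp_Liminf[symmetric] lim) simp
  also have "\<dots> \<le> liminf (\<lambda>m. \<integral>\<^sup>+\<omega>. ennreal ((norm (?U n \<omega> - ?U (n * Suc m) \<omega>))\<^sup>2) \<partial>M)"
    by (intro nn_integral_liminf) measurable
  also have "\<dots> \<le> ennreal (CH * t * (K\<^sup>2 * (t / n) powr (2*H)))"
    by (intro Liminf_le always_eventually allI bound) simp
  finally show ?thesis .
qed

text \<open>Malliavin integration by parts for one increment. The variable \<open>X u\<close> is
  appended to the functional as a further coordinate with index n: derivatives in the coordinates
  below n hit the functional, the derivative in coordinate n hits \<open>h\<close> and produces the
  factor \<open>inner (e u) \<psi>\<close>.\<close>

lemma ito_increment:
  fixes \<phi> :: "nat \<Rightarrow> 'h"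
  assumes g: "Cb_infinity n g"
    and h: "\<And>x. (h has_real_derivative h' x) (at x)" and ch': "continuous_on UNIV h'"
    and K: "\<And>x. \<bar>h' x\<bar> \<le> K" and u: "u \<in> {0..T}"
  shows "expectation (\<lambda>\<omega>. g (\<lambda>j. W (\<phi> j) \<omega>) * h (X u \<omega>) * W \<psi> \<omega>) =
    (\<Sum>j<n. inner (\<phi> j) \<psi> * expectation (\<lambda>\<omega>. partial_deriv j g (\<lambda>i. W (\<phi> i) \<omega>) * h (X u \<omega>)))
     + inner (e u) \<psi> * expectation (\<lambda>\<omega>. g (\<lambda>j. W (\<phi> j) \<omega>) * h' (X u \<omega>))"
proof -
  note gp = Cb_infinity_props[OF g]
  have ch: "continuous_on UNIV h" using h by (meson DERIV_isCont continuous_at_imp_continuous_on)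
  have [measurable]: "h \<in> borel_measurable borel" "h' \<in> borel_measurable borel"
    using ch ch' by (auto intro: borel_measurable_continuous_onI)
  have gm [measurable]: "g \<in> borel_measurable seq_borel"
    using gp(1) by (rule continuous_product_measurable)
  have dgm: "partial_deriv j g \<in> borel_measurable seq_borel" if "j < n" for j
    using gp(4)[OF that] by (rule continuous_product_measurable)
  obtain Kg where Kg: "Kg \<ge> 0" "\<And>x. \<bar>g x\<bar> \<le> Kg" "\<And>j x. j < n \<Longrightarrow> \<bar>partial_deriv j g x\<bar> \<le> Kg"
    using Cb_infinity_bound[OF g] by blast
  define D where "D = max \<bar>h 0\<bar> K"
  have K0: "K \<ge> 0" using K[of 0] by (meson abs_ge_zero order_trans)
  have hD: "\<bar>h y\<bar> \<le> D * (1 + \<bar>y\<bar>)" for y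
  proof -
    have "norm (h y - h 0) \<le> K * norm (y - 0)"
      by (rule field_differentiable_bound[of UNIV h h']) (auto simp: h K intro: has_field_derivative_at_within)
    then have "\<bar>h y\<bar> \<le> \<bar>h 0\<bar> + K * \<bar>y\<bar>" by simp
    also have "\<dots> \<le> D + D * \<bar>y\<bar>" unfolding D_def by (intro add_mono mult_right_mono) auto
    finally show ?thesis by (simp add: distrib_left)
  qed
  have h'D: "\<bar>h' y\<bar> \<le> D" for y using K[of y] by (simp add: D_def)
  have D0: "D \<ge> 0" by (simp add: D_def)
  \<comment> \<open>Coordinate n is free for this use because \<open>g\<close> depends only on the
    first n entries.\<close>
  define \<phi>u where "\<phi>u = \<phi>(n := e u)"
  define \<Psi> where "\<Psi> x = g x * h (x n)" for x
  define D\<Psi> where "D\<Psi> j x = (if j < n then partial_deriv j g x * h (x n) else g x * h' (x n))" for j and x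
  have sum_le: "1 + \<bar>x n\<bar> \<le> 1 + (\<Sum>i<Suc n. \<bar>x i\<bar>)" for x :: "nat \<Rightarrow> real"
    by (simp add: sum_nonneg)
  have prod_le: "\<bar>a * b\<bar> \<le> (Kg * D) * (1 + (\<Sum>i<Suc n. \<bar>x i\<bar>))"
    if "\<bar>a\<bar> \<le> Kg" "\<bar>b\<bar> \<le> D * (1 + \<bar>x n\<bar>)" for a b and x :: "nat \<Rightarrow> real"
  proof -
    have "\<bar>a * b\<bar> \<le> Kg * (D * (1 + \<bar>x n\<bar>))"
      unfolding abs_mult using that Kg(1) by (intro mult_mono) auto
    also have "\<dots> \<le> Kg * (D * (1 + (\<Sum>i<Suc n. \<bar>x i\<bar>)))"
      using sum_le[of x] Kg(1) D0 by (intro mult_left_mono) auto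
    finally show ?thesis by (simp add: mult.assoc)
  qed
  have h'D2: "\<bar>h' y\<bar> \<le> D * (1 + \<bar>y\<bar>)" for y
    using h'D[of y] D0 by (simp add: distrib_left add_increasing2)
  have chain: "((\<lambda>y. \<Psi> (\<lambda>i. x i + c i * y)) has_real_derivative (\<Sum>j<Suc n. c j * D\<Psi> j (\<lambda>i. x i + c i * y))) (at y)" for x c y
  proof -
    have g': "((\<lambda>y. g (\<lambda>i. x i + c i * y)) has_real_derivative
      (\<Sum>j<n. c j * partial_deriv j g (\<lambda>i. x i + c i * y))) (at y)"
      by (rule chain_rule_partial_deriv) (use gp Cb_infinity_dep[OF g] in blast)+
    have h'': "((\<lambda>y. h (x n + c n * y)) has_real_derivative h' (x n + c n * y) * c n) (at y)"
      by (rule DERIV_chain2[OF h]) (auto intro!: derivative_eq_intros)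
    show ?thesis
      unfolding \<Psi>_def
      by (rule DERIV_cong[OF DERIV_mult[OF g' h'']])
        (simp add: D\<Psi>_def sum_distrib_right sum_distrib_left mult_ac add.commute)
  qed
  have cont_line: "continuous_on UNIV (\<lambda>y. (\<lambda>i. x i + c i * y))" for x c :: "nat \<Rightarrow> real"
    by (intro continuous_on_coordinatewise_then_product continuous_intros)
  have "expectation (\<lambda>\<omega>. \<Psi> (\<lambda>i. W (\<phi>u i) \<omega>) * W \<psi> \<omega>) =
    (\<Sum>j<Suc n. inner (\<phi>u j) \<psi> * expectation (\<lambda>\<omega>. D\<Psi> j (\<lambda>i. W (\<phi>u i) \<omega>)))"
  proof (rule W_gaussian_integration_by_parts[where K="Kg * D"])
    show "\<Psi> \<in> borel_measurable seq_borel" unfolding \<Psi>_def by measurable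
    show "D\<Psi> j \<in> borel_measurable seq_borel" for j
      unfolding D\<Psi>_def using dgm[of j] by (cases "j < n") auto
    show "\<bar>\<Psi> x\<bar> \<le> Kg * D * (1 + (\<Sum>i<Suc n. \<bar>x i\<bar>))" for x
      unfolding \<Psi>_def by (intro prod_le Kg hD)
    show "\<bar>D\<Psi> j x\<bar> \<le> Kg * D * (1 + (\<Sum>i<Suc n. \<bar>x i\<bar>))" for x j
      unfolding D\<Psi>_def by (cases "j < n") (auto intro!: prod_le Kg hD h'D2 simp del: sum.lessThan_Suc)
    show "continuous_on UNIV (\<lambda>y. D\<Psi> j (\<lambda>i. x i + c i * y))" for x c j
      unfolding D\<Psi>_def
      by (cases "j < n") (auto intro!: continuous_intros continuous_on_compose2[OF gp(1) cont_line]
          continuous_on_compose2[OF gp(4) cont_line] continuous_on_compose2[OF ch] continuous_on_compose2[OF ch'])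
  qed (rule chain)
  moreover have g_upd: "g (\<lambda>i. W (\<phi>u i) \<omega>) = g (\<lambda>i. W (\<phi> i) \<omega>)" for \<omega>
    by (rule Cb_infinity_dep[OF g]) (simp add: \<phi>u_def)
  moreover have pg_upd: "partial_deriv j g (\<lambda>i. W (\<phi>u i) \<omega>) = partial_deriv j g (\<lambda>i. W (\<phi> i) \<omega>)" if "j < n" for \<omega> j
    unfolding partial_deriv_def using that
    by (intro arg_cong2[where f=deriv] ext Cb_infinity_dep[OF g]) (auto simp: \<phi>u_def)
  moreover have Wu: "AE \<omega> in M. W (\<phi>u n) \<omega> = X u \<omega>"
    using W_e_X[OF u] by (simp add: \<phi>u_def)
  have "expectation (\<lambda>\<omega>. \<Psi> (\<lambda>i. W (\<phi>u i) \<omega>) * W \<psi> \<omega>) = expectation (\<lambda>\<omega>. g (\<lambda>j. W (\<phi> j) \<omega>) * h (X u \<omega>) * W \<psi> \<omega>)"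
    unfolding \<Psi>_def g_upd using Wu by (intro integral_cong_AE) auto
  moreover have "expectation (\<lambda>\<omega>. D\<Psi> j (\<lambda>i. W (\<phi>u i) \<omega>)) = expectation (\<lambda>\<omega>. partial_deriv j g (\<lambda>i. W (\<phi> i) \<omega>) * h (X u \<omega>))" if "j < n" for j
    unfolding D\<Psi>_def using Wu that measurable_compose[OF W_sequence_measurable dgm[OF that]]
    by (intro integral_cong_AE) (auto simp: pg_upd)
  moreover have "expectation (\<lambda>\<omega>. D\<Psi> n (\<lambda>i. W (\<phi>u i) \<omega>)) = expectation (\<lambda>\<omega>. g (\<lambda>j. W (\<phi> j) \<omega>) * h' (X u \<omega>))"
    unfolding D\<Psi>_def g_upd using Wu by (intro integral_cong_AE) auto
  ultimately show ?thesis by (simp add: \<phi>u_def)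
qed

end

lemma (in prob_space) expectation_abs_le_nn:
  assumes [measurable]: "f \<in> borel_measurable M" and c: "0 \<le> c" "L2sq M f \<le> ennreal (c\<^sup>2)"
  shows "integrable M f" "expectation (\<lambda>\<omega>. \<bar>f \<omega>\<bar>) \<le> c" "integrable M (\<lambda>\<omega>. (f \<omega>)\<^sup>2)"
proof -
  have fin: "L2sq M f < \<infinity>"
    using c(2) ennreal_less_top le_less_trans by (metis infinity_ennreal_def)
  show i2: "integrable M (\<lambda>\<omega>. (f \<omega>)\<^sup>2)"
    using fin by (intro integrableI_bounded) auto
  show i1: "integrable M f"
    by (rule square_integrable_imp_integrable[OF _ i2]) simp
  have e: "expectation (\<lambda>\<omega>. (f \<omega>)\<^sup>2) \<le> c\<^sup>2"
    using c(2) nn_integral_eq_integral[OF i2] by (simp add: integral_nonneg_AE)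
  have i: "integrable M (\<lambda>\<omega>. \<bar>f \<omega>\<bar>)" using i1 by simp
  have "0 \<le> variance (\<lambda>\<omega>. \<bar>f \<omega>\<bar>)" by (rule variance_positive)
  also have "\<dots> = expectation (\<lambda>\<omega>. (f \<omega>)\<^sup>2) - (expectation (\<lambda>\<omega>. \<bar>f \<omega>\<bar>))\<^sup>2"
    using i i2 by (subst variance_eq) auto
  finally have "(expectation (\<lambda>\<omega>. \<bar>f \<omega>\<bar>))\<^sup>2 \<le> c\<^sup>2" using e by simp
  then show "expectation (\<lambda>\<omega>. \<bar>f \<omega>\<bar>) \<le> c" using c(1) by (rule power2_le_imp_le)
qed

lemma tendsto_0_squeeze:
  fixes f g :: "nat \<Rightarrow> real"
  assumes "\<And>n. \<bar>f n\<bar> \<le> g n" "g \<longlonglongrightarrow> 0"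
  shows "f \<longlonglongrightarrow> 0"
  by (rule Lim_null_comparison[OF _ assms(2)]) (simp add: assms(1))

context fbm_version
begin

lemma mesh_tendsto_0:
  assumes "p > 1" "0 \<le> t"
  shows "(\<lambda>n. real (Suc n) * (t / real (Suc n)) powr p) \<longlonglongrightarrow> 0"
proof (cases "t = 0")
  case True
  then show ?thesis by simp
next
  case False
  then have "t > 0" using assms by simp
  then show ?thesis using assms(1) by real_asymp
qed

lemma weighted_riemann_sum_tendsto:
  assumes t: "0 \<le> t" and \<phi>: "continuous_on {0..t} \<phi>"
  shows "(\<lambda>n. \<Sum>k<Suc n. \<phi> (t * real (Suc k) / real (Suc n)) *
      (\<bar>t * real (Suc k) / real (Suc n)\<bar> powr (2*H) / 2 - \<bar>t * real k / real (Suc n)\<bar> powr (2*H) / 2))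
    \<longlonglongrightarrow> integral {0..t} (\<lambda>s. \<phi> s * (H * s powr (2*H-1)))"
proof (rule riemann_stieltjes_sum_tendsto[OF t \<phi>])
  show "continuous_on {0..t} (\<lambda>s. H * s powr (2*H-1))"
    using H by (intro continuous_intros continuous_on_powr') auto
  fix x assume x: "x \<in> {0..t}"
  let ?a = "(2*H) * (sgn (x - 0) * \<bar>x - 0\<bar> powr (2*H - 1)) / 2"
  have "((\<lambda>x. \<bar>x - 0\<bar> powr (2*H) / 2) has_real_derivative ?a) (at x)"
    by (rule DERIV_cdivide, rule abs_powr_deriv) (use H in auto)
  moreover have "?a = H * x powr (2*H-1)" using x by (cases "x = 0") auto
  ultimately show "((\<lambda>x. \<bar>x\<bar> powr (2*H) / 2) has_real_derivative H * x powr (2*H-1)) (at x within {0..t})"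
    by (auto intro: DERIV_subset)
qed

text \<open>The covariance of the process at a right end point with its own increment is the source
  of the correction term: half the increment of the variance, plus half of a power of the mesh whose
  sum over all cells vanishes in the limit since 2H > 1.\<close>

lemma e_diag: "k < n \<Longrightarrow> 0 \<le> t \<Longrightarrow> t \<le> T \<Longrightarrow> inner (e (grid t n (Suc k))) (De t n k) =
    ((grid t n (Suc k)) powr (2*H) - (grid t n k) powr (2*H) + (t / n) powr (2*H)) / 2"
proof -
  assume a: "k < n" "0 \<le> t" "t \<le> T"
  have rng: "0 \<le> grid t n i" "grid t n i \<le> T" if "i \<le> n" for i
    using grid_nonneg[OF a(2)] grid_le[OF a(2) that, THEN order_trans, OF a(3)] by auto
  have "0 \<le> t / real n" using a by simp
  then show ?thesis
    using rng[of k] rng[of "Suc k"] a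
    by (simp add: De_def inner_diff_right inner_e cov_def grid_Suc) (simp add: field_simps)
qed

text \<open>Evaluating at right end points matches the definition of \<open>U\<close>. The three
  discrete contributions converge in different modes: the Taylor remainder in mean because 2H > 1,
  the correction pointwise with a uniform bound, and \<open>U\<close> to \<open>J\<close> in mean at
  the rate of \<open>U_J_L2\<close>.\<close>

lemma ito_formula:
  fixes \<phi> :: "nat \<Rightarrow> 'h"
  assumes t: "0 \<le> t" "t \<le> T" and g: "Cb_infinity n g"
    and f: "\<And>x. (f has_real_derivative h x) (at x)"
    and h: "\<And>x. (h has_real_derivative h' x) (at x)" and ch': "continuous_on UNIV h'"
    and K: "\<And>x. \<bar>h' x\<bar> \<le> K" and fi: "integrable M (\<lambda>\<omega>. f (X t \<omega>))"
  shows "expectation (\<lambda>\<omega>. smooth_functional W g \<phi> \<omega> *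
      (f (X t \<omega>) - f (X 0 \<omega>) - H * integral {0..t} (\<lambda>s. h' (X s \<omega>) * s powr (2*H-1)))) =
    expectation (\<lambda>\<omega>. inner (malliavin_deriv W n g \<phi> \<omega>) (J t (\<lambda>s. h (X s \<omega>))))"
proof -
  note gp = Cb_infinity_props[OF g]
  have ch: "continuous_on UNIV h" using h by (meson DERIV_isCont continuous_at_imp_continuous_on)
  have cf: "continuous_on UNIV f" using f by (meson DERIV_isCont continuous_at_imp_continuous_on)
  have [measurable]: "h \<in> borel_measurable borel" "h' \<in> borel_measurable borel" "f \<in> borel_measurable borel"
    using ch ch' cf by (auto intro: borel_measurable_continuous_onI)
  obtain Kg where Kg: "Kg \<ge> 0" "\<And>x. \<bar>g x\<bar> \<le> Kg" "\<And>j x. j < n \<Longrightarrow> \<bar>partial_deriv j g x\<bar> \<le> Kg"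
    using Cb_infinity_bound[OF g] by blast
  have K0: "K \<ge> 0" using K[of 0] by (meson abs_ge_zero order_trans)
  have hlip: "\<bar>h x - h y\<bar> \<le> K * \<bar>x - y\<bar>" for x y
    using field_differentiable_bound[of UNIV h h' K x y] h K by (auto intro: has_field_derivative_at_within)
  define G where "G \<omega> = g (\<lambda>j. W (\<phi> j) \<omega>)" for \<omega>
  define DG where "DG j \<omega> = partial_deriv j g (\<lambda>j. W (\<phi> j) \<omega>)" for j \<omega>
  have Gm [measurable]: "G \<in> borel_measurable M"
    unfolding G_def using continuous_product_measurable[OF gp(1)] by measurable
  have DGm [measurable]: "DG j \<in> borel_measurable M" if "j < n" for j
    unfolding DG_def using continuous_product_measurable[OF gp(4)[OF that]] by measurable
  have Gb: "\<bar>G \<omega>\<bar> \<le> Kg" for \<omega> unfolding G_def by (rule Kg)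
  have DGb: "\<bar>DG j \<omega>\<bar> \<le> Kg" if "j < n" for j \<omega> unfolding DG_def by (rule Kg(3)[OF that])
  let ?U = "\<lambda>m \<omega>. U t (Suc m) (\<lambda>s. h (X s \<omega>))" and ?J = "\<lambda>\<omega>. J t (\<lambda>s. h (X s \<omega>))"
  let ?x = "\<lambda>m k. grid t (Suc m) k"
  let ?d = "\<lambda>m k \<omega>. X (?x m (Suc k)) \<omega> - X (?x m k) \<omega>" and ?q = "\<lambda>m k. inner (e (?x m (Suc k))) (De t (Suc m) k)"
  have rng: "?x m k \<in> {0..T}" if "k \<le> Suc m" for k m
    using grid_nonneg[OF t(1), of "Suc m" k] grid_le[OF t(1) that, THEN order_trans, OF t(2)] by auto
  note Jm [measurable] = J_measurable[OF t ch]
  have mult_int: "integrable M (\<lambda>\<omega>. a \<omega> * b \<omega>)" if "integrable M b" and [measurable]: "a \<in> borel_measurable M" and "\<And>\<omega>. \<bar>a \<omega>\<bar> \<le> Kg"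
    for a b :: "'a \<Rightarrow> real"
  proof (rule Bochner_Integration.integrable_bound)
    show "integrable M (\<lambda>\<omega>. Kg * b \<omega>)" using that by simp
    have [measurable]: "b \<in> borel_measurable M" using that by auto
    show "(\<lambda>\<omega>. a \<omega> * b \<omega>) \<in> borel_measurable M" by measurable
    show "AE \<omega> in M. norm (a \<omega> * b \<omega>) \<le> norm (Kg * b \<omega>)"
      using that Kg(1) by (intro AE_I2) (auto simp: abs_mult intro!: mult_right_mono)
  qed
  have mult_le: "\<bar>expectation (\<lambda>\<omega>. a \<omega> * b \<omega>)\<bar> \<le> Kg * expectation (\<lambda>\<omega>. \<bar>b \<omega>\<bar>)"
    if "integrable M b" and [measurable]: "a \<in> borel_measurable M" and "\<And>\<omega>. \<bar>a \<omega>\<bar> \<le> Kg"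
    for a b :: "'a \<Rightarrow> real"
  proof -
    have "\<bar>expectation (\<lambda>\<omega>. a \<omega> * b \<omega>)\<bar> \<le> expectation (\<lambda>\<omega>. \<bar>a \<omega> * b \<omega>\<bar>)" by (rule integral_abs_bound)
    also have "\<dots> \<le> expectation (\<lambda>\<omega>. Kg * \<bar>b \<omega>\<bar>)"
    proof (rule integral_mono)
      show "integrable M (\<lambda>\<omega>. \<bar>a \<omega> * b \<omega>\<bar>)" using mult_int[OF that] by (rule integrable_abs)
      show "integrable M (\<lambda>\<omega>. Kg * \<bar>b \<omega>\<bar>)" using that by simp
      show "\<bar>a \<omega> * b \<omega>\<bar> \<le> Kg * \<bar>b \<omega>\<bar>" for \<omega> using that(3) by (auto simp: abs_mult intro!: mult_right_mono)
    qed
    finally show ?thesis by simp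
  qed
  have hX2: "integrable M (\<lambda>\<omega>. (h (X u \<omega>))\<^sup>2)" if u: "u \<in> {0..T}" for u
  proof (rule Bochner_Integration.integrable_bound)
    have X2: "integrable M (\<lambda>\<omega>. (X u \<omega>)\<^sup>2)"
      by (rule integrable_cong_AE_imp[OF W_square_integrable[of "e u"]]) (use W_e_X[OF u] in auto)
    then show "integrable M (\<lambda>\<omega>. 2 * (h 0)\<^sup>2 + 2 * K\<^sup>2 * (X u \<omega>)\<^sup>2)" by simp
    have "(h y)\<^sup>2 \<le> 2 * (h 0)\<^sup>2 + 2 * K\<^sup>2 * y\<^sup>2" for y
    proof -
      have "\<bar>h y\<bar> \<le> \<bar>h 0\<bar> + K * \<bar>y\<bar>" using hlip[of y 0] by simp
      then have "\<bar>h y\<bar>\<^sup>2 \<le> (\<bar>h 0\<bar> + K * \<bar>y\<bar>)\<^sup>2" by (intro power_mono) auto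
      also have "\<dots> \<le> 2 * \<bar>h 0\<bar>\<^sup>2 + 2 * (K * \<bar>y\<bar>)\<^sup>2"
        using sum_squares_bound[of "\<bar>h 0\<bar>" "K * \<bar>y\<bar>"] by (simp add: power2_sum)
      finally show ?thesis by (simp add: power_mult_distrib)
    qed
    then show "AE \<omega> in M. norm ((h (X u \<omega>))\<^sup>2) \<le> norm (2 * (h 0)\<^sup>2 + 2 * K\<^sup>2 * (X u \<omega>)\<^sup>2)"
      unfolding real_norm_def by (intro AE_I2 order_trans[OF _ abs_ge_self]) auto
  qed measurable
  have hX: "integrable M (\<lambda>\<omega>. h (X u \<omega>))" if u: "u \<in> {0..T}" for u
    by (rule square_integrable_imp_integrable[OF _ hX2[OF u]]) simp
  \<comment> \<open>Taylor expansion around the right end points; the remainder is of second order in the increments.\<close>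
  define \<rho> where "\<rho> m \<omega> = f (X t \<omega>) - f (X 0 \<omega>) - (\<Sum>k<Suc m. h (X (?x m (Suc k)) \<omega>) * ?d m k \<omega>)" for m \<omega>
  have taylor: "\<bar>f y - f x - h y * (y - x)\<bar> \<le> K * (y - x)\<^sup>2" for x y
  proof -
    have "\<exists>z. \<bar>z - y\<bar> \<le> \<bar>y - x\<bar> \<and> f y - f x = h z * (y - x)"
    proof (cases x y rule: linorder_cases)
      case less
      then show ?thesis using MVT2[OF less, of f h] f by (auto simp: abs_if mult.commute) (smt (verit))
    next
      case greater
      then obtain z where "y < z" "z < x" "f x - f y = (x - y) * h z" using MVT2[OF greater, of f h] f by auto
      then show ?thesis by (intro exI[of _ z]) (auto simp: algebra_simps)
    qed auto
    then obtain z where z: "\<bar>z - y\<bar> \<le> \<bar>y - x\<bar>" "f y - f x = h z * (y - x)" by blast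
    have "\<bar>f y - f x - h y * (y - x)\<bar> = \<bar>h z - h y\<bar> * \<bar>y - x\<bar>"
      unfolding z(2) left_diff_distrib[symmetric] abs_mult ..
    also have "\<dots> \<le> K * \<bar>z - y\<bar> * \<bar>y - x\<bar>" using hlip by (intro mult_right_mono) auto
    also have "\<dots> \<le> K * \<bar>y - x\<bar> * \<bar>y - x\<bar>" using z(1) K0 by (intro mult_right_mono mult_left_mono) auto
    finally show ?thesis by (simp add: power2_eq_square mult.assoc)
  qed
  have \<rho>_le: "\<bar>\<rho> m \<omega>\<bar> \<le> K * (\<Sum>k<Suc m. (?d m k \<omega>)\<^sup>2)" for m \<omega>
  proof -
    have "f (X t \<omega>) - f (X 0 \<omega>) = (\<Sum>k<Suc m. f (X (?x m (Suc k)) \<omega>) - f (X (?x m k) \<omega>))"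
      by (subst sum_lessThan_telescope) (simp add: grid_n grid_0)
    then have "\<rho> m \<omega> = (\<Sum>k<Suc m. f (X (?x m (Suc k)) \<omega>) - f (X (?x m k) \<omega>) - h (X (?x m (Suc k)) \<omega>) * ?d m k \<omega>)"
      by (simp add: \<rho>_def sum_subtractf del: sum.lessThan_Suc)
    then show ?thesis
      unfolding sum_distrib_left by (auto intro!: order_trans[OF sum_abs] sum_mono taylor simp del: sum.lessThan_Suc)
  qed
  have X0i: "integrable M (\<lambda>\<omega>. f (X 0 \<omega>))"
  proof (rule integrable_cong_AE_imp)
    show "AE \<omega> in M. f 0 = f (X 0 \<omega>)" using X_0 by eventually_elim simp
  qed auto
  have inc_i: "integrable M (\<lambda>\<omega>. h (X u \<omega>) * (X u \<omega> - X v \<omega>))" if "u \<in> {0..T}" "v \<in> {0..T}" for u v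
  proof (rule Bochner_Integration.integrable_bound)
    show "integrable M (\<lambda>\<omega>. (h (X u \<omega>))\<^sup>2 + (X u \<omega> - X v \<omega>)\<^sup>2)"
      using hX2[OF that(1)] X_increment[OF that] by simp
    have "\<bar>x * y\<bar> \<le> x\<^sup>2 + y\<^sup>2" for x y :: real
      using sum_squares_bound[of "\<bar>x\<bar>" "\<bar>y\<bar>"] abs_ge_zero[of "x * y"] unfolding abs_mult power2_abs by linarith
    then show "AE \<omega> in M. norm (h (X u \<omega>) * (X u \<omega> - X v \<omega>)) \<le> norm ((h (X u \<omega>))\<^sup>2 + (X u \<omega> - X v \<omega>)\<^sup>2)"
      by simp
  qed measurable
  have \<rho>_i: "integrable M (\<rho> m)" for m
    unfolding \<rho>_def using fi X0i inc_i rng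
    by (intro Bochner_Integration.integrable_diff Bochner_Integration.integrable_sum) auto
  have \<rho>_E: "expectation (\<lambda>\<omega>. \<bar>\<rho> m \<omega>\<bar>) \<le> K * (real (Suc m) * (t / real (Suc m)) powr (2*H))" for m
  proof -
    have "expectation (\<lambda>\<omega>. \<bar>\<rho> m \<omega>\<bar>) \<le> expectation (\<lambda>\<omega>. K * (\<Sum>k<Suc m. (?d m k \<omega>)\<^sup>2))"
      using \<rho>_i \<rho>_le X_increment(1) rng
      by (intro integral_mono) (auto intro!: integrable_mult_right Bochner_Integration.integrable_sum simp del: sum.lessThan_Suc)
    also have "\<dots> = K * (\<Sum>k<Suc m. \<bar>?x m (Suc k) - ?x m k\<bar> powr (2*H))"
      using X_increment rng by (simp del: sum.lessThan_Suc)
    also have "(\<Sum>k<Suc m. \<bar>?x m (Suc k) - ?x m k\<bar> powr (2*H)) = real (Suc m) * (t / real (Suc m)) powr (2*H)"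
      unfolding grid_Suc using t by (simp del: sum.lessThan_Suc)
    finally show ?thesis .
  qed
  \<comment> \<open>The discrete correction term. Its weights are nonnegative with bounded total
    mass, which gives the uniform bound \<open>\<kappa>b\<close> needed for dominated
    convergence.\<close>
  define \<kappa> where "\<kappa> m \<omega> = (\<Sum>k<Suc m. h' (X (?x m (Suc k)) \<omega>) * ?q m k)" for m \<omega>
  have \<kappa>m [measurable]: "\<kappa> m \<in> borel_measurable M" for m unfolding \<kappa>_def by measurable
  have diag_nn: "0 \<le> ?q m k" if "k < Suc m" for m k
  proof -
    have "?x m k powr (2*H) \<le> ?x m (Suc k) powr (2*H)"
      using grid_mono[OF t(1), of k "Suc k"] grid_nonneg[OF t(1)] H by (intro powr_mono2) auto
    then show ?thesis using that t by (subst e_diag) auto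
  qed
  have diag_sum: "(\<Sum>k<Suc m. ?q m k) \<le> t powr (2*H) / 2 + real (Suc m) * (t / real (Suc m)) powr (2*H) / 2" for m
  proof -
    have "(\<Sum>k<Suc m. ?q m k) =
        (\<Sum>k<Suc m. (?x m (Suc k)) powr (2*H) - (?x m k) powr (2*H)) / 2 + (\<Sum>k<Suc m. (t / real (Suc m)) powr (2*H)) / 2"
      unfolding sum_divide_distrib sum.distrib[symmetric] using t
      by (intro sum.cong refl) (subst e_diag, auto simp: add_divide_distrib)
    also have "(\<Sum>k<Suc m. (?x m (Suc k)) powr (2*H) - (?x m k) powr (2*H)) = t powr (2*H)"
      by (subst sum_lessThan_telescope) (simp add: grid_n grid_0)
    finally show ?thesis by simp
  qed
  have mesh_bdd: "real (Suc m) * (t / real (Suc m)) powr (2*H) \<le> t powr (2*H)" for m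
  proof -
    have "real (Suc m) * (t / real (Suc m)) powr (2*H) = t powr (2*H) * (real (Suc m) / real (Suc m) powr (2*H))"
      using t by (simp add: powr_divide)
    also have "\<dots> \<le> t powr (2*H) * 1"
    proof (intro mult_left_mono)
      have "real (Suc m) powr 1 \<le> real (Suc m) powr (2*H)" using H by (intro powr_mono) auto
      then show "real (Suc m) / real (Suc m) powr (2*H) \<le> 1" by (simp add: divide_le_eq)
    qed simp
    finally show ?thesis by simp
  qed
  have \<kappa>b: "\<bar>\<kappa> m \<omega>\<bar> \<le> K * t powr (2*H)" for m \<omega>
  proof -
    have "\<bar>\<kappa> m \<omega>\<bar> \<le> (\<Sum>k<Suc m. K * ?q m k)"
      unfolding \<kappa>_def
    proof (rule order_trans[OF sum_abs sum_mono])
      fix k assume "k \<in> {..<Suc m}"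
      then show "\<bar>h' (X (?x m (Suc k)) \<omega>) * ?q m k\<bar> \<le> K * ?q m k"
        using diag_nn[of k m] K by (auto simp: abs_mult intro!: mult_right_mono)
    qed
    also have "\<dots> \<le> K * t powr (2*H)"
      unfolding sum_distrib_left[symmetric] using diag_sum[of m] mesh_bdd[of m] K0 by (intro mult_left_mono) auto
    finally show ?thesis .
  qed
  define \<kappa>lim where "\<kappa>lim \<omega> = H * integral {0..t} (\<lambda>s. h' (X s \<omega>) * s powr (2*H-1))" for \<omega>
  have \<kappa>_lim: "(\<lambda>m. \<kappa> m \<omega>) \<longlonglongrightarrow> \<kappa>lim \<omega>" for \<omega>
  proof -
    let ?A = "\<lambda>x. \<bar>x\<bar> powr (2*H) / 2"
    have rs: "(\<lambda>m. \<Sum>k<Suc m. h' (X (t * real (Suc k) / real (Suc m)) \<omega>) * (?A (t * real (Suc k) / real (Suc m)) - ?A (t * real k / real (Suc m))))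
       \<longlonglongrightarrow> integral {0..t} (\<lambda>s. h' (X s \<omega>) * (H * s powr (2*H-1)))"
      by (intro weighted_riemann_sum_tendsto t continuous_on_compose2[OF ch' X_cont']) auto
    \<comment> \<open>The part of the diagonal weights that is not an increment of half the
      variance; it is of order n times the mesh to the power 2H.\<close>
    define E where "E m = (\<Sum>k<Suc m. h' (X (?x m (Suc k)) \<omega>) * ((t / real (Suc m)) powr (2*H) / 2))" for m
    have "\<bar>E m\<bar> \<le> K / 2 * (real (Suc m) * (t / real (Suc m)) powr (2*H))" for m
    proof -
      have "\<bar>E m\<bar> \<le> (\<Sum>k<Suc m. K * ((t / real (Suc m)) powr (2*H) / 2))"
        unfolding E_def by (rule order_trans[OF sum_abs sum_mono]) (auto simp: abs_mult K intro!: mult_right_mono)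
      then show ?thesis by (simp add: algebra_simps del: sum.lessThan_Suc)
    qed
    then have E0: "E \<longlonglongrightarrow> 0"
      by (rule tendsto_0_squeeze) (use tendsto_mult_right_zero[OF mesh_tendsto_0[of "2*H" t]] H t in auto)
    have "\<kappa> m \<omega> = (\<Sum>k<Suc m. h' (X (t * real (Suc k) / real (Suc m)) \<omega>) * (?A (t * real (Suc k) / real (Suc m)) - ?A (t * real k / real (Suc m)))) + E m" for m
      unfolding \<kappa>_def E_def sum.distrib[symmetric]
    proof (intro sum.cong refl)
      fix k assume "k \<in> {..<Suc m}"
      then have k: "k < Suc m" by simp
      have "?A (t * real (Suc k) / real (Suc m)) - ?A (t * real k / real (Suc m)) = ((?x m (Suc k)) powr (2*H) - (?x m k) powr (2*H)) / 2"
        using t by (simp add: grid_def diff_divide_distrib)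
      moreover have "X (t * real (Suc k) / real (Suc m)) \<omega> = X (?x m (Suc k)) \<omega>" by (simp add: grid_def)
      ultimately show "h' (X (?x m (Suc k)) \<omega>) * ?q m k =
          h' (X (t * real (Suc k) / real (Suc m)) \<omega>) * (?A (t * real (Suc k) / real (Suc m)) - ?A (t * real k / real (Suc m))) +
          h' (X (?x m (Suc k)) \<omega>) * ((t / real (Suc m)) powr (2*H) / 2)"
        unfolding e_diag[OF k t] by (simp only:) (simp add: add_divide_distrib distrib_left)
    qed
    then have "(\<lambda>m. \<kappa> m \<omega>) \<longlonglongrightarrow> integral {0..t} (\<lambda>s. h' (X s \<omega>) * (H * s powr (2*H-1))) + 0"
      using tendsto_add[OF rs E0] by (simp only:)
    moreover have "integral {0..t} (\<lambda>s. h' (X s \<omega>) * (H * s powr (2*H-1))) = \<kappa>lim \<omega>"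
      unfolding \<kappa>lim_def by (subst integral_mult_right[symmetric]) (simp add: mult_ac)
    ultimately show ?thesis by simp
  qed
  have \<kappa>lim_m [measurable]: "\<kappa>lim \<in> borel_measurable M"
    by (rule borel_measurable_LIMSEQ_real[OF \<kappa>_lim]) simp
  have \<kappa>lim_b: "\<bar>\<kappa>lim \<omega>\<bar> \<le> K * t powr (2*H)" for \<omega>
    by (rule LIMSEQ_le_const2[OF tendsto_rabs[OF \<kappa>_lim]]) (use \<kappa>b in auto)
  let ?EU = "\<lambda>j m. expectation (\<lambda>\<omega>. DG j \<omega> * inner (\<phi> j) (?U m \<omega>))" and ?EJ = "\<lambda>j. expectation (\<lambda>\<omega>. DG j \<omega> * inner (\<phi> j) (?J \<omega>))"
    and ?Ef = "expectation (\<lambda>\<omega>. G \<omega> * (f (X t \<omega>) - f (X 0 \<omega>)))"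
  \<comment> \<open>Each increment of X is the Gaussian variable of some \<open>De\<close>, and
    \<open>ito_increment\<close> removes it: derivatives of G reassemble the step function element
    \<open>U\<close>, derivatives of \<open>h\<close> collect in \<kappa>.\<close>
  have discrete: "?Ef - expectation (\<lambda>\<omega>. G \<omega> * \<rho> m \<omega>) =
      (\<Sum>j<n. ?EU j m) + expectation (\<lambda>\<omega>. G \<omega> * \<kappa> m \<omega>)" for m
  proof -
    have i1: "integrable M (\<lambda>\<omega>. G \<omega> * (h (X (?x m (Suc k)) \<omega>) * ?d m k \<omega>))" if "k < Suc m" for k
      using that rng by (intro mult_int inc_i Gb) auto
    have i2: "integrable M (\<lambda>\<omega>. DG j \<omega> * h (X (?x m (Suc k)) \<omega>))" if "k < Suc m" "j < n" for k j
      using that rng by (intro mult_int hX DGb) auto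
    have i3: "integrable M (\<lambda>\<omega>. G \<omega> * h' (X (?x m (Suc k)) \<omega>))" for k
      using K by (intro mult_int Gb integrable_const_bound[where B=K]) auto
    have "?Ef - expectation (\<lambda>\<omega>. G \<omega> * \<rho> m \<omega>) =
       expectation (\<lambda>\<omega>. G \<omega> * (f (X t \<omega>) - f (X 0 \<omega>)) - G \<omega> * \<rho> m \<omega>)"
      using fi X0i \<rho>_i by (intro Bochner_Integration.integral_diff[symmetric] mult_int Gb Bochner_Integration.integrable_diff) auto
    also have "\<dots> = expectation (\<lambda>\<omega>. \<Sum>k<Suc m. G \<omega> * (h (X (?x m (Suc k)) \<omega>) * ?d m k \<omega>))"
      by (intro Bochner_Integration.integral_cong refl)
        (simp add: \<rho>_def right_diff_distrib[symmetric] sum_distrib_left[symmetric] del: sum.lessThan_Suc)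
    also have "\<dots> = (\<Sum>k<Suc m. expectation (\<lambda>\<omega>. G \<omega> * (h (X (?x m (Suc k)) \<omega>) * ?d m k \<omega>)))"
      using i1 by (intro Bochner_Integration.integral_sum) auto
    also have "\<dots> = (\<Sum>k<Suc m. (\<Sum>j<n. inner (\<phi> j) (De t (Suc m) k) * expectation (\<lambda>\<omega>. DG j \<omega> * h (X (?x m (Suc k)) \<omega>)))
       + ?q m k * expectation (\<lambda>\<omega>. G \<omega> * h' (X (?x m (Suc k)) \<omega>)))"
    proof (intro sum.cong refl)
      fix k assume "k \<in> {..<Suc m}"
      then have k: "?x m (Suc k) \<in> {0..T}" "?x m k \<in> {0..T}" using rng by auto
      have "expectation (\<lambda>\<omega>. G \<omega> * (h (X (?x m (Suc k)) \<omega>) * ?d m k \<omega>)) =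
          expectation (\<lambda>\<omega>. G \<omega> * h (X (?x m (Suc k)) \<omega>) * W (De t (Suc m) k) \<omega>)"
        using W_De[OF k] unfolding De_def by (intro integral_cong_AE) auto
      then show "expectation (\<lambda>\<omega>. G \<omega> * (h (X (?x m (Suc k)) \<omega>) * ?d m k \<omega>)) =
        (\<Sum>j<n. inner (\<phi> j) (De t (Suc m) k) * expectation (\<lambda>\<omega>. DG j \<omega> * h (X (?x m (Suc k)) \<omega>)))
       + ?q m k * expectation (\<lambda>\<omega>. G \<omega> * h' (X (?x m (Suc k)) \<omega>))"
        unfolding G_def DG_def ito_increment[OF g h ch' K k(1), of \<phi> "De t (Suc m) k"] .
    qed
    also have "\<dots> = (\<Sum>j<n. \<Sum>k<Suc m. inner (\<phi> j) (De t (Suc m) k) * expectation (\<lambda>\<omega>. DG j \<omega> * h (X (?x m (Suc k)) \<omega>)))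
       + (\<Sum>k<Suc m. ?q m k * expectation (\<lambda>\<omega>. G \<omega> * h' (X (?x m (Suc k)) \<omega>)))"
      unfolding sum.distrib by (subst sum.swap) simp
    also have "(\<Sum>k<Suc m. ?q m k * expectation (\<lambda>\<omega>. G \<omega> * h' (X (?x m (Suc k)) \<omega>))) =
        expectation (\<lambda>\<omega>. G \<omega> * \<kappa> m \<omega>)"
    proof -
      have "expectation (\<lambda>\<omega>. G \<omega> * \<kappa> m \<omega>) = expectation (\<lambda>\<omega>. \<Sum>k<Suc m. ?q m k * (G \<omega> * h' (X (?x m (Suc k)) \<omega>)))"
        unfolding \<kappa>_def sum_distrib_left by (intro Bochner_Integration.integral_cong sum.cong refl) (simp add: mult_ac)
      also have "\<dots> = (\<Sum>k<Suc m. expectation (\<lambda>\<omega>. ?q m k * (G \<omega> * h' (X (?x m (Suc k)) \<omega>))))"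
        by (intro Bochner_Integration.integral_sum integrable_mult_right i3)
      finally show ?thesis by (simp del: sum.lessThan_Suc)
    qed
    also have "(\<Sum>j<n. \<Sum>k<Suc m. inner (\<phi> j) (De t (Suc m) k) * expectation (\<lambda>\<omega>. DG j \<omega> * h (X (?x m (Suc k)) \<omega>))) =
        (\<Sum>j<n. ?EU j m)"
    proof (intro sum.cong refl)
      fix j assume j: "j \<in> {..<n}"
      have "?EU j m =
        expectation (\<lambda>\<omega>. \<Sum>k<Suc m. inner (\<phi> j) (De t (Suc m) k) * (DG j \<omega> * h (X (?x m (Suc k)) \<omega>)))"
        unfolding U_def inner_sum_right sum_distrib_left by (intro Bochner_Integration.integral_cong sum.cong refl) (simp add: mult_ac)
      also have "\<dots> = (\<Sum>k<Suc m. expectation (\<lambda>\<omega>. inner (\<phi> j) (De t (Suc m) k) * (DG j \<omega> * h (X (?x m (Suc k)) \<omega>))))"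
        using i2 j by (intro Bochner_Integration.integral_sum integrable_mult_right) auto
      finally show "(\<Sum>k<Suc m. inner (\<phi> j) (De t (Suc m) k) * expectation (\<lambda>\<omega>. DG j \<omega> * h (X (?x m (Suc k)) \<omega>))) =
        ?EU j m" by (simp del: sum.lessThan_Suc)
    qed
    finally show ?thesis .
  qed
  have lim1: "(\<lambda>m. expectation (\<lambda>\<omega>. G \<omega> * \<rho> m \<omega>)) \<longlonglongrightarrow> 0"
  proof (rule tendsto_0_squeeze)
    show "\<bar>expectation (\<lambda>\<omega>. G \<omega> * \<rho> m \<omega>)\<bar> \<le> Kg * (K * (real (Suc m) * (t / real (Suc m)) powr (2*H)))" for m
      using mult_le[OF \<rho>_i Gm Gb, of m] mult_left_mono[OF \<rho>_E[of m] Kg(1)] by linarith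
    show "(\<lambda>m. Kg * (K * (real (Suc m) * (t / real (Suc m)) powr (2*H)))) \<longlonglongrightarrow> 0"
      by (intro tendsto_mult_right_zero mesh_tendsto_0) (use H t in auto)
  qed
  have lim2: "(\<lambda>m. expectation (\<lambda>\<omega>. G \<omega> * \<kappa> m \<omega>)) \<longlonglongrightarrow> expectation (\<lambda>\<omega>. G \<omega> * \<kappa>lim \<omega>)"
  proof (rule integral_dominated_convergence[where w="\<lambda>_. Kg * (K * t powr (2*H))"])
    show "AE \<omega> in M. (\<lambda>m. G \<omega> * \<kappa> m \<omega>) \<longlonglongrightarrow> G \<omega> * \<kappa>lim \<omega>"
      by (intro AE_I2 tendsto_intros \<kappa>_lim)
    show "AE \<omega> in M. norm (G \<omega> * \<kappa> m \<omega>) \<le> Kg * (K * t powr (2*H))" for m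
      unfolding real_norm_def abs_mult using Gb \<kappa>b Kg(1) by (intro AE_I2 mult_mono) auto
  qed auto
  have UJi: "integrable M (\<lambda>\<omega>. norm (?U m \<omega> - ?J \<omega>))"
    and UJe: "expectation (\<lambda>\<omega>. norm (?U m \<omega> - ?J \<omega>)) \<le> sqrt (CH * t) * K * (t / real (Suc m)) powr H" for m
  proof -
    have c: "CH * t * (K\<^sup>2 * (t / real (Suc m)) powr (2*H)) = (sqrt (CH * t) * K * (t / real (Suc m)) powr H)\<^sup>2"
      using CH_pos t by (simp add: power_mult_distrib powr_power[symmetric] powr_powr mult.commute[of H])
        (simp add: powr_add[symmetric] power2_eq_square)
    have *: "L2sq M (\<lambda>\<omega>. norm (?U m \<omega> - ?J \<omega>)) \<le> ennreal ((sqrt (CH * t) * K * (t / real (Suc m)) powr H)\<^sup>2)"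
      using U_J_L2[OF t hlip ch, of "Suc m"] unfolding c by simp
    have nn: "0 \<le> sqrt (CH * t) * K * (t / real (Suc m)) powr H" using CH_pos t K0 by simp
    show "integrable M (\<lambda>\<omega>. norm (?U m \<omega> - ?J \<omega>))"
      "expectation (\<lambda>\<omega>. norm (?U m \<omega> - ?J \<omega>)) \<le> sqrt (CH * t) * K * (t / real (Suc m)) powr H"
      using expectation_abs_le_nn[OF _ nn *] by simp_all
  qed
  have Ji: "integrable M (\<lambda>\<omega>. norm (?J \<omega>))"
  proof (rule Bochner_Integration.integrable_bound)
    show "integrable M (\<lambda>\<omega>. norm (?U 0 \<omega> - ?J \<omega>) + \<bar>h (X t \<omega>)\<bar> * norm (e t))"
      using UJi[of 0] hX[of t] t by (intro Bochner_Integration.integrable_add) auto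
    have "norm (?J \<omega>) \<le> norm (?U 0 \<omega> - ?J \<omega>) + \<bar>h (X t \<omega>)\<bar> * norm (e t)" for \<omega>
    proof -
      \<comment> \<open>The partition into a single cell has an explicit element, so integrability
        of \<open>J\<close> follows from that of its distance to this element.\<close>
      have "?U 0 \<omega> = h (X t \<omega>) *\<^sub>R e t" by (simp add: U_def De_def grid_n grid_0 e_0 grid_def)
      then have "norm (?U 0 \<omega>) = \<bar>h (X t \<omega>)\<bar> * norm (e t)" by simp
      then show ?thesis using norm_triangle_sub[of "?J \<omega>" "?U 0 \<omega>"] by (simp add: norm_minus_commute)
    qed
    then show "AE \<omega> in M. norm (norm (?J \<omega>)) \<le> norm (norm (?U 0 \<omega> - ?J \<omega>) + \<bar>h (X t \<omega>)\<bar> * norm (e t))"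
      unfolding real_norm_def by (intro AE_I2) (auto intro: order_trans[OF _ abs_ge_self])
  qed measurable
  have inner_i: "integrable M (\<lambda>\<omega>. inner v (Y \<omega>))" if "integrable M (\<lambda>\<omega>. norm (Y \<omega>))" and [measurable]: "Y \<in> borel_measurable M" for v and Y :: "'a \<Rightarrow> 'h"
  proof (rule Bochner_Integration.integrable_bound)
    show "integrable M (\<lambda>\<omega>. norm v * norm (Y \<omega>))" using that by simp
  qed (auto simp: Cauchy_Schwarz_ineq2)
  have lim3: "(\<lambda>m. ?EU j m) \<longlonglongrightarrow> ?EJ j" if j: "j < n" for j
  proof (rule LIM_zero_cancel, rule tendsto_0_squeeze)
    fix m
    have i: "integrable M (\<lambda>\<omega>. inner (\<phi> j) (?U m \<omega> - ?J \<omega>))" by (rule inner_i[OF UJi]) measurable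
    have iJ: "integrable M (\<lambda>\<omega>. inner (\<phi> j) (?J \<omega>))" by (rule inner_i[OF Ji]) measurable
    have iU: "integrable M (\<lambda>\<omega>. inner (\<phi> j) (?U m \<omega>))"
      using Bochner_Integration.integrable_add[OF i iJ] by (simp add: inner_diff_right)
    have "?EU j m - ?EJ j =
        expectation (\<lambda>\<omega>. DG j \<omega> * inner (\<phi> j) (?U m \<omega> - ?J \<omega>))"
      using mult_int[OF iU DGm[OF j] DGb[OF j]] mult_int[OF iJ DGm[OF j] DGb[OF j]]
      by (simp add: inner_diff_right right_diff_distrib)
    then have "\<bar>?EU j m - ?EJ j\<bar>
        \<le> Kg * expectation (\<lambda>\<omega>. \<bar>inner (\<phi> j) (?U m \<omega> - ?J \<omega>)\<bar>)"
      using mult_le[OF i DGm[OF j] DGb[OF j]] by simp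
    also have "\<dots> \<le> Kg * expectation (\<lambda>\<omega>. norm (\<phi> j) * norm (?U m \<omega> - ?J \<omega>))"
      using i UJi by (intro mult_left_mono integral_mono Kg) (auto simp: Cauchy_Schwarz_ineq2)
    also have "\<dots> \<le> Kg * (norm (\<phi> j) * (sqrt (CH * t) * K * (t / real (Suc m)) powr H))"
      using UJe[of m] Kg(1) by (simp add: mult_left_mono)
    finally show "\<bar>?EU j m - ?EJ j\<bar>
        \<le> Kg * (norm (\<phi> j) * (sqrt (CH * t) * K * (t / real (Suc m)) powr H))" .
  next
    have "(\<lambda>m. t / real (Suc m)) \<longlonglongrightarrow> 0" by real_asymp
    then have "(\<lambda>m. (t / real (Suc m)) powr H) \<longlonglongrightarrow> 0"
      using tendsto_powr'[of "\<lambda>m. t / real (Suc m)" 0 sequentially "\<lambda>_. H" H] H t by simp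
    then show "(\<lambda>m. Kg * (norm (\<phi> j) * (sqrt (CH * t) * K * (t / real (Suc m)) powr H))) \<longlonglongrightarrow> 0"
      by (intro tendsto_mult_right_zero)
  qed
  have "?Ef - 0 =
      (\<Sum>j<n. ?EJ j) + expectation (\<lambda>\<omega>. G \<omega> * \<kappa>lim \<omega>)"
  proof (rule LIMSEQ_unique)
    show "(\<lambda>m. ?Ef - expectation (\<lambda>\<omega>. G \<omega> * \<rho> m \<omega>)) \<longlonglongrightarrow> ?Ef - 0"
      by (intro tendsto_intros lim1)
    show "(\<lambda>m. ?Ef - expectation (\<lambda>\<omega>. G \<omega> * \<rho> m \<omega>)) \<longlonglongrightarrow>
        (\<Sum>j<n. ?EJ j) + expectation (\<lambda>\<omega>. G \<omega> * \<kappa>lim \<omega>)"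
      unfolding discrete by (intro tendsto_add tendsto_sum lim2 lim3) auto
  qed
  moreover have "expectation (\<lambda>\<omega>. G \<omega> * (f (X t \<omega>) - f (X 0 \<omega>) - \<kappa>lim \<omega>)) =
      ?Ef - expectation (\<lambda>\<omega>. G \<omega> * \<kappa>lim \<omega>)"
  proof -
    have "integrable M \<kappa>lim" using \<kappa>lim_b by (intro integrable_const_bound[where B="K * t powr (2*H)"]) auto
    then have "integrable M (\<lambda>\<omega>. G \<omega> * \<kappa>lim \<omega>)" "integrable M (\<lambda>\<omega>. G \<omega> * (f (X t \<omega>) - f (X 0 \<omega>)))"
      using fi X0i by (auto intro!: mult_int Gb)
    then show ?thesis by (simp add: right_diff_distrib[of _ "_ - _"])
  qed
  moreover have "(\<Sum>j<n. ?EJ j) =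
      expectation (\<lambda>\<omega>. inner (malliavin_deriv W n g \<phi> \<omega>) (?J \<omega>))"
  proof -
    have "integrable M (\<lambda>\<omega>. DG j \<omega> * inner (\<phi> j) (?J \<omega>))" if "j < n" for j
      using that by (intro mult_int inner_i Ji DGb) auto
    then show ?thesis
      by (simp add: malliavin_deriv_def inner_sum_left DG_def Bochner_Integration.integral_sum)
  qed
  ultimately show ?thesis
    unfolding smooth_functional_def G_def[symmetric] \<kappa>lim_def by simp
qed

end

text \<open>The integrand may be singular at a, but the signed power is a continuous primitive
  across a because p > -1, so the fundamental theorem with one exceptional point applies.\<close>

lemma has_integral_abs_powr:
  fixes a b c p :: real
  assumes p: "p > -1" and bc: "b \<le> c"
  shows "((\<lambda>x. \<bar>x - a\<bar> powr p) has_integral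
    (sgn (c - a) * \<bar>c - a\<bar> powr (p+1) - sgn (b - a) * \<bar>b - a\<bar> powr (p+1)) / (p+1)) {b..c}"
proof -
  let ?F = "\<lambda>x. sgn (x - a) * \<bar>x - a\<bar> powr (p+1) / (p+1)"
  have cont: "isCont (\<lambda>x. sgn (x - a) * \<bar>x - a\<bar> powr (p+1)) x" for x
  proof (cases "x = a")
    case True
    have "((\<lambda>x. \<bar>x - a\<bar> powr (p+1)) \<longlongrightarrow> 0) (at a)"
      using p by (auto intro!: tendsto_eq_intros)
    then have "((\<lambda>x. sgn (x - a) * \<bar>x - a\<bar> powr (p+1)) \<longlongrightarrow> 0) (at a)"
      by (rule Lim_null_comparison[rotated]) (auto simp: abs_mult abs_sgn_eq intro!: always_eventually)
    then show ?thesis using True by (simp add: isCont_def)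
  next
    case False
    then show ?thesis by (intro continuous_intros) auto
  qed
  have "((\<lambda>x. \<bar>x - a\<bar> powr p) has_integral ?F c - ?F b) {b..c}"
  proof (rule fundamental_theorem_of_calculus_strong[where S="{a}"])
    show "continuous_on {b..c} ?F"
      using cont p by (intro continuous_on_divide continuous_at_imp_continuous_on) auto
    fix x assume "x \<in> {b..c} - {a}"
    then have "x \<noteq> a" by simp
    then consider "x > a" | "x < a" by linarith
    then have "(?F has_real_derivative \<bar>x - a\<bar> powr p) (at x)"
    proof cases
      case 1
      have "((\<lambda>x. (x - a) powr (p+1) / (p+1)) has_real_derivative \<bar>x - a\<bar> powr p) (at x)"
        using 1 p by (auto intro!: derivative_eq_intros)
      moreover have "\<forall>\<^sub>F y in nhds x. ?F y = (y - a) powr (p+1) / (p+1)"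
      proof -
        have "\<forall>\<^sub>F y in nhds x. y \<in> {a<..}" using 1 by (intro eventually_nhds_in_open) auto
        then show ?thesis by eventually_elim simp
      qed
      ultimately show ?thesis by (subst DERIV_cong_ev) auto
    next
      case 2
      have "((\<lambda>x. - ((a - x) powr (p+1)) / (p+1)) has_real_derivative \<bar>x - a\<bar> powr p) (at x)"
        using 2 p by (auto intro!: derivative_eq_intros)
      moreover have "\<forall>\<^sub>F y in nhds x. ?F y = - ((a - y) powr (p+1)) / (p+1)"
      proof -
        have "\<forall>\<^sub>F y in nhds x. y \<in> {..<a}" using 2 by (intro eventually_nhds_in_open) auto
        then show ?thesis by eventually_elim simp
      qed
      ultimately show ?thesis by (subst DERIV_cong_ev) auto
    qed
    then show "(?F has_vector_derivative \<bar>x - a\<bar> powr p) (at x)"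
      by (simp add: has_real_derivative_iff_has_vector_derivative)
  qed (use bc in auto)
  then show ?thesis by (simp add: diff_divide_distrib)
qed

lemma nn_integral_abs_powr:
  fixes a b c p :: real
  assumes "p > -1" "b \<le> c"
  shows "(\<integral>\<^sup>+x. ennreal (indicator {b..c} x * \<bar>x - a\<bar> powr p) \<partial>lborel) =
    ennreal ((sgn (c - a) * \<bar>c - a\<bar> powr (p+1) - sgn (b - a) * \<bar>b - a\<bar> powr (p+1)) / (p+1))"
  by (rule nn_integral_has_integral_lebesgue[OF _ has_integral_abs_powr[OF assms]]) simp

section \<open>Regularizations of the logarithm\<close>

definition ell :: "real \<Rightarrow> real \<Rightarrow> real" where
  "ell \<epsilon> x = ln (x\<^sup>2 + \<epsilon>\<^sup>2) / 2"

text \<open>The primitive of \<open>ell \<epsilon>\<close> that vanishes at 0: integration by parts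
  leaves the integral of \<open>x\<^sup>2 / (x\<^sup>2 + \<epsilon>\<^sup>2)\<close>, whence the
  arctangent.\<close>

definition Fell :: "real \<Rightarrow> real \<Rightarrow> real" where
  "Fell \<epsilon> x = x * ell \<epsilon> x - x + \<epsilon> * arctan (x / \<epsilon>)"

lemma ell_deriv: "\<epsilon> > 0 \<Longrightarrow> (ell \<epsilon> has_real_derivative x / (x\<^sup>2 + \<epsilon>\<^sup>2)) (at x)"
proof -
  assume \<epsilon>: "\<epsilon> > 0"
  have pos: "x\<^sup>2 + \<epsilon>\<^sup>2 > 0" using \<epsilon> by (simp add: add_nonneg_pos)
  have "((\<lambda>x. x\<^sup>2 + \<epsilon>\<^sup>2) has_real_derivative 2 * x) (at x)"
    by (auto intro!: derivative_eq_intros)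
  from DERIV_chain2[OF DERIV_ln[OF pos] this]
  have "((\<lambda>x. ln (x\<^sup>2 + \<epsilon>\<^sup>2)) has_real_derivative inverse (x\<^sup>2 + \<epsilon>\<^sup>2) * (2 * x)) (at x)" .
  then have d: "((\<lambda>x. ln (x\<^sup>2 + \<epsilon>\<^sup>2) / 2) has_real_derivative inverse (x\<^sup>2 + \<epsilon>\<^sup>2) * (2 * x) / 2) (at x)"
    by (rule DERIV_cdivide)
  have "inverse y * (2 * x) / 2 = x / y" for y :: real by (simp add: field_simps)
  with d show ?thesis
    unfolding ell_def[abs_def] by (simp only:)
qed

lemma Fell_deriv: "\<epsilon> > 0 \<Longrightarrow> (Fell \<epsilon> has_real_derivative ell \<epsilon> x) (at x)"
proof -
  assume \<epsilon>: "\<epsilon> > 0"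
  have "x\<^sup>2 + \<epsilon>\<^sup>2 > 0" using \<epsilon> by (simp add: add_nonneg_pos)
  then have nz: "x\<^sup>2 + \<epsilon>\<^sup>2 \<noteq> 0" by (metis less_irrefl)
  have "1 + (x / \<epsilon>)\<^sup>2 = (x\<^sup>2 + \<epsilon>\<^sup>2) / \<epsilon>\<^sup>2" using \<epsilon> by (simp add: power_divide field_simps)
  then have "\<epsilon> * (inverse (1 + (x / \<epsilon>)\<^sup>2) * (1 / \<epsilon>)) = \<epsilon>\<^sup>2 / (x\<^sup>2 + \<epsilon>\<^sup>2)"
    using \<epsilon> less_imp_neq[OF \<epsilon>] by (auto simp: inverse_divide)
  moreover have "x * (x / (x\<^sup>2 + \<epsilon>\<^sup>2)) + \<epsilon>\<^sup>2 / (x\<^sup>2 + \<epsilon>\<^sup>2) = 1"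
    using nz by (simp add: add_divide_distrib[symmetric] power2_eq_square)
  ultimately have e: "(x * (x / (x\<^sup>2 + \<epsilon>\<^sup>2)) + 1 * ell \<epsilon> x) - 1 + \<epsilon> * (inverse (1 + (x / \<epsilon>)\<^sup>2) * (1 / \<epsilon>)) = ell \<epsilon> x"
    by linarith
  have "((\<lambda>x. x / \<epsilon>) has_real_derivative 1 / \<epsilon>) (at x)" by (rule DERIV_cdivide[OF DERIV_ident])
  from DERIV_chain2[OF DERIV_arctan this]
  have a: "((\<lambda>x. arctan (x / \<epsilon>)) has_real_derivative inverse (1 + (x / \<epsilon>)\<^sup>2) * (1 / \<epsilon>)) (at x)" .
  show ?thesis
    unfolding Fell_def[abs_def]
    by (rule DERIV_cong[OF _ e])
      (rule DERIV_add[OF DERIV_diff[OF DERIV_mult'[OF DERIV_ident ell_deriv[OF \<epsilon>]] DERIV_ident] DERIV_cmult[OF a]])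
qed

lemma ell_deriv_continuous: "\<epsilon> > 0 \<Longrightarrow> continuous_on A (\<lambda>x. x / (x\<^sup>2 + \<epsilon>\<^sup>2))" for \<epsilon> :: real
  by (intro continuous_intros) (metis add_nonneg_pos less_irrefl zero_le_power2 zero_less_power)

lemma ell_continuous: "\<epsilon> > 0 \<Longrightarrow> continuous_on A (ell \<epsilon>)"
  by (meson DERIV_isCont ell_deriv continuous_at_imp_continuous_on)

lemma ell_measurable [measurable]: "ell \<epsilon> \<in> borel_measurable borel"
  unfolding ell_def[abs_def] by measurable

lemma ell_deriv_bound:
  fixes \<epsilon> x :: real
  assumes "\<epsilon> > 0"
  shows "\<bar>x / (x\<^sup>2 + \<epsilon>\<^sup>2)\<bar> \<le> 1 / \<epsilon>"
proof -
  have "2 * \<bar>x\<bar> * \<epsilon> \<le> x\<^sup>2 + \<epsilon>\<^sup>2" using sum_squares_bound[of "\<bar>x\<bar>" \<epsilon>] by simp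
  moreover have "0 \<le> \<bar>x\<bar> * \<epsilon>" using assms by simp
  ultimately have "\<bar>x\<bar> * \<epsilon> \<le> x\<^sup>2 + \<epsilon>\<^sup>2" by linarith
  moreover have "x\<^sup>2 + \<epsilon>\<^sup>2 > 0" using assms by (simp add: add_nonneg_pos)
  ultimately show ?thesis using assms by (simp add: abs_divide divide_simps)
qed

lemma ln_add_one_square_le: "ln (1 + u\<^sup>2) / 2 \<le> ln (1 + \<bar>u\<bar>)" for u :: real
proof -
  have "1 + u\<^sup>2 \<le> (1 + \<bar>u\<bar>)\<^sup>2" by (simp add: power2_sum)
  then have "ln (1 + u\<^sup>2) \<le> ln ((1 + \<bar>u\<bar>)\<^sup>2)" by (subst ln_le_cancel_iff) (auto simp: add_pos_nonneg)
  also have "\<dots> = 2 * ln (1 + \<bar>u\<bar>)" by (simp add: ln_realpow add_pos_nonneg)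
  finally show ?thesis by simp
qed

text \<open>The fourth power of 1 + u powr (1/4) is at least 1 + u, and ln (1 + v) \<le> v. The
  exponent 1/4 is chosen so that squares have a singularity of order -1/2, which is integrable
  against a bounded density.\<close>

lemma ln_add_one_le_powr: "u \<ge> 0 \<Longrightarrow> ln (1 + u) \<le> 4 * u powr (1/4)" for u :: real
proof -
  assume u: "u \<ge> 0"
  define v where "v = u powr (1/4)"
  have v: "v \<ge> 0" "v ^ 4 = u"
    using u powr_power[of u "1/4" 4] by (cases "u = 0"; simp add: v_def)+
  have "1 + v ^ 4 \<le> (1 + v) ^ 4"
    using v(1) by (simp add: power4_eq_xxxx algebra_simps)
  then have "ln (1 + u) \<le> ln ((1 + v) ^ 4)" using v u by (subst ln_le_cancel_iff) (auto simp: add_pos_nonneg)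
  also have "\<dots> = 4 * ln (1 + v)" using v by (subst ln_realpow) (auto simp: add_pos_nonneg)
  also have "\<dots> \<le> 4 * v" using ln_add_one_self_le_self[of v] v by simp
  finally show ?thesis by (simp add: v_def)
qed

lemma ell_minus_ln:
  assumes "\<epsilon> > 0" "x \<noteq> 0"
  shows "ell \<epsilon> x - ln \<bar>x\<bar> = ln (1 + (\<epsilon> / x)\<^sup>2) / 2"
proof -
  have "x\<^sup>2 + \<epsilon>\<^sup>2 = x\<^sup>2 * (1 + (\<epsilon> / x)\<^sup>2)" using assms by (simp add: power_divide field_simps)
  then have "ln (x\<^sup>2 + \<epsilon>\<^sup>2) = ln (x\<^sup>2) + ln (1 + (\<epsilon> / x)\<^sup>2)"
  proof -
    have "1 + (\<epsilon> / x)\<^sup>2 > 0" by (simp add: add_pos_nonneg)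
    moreover have "x\<^sup>2 > 0" using assms by simp
    ultimately show ?thesis
      unfolding \<open>x\<^sup>2 + \<epsilon>\<^sup>2 = x\<^sup>2 * (1 + (\<epsilon> / x)\<^sup>2)\<close> by (intro ln_mult_pos)
  qed
  moreover have "ln (x\<^sup>2) = 2 * ln \<bar>x\<bar>" using assms ln_realpow[of "\<bar>x\<bar>" 2] by simp
  ultimately show ?thesis by (simp add: ell_def add_divide_distrib)
qed

lemma ell_ln_diff:
  assumes "\<epsilon> > 0" "x \<noteq> 0"
  shows "0 \<le> ell \<epsilon> x - ln \<bar>x\<bar>" "ell \<epsilon> x - ln \<bar>x\<bar> \<le> 4 * (\<epsilon> / \<bar>x\<bar>) powr (1/4)"
proof -
  show "0 \<le> ell \<epsilon> x - ln \<bar>x\<bar>" unfolding ell_minus_ln[OF assms] by simp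
  have "ell \<epsilon> x - ln \<bar>x\<bar> \<le> ln (1 + \<bar>\<epsilon> / x\<bar>)"
    unfolding ell_minus_ln[OF assms] by (rule ln_add_one_square_le)
  also have "\<dots> \<le> 4 * \<bar>\<epsilon> / x\<bar> powr (1/4)" by (rule ln_add_one_le_powr) simp
  finally show "ell \<epsilon> x - ln \<bar>x\<bar> \<le> 4 * (\<epsilon> / \<bar>x\<bar>) powr (1/4)" using assms by (simp add: abs_divide)
qed

text \<open>The logarithmic part contributes at most \<epsilon> because ln (1 + u) \<le> u, the
  arctangent at most 2 * \<epsilon>; uniformity in x is what makes the boundary terms converge in
  every sense needed.\<close>

lemma Fell_diff:
  assumes "\<epsilon> > 0"
  shows "\<bar>Fell \<epsilon> x - log_primitive x\<bar> \<le> 3 * \<epsilon>"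
proof (cases "x = 0")
  case True
  then show ?thesis using assms by (simp add: Fell_def log_primitive_def)
next
  case False
  have "\<bar>x * (ell \<epsilon> x - ln \<bar>x\<bar>)\<bar> \<le> \<bar>x\<bar> * (\<epsilon> / \<bar>x\<bar>)"
    unfolding abs_mult
  proof (intro mult_left_mono)
    have "ell \<epsilon> x - ln \<bar>x\<bar> \<le> ln (1 + \<bar>\<epsilon> / x\<bar>)"
      unfolding ell_minus_ln[OF assms False] by (rule ln_add_one_square_le)
    also have "\<dots> \<le> \<bar>\<epsilon> / x\<bar>" by (rule ln_add_one_self_le_self) simp
    finally show "\<bar>ell \<epsilon> x - ln \<bar>x\<bar>\<bar> \<le> \<epsilon> / \<bar>x\<bar>"
      using ell_ln_diff(1)[OF assms False] assms by (simp add: abs_divide)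
  qed simp
  then have 1: "\<bar>x * (ell \<epsilon> x - ln \<bar>x\<bar>)\<bar> \<le> \<epsilon>" using False by simp
  have "\<bar>arctan (x / \<epsilon>)\<bar> \<le> 2" using arctan_lbound[of "x / \<epsilon>"] arctan_ubound[of "x / \<epsilon>"] pi_less_4 by (simp add: abs_le_iff)
  then have 2: "\<bar>\<epsilon> * arctan (x / \<epsilon>)\<bar> \<le> \<epsilon> * 2" using assms by (simp add: abs_mult)
  have "Fell \<epsilon> x - log_primitive x = x * (ell \<epsilon> x - ln \<bar>x\<bar>) + \<epsilon> * arctan (x / \<epsilon>)"
    by (simp add: Fell_def log_primitive_def algebra_simps)
  then show ?thesis using 1 2 by linarith
qed

text \<open>Near 0 the logarithm is compared with the power of exponent -1/4, away from 0 with |x|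
  itself.\<close>

lemma ln_square_le:
  fixes x :: real
  assumes "x \<noteq> 0"
  shows "(ln \<bar>x\<bar>)\<^sup>2 \<le> 32 * \<bar>x\<bar> powr (-1/2) + 2 * x\<^sup>2"
proof -
  have "\<bar>ln \<bar>x\<bar>\<bar> \<le> 4 * \<bar>x\<bar> powr (-1/4) + \<bar>x\<bar>"
  proof (cases "\<bar>x\<bar> \<ge> 1")
    case True
    then have "\<bar>ln \<bar>x\<bar>\<bar> \<le> \<bar>x\<bar>" using ln_bound[of "\<bar>x\<bar>"] by simp
    then show ?thesis by (simp add: add_increasing)
  next
    case False
    then have "ln (inverse \<bar>x\<bar>) = \<bar>ln \<bar>x\<bar>\<bar>" using assms by (simp add: ln_inverse)
    moreover have "ln (inverse \<bar>x\<bar>) \<le> ln (1 + inverse \<bar>x\<bar>)"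
      using assms by (intro ln_mono) auto
    moreover have "ln (1 + inverse \<bar>x\<bar>) \<le> 4 * inverse \<bar>x\<bar> powr (1/4)" by (rule ln_add_one_le_powr) simp
    moreover have "inverse \<bar>x\<bar> powr (1/4) = \<bar>x\<bar> powr (-1/4)"
      using assms by (simp add: powr_minus powr_divide inverse_eq_divide powr_minus_divide)
    ultimately show ?thesis using abs_ge_zero[of x] by linarith
  qed
  then have "\<bar>ln \<bar>x\<bar>\<bar>\<^sup>2 \<le> (4 * \<bar>x\<bar> powr (-1/4) + \<bar>x\<bar>)\<^sup>2" by (intro power_mono) auto
  also have "\<dots> \<le> 2 * (4 * \<bar>x\<bar> powr (-1/4))\<^sup>2 + 2 * \<bar>x\<bar>\<^sup>2"
    using sum_squares_bound[of "4 * \<bar>x\<bar> powr (-1/4)" "\<bar>x\<bar>"] by (simp add: power2_sum)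
  also have "(4 * \<bar>x\<bar> powr (-1/4))\<^sup>2 = 16 * \<bar>x\<bar> powr (-1/2)"
    by (simp add: power_mult_distrib power2_eq_square powr_add[symmetric])
  finally show ?thesis by simp
qed

lemma ell_1_abs: "\<bar>ell 1 x\<bar> \<le> \<bar>x\<bar>"
proof -
  have "ell 1 x = ln (1 + x\<^sup>2) / 2" by (simp add: ell_def add.commute)
  moreover have "0 \<le> ln (1 + x\<^sup>2)" by (rule ln_ge_zero) simp
  moreover have "ln (1 + x\<^sup>2) / 2 \<le> \<bar>x\<bar>"
    using ln_add_one_square_le[of x] ln_add_one_self_le_self[of "\<bar>x\<bar>"] by simp
  ultimately show ?thesis by linarith
qed

text \<open>The derivative \<open>ell\<close> grows at most linearly, so the mean value bound on the
  ball of radius |x| is quadratic; finite second moments of X then make the boundary term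
  integrable.\<close>

lemma Fell_quadratic:
  assumes \<epsilon>: "\<epsilon> > 0"
  shows "\<bar>Fell \<epsilon> x\<bar> \<le> (\<bar>ell \<epsilon> 0\<bar> + \<bar>x\<bar> / \<epsilon>) * \<bar>x\<bar>"
proof -
  have lip: "\<bar>ell \<epsilon> x - ell \<epsilon> y\<bar> \<le> (1 / \<epsilon>) * \<bar>x - y\<bar>" for x y
    using field_differentiable_bound[of UNIV "ell \<epsilon>" "\<lambda>x. x / (x\<^sup>2 + \<epsilon>\<^sup>2)" "1 / \<epsilon>" x y] ell_deriv[OF \<epsilon>] ell_deriv_bound[OF \<epsilon>]
    by (auto intro: has_field_derivative_at_within)
  have "norm (Fell \<epsilon> x - Fell \<epsilon> 0) \<le> (\<bar>ell \<epsilon> 0\<bar> + \<bar>x\<bar> / \<epsilon>) * norm (x - 0)"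
  proof (rule field_differentiable_bound[of "cball 0 \<bar>x\<bar>" "Fell \<epsilon>" "ell \<epsilon>"])
    fix z :: real assume "z \<in> cball 0 \<bar>x\<bar>"
    then have "\<bar>z\<bar> / \<epsilon> \<le> \<bar>x\<bar> / \<epsilon>" using \<epsilon> by (intro divide_right_mono) auto
    then show "norm (ell \<epsilon> z) \<le> \<bar>ell \<epsilon> 0\<bar> + \<bar>x\<bar> / \<epsilon>" using lip[of z 0] by simp
  qed (auto intro!: has_field_derivative_at_within Fell_deriv \<epsilon>)
  then show ?thesis by (simp add: Fell_def)
qed

lemma ennreal_integral_eq_nn_integral:
  fixes f :: "real \<Rightarrow> real"
  assumes "continuous_on {0..t} f" "\<And>s. s \<in> {0..t} \<Longrightarrow> 0 \<le> f s"
  shows "ennreal (integral {0..t} f) = (\<integral>\<^sup>+s. ennreal (indicator {0..t} s * f s) \<partial>lborel)"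
  by (rule nn_integral_has_integral_lebesgue[symmetric, OF _ integrable_integral])
    (use assms in \<open>auto intro: integrable_continuous_interval\<close>)

lemma powr_quarter_square: "0 \<le> x \<Longrightarrow> (x powr (1/4))\<^sup>2 = x powr (1/2)" for x :: real
  by (simp add: power2_eq_square powr_add[symmetric])

text \<open>Both regularizations lie above ln |x|, by at most 4 * (m / |x|) powr (1/4), so they
  differ by no more than that.\<close>

lemma ell_diff_square:
  assumes \<epsilon>: "0 < \<epsilon>" "\<epsilon> \<le> m" "0 < \<epsilon>'" "\<epsilon>' \<le> m" and x: "x \<noteq> 0"
  shows "(ell \<epsilon> x - ell \<epsilon>' x)\<^sup>2 \<le> 16 * m powr (1/2) * \<bar>x\<bar> powr (-1/2)"
proof -
  have "4 * (\<delta> / \<bar>x\<bar>) powr (1/4) \<le> 4 * (m / \<bar>x\<bar>) powr (1/4)" if "0 < \<delta>" "\<delta> \<le> m" for \<delta>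
    using that x by (intro mult_left_mono powr_mono2 divide_right_mono) auto
  then have "\<bar>ell \<epsilon> x - ell \<epsilon>' x\<bar> \<le> 4 * (m / \<bar>x\<bar>) powr (1/4)"
    using ell_ln_diff[OF \<epsilon>(1) x] ell_ln_diff[OF \<epsilon>(3) x] \<epsilon> by (smt (verit))
  then have "\<bar>ell \<epsilon> x - ell \<epsilon>' x\<bar>\<^sup>2 \<le> (4 * (m / \<bar>x\<bar>) powr (1/4))\<^sup>2" by (intro power_mono) auto
  also have "\<dots> = 16 * (m / \<bar>x\<bar>) powr (1/2)" using \<epsilon> by (simp add: power_mult_distrib powr_quarter_square)
  also have "(m / \<bar>x\<bar>) powr (1/2) = m powr (1/2) * \<bar>x\<bar> powr (-1/2)"
    using \<epsilon> by (simp add: powr_divide powr_minus_divide)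
  finally show ?thesis by simp
qed

text \<open>A majorant independent of \<epsilon>, with a singularity of order -1/2 and quadratic
  growth, both of which are integrable along almost every path.\<close>

lemma ell_dominated:
  assumes \<epsilon>: "0 < \<epsilon>" "\<epsilon> \<le> 1" and x: "x \<noteq> 0"
  shows "\<bar>ell \<epsilon> x\<bar> \<le> 5 + 36 * \<bar>x\<bar> powr (-1/2) + 2 * x\<^sup>2"
proof -
  have y: "y \<le> 1 + y\<^sup>2" if "y \<ge> 0" for y :: real
  proof -
    have "0 \<le> (y - 1)\<^sup>2" by simp
    then have "2 * y \<le> 1 + y\<^sup>2" unfolding power2_diff by simp
    then show ?thesis using that by linarith
  qed
  have "\<bar>ln \<bar>x\<bar>\<bar> \<le> 1 + (ln \<bar>x\<bar>)\<^sup>2" using y[of "\<bar>ln \<bar>x\<bar>\<bar>"] by simp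
  then have 1: "\<bar>ln \<bar>x\<bar>\<bar> \<le> 1 + (32 * \<bar>x\<bar> powr (-1/2) + 2 * x\<^sup>2)" using ln_square_le[OF x] by linarith
  have "(\<epsilon> / \<bar>x\<bar>) powr (1/4) \<le> (1 / \<bar>x\<bar>) powr (1/4)"
    using \<epsilon> x by (intro powr_mono2 divide_right_mono) auto
  also have "\<dots> \<le> 1 + ((1 / \<bar>x\<bar>) powr (1/4))\<^sup>2" by (rule y) simp
  also have "((1 / \<bar>x\<bar>) powr (1/4))\<^sup>2 = \<bar>x\<bar> powr (-1/2)"
    by (subst powr_quarter_square) (auto simp: powr_divide powr_minus_divide)
  finally have 2: "4 * (\<epsilon> / \<bar>x\<bar>) powr (1/4) \<le> 4 + 4 * \<bar>x\<bar> powr (-1/2)" by simp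
  show ?thesis using ell_ln_diff[OF \<epsilon>(1) x] 1 2 by linarith
qed

lemma ell_tendsto: "x \<noteq> 0 \<Longrightarrow> (\<lambda>n. ell (eps n) x) \<longlonglongrightarrow> ln \<bar>x\<bar>"
proof -
  assume x: "x \<noteq> 0"
  have "(\<lambda>n. ln (x\<^sup>2 + (eps n)\<^sup>2) / 2) \<longlonglongrightarrow> ln (x\<^sup>2 + 0\<^sup>2) / 2"
    using x LIMSEQ_inverse_real_of_nat by (intro tendsto_intros) (auto simp: inverse_eq_divide)
  moreover have "ln (x\<^sup>2) = 2 * ln \<bar>x\<bar>" using x ln_realpow[of "\<bar>x\<bar>" 2] by simp
  ultimately show ?thesis by (simp add: ell_def)
qed

section \<open>Mean square convergence of the regularized integrands\<close>

context fbm_version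
begin

lemma norm_e: "s \<in> {0..T} \<Longrightarrow> norm (e s) = s powr H"
proof -
  assume s: "s \<in> {0..T}"
  then have "(norm (e s))\<^sup>2 = s powr (2*H)"
    using norm_increment[of s 0] T by (simp add: e_0)
  also have "\<dots> = (s powr H)\<^sup>2" by (simp add: power2_eq_square powr_add[symmetric])
  finally show ?thesis by (simp add: power2_eq_iff_nonneg)
qed

lemma normal_density_le: "\<sigma> > 0 \<Longrightarrow> normal_density 0 \<sigma> x \<le> 1 / \<sigma>"
proof -
  assume \<sigma>: "\<sigma> > 0"
  have "sqrt (1 * \<sigma>\<^sup>2) \<le> sqrt (2 * pi * \<sigma>\<^sup>2)" using pi_gt3 by (intro real_sqrt_le_mono mult_right_mono) auto
  then have s: "\<sigma> \<le> sqrt (2 * pi * \<sigma>\<^sup>2)" using \<sigma> by simp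
  have "normal_density 0 \<sigma> x \<le> 1 / sqrt (2 * pi * \<sigma>\<^sup>2) * 1"
    unfolding normal_density_def by (intro mult_left_mono) auto
  also have "\<dots> \<le> 1 / \<sigma>" using s \<sigma> by (simp add: frac_le)
  finally show ?thesis .
qed

lemma W_density_le:
  assumes \<phi>: "\<phi> \<noteq> 0" and [measurable]: "f \<in> borel_measurable borel"
  shows "(\<integral>\<^sup>+\<omega>. f (W \<phi> \<omega>) \<partial>M) \<le> ennreal (1 / norm \<phi>) * (\<integral>\<^sup>+x. f x \<partial>lborel)"
proof -
  have "(\<integral>\<^sup>+\<omega>. f (W \<phi> \<omega>) \<partial>M) = (\<integral>\<^sup>+x. f x \<partial>distr M borel (W \<phi>))"
    by (simp add: nn_integral_distr)
  also have "\<dots> = (\<integral>\<^sup>+x. ennreal (normal_density 0 (norm \<phi>) x) * f x \<partial>lborel)"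
    unfolding W_distr[OF \<phi>] by (simp add: nn_integral_density)
  also have "\<dots> \<le> (\<integral>\<^sup>+x. ennreal (1 / norm \<phi>) * f x \<partial>lborel)"
    using \<phi> by (intro nn_integral_mono mult_right_mono ennreal_leI normal_density_le) auto
  also have "\<dots> = ennreal (1 / norm \<phi>) * (\<integral>\<^sup>+x. f x \<partial>lborel)" by (simp add: nn_integral_cmult)
  finally show ?thesis .
qed

lemma X_density_le:
  assumes s: "0 < s" "s \<le> T" and [measurable]: "f \<in> borel_measurable borel"
  shows "(\<integral>\<^sup>+\<omega>. f (X s \<omega>) \<partial>M) \<le> ennreal (s powr (-H)) * (\<integral>\<^sup>+x. f x \<partial>lborel)"
proof -
  have n: "norm (e s) = s powr H" using s by (intro norm_e) auto
  then have "e s \<noteq> 0" using s by auto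
  have "(\<integral>\<^sup>+\<omega>. f (X s \<omega>) \<partial>M) = (\<integral>\<^sup>+\<omega>. f (W (e s) \<omega>) \<partial>M)"
    using W_e_X[of s] s by (intro nn_integral_cong_AE) auto
  also have "\<dots> \<le> ennreal (1 / norm (e s)) * (\<integral>\<^sup>+x. f x \<partial>lborel)"
    by (rule W_density_le[OF \<open>e s \<noteq> 0\<close>]) simp
  finally show ?thesis by (simp add: n powr_minus_divide)
qed

text \<open>Beyond distance 1 from a the integrand is at most 1; within distance 1 the density bound
  s powr (-H) multiplies the integral of the singularity, which equals 4.\<close>

lemma X_neg_half_moment:
  assumes s: "0 < s" "s \<le> T"
  shows "(\<integral>\<^sup>+\<omega>. ennreal (\<bar>X s \<omega> - a\<bar> powr (-1/2)) \<partial>M) \<le> ennreal (1 + 4 * s powr (-H))"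
proof -
  have le: "\<bar>x - a\<bar> powr (-1/2) \<le> 1 + indicator {a-1..a+1} x * \<bar>x - a\<bar> powr (-1/2)" for x
  proof (cases "x \<in> {a-1..a+1}")
    case False
    then have "\<bar>x - a\<bar> \<ge> 1" by auto
    then have "\<bar>x - a\<bar> powr (-1/2) \<le> \<bar>x - a\<bar> powr 0" by (intro powr_mono) auto
    also have "\<dots> \<le> 1" by simp
    finally show ?thesis using False by simp
  qed simp
  have "(\<integral>\<^sup>+\<omega>. ennreal (\<bar>X s \<omega> - a\<bar> powr (-1/2)) \<partial>M) \<le>
      (\<integral>\<^sup>+\<omega>. 1 + ennreal (indicator {a-1..a+1} (X s \<omega>) * \<bar>X s \<omega> - a\<bar> powr (-1/2)) \<partial>M)"
    using le by (intro nn_integral_mono) (simp add: ennreal_1[symmetric] ennreal_plus[symmetric] ennreal_leI del: ennreal_1 ennreal_plus)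
  also have "\<dots> = 1 + (\<integral>\<^sup>+\<omega>. ennreal (indicator {a-1..a+1} (X s \<omega>) * \<bar>X s \<omega> - a\<bar> powr (-1/2)) \<partial>M)"
    by (subst nn_integral_add) (auto simp: emeasure_space_1)
  also have "\<dots> \<le> 1 + ennreal (s powr (-H)) * (\<integral>\<^sup>+x. ennreal (indicator {a-1..a+1} x * \<bar>x - a\<bar> powr (-1/2)) \<partial>lborel)"
    by (intro add_left_mono X_density_le[OF s]) measurable
  also have "(\<integral>\<^sup>+x. ennreal (indicator {a-1..a+1} x * \<bar>x - a\<bar> powr (-1/2)) \<partial>lborel) = ennreal 4"
    by (subst nn_integral_abs_powr) auto
  also have "1 + ennreal (s powr (-H)) * ennreal 4 = ennreal (1 + 4 * s powr (-H))"
    by (simp add: ennreal_mult[symmetric] ennreal_plus[symmetric] ennreal_1[symmetric] mult.commute del: ennreal_1 ennreal_plus ennreal_numeral)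
  finally show ?thesis .
qed

text \<open>Controls all squared distances between regularized integrands along one path at once;
  its mean is finite because H < 1.\<close>

definition Aw :: "real \<Rightarrow> 'a \<Rightarrow> ennreal" where
  "Aw a \<omega> = (\<integral>\<^sup>+s. ennreal (indicator {0..T} s * \<bar>X s \<omega> - a\<bar> powr (-1/2)) \<partial>lborel)"

text \<open>The time spent exactly at level a. It vanishes almost surely, so the default value of ln
  at 0 is met only on a null set of times.\<close>

definition hit :: "real \<Rightarrow> 'a \<Rightarrow> ennreal" where
  "hit a \<omega> = (\<integral>\<^sup>+s. indicator {0..T} s * indicator {a} (X s \<omega>) \<partial>lborel)"

lemma X_joint_lborel [measurable]: "(\<lambda>(s, \<omega>). X s \<omega>) \<in> borel_measurable (lborel \<Otimes>\<^sub>M M)"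
  using X_joint by (simp cong: measurable_cong_sets)

lemma X_joint_lborel' [measurable]: "(\<lambda>(\<omega>, s). X s \<omega>) \<in> borel_measurable (M \<Otimes>\<^sub>M lborel)"
  using measurable_compose[OF measurable_pair_swap' X_joint_lborel] by (simp add: case_prod_unfold)

lemma X_path_measurable [measurable]: "(\<lambda>s. X s \<omega>) \<in> borel_measurable borel"
  using X_cont by (rule borel_measurable_continuous_onI)

lemma Aw_measurable [measurable]: "Aw a \<in> borel_measurable M"
  unfolding Aw_def[abs_def] by measurable

lemma hit_measurable [measurable]: "hit a \<in> borel_measurable M"
  unfolding hit_def[abs_def] by measurable

definition CA :: ennreal where
  "CA = (\<integral>\<^sup>+s. ennreal (indicator {0..T} s * (1 + 4 * s powr (-H))) \<partial>lborel)"

lemma CA_finite: "CA < \<infinity>"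
proof -
  have "CA = (\<integral>\<^sup>+s. ennreal (indicator {0..T} s) + 4 * ennreal (indicator {0..T} s * \<bar>s - 0\<bar> powr (-H)) \<partial>lborel)"
    unfolding CA_def
    by (intro nn_integral_cong)
      (auto simp: ennreal_mult[symmetric] ennreal_plus[symmetric] ennreal_numeral[symmetric] split: split_indicator simp del: ennreal_plus ennreal_numeral)
  also have "\<dots> = (\<integral>\<^sup>+s. indicator {0..T} s \<partial>lborel) + 4 * (\<integral>\<^sup>+s. ennreal (indicator {0..T} s * \<bar>s - 0\<bar> powr (-H)) \<partial>lborel)"
    by (subst nn_integral_add, simp, simp, subst nn_integral_cmult) (auto simp: ennreal_indicator)
  also have "\<dots> < \<infinity>"
    using T H by (subst nn_integral_abs_powr) (auto simp: ennreal_mult_less_top)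
  finally show ?thesis .
qed

lemma Aw_expectation: "(\<integral>\<^sup>+\<omega>. Aw a \<omega> \<partial>M) \<le> CA"
proof -
  interpret LM: pair_sigma_finite lborel M ..
  have "(\<integral>\<^sup>+\<omega>. Aw a \<omega> \<partial>M) = (\<integral>\<^sup>+s. (\<integral>\<^sup>+\<omega>. ennreal (indicator {0..T} s * \<bar>X s \<omega> - a\<bar> powr (-1/2)) \<partial>M) \<partial>lborel)"
    unfolding Aw_def by (rule LM.Fubini') measurable
  also have "\<dots> \<le> CA"
    unfolding CA_def
  proof (rule nn_integral_mono_AE)
    have "AE s::real in lborel. s \<noteq> 0" by (rule AE_lborel_singleton)
    then show "AE s in lborel. (\<integral>\<^sup>+\<omega>. ennreal (indicator {0..T} s * \<bar>X s \<omega> - a\<bar> powr (-1/2)) \<partial>M) \<le> ennreal (indicator {0..T} s * (1 + 4 * s powr (-H)))"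
    proof eventually_elim
      case (elim s)
      then show ?case using X_neg_half_moment[of s a] by (cases "s \<in> {0..T}") auto
    qed
  qed
  finally show ?thesis .
qed

lemma Aw_AE_finite: "AE \<omega> in M. Aw a \<omega> < \<infinity>"
proof -
  have "(\<integral>\<^sup>+\<omega>. Aw a \<omega> \<partial>M) \<noteq> \<infinity>" using Aw_expectation[of a] CA_finite by auto
  then have "AE \<omega> in M. Aw a \<omega> \<noteq> \<infinity>" by (intro nn_integral_PInf_AE) auto
  then show ?thesis by eventually_elim (simp add: less_top)
qed

lemma hit_AE: "AE \<omega> in M. hit a \<omega> = 0"
proof -
  interpret LM: pair_sigma_finite lborel M ..
  have "(\<integral>\<^sup>+\<omega>. hit a \<omega> \<partial>M) = (\<integral>\<^sup>+s. (\<integral>\<^sup>+\<omega>. indicator {0..T} s * indicator {a} (X s \<omega>) \<partial>M) \<partial>lborel)"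
    unfolding hit_def by (rule LM.Fubini') measurable
  also have "\<dots> = (\<integral>\<^sup>+s. 0 \<partial>(lborel :: real measure))"
  proof (rule nn_integral_cong_AE)
    have "AE s::real in lborel. s \<noteq> 0" by (rule AE_lborel_singleton)
    then show "AE s in lborel. (\<integral>\<^sup>+\<omega>. indicator {0..T} s * indicator {a} (X s \<omega>) \<partial>M) = 0"
    proof eventually_elim
      case (elim s)
      show ?case
      proof (cases "s \<in> {0..T}")
        case True
        then have "(\<integral>\<^sup>+\<omega>. indicator {a} (X s \<omega>) \<partial>M) \<le> ennreal (s powr (-H)) * (\<integral>\<^sup>+x. indicator {a} x \<partial>lborel)"
          using elim by (intro X_density_le) auto
        then show ?thesis using True by simp
      qed simp
    qed
  qed
  finally have "(\<integral>\<^sup>+\<omega>. hit a \<omega> \<partial>M) = 0" by simp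
  then show ?thesis by (simp add: nn_integral_0_iff_AE)
qed

lemma hit_AE_neq: "hit a \<omega> = 0 \<Longrightarrow> AE s in lborel. s \<in> {0..T} \<longrightarrow> X s \<omega> \<noteq> a"
  unfolding hit_def
  by (subst (asm) nn_integral_0_iff_AE) (auto elim!: eventually_mono split: split_indicator_asm)

definition Jell :: "real \<Rightarrow> real \<Rightarrow> real \<Rightarrow> 'a \<Rightarrow> 'h" where
  "Jell t a \<epsilon> \<omega> = J t (\<lambda>s. ell \<epsilon> (X s \<omega> - a))"

lemma ell_shift_continuous: "\<epsilon> > 0 \<Longrightarrow> continuous_on A (\<lambda>x. ell \<epsilon> (x - a))"
  by (intro continuous_on_compose2[OF ell_continuous[of \<epsilon> UNIV]] continuous_intros) auto

lemma ell_path_continuous: "\<epsilon> > 0 \<Longrightarrow> continuous_on A (\<lambda>s. ell \<epsilon> (X s \<omega> - a))"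
  by (intro continuous_on_compose2[OF ell_continuous[of \<epsilon> UNIV]] continuous_intros X_cont') auto

lemma Jell_measurable: "0 \<le> t \<Longrightarrow> t \<le> T \<Longrightarrow> \<epsilon> > 0 \<Longrightarrow> Jell t a \<epsilon> \<in> borel_measurable M"
  unfolding Jell_def[abs_def] by (rule J_measurable[of t "\<lambda>x. ell \<epsilon> (x - a)"]) (auto intro: ell_shift_continuous)

lemma Jell_diff:
  assumes t: "0 \<le> t" "t \<le> T" and \<epsilon>: "0 < \<epsilon>" "\<epsilon> \<le> m" "0 < \<epsilon>'" "\<epsilon>' \<le> m" and hit: "hit a \<omega> = 0"
  shows "ennreal ((norm (Jell t a \<epsilon> \<omega> - Jell t a \<epsilon>' \<omega>))\<^sup>2) \<le> ennreal (CH * (16 * m powr (1/2))) * Aw a \<omega>"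
proof -
  let ?d = "\<lambda>s. (ell \<epsilon> (X s \<omega> - a) - ell \<epsilon>' (X s \<omega> - a))\<^sup>2"
  have cont: "continuous_on {0..t} ?d" using \<epsilon> by (intro continuous_intros ell_path_continuous)
  have "ennreal ((norm (Jell t a \<epsilon> \<omega> - Jell t a \<epsilon>' \<omega>))\<^sup>2) \<le> ennreal (CH * integral {0..t} ?d)"
    unfolding Jell_def using \<epsilon> by (intro ennreal_leI norm_J_diff t ell_path_continuous) auto
  also have "\<dots> = ennreal CH * (\<integral>\<^sup>+s. ennreal (indicator {0..t} s * ?d s) \<partial>lborel)"
    using CH_pos by (subst ennreal_mult) (auto intro!: integral_nonneg integrable_continuous_interval cont
        simp: ennreal_integral_eq_nn_integral[OF cont])
  also have "(\<integral>\<^sup>+s. ennreal (indicator {0..t} s * ?d s) \<partial>lborel) \<le>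
      (\<integral>\<^sup>+s. ennreal (16 * m powr (1/2)) * ennreal (indicator {0..T} s * \<bar>X s \<omega> - a\<bar> powr (-1/2)) \<partial>lborel)"
  proof (rule nn_integral_mono_AE)
    show "AE s in lborel. ennreal (indicator {0..t} s * ?d s) \<le> ennreal (16 * m powr (1/2)) * ennreal (indicator {0..T} s * \<bar>X s \<omega> - a\<bar> powr (-1/2))"
      using hit_AE_neq[OF hit]
    proof eventually_elim
      case (elim s)
      show ?case
      proof (cases "s \<in> {0..t}")
        case True
        then have "X s \<omega> - a \<noteq> 0" using elim t by auto
        from ell_diff_square[OF \<epsilon> this] True t show ?thesis
          by (simp add: ennreal_mult[symmetric] ennreal_leI del: ennreal_mult' ennreal_mult'')
      qed simp
    qed
  qed
  also have "\<dots> = ennreal (16 * m powr (1/2)) * Aw a \<omega>"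
    unfolding Aw_def by (rule nn_integral_cmult) measurable
  finally have "ennreal ((norm (Jell t a \<epsilon> \<omega> - Jell t a \<epsilon>' \<omega>))\<^sup>2) \<le> ennreal CH * (ennreal (16 * m powr (1/2)) * Aw a \<omega>)"
    by (simp add: mult_left_mono)
  then show ?thesis using CH_pos by (simp add: ennreal_mult mult.assoc)
qed

text \<open>The regularized integrands converge on this set; it is described through measurable
  functionals so as to be measurable itself.\<close>

definition good :: "real \<Rightarrow> 'a set" where
  "good a = {\<omega> \<in> space M. Aw a \<omega> < \<infinity> \<and> hit a \<omega> = 0}"

lemma good_sets [measurable]: "good a \<in> sets M"
  unfolding good_def by measurable

lemma good_AE: "AE \<omega> in M. \<omega> \<in> good a"
  using Aw_AE_finite[of a] hit_AE[of a] AE_space by eventually_elim (simp add: good_def)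

text \<open>The Hilbert space element of the logarithm. The default 0 off \<open>good a\<close>
  keeps it measurable on the whole space.\<close>

definition ulog :: "real \<Rightarrow> real \<Rightarrow> 'a \<Rightarrow> 'h" where
  "ulog t a \<omega> = (if \<omega> \<in> good a then lim (\<lambda>n. Jell t a (eps n) \<omega>) else 0)"

lemma eps_powr_tendsto: "(\<lambda>n. eps n powr (1/2)) \<longlonglongrightarrow> 0"
  by real_asymp

lemma Jell_tendsto:
  assumes t: "0 \<le> t" "t \<le> T" and \<omega>: "\<omega> \<in> good a"
  shows "(\<lambda>n. Jell t a (eps n) \<omega>) \<longlonglongrightarrow> ulog t a \<omega>"
proof -
  obtain A where A: "Aw a \<omega> = ennreal A" "A \<ge> 0" and hit: "hit a \<omega> = 0"
    using \<omega> by (cases "Aw a \<omega>") (auto simp: good_def)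
  have bound: "(norm (Jell t a (eps n) \<omega> - Jell t a (eps m) \<omega>))\<^sup>2 \<le> CH * (16 * eps k powr (1/2)) * A"
    if "k \<le> n" "k \<le> m" for k n m
  proof -
    have "ennreal ((norm (Jell t a (eps n) \<omega> - Jell t a (eps m) \<omega>))\<^sup>2) \<le> ennreal (CH * (16 * eps k powr (1/2))) * Aw a \<omega>"
      using that by (intro Jell_diff t hit) (auto intro!: divide_left_mono)
    also have "\<dots> = ennreal (CH * (16 * eps k powr (1/2)) * A)"
      using CH_pos A by (simp add: ennreal_mult)
    finally show ?thesis using CH_pos A by (subst (asm) ennreal_le_iff) auto
  qed
  have "Cauchy (\<lambda>n. Jell t a (eps n) \<omega>)"
  proof (rule metric_CauchyI)
    fix r :: real assume r: "r > 0"
    have "(\<lambda>k. CH * (16 * eps k powr (1/2)) * A) \<longlonglongrightarrow> CH * (16 * 0) * A"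
      by (intro tendsto_intros eps_powr_tendsto)
    then have "\<forall>\<^sub>F k in sequentially. CH * (16 * eps k powr (1/2)) * A < r\<^sup>2"
      using r by (intro order_tendstoD(2)) auto
    then obtain k where k: "CH * (16 * eps k powr (1/2)) * A < r\<^sup>2" by (auto simp: eventually_sequentially)
    show "\<exists>K. \<forall>m\<ge>K. \<forall>n\<ge>K. dist (Jell t a (eps m) \<omega>) (Jell t a (eps n) \<omega>) < r"
    proof (intro exI[of _ k] allI impI)
      fix m n assume "m \<ge> k" "n \<ge> k"
      then have "(norm (Jell t a (eps m) \<omega> - Jell t a (eps n) \<omega>))\<^sup>2 < r\<^sup>2" using bound[of k m n] k by linarith
      then show "dist (Jell t a (eps m) \<omega>) (Jell t a (eps n) \<omega>) < r"
        unfolding dist_norm using r by (intro power2_less_imp_less[of "norm _"]) auto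
    qed
  qed
  then show ?thesis using \<omega> by (simp add: ulog_def Cauchy_convergent_iff convergent_LIMSEQ_iff)
qed

lemma ulog_measurable:
  assumes t: "0 \<le> t" "t \<le> T"
  shows "ulog t a \<in> borel_measurable M"
proof (rule borel_measurable_LIMSEQ_metric)
  fix n
  have [measurable]: "Jell t a (eps n) \<in> borel_measurable M" by (rule Jell_measurable[OF t]) simp
  show "(\<lambda>\<omega>. if \<omega> \<in> good a then Jell t a (eps n) \<omega> else 0) \<in> borel_measurable M"
    by measurable
next
  fix \<omega>
  show "(\<lambda>n. if \<omega> \<in> good a then Jell t a (eps n) \<omega> else 0) \<longlonglongrightarrow> ulog t a \<omega>"
    using Jell_tendsto[OF t, of \<omega> a] by (cases "\<omega> \<in> good a") (auto simp: ulog_def)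
qed

lemma Jell_ulog:
  assumes t: "0 \<le> t" "t \<le> T" and \<omega>: "\<omega> \<in> good a"
  shows "ennreal ((norm (Jell t a (eps n) \<omega> - ulog t a \<omega>))\<^sup>2) \<le> ennreal (CH * (16 * eps n powr (1/2))) * Aw a \<omega>"
proof (rule LIMSEQ_le_const2)
  show "(\<lambda>m. ennreal ((norm (Jell t a (eps n) \<omega> - Jell t a (eps m) \<omega>))\<^sup>2)) \<longlonglongrightarrow> ennreal ((norm (Jell t a (eps n) \<omega> - ulog t a \<omega>))\<^sup>2)"
    by (intro tendsto_intros Jell_tendsto assms)
  have hit: "hit a \<omega> = 0" using \<omega> by (simp add: good_def)
  show "\<exists>N. \<forall>m\<ge>N. ennreal ((norm (Jell t a (eps n) \<omega> - Jell t a (eps m) \<omega>))\<^sup>2) \<le> ennreal (CH * (16 * eps n powr (1/2))) * Aw a \<omega>"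
    by (intro exI[of _ n] allI impI Jell_diff t hit) (auto intro!: divide_left_mono)
qed

lemma Jell_ulog_L2:
  assumes t: "0 \<le> t" "t \<le> T"
  shows "L2sq M (\<lambda>\<omega>. norm (Jell t a (eps n) \<omega> - ulog t a \<omega>)) \<le> ennreal (CH * (16 * eps n powr (1/2)) * enn2real CA)"
proof -
  have "L2sq M (\<lambda>\<omega>. norm (Jell t a (eps n) \<omega> - ulog t a \<omega>)) \<le>
      (\<integral>\<^sup>+\<omega>. ennreal (CH * (16 * eps n powr (1/2))) * Aw a \<omega> \<partial>M)"
  proof (rule nn_integral_mono_AE)
    show "AE \<omega> in M. ennreal ((norm (Jell t a (eps n) \<omega> - ulog t a \<omega>))\<^sup>2) \<le> ennreal (CH * (16 * eps n powr (1/2))) * Aw a \<omega>"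
      using good_AE[of a] by eventually_elim (rule Jell_ulog[OF t])
  qed
  also have "\<dots> = ennreal (CH * (16 * eps n powr (1/2))) * (\<integral>\<^sup>+\<omega>. Aw a \<omega> \<partial>M)"
    by (rule nn_integral_cmult) measurable
  also have "\<dots> \<le> ennreal (CH * (16 * eps n powr (1/2))) * CA"
    by (intro mult_left_mono Aw_expectation) simp
  also have "CA = ennreal (enn2real CA)" using CA_finite by simp
  also have "ennreal (CH * (16 * eps n powr (1/2))) * ennreal (enn2real CA) = ennreal (CH * (16 * eps n powr (1/2)) * enn2real CA)"
    using CH_pos by (subst ennreal_mult) auto
  finally show ?thesis .
qed

lemma J_zero: "J t (\<lambda>s. 0) = 0"
  unfolding J_def U_def by (simp add: lim_const)

lemma X_second_moment: "s \<in> {0..T} \<Longrightarrow> L2sq M (X s) = ennreal (s powr (2*H))"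
proof -
  assume s: "s \<in> {0..T}"
  have i: "integrable M (\<lambda>\<omega>. (W (e s) \<omega>)\<^sup>2)" by (rule W_square_integrable)
  have "L2sq M (X s) = L2sq M (\<lambda>\<omega>. W (e s) \<omega>)"
    using W_e_X[OF s] by (intro nn_integral_cong_AE) auto
  also have "\<dots> = ennreal ((norm (e s))\<^sup>2)"
    using nn_integral_eq_integral[OF i] by (simp add: W_norm)
  finally show ?thesis using s by (simp add: norm_e power2_eq_square powr_add[symmetric])
qed

text \<open>Serves the square integrability of \<open>ulog\<close>, which lies within finite mean
  square distance of the regularization with parameter \<open>eps 0 = 1\<close>. There
  \<open>ell\<close> is at most |x| in modulus, so second moments of X are enough.\<close>

lemma Jell_0_L2:
  assumes t: "0 \<le> t" "t \<le> T"
  shows "L2sq M (\<lambda>\<omega>. norm (Jell t a 1 \<omega>)) < \<infinity>"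
proof -
  interpret LM: pair_sigma_finite lborel M ..
  let ?d = "\<lambda>\<omega> s. (ell 1 (X s \<omega> - a))\<^sup>2"
  have le: "?d \<omega> s \<le> 2 * (X s \<omega>)\<^sup>2 + 2 * a\<^sup>2" for \<omega> s
  proof -
    have "(ell 1 (X s \<omega> - a))\<^sup>2 \<le> (X s \<omega> - a)\<^sup>2"
      using ell_1_abs[of "X s \<omega> - a"] by (simp add: abs_le_square_iff)
    also have "\<dots> \<le> 2 * (X s \<omega>)\<^sup>2 + 2 * a\<^sup>2"
      using zero_le_power2[of "X s \<omega> + a"] by (simp add: power2_sum power2_diff)
    finally show ?thesis .
  qed
  have cont: "continuous_on {0..t} (?d \<omega>)" for \<omega> by (intro continuous_intros ell_path_continuous) auto
  have "L2sq M (\<lambda>\<omega>. norm (Jell t a 1 \<omega>)) \<le>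
     (\<integral>\<^sup>+\<omega>. (\<integral>\<^sup>+s. ennreal CH * ennreal (indicator {0..T} s * (2 * (X s \<omega>)\<^sup>2 + 2 * a\<^sup>2)) \<partial>lborel) \<partial>M)"
  proof (rule nn_integral_mono)
    fix \<omega>
    have "ennreal ((norm (Jell t a 1 \<omega> - J t (\<lambda>s. 0)))\<^sup>2) \<le> ennreal (CH * integral {0..t} (\<lambda>s. (ell 1 (X s \<omega> - a) - 0)\<^sup>2))"
      unfolding Jell_def by (intro ennreal_leI norm_J_diff t ell_path_continuous continuous_intros) auto
    also have "\<dots> = ennreal CH * (\<integral>\<^sup>+s. ennreal (indicator {0..t} s * ?d \<omega> s) \<partial>lborel)"
      using CH_pos by (simp, subst ennreal_mult) (auto intro!: integral_nonneg integrable_continuous_interval cont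
          simp: ennreal_integral_eq_nn_integral[OF cont])
    also have "\<dots> = (\<integral>\<^sup>+s. ennreal CH * ennreal (indicator {0..t} s * ?d \<omega> s) \<partial>lborel)"
      by (rule nn_integral_cmult[symmetric]) measurable
    also have "\<dots> \<le> (\<integral>\<^sup>+s. ennreal CH * ennreal (indicator {0..T} s * (2 * (X s \<omega>)\<^sup>2 + 2 * a\<^sup>2)) \<partial>lborel)"
      using le t by (intro nn_integral_mono mult_left_mono ennreal_leI) (auto split: split_indicator)
    finally show "ennreal ((norm (Jell t a 1 \<omega>))\<^sup>2) \<le> (\<integral>\<^sup>+s. ennreal CH * ennreal (indicator {0..T} s * (2 * (X s \<omega>)\<^sup>2 + 2 * a\<^sup>2)) \<partial>lborel)"
      by (simp add: J_zero)
  qed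
  also have "\<dots> = (\<integral>\<^sup>+s. (\<integral>\<^sup>+\<omega>. ennreal CH * ennreal (indicator {0..T} s * (2 * (X s \<omega>)\<^sup>2 + 2 * a\<^sup>2)) \<partial>M) \<partial>lborel)"
    by (rule LM.Fubini') measurable
  also have "\<dots> \<le> (\<integral>\<^sup>+s. ennreal (CH * (2 * T powr (2*H) + 2 * a\<^sup>2)) * indicator {0..T} s \<partial>lborel)"
  proof (rule nn_integral_mono)
    fix s :: real
    show "(\<integral>\<^sup>+\<omega>. ennreal CH * ennreal (indicator {0..T} s * (2 * (X s \<omega>)\<^sup>2 + 2 * a\<^sup>2)) \<partial>M) \<le> ennreal (CH * (2 * T powr (2*H) + 2 * a\<^sup>2)) * indicator {0..T} s"
    proof (cases "s \<in> {0..T}")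
      case True
      have "(\<integral>\<^sup>+\<omega>. ennreal (2 * (X s \<omega>)\<^sup>2 + 2 * a\<^sup>2) \<partial>M) = (\<integral>\<^sup>+\<omega>. 2 * ennreal ((X s \<omega>)\<^sup>2) + ennreal (2 * a\<^sup>2) \<partial>M)"
        by (intro nn_integral_cong) (simp add: ennreal_plus ennreal_mult)
      also have "\<dots> = 2 * ennreal (s powr (2*H)) + ennreal (2 * a\<^sup>2)"
        by (subst nn_integral_add, simp, simp, subst nn_integral_cmult) (auto simp: X_second_moment[OF True] emeasure_space_1)
      also have "\<dots> = ennreal (2 * s powr (2*H) + 2 * a\<^sup>2)"
        by (simp add: ennreal_plus ennreal_mult)
      also have "\<dots> \<le> ennreal (2 * T powr (2*H) + 2 * a\<^sup>2)"
        using True H by (intro ennreal_leI add_right_mono mult_left_mono powr_mono2) auto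
      finally have "ennreal CH * (\<integral>\<^sup>+\<omega>. ennreal (2 * (X s \<omega>)\<^sup>2 + 2 * a\<^sup>2) \<partial>M) \<le> ennreal CH * ennreal (2 * T powr (2*H) + 2 * a\<^sup>2)"
        by (rule mult_left_mono) simp
      then show ?thesis using True CH_pos by (simp add: nn_integral_cmult ennreal_mult)
    qed simp
  qed
  also have "\<dots> < \<infinity>"
    using T by (subst nn_integral_cmult) (auto simp: ennreal_mult_less_top)
  finally show ?thesis .
qed

lemma ulog_square_integrable:
  assumes t: "0 \<le> t" "t \<le> T"
  shows "integrable M (\<lambda>\<omega>. (norm (ulog t a \<omega>))\<^sup>2)"
proof (rule integrableI_bounded)
  note [measurable] = ulog_measurable[OF t]
  have [measurable]: "Jell t a 1 \<in> borel_measurable M" by (rule Jell_measurable[OF t]) simp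
  show "(\<lambda>\<omega>. (norm (ulog t a \<omega>))\<^sup>2) \<in> borel_measurable M" by measurable
  have "(\<integral>\<^sup>+\<omega>. ennreal (norm ((norm (ulog t a \<omega>))\<^sup>2)) \<partial>M) \<le>
    (\<integral>\<^sup>+\<omega>. 2 * ennreal ((norm (Jell t a 1 \<omega>))\<^sup>2) + 2 * ennreal ((norm (Jell t a 1 \<omega> - ulog t a \<omega>))\<^sup>2) \<partial>M)"
  proof (rule nn_integral_mono)
    fix \<omega>
    have "(norm (ulog t a \<omega>))\<^sup>2 \<le> (norm (Jell t a 1 \<omega>) + norm (Jell t a 1 \<omega> - ulog t a \<omega>))\<^sup>2"
      using norm_triangle_sub[of "ulog t a \<omega>" "Jell t a 1 \<omega>"] by (intro power_mono) (auto simp: norm_minus_commute)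
    also have "\<dots> \<le> 2 * (norm (Jell t a 1 \<omega>))\<^sup>2 + 2 * (norm (Jell t a 1 \<omega> - ulog t a \<omega>))\<^sup>2"
      using sum_squares_bound[of "norm (Jell t a 1 \<omega>)" "norm (Jell t a 1 \<omega> - ulog t a \<omega>)"] by (simp add: power2_sum)
    finally have "ennreal ((norm (ulog t a \<omega>))\<^sup>2) \<le> ennreal (2 * (norm (Jell t a 1 \<omega>))\<^sup>2 + 2 * (norm (Jell t a 1 \<omega> - ulog t a \<omega>))\<^sup>2)"
      by (rule ennreal_leI)
    then show "ennreal (norm ((norm (ulog t a \<omega>))\<^sup>2)) \<le> 2 * ennreal ((norm (Jell t a 1 \<omega>))\<^sup>2) + 2 * ennreal ((norm (Jell t a 1 \<omega> - ulog t a \<omega>))\<^sup>2)"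
      by (simp add: ennreal_plus ennreal_mult)
  qed
  also have "\<dots> = 2 * L2sq M (\<lambda>\<omega>. norm (Jell t a 1 \<omega>)) + 2 * L2sq M (\<lambda>\<omega>. norm (Jell t a 1 \<omega> - ulog t a \<omega>))"
    by (subst nn_integral_add, measurable, simp add: nn_integral_cmult)
  also have "\<dots> < \<infinity>"
  proof -
    have "L2sq M (\<lambda>\<omega>. norm (Jell t a 1 \<omega> - ulog t a \<omega>)) < \<infinity>"
      using Jell_ulog_L2[OF t, of a 0] by (simp add: le_less_trans)
    then show ?thesis using Jell_0_L2[OF t, of a] by (simp add: ennreal_mult_less_top)
  qed
  finally show "(\<integral>\<^sup>+\<omega>. ennreal (norm ((norm (ulog t a \<omega>))\<^sup>2)) \<partial>M) < \<infinity>" .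
qed

section \<open>The integrand as an element of the Hilbert space\<close>

abbreviation log_bound :: "real \<Rightarrow> real \<Rightarrow> 'a \<Rightarrow> real" where
  "log_bound a s \<omega> \<equiv> 5 + 36 * \<bar>X s \<omega> - a\<bar> powr (-1/2) + 2 * (X s \<omega> - a)\<^sup>2"

lemma dominating_integrable:
  assumes \<omega>: "\<omega> \<in> good a"
  shows "integrable lborel (\<lambda>s. indicator {0..T} s * log_bound a s \<omega>)"
proof -
  have 1: "integrable lborel (\<lambda>s. indicator {0..T} s * \<bar>X s \<omega> - a\<bar> powr (-1/2))"
    using \<omega> by (intro integrableI_bounded) (auto simp: good_def Aw_def)
  have "set_integrable lborel {0..T} (\<lambda>s. 5 + 2 * (X s \<omega> - a)\<^sup>2)"
    by (intro borel_integrable_atLeastAtMost' continuous_intros X_cont')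
  then have 2: "integrable lborel (\<lambda>s. indicator {0..T} s * (5 + 2 * (X s \<omega> - a)\<^sup>2))"
    by (simp add: set_integrable_def)
  show ?thesis using Bochner_Integration.integrable_add[OF 2 integrable_mult_right[OF 1, of 36]]
    by (simp add: algebra_simps)
qed

text \<open>Integrating the kernel over [0,r] gives \<open>kap s r / (2*H-1)\<close>, whose
  denominator cancels against the constant of \<open>kernel_inner\<close>. This links
  \<open>represents\<close> with \<open>inner_J\<close>.\<close>

lemma kernel_inner_indicator:
  assumes r: "r \<in> {0..T}"
  shows "kernel_inner T H \<phi> (indicator {0..r}) = H * (LINT s:{0..T}|lborel. \<phi> s * kap s r)"
proof -
  have "(LINT q:{0..T}|lborel. \<phi> s * indicator {0..r} q * \<bar>s - q\<bar> powr (2*H-2)) = \<phi> s * (kap s r / (2*H-1))" if "s \<in> {0..T}" for s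
  proof -
    have p: "2*H - 2 > -1" using H by simp
    have kap0: "0 \<le> kap s r" using that r kap_nonneg_le[of s r] by auto
    have e: "\<bar>s - q\<bar> = \<bar>q - s\<bar>" for q by simp
    have "(\<integral>\<^sup>+q. ennreal (indicator {0..r} q * \<bar>q - s\<bar> powr (2*H-2)) \<partial>lborel) = ennreal (kap s r / (2*H-1))"
      using r by (subst nn_integral_abs_powr[OF p]) (auto simp: kap_def sgn_minus algebra_simps)
    then have "(LINT q|lborel. indicator {0..r} q * \<bar>q - s\<bar> powr (2*H-2)) = kap s r / (2*H-1)"
      using kap0 H by (subst integral_eq_nn_integral) auto
    moreover have "(LINT q:{0..T}|lborel. \<phi> s * indicator {0..r} q * \<bar>s - q\<bar> powr (2*H-2)) =
        \<phi> s * (LINT q|lborel. indicator {0..r} q * \<bar>q - s\<bar> powr (2*H-2))"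
      unfolding set_lebesgue_integral_def integral_mult_right_zero[symmetric] e using r
      by (intro Bochner_Integration.integral_cong) (auto split: split_indicator)
    ultimately show ?thesis by simp
  qed
  then have "(LINT s:{0..T}|lborel. LINT q:{0..T}|lborel. \<phi> s * indicator {0..r} q * \<bar>s - q\<bar> powr (2*H-2)) =
      (LINT s:{0..T}|lborel. \<phi> s * (kap s r / (2*H-1)))"
    by (intro set_lebesgue_integral_cong) auto
  also have "\<dots> = (LINT s:{0..T}|lborel. (\<phi> s * kap s r) / (2*H-1))" by simp
  also have "\<dots> = (LINT s:{0..T}|lborel. \<phi> s * kap s r) / (2*H-1)" by (rule set_integral_divide_zero)
  finally show ?thesis using H unfolding kernel_inner_def by simp
qed

text \<open>The identity of \<open>inner_J\<close> for each regularization passes to the limit: on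
  the left by convergence in the Hilbert space, on the right by dominated convergence with
  \<open>log_bound\<close>.\<close>

lemma ulog_inner:
  assumes t: "0 \<le> t" "t \<le> T" and \<omega>: "\<omega> \<in> good a" and r: "r \<in> {0..T}"
  shows "inner (ulog t a \<omega>) (e r) = H * (LINT s:{0..T}|lborel. (ln \<bar>X s \<omega> - a\<bar> * indicator {0..t} s) * kap s r)"
proof -
  have hit: "hit a \<omega> = 0" using \<omega> by (simp add: good_def)
  have [measurable]: "(\<lambda>s. kap s r) \<in> borel_measurable borel"
    using kap_continuous by (rule borel_measurable_continuous_onI)
  have lim1: "(\<lambda>n. inner (Jell t a (eps n) \<omega>) (e r)) \<longlonglongrightarrow> inner (ulog t a \<omega>) (e r)"
    by (intro tendsto_intros Jell_tendsto t \<omega>)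
  have eq: "inner (Jell t a (eps n) \<omega>) (e r) = H * (LINT s|lborel. indicator {0..t} s * (ell (eps n) (X s \<omega> - a) * kap s r))" for n
  proof -
    have c: "continuous_on {0..t} (\<lambda>s. ell (eps n) (X s \<omega> - a) * kap s r)"
      by (intro continuous_intros ell_path_continuous continuous_on_subset[OF kap_continuous]) auto
    have "inner (Jell t a (eps n) \<omega>) (e r) = H * integral {0..t} (\<lambda>s. ell (eps n) (X s \<omega> - a) * kap s r)"
      unfolding Jell_def by (intro inner_J t r ell_path_continuous) auto
    also have "integral {0..t} (\<lambda>s. ell (eps n) (X s \<omega> - a) * kap s r) = (LINT s:{0..t}|lborel. ell (eps n) (X s \<omega> - a) * kap s r)"
      using borel_integrable_atLeastAtMost'[OF c] by (simp add: set_borel_integral_eq_integral)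
    finally show ?thesis by (simp add: set_lebesgue_integral_def)
  qed
  have lim2: "(\<lambda>n. LINT s|lborel. indicator {0..t} s * (ell (eps n) (X s \<omega> - a) * kap s r)) \<longlonglongrightarrow>
      (LINT s|lborel. indicator {0..t} s * (ln \<bar>X s \<omega> - a\<bar> * kap s r))"
  proof (rule integral_dominated_convergence)
    show "integrable lborel (\<lambda>s. 2 * T powr (2*H-1) * (indicator {0..T} s * log_bound a s \<omega>))"
      by (intro integrable_mult_right dominating_integrable \<omega>)
    show "AE s in lborel. (\<lambda>n. indicator {0..t} s * (ell (eps n) (X s \<omega> - a) * kap s r)) \<longlonglongrightarrow> indicator {0..t} s * (ln \<bar>X s \<omega> - a\<bar> * kap s r)"
      using hit_AE_neq[OF hit]
    proof eventually_elim
      case (elim s)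
      show ?case
      proof (cases "s \<in> {0..t}")
        case True
        then have "X s \<omega> - a \<noteq> 0" using elim t by auto
        then show ?thesis by (intro tendsto_mult tendsto_const ell_tendsto)
      qed simp
    qed
    fix n
    show "AE s in lborel. norm (indicator {0..t} s * (ell (eps n) (X s \<omega> - a) * kap s r)) \<le>
        2 * T powr (2*H-1) * (indicator {0..T} s * log_bound a s \<omega>)"
      using hit_AE_neq[OF hit]
    proof eventually_elim
      case (elim s)
      show ?case
      proof (cases "s \<in> {0..t}")
        case True
        then have "X s \<omega> - a \<noteq> 0" using elim t by auto
        then have "\<bar>ell (eps n) (X s \<omega> - a)\<bar> \<le> log_bound a s \<omega>"
          by (intro ell_dominated) auto
        moreover have "\<bar>kap s r\<bar> \<le> 2 * T powr (2*H-1)" using kap_nonneg_le[of s r] True t r by auto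
        ultimately have "\<bar>kap s r\<bar> * \<bar>ell (eps n) (X s \<omega> - a)\<bar> \<le> 2 * T powr (2*H-1) * log_bound a s \<omega>"
          by (intro mult_mono) auto
        then show ?thesis using True t by (simp add: abs_mult mult.commute)
      next
        case False
        have "0 \<le> indicator {0..T} s * log_bound a s \<omega>"
          by (intro mult_nonneg_nonneg add_nonneg_nonneg) auto
        then show ?thesis using False by simp
      qed
    qed
  qed measurable
  have "inner (ulog t a \<omega>) (e r) = H * (LINT s|lborel. indicator {0..t} s * (ln \<bar>X s \<omega> - a\<bar> * kap s r))"
    using LIMSEQ_unique[OF lim1[unfolded eq] tendsto_mult_left[OF lim2]] .
  also have "(LINT s|lborel. indicator {0..t} s * (ln \<bar>X s \<omega> - a\<bar> * kap s r)) =
      (LINT s:{0..T}|lborel. (ln \<bar>X s \<omega> - a\<bar> * indicator {0..t} s) * kap s r)"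
    unfolding set_lebesgue_integral_def using t
    by (intro Bochner_Integration.integral_cong) (auto split: split_indicator)
  finally show ?thesis .
qed

text \<open>Schur test again: |x| * |y| is at most the sum of the squares, which splits the double
  integral into two equal ones. In each, the kernel integrates to at most \<open>KB\<close> in one
  variable, and the squared logarithm is integrable along a good path in the other.\<close>

lemma kernel_integrable_log:
  assumes t: "0 \<le> t" "t \<le> T" and \<omega>: "\<omega> \<in> good a"
  shows "kernel_integrable T H (\<lambda>s. ln \<bar>X s \<omega> - a\<bar> * indicator {0..t} s)"
proof -
  let ?\<phi> = "\<lambda>s. ln \<bar>X s \<omega> - a\<bar> * indicator {0..t} s"
  have hit: "hit a \<omega> = 0" using \<omega> by (simp add: good_def)
  define p where "p = 2*H - 2"
  have p: "p > -1" using H by (simp add: p_def)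
  let ?K = "\<lambda>s r. ennreal (indicator {0..T} s * indicator {0..T} r * \<bar>s - r\<bar> powr p)"
  define KB where "KB = 2 * T powr (2*H-1) / (2*H-1)"
  have K: "(\<integral>\<^sup>+r. ?K s r \<partial>lborel) \<le> ennreal KB * indicator {0..T} s" for s
  proof (cases "s \<in> {0..T}")
    case True
    have "(\<integral>\<^sup>+r. ?K s r \<partial>lborel) = (\<integral>\<^sup>+r. ennreal (indicator {0..T} r * \<bar>r - s\<bar> powr p) \<partial>lborel)"
      using True by (intro nn_integral_cong) (simp add: abs_minus_commute)
    also have "\<dots> = ennreal (kap s T / (2*H-1))"
      using T by (subst nn_integral_abs_powr[OF p]) (auto simp: kap_def p_def sgn_minus algebra_simps)
    also have "\<dots> \<le> ennreal KB"
      unfolding KB_def using kap_nonneg_le[of s T] True H T by (intro ennreal_leI divide_right_mono) auto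
    finally show ?thesis using True by simp
  qed simp
  have sq: "(\<integral>\<^sup>+s. ennreal ((?\<phi> s)\<^sup>2) * indicator {0..T} s \<partial>lborel) < \<infinity>"
  proof -
    have "(\<integral>\<^sup>+s. ennreal ((?\<phi> s)\<^sup>2) * indicator {0..T} s \<partial>lborel) \<le>
        (\<integral>\<^sup>+s. ennreal (indicator {0..T} s * log_bound a s \<omega>) \<partial>lborel)"
    proof (rule nn_integral_mono_AE)
      show "AE s in lborel. ennreal ((?\<phi> s)\<^sup>2) * indicator {0..T} s \<le> ennreal (indicator {0..T} s * log_bound a s \<omega>)"
        using hit_AE_neq[OF hit]
      proof eventually_elim
        case (elim s)
        show ?case
        proof (cases "s \<in> {0..T}")
          case True
          then have n: "X s \<omega> - a \<noteq> 0" using elim by auto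
          have "(?\<phi> s)\<^sup>2 \<le> (ln \<bar>X s \<omega> - a\<bar>)\<^sup>2" by (auto split: split_indicator)
          also have "\<dots> \<le> 32 * \<bar>X s \<omega> - a\<bar> powr (-1/2) + 2 * (X s \<omega> - a)\<^sup>2" by (rule ln_square_le[OF n])
          also have "\<dots> \<le> log_bound a s \<omega>"
            using powr_ge_zero[of "\<bar>X s \<omega> - a\<bar>" "-1/2"] by linarith
          finally show ?thesis using True by (simp add: ennreal_leI del: ennreal_plus)
        qed simp
      qed
    qed
    also have "\<dots> < \<infinity>"
      using dominating_integrable[OF \<omega>]
      by (subst nn_integral_eq_integral) (auto intro!: AE_I2 mult_nonneg_nonneg add_nonneg_nonneg)
    finally show ?thesis .
  qed
  have half: "(\<integral>\<^sup>+s. \<integral>\<^sup>+r. ennreal ((?\<phi> s)\<^sup>2) * ?K s r \<partial>lborel \<partial>lborel) < \<infinity>"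
  proof -
    have "(\<integral>\<^sup>+s. \<integral>\<^sup>+r. ennreal ((?\<phi> s)\<^sup>2) * ?K s r \<partial>lborel \<partial>lborel) = (\<integral>\<^sup>+s. ennreal ((?\<phi> s)\<^sup>2) * (\<integral>\<^sup>+r. ?K s r \<partial>lborel) \<partial>lborel)"
      by (intro nn_integral_cong nn_integral_cmult) measurable
    also have "\<dots> \<le> (\<integral>\<^sup>+s. ennreal KB * (ennreal ((?\<phi> s)\<^sup>2) * indicator {0..T} s) \<partial>lborel)"
      using K by (intro nn_integral_mono order_trans[OF mult_left_mono[OF K]]) (auto simp: mult_ac)
    also have "\<dots> = ennreal KB * (\<integral>\<^sup>+s. ennreal ((?\<phi> s)\<^sup>2) * indicator {0..T} s \<partial>lborel)"
      by (rule nn_integral_cmult) measurable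
    also have "\<dots> < \<infinity>" using sq by (simp add: ennreal_mult_less_top)
    finally show ?thesis .
  qed
  have half': "(\<integral>\<^sup>+s. \<integral>\<^sup>+r. ennreal ((?\<phi> r)\<^sup>2) * ?K s r \<partial>lborel \<partial>lborel) < \<infinity>"
  proof -
    have "(\<integral>\<^sup>+s. \<integral>\<^sup>+r. ennreal ((?\<phi> r)\<^sup>2) * ?K s r \<partial>lborel \<partial>lborel) = (\<integral>\<^sup>+r. \<integral>\<^sup>+s. ennreal ((?\<phi> r)\<^sup>2) * ?K s r \<partial>lborel \<partial>lborel)"
      by (rule lborel_pair.Fubini'[symmetric]) measurable
    also have "\<dots> = (\<integral>\<^sup>+s. \<integral>\<^sup>+r. ennreal ((?\<phi> s)\<^sup>2) * ?K s r \<partial>lborel \<partial>lborel)"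
      by (intro nn_integral_cong) (simp add: abs_minus_commute mult.commute)
    finally show ?thesis using half by simp
  qed
  define f1 where "f1 s r = ennreal ((?\<phi> s)\<^sup>2) * ?K s r" for s r
  define f2 where "f2 s r = ennreal ((?\<phi> r)\<^sup>2) * ?K s r" for s r
  have f1m: "(\<lambda>(s, r). f1 s r) \<in> borel_measurable (lborel \<Otimes>\<^sub>M lborel)"
    unfolding f1_def by measurable
  have f2m: "(\<lambda>(s, r). f2 s r) \<in> borel_measurable (lborel \<Otimes>\<^sub>M lborel)"
    unfolding f2_def by measurable
  have "set_integrable (lborel \<Otimes>\<^sub>M lborel) ({0..T} \<times> {0..T}) (\<lambda>(s, r). \<bar>?\<phi> s\<bar> * \<bar>?\<phi> r\<bar> * \<bar>s - r\<bar> powr p)"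
    unfolding set_integrable_def
  proof (rule integrableI_bounded)
    show "(\<lambda>z. indicator ({0..T} \<times> {0..T}) z *\<^sub>R (case z of (s, r) \<Rightarrow> \<bar>?\<phi> s\<bar> * \<bar>?\<phi> r\<bar> * \<bar>s - r\<bar> powr p)) \<in> borel_measurable (lborel \<Otimes>\<^sub>M lborel)"
      by measurable
    have "(\<integral>\<^sup>+z. ennreal (norm (indicator ({0..T} \<times> {0..T}) z *\<^sub>R (case z of (s, r) \<Rightarrow> \<bar>?\<phi> s\<bar> * \<bar>?\<phi> r\<bar> * \<bar>s - r\<bar> powr p))) \<partial>(lborel \<Otimes>\<^sub>M lborel))
      \<le> (\<integral>\<^sup>+z. (case z of (s, r) \<Rightarrow> ennreal ((?\<phi> s)\<^sup>2) * ?K s r + ennreal ((?\<phi> r)\<^sup>2) * ?K s r) \<partial>(lborel \<Otimes>\<^sub>M lborel))"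
    proof (rule nn_integral_mono)
      fix z :: "real \<times> real"
      obtain s r where z: "z = (s, r)" by (cases z)
      have xy: "\<bar>x\<bar> * \<bar>y\<bar> \<le> x\<^sup>2 + y\<^sup>2" for x y :: real
      proof -
        have "2 * \<bar>x\<bar> * \<bar>y\<bar> \<le> x\<^sup>2 + y\<^sup>2" using sum_squares_bound[of "\<bar>x\<bar>" "\<bar>y\<bar>"] by simp
        moreover have "0 \<le> \<bar>x\<bar> * \<bar>y\<bar>" by simp
        ultimately show ?thesis by linarith
      qed
      have le: "indicator {0..T} s * indicator {0..T} r * (\<bar>?\<phi> s\<bar> * \<bar>?\<phi> r\<bar> * \<bar>s - r\<bar> powr p) \<le>
          ((?\<phi> s)\<^sup>2 + (?\<phi> r)\<^sup>2) * (indicator {0..T} s * indicator {0..T} r * \<bar>s - r\<bar> powr p)"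
        using mult_right_mono[OF xy[of "?\<phi> s" "?\<phi> r"], of "indicator {0..T} s * indicator {0..T} r * \<bar>s - r\<bar> powr p"]
        by (simp add: mult_ac)
      have "ennreal (indicator {0..T} s * indicator {0..T} r * (\<bar>?\<phi> s\<bar> * \<bar>?\<phi> r\<bar> * \<bar>s - r\<bar> powr p)) \<le>
          ennreal ((?\<phi> s)\<^sup>2) * ?K s r + ennreal ((?\<phi> r)\<^sup>2) * ?K s r"
      proof -
        have eq: "ennreal (x\<^sup>2) * ennreal k + ennreal (y\<^sup>2) * ennreal k = ennreal ((x\<^sup>2 + y\<^sup>2) * k)" if "k \<ge> 0" for x y k :: real
          using that by (simp add: ennreal_mult ennreal_plus distrib_right)
        have k: "0 \<le> indicator {0..T} s * indicator {0..T} r * \<bar>s - r\<bar> powr p" by (auto split: split_indicator)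
        show ?thesis unfolding eq[OF k] by (rule ennreal_leI[OF le])
      qed
      then show "ennreal (norm (indicator ({0..T} \<times> {0..T}) z *\<^sub>R (case z of (s, r) \<Rightarrow> \<bar>?\<phi> s\<bar> * \<bar>?\<phi> r\<bar> * \<bar>s - r\<bar> powr p)))
          \<le> (case z of (s, r) \<Rightarrow> ennreal ((?\<phi> s)\<^sup>2) * ?K s r + ennreal ((?\<phi> r)\<^sup>2) * ?K s r)"
        unfolding z by (simp add: indicator_times abs_mult)
    qed
    also have "\<dots> = (\<integral>\<^sup>+z. (case z of (s, r) \<Rightarrow> f1 s r) + (case z of (s, r) \<Rightarrow> f2 s r) \<partial>(lborel \<Otimes>\<^sub>M lborel))"
      by (intro nn_integral_cong) (simp add: f1_def f2_def case_prod_unfold)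
    also have "\<dots> = (\<integral>\<^sup>+z. (case z of (s, r) \<Rightarrow> f1 s r) \<partial>(lborel \<Otimes>\<^sub>M lborel)) + (\<integral>\<^sup>+z. (case z of (s, r) \<Rightarrow> f2 s r) \<partial>(lborel \<Otimes>\<^sub>M lborel))"
      by (rule nn_integral_add[OF f1m f2m])
    also have "\<dots> = (\<integral>\<^sup>+s. \<integral>\<^sup>+r. f1 s r \<partial>lborel \<partial>lborel) + (\<integral>\<^sup>+s. \<integral>\<^sup>+r. f2 s r \<partial>lborel \<partial>lborel)"
      unfolding lborel.nn_integral_fst[OF f1m, symmetric] lborel.nn_integral_fst[OF f2m, symmetric] case_prod_conv ..
    also have "\<dots> < \<infinity>" using half half' by (simp add: f1_def f2_def)
    finally show "(\<integral>\<^sup>+z. ennreal (norm (indicator ({0..T} \<times> {0..T}) z *\<^sub>R (case z of (s, r) \<Rightarrow> \<bar>?\<phi> s\<bar> * \<bar>?\<phi> r\<bar> * \<bar>s - r\<bar> powr p))) \<partial>(lborel \<Otimes>\<^sub>M lborel)) < \<infinity>" .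
  qed
  moreover have "set_borel_measurable lborel {0..T} ?\<phi>"
    unfolding set_borel_measurable_def by measurable
  ultimately show ?thesis by (simp add: kernel_integrable_def p_def)
qed

lemma process_element_ulog:
  assumes t: "0 \<le> t" "t \<le> T"
  shows "process_element M T H e (\<lambda>s \<omega>. ln \<bar>B s \<omega> - a\<bar>) t (ulog t a)"
  unfolding process_element_def using good_AE[of a] X_B
proof eventually_elim
  case (elim \<omega>)
  have eq: "(\<lambda>s. ln \<bar>B s \<omega> - a\<bar> * indicator {0..t} s) = (\<lambda>s. ln \<bar>X s \<omega> - a\<bar> * indicator {0..t} s)"
  proof
    fix s
    show "ln \<bar>B s \<omega> - a\<bar> * indicator {0..t} s = ln \<bar>X s \<omega> - a\<bar> * indicator {0..t} s"
      using elim(2) t by (cases "s \<in> {0..t}") auto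
  qed
  show ?case
    unfolding eq represents_def using kernel_integrable_log[OF t elim(1)] ulog_inner[OF t elim(1)]
    by (simp add: kernel_inner_indicator)
qed

section \<open>Duality for the regularized and for the logarithmic integrand\<close>

definition Zeps :: "real \<Rightarrow> real \<Rightarrow> real \<Rightarrow> 'a \<Rightarrow> real" where
  "Zeps t a \<epsilon> \<omega> = Fell \<epsilon> (X t \<omega> - a) - Fell \<epsilon> (X 0 \<omega> - a) -
     H * integral {0..t} (\<lambda>s. (X s \<omega> - a) / ((X s \<omega> - a)\<^sup>2 + \<epsilon>\<^sup>2) * s powr (2*H-1))"

lemma duality_regularized:
  assumes t: "0 \<le> t" "t \<le> T" and g: "Cb_infinity n g" and \<epsilon>: "\<epsilon> > 0"
  shows "expectation (\<lambda>\<omega>. smooth_functional W g \<phi> \<omega> * Zeps t a \<epsilon> \<omega>) =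
    expectation (\<lambda>\<omega>. inner (malliavin_deriv W n g \<phi> \<omega>) (Jell t a \<epsilon> \<omega>))"
  unfolding Zeps_def Jell_def
proof (rule ito_formula[OF t g])
  have "((\<lambda>x. Fell \<epsilon> (x - a)) has_real_derivative ell \<epsilon> (x - a) * 1) (at x)" for x
    by (rule DERIV_chain2[OF Fell_deriv[OF \<epsilon>]]) (auto intro!: derivative_eq_intros)
  then show "((\<lambda>x. Fell \<epsilon> (x - a)) has_real_derivative ell \<epsilon> (x - a)) (at x)" for x by simp
  have "((\<lambda>x. ell \<epsilon> (x - a)) has_real_derivative (x - a) / ((x - a)\<^sup>2 + \<epsilon>\<^sup>2) * 1) (at x)" for x
    by (rule DERIV_chain2[OF ell_deriv[OF \<epsilon>]]) (auto intro!: derivative_eq_intros)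
  then show "((\<lambda>x. ell \<epsilon> (x - a)) has_real_derivative (x - a) / ((x - a)\<^sup>2 + \<epsilon>\<^sup>2)) (at x)" for x by simp
  show "continuous_on UNIV (\<lambda>x. (x - a) / ((x - a)\<^sup>2 + \<epsilon>\<^sup>2))"
    by (intro continuous_on_compose2[OF ell_deriv_continuous[OF \<epsilon>, of UNIV]] continuous_intros) auto
  show "\<bar>(x - a) / ((x - a)\<^sup>2 + \<epsilon>\<^sup>2)\<bar> \<le> 1 / \<epsilon>" for x by (rule ell_deriv_bound[OF \<epsilon>])
  have tT: "t \<in> {0..T}" using t by simp
  have X2: "integrable M (\<lambda>\<omega>. (X t \<omega>)\<^sup>2)"
    using X_second_moment[OF tT] by (intro integrableI_bounded) auto
  have Fm [measurable]: "Fell \<epsilon> \<in> borel_measurable borel"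
    unfolding Fell_def[abs_def] by measurable
  show "integrable M (\<lambda>\<omega>. Fell \<epsilon> (X t \<omega> - a))"
  proof (rule Bochner_Integration.integrable_bound)
    define c where "c = \<bar>ell \<epsilon> 0\<bar>"
    show "integrable M (\<lambda>\<omega>. (c + (c + 1 / \<epsilon>) * (2 * a\<^sup>2)) + (c + 1 / \<epsilon>) * 2 * (X t \<omega>)\<^sup>2)"
      using X2 by simp
    have "\<bar>Fell \<epsilon> (x - a)\<bar> \<le> (c + (c + 1 / \<epsilon>) * (2 * a\<^sup>2)) + (c + 1 / \<epsilon>) * 2 * x\<^sup>2" for x
    proof -
      have c0: "c \<ge> 0" by (simp add: c_def)
      define y where "y = \<bar>x - a\<bar>"
      have y0: "y \<ge> 0" by (simp add: y_def)
      have "0 \<le> (y - 1)\<^sup>2" by simp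
      then have "2 * y \<le> 1 + y\<^sup>2" unfolding power2_diff by simp
      then have y1: "y \<le> 1 + y\<^sup>2" using y0 by linarith
      have "y\<^sup>2 = (x - a)\<^sup>2" by (simp add: y_def)
      also have "\<dots> \<le> 2 * x\<^sup>2 + 2 * a\<^sup>2" using zero_le_power2[of "x + a"] by (simp add: power2_sum power2_diff)
      finally have y2: "y\<^sup>2 \<le> 2 * x\<^sup>2 + 2 * a\<^sup>2" .
      have "\<bar>Fell \<epsilon> (x - a)\<bar> \<le> (c + y / \<epsilon>) * y"
        unfolding c_def y_def by (rule Fell_quadratic[OF \<epsilon>])
      also have "\<dots> = c * y + (1 / \<epsilon>) * y\<^sup>2" by (simp add: algebra_simps power2_eq_square)
      also have "\<dots> \<le> c * (1 + y\<^sup>2) + (1 / \<epsilon>) * y\<^sup>2" using y1 c0 by (intro add_right_mono mult_left_mono) auto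
      also have "\<dots> = c + (c + 1 / \<epsilon>) * y\<^sup>2" by (simp add: algebra_simps)
      also have "\<dots> \<le> c + (c + 1 / \<epsilon>) * (2 * x\<^sup>2 + 2 * a\<^sup>2)"
        using y2 c0 \<epsilon> by (intro add_left_mono mult_left_mono) auto
      finally show ?thesis by (simp add: algebra_simps)
    qed
    then show "AE \<omega> in M. norm (Fell \<epsilon> (X t \<omega> - a)) \<le> norm ((c + (c + 1 / \<epsilon>) * (2 * a\<^sup>2)) + (c + 1 / \<epsilon>) * 2 * (X t \<omega>)\<^sup>2)"
      unfolding real_norm_def by (intro AE_I2 order_trans[OF _ abs_ge_self])
  qed measurable
qed

lemma smooth_functional_measurable:
  assumes "Cb_infinity n g"
  shows "smooth_functional W g \<phi> \<in> borel_measurable M"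
  unfolding smooth_functional_def[abs_def] using continuous_product_measurable[OF Cb_infinity_props(1)[OF assms]] by measurable

lemma malliavin_deriv_measurable:
  assumes g: "Cb_infinity n g"
  shows "malliavin_deriv W n g \<phi> \<in> borel_measurable M"
  unfolding malliavin_deriv_def[abs_def]
proof (intro borel_measurable_sum borel_measurable_scaleR borel_measurable_const)
  fix j assume "j \<in> {..<n}"
  then have "partial_deriv j g \<in> borel_measurable seq_borel"
    using Cb_infinity_props(4)[OF g] by (intro continuous_product_measurable) auto
  then show "(\<lambda>\<omega>. partial_deriv j g (\<lambda>i. W (\<phi> i) \<omega>)) \<in> borel_measurable M" by measurable
qed

text \<open>The two sides converge for different reasons: the left one by domination of
  \<open>Zeps\<close>, the right one because the Malliavin derivative is bounded and the integrands
  converge in mean square at the rate of \<open>Jell_ulog_L2\<close>.\<close>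

lemma duality_limit:
  assumes t: "0 \<le> t" "t \<le> T" and g: "Cb_infinity n g"
    and Zm: "\<And>k. Zeps t a (eps k) \<in> borel_measurable M" "Z \<in> borel_measurable M"
    and lim: "AE \<omega> in M. (\<lambda>k. Zeps t a (eps k) \<omega>) \<longlonglongrightarrow> Z \<omega>"
    and w: "integrable M w" "\<And>k. AE \<omega> in M. \<bar>Zeps t a (eps k) \<omega>\<bar> \<le> w \<omega>"
  shows "expectation (\<lambda>\<omega>. smooth_functional W g \<phi> \<omega> * Z \<omega>) =
    expectation (\<lambda>\<omega>. inner (malliavin_deriv W n g \<phi> \<omega>) (ulog t a \<omega>))"
proof (rule LIMSEQ_unique)
  obtain Kg where Kg: "Kg \<ge> 0" "\<And>x. \<bar>g x\<bar> \<le> Kg" "\<And>j x. j < n \<Longrightarrow> \<bar>partial_deriv j g x\<bar> \<le> Kg"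
    using Cb_infinity_bound[OF g] by blast
  note [measurable] = Zm ulog_measurable[OF t]
  have Gm [measurable]: "smooth_functional W g \<phi> \<in> borel_measurable M" by (rule smooth_functional_measurable[OF g])
  have Dm [measurable]: "malliavin_deriv W n g \<phi> \<in> borel_measurable M" by (rule malliavin_deriv_measurable[OF g])
  define C where "C = Kg * (\<Sum>j<n. norm (\<phi> j))"
  have C0: "C \<ge> 0" unfolding C_def using Kg(1) by (intro mult_nonneg_nonneg sum_nonneg) auto
  have DC: "norm (malliavin_deriv W n g \<phi> \<omega>) \<le> C" for \<omega>
    unfolding malliavin_deriv_def C_def sum_distrib_left
    by (rule order_trans[OF norm_sum sum_mono]) (auto intro!: mult_right_mono Kg)
  let ?D = "malliavin_deriv W n g \<phi>"
  have Jm [measurable]: "Jell t a (eps k) \<in> borel_measurable M" for k by (rule Jell_measurable[OF t]) simp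
  have inner_i: "integrable M (\<lambda>\<omega>. inner (?D \<omega>) (Y \<omega>))" if "integrable M (\<lambda>\<omega>. norm (Y \<omega>))" and [measurable]: "Y \<in> borel_measurable M" for Y
  proof (rule Bochner_Integration.integrable_bound)
    show "integrable M (\<lambda>\<omega>. C * norm (Y \<omega>))" using that by simp
    show "AE \<omega> in M. norm (inner (?D \<omega>) (Y \<omega>)) \<le> norm (C * norm (Y \<omega>))"
      using C0 by (intro AE_I2) (auto intro!: order_trans[OF Cauchy_Schwarz_ineq2] mult_right_mono DC)
  qed measurable
  show "(\<lambda>k. expectation (\<lambda>\<omega>. smooth_functional W g \<phi> \<omega> * Zeps t a (eps k) \<omega>)) \<longlonglongrightarrow> expectation (\<lambda>\<omega>. smooth_functional W g \<phi> \<omega> * Z \<omega>)"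
  proof (rule integral_dominated_convergence[where w="\<lambda>\<omega>. Kg * w \<omega>"])
    show "AE \<omega> in M. (\<lambda>k. smooth_functional W g \<phi> \<omega> * Zeps t a (eps k) \<omega>) \<longlonglongrightarrow> smooth_functional W g \<phi> \<omega> * Z \<omega>"
      using lim by eventually_elim (intro tendsto_intros)
    show "AE \<omega> in M. norm (smooth_functional W g \<phi> \<omega> * Zeps t a (eps k) \<omega>) \<le> Kg * w \<omega>" for k
      using w(2)[of k] unfolding real_norm_def abs_mult
      by eventually_elim (intro mult_mono, auto simp: smooth_functional_def Kg)
    show "(\<lambda>\<omega>. smooth_functional W g \<phi> \<omega> * Zeps t a (eps k) \<omega>) \<in> borel_measurable M" for k
      by (intro borel_measurable_times Gm Zm)
  qed (use w(1) in auto)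
  define c where "c k = sqrt (CH * (16 * eps k powr (1/2)) * enn2real CA)" for k
  have c2: "(c k)\<^sup>2 = CH * (16 * eps k powr (1/2)) * enn2real CA" for k
    unfolding c_def using CH_pos by (intro real_sqrt_pow2) auto
  have c0: "c k \<ge> 0" for k unfolding c_def using CH_pos by simp
  have diff: "integrable M (\<lambda>\<omega>. norm (Jell t a (eps k) \<omega> - ulog t a \<omega>))"
    "expectation (\<lambda>\<omega>. norm (Jell t a (eps k) \<omega> - ulog t a \<omega>)) \<le> c k" for k
  proof -
    have m: "(\<lambda>\<omega>. norm (Jell t a (eps k) \<omega> - ulog t a \<omega>)) \<in> borel_measurable M"
      by (rule measurable_compose[OF _ borel_measurable_norm]) (intro borel_measurable_diff Jm ulog_measurable[OF t])
    have nn: "L2sq M (\<lambda>\<omega>. norm (Jell t a (eps k) \<omega> - ulog t a \<omega>)) \<le> ennreal ((c k)\<^sup>2)"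
      unfolding c2 by (rule Jell_ulog_L2[OF t])
    show "integrable M (\<lambda>\<omega>. norm (Jell t a (eps k) \<omega> - ulog t a \<omega>))"
      by (rule expectation_abs_le_nn(1)[OF m c0 nn])
    show "expectation (\<lambda>\<omega>. norm (Jell t a (eps k) \<omega> - ulog t a \<omega>)) \<le> c k"
      using expectation_abs_le_nn(2)[OF m c0 nn] by (simp only: abs_norm_cancel)
  qed
  have ui: "integrable M (\<lambda>\<omega>. norm (ulog t a \<omega>))"
    by (rule square_integrable_imp_integrable[OF _ ulog_square_integrable[OF t]]) simp
  show "(\<lambda>k. expectation (\<lambda>\<omega>. smooth_functional W g \<phi> \<omega> * Zeps t a (eps k) \<omega>)) \<longlonglongrightarrow>
      expectation (\<lambda>\<omega>. inner (?D \<omega>) (ulog t a \<omega>))"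
  proof (rule LIM_zero_cancel, rule tendsto_0_squeeze)
    fix k
    have i1: "integrable M (\<lambda>\<omega>. inner (?D \<omega>) (Jell t a (eps k) \<omega> - ulog t a \<omega>))" by (intro inner_i diff(1) borel_measurable_diff Jm ulog_measurable[OF t])
    have i2: "integrable M (\<lambda>\<omega>. inner (?D \<omega>) (ulog t a \<omega>))" by (rule inner_i[OF ui]) measurable
    have i3: "integrable M (\<lambda>\<omega>. inner (?D \<omega>) (Jell t a (eps k) \<omega>))"
      using Bochner_Integration.integrable_add[OF i1 i2] by (simp add: inner_diff_right)
    have eq: "expectation (\<lambda>\<omega>. smooth_functional W g \<phi> \<omega> * Zeps t a (eps k) \<omega>) - expectation (\<lambda>\<omega>. inner (?D \<omega>) (ulog t a \<omega>)) =
        expectation (\<lambda>\<omega>. inner (?D \<omega>) (Jell t a (eps k) \<omega> - ulog t a \<omega>))"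
      using i2 i3 duality_regularized[OF t g, of "eps k" \<phi> a] by (simp add: inner_diff_right)
    have "\<bar>expectation (\<lambda>\<omega>. inner (?D \<omega>) (Jell t a (eps k) \<omega> - ulog t a \<omega>))\<bar> \<le> expectation (\<lambda>\<omega>. \<bar>inner (?D \<omega>) (Jell t a (eps k) \<omega> - ulog t a \<omega>)\<bar>)" by (rule integral_abs_bound)
    also have "\<dots> \<le> expectation (\<lambda>\<omega>. C * norm (Jell t a (eps k) \<omega> - ulog t a \<omega>))"
      using i1 diff(1) by (intro integral_mono) (auto intro!: order_trans[OF Cauchy_Schwarz_ineq2] mult_right_mono DC)
    also have "\<dots> \<le> C * c k" using diff(2)[of k] C0 by (simp add: mult_left_mono)
    finally show "\<bar>expectation (\<lambda>\<omega>. smooth_functional W g \<phi> \<omega> * Zeps t a (eps k) \<omega>) - expectation (\<lambda>\<omega>. inner (?D \<omega>) (ulog t a \<omega>))\<bar> \<le> C * c k"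
      unfolding eq .
  next
    have "(\<lambda>k. C * sqrt (CH * (16 * eps k powr (1/2)) * enn2real CA)) \<longlonglongrightarrow> C * sqrt (CH * (16 * 0) * enn2real CA)"
      by (intro tendsto_intros eps_powr_tendsto)
    then show "(\<lambda>k. C * c k) \<longlonglongrightarrow> 0" by (simp add: c_def)
  qed
qed

end

section \<open>Weighted local time as an occupation density\<close>

text \<open>The right derivative of the integral function. Applied to the occupation formula with
  short windows, it recovers a continuous density pointwise from integrals of indicators.\<close>

lemma averages_tendsto:
  fixes f :: "real \<Rightarrow> real"
  assumes f: "continuous_on UNIV f"
  shows "(\<lambda>n. real (Suc n) * (LINT y|lborel. indicator {x..x + eps n} y * f y)) \<longlonglongrightarrow> f x"
proof -
  have c: "continuous_on S f" for S using f continuous_on_subset by blast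
  have "((\<lambda>u. integral {x..u} f) has_vector_derivative f x) (at x within {x..x+1})"
    by (rule integral_has_vector_derivative[OF c]) auto
  then have d: "((\<lambda>u. (integral {x..u} f - integral {x..x} f) / (u - x)) \<longlongrightarrow> f x) (at x within {x..x+1})"
    by (simp add: has_real_derivative_iff_has_vector_derivative[symmetric] has_field_derivative_iff)
  have "filterlim (\<lambda>n. x + eps n) (at x within {x..x+1}) sequentially"
    unfolding filterlim_at
  proof
    show "(\<lambda>n. x + eps n) \<longlonglongrightarrow> x" by real_asymp
  qed (auto intro!: always_eventually)
  from filterlim_compose[OF d this]
  have "(\<lambda>n. integral {x..x + eps n} f / (eps n)) \<longlonglongrightarrow> f x" by simp
  moreover have "integral {x..x + eps n} f = (LINT y|lborel. indicator {x..x + eps n} y * f y)" for n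
    using set_borel_integral_eq_integral(2)[OF borel_integrable_atLeastAtMost'[OF c]] by (simp add: set_lebesgue_integral_def)
  ultimately show ?thesis by (simp add: mult.commute)
qed

text \<open>One fixed path with its local time: the properties of the weighted local time are
  deterministic consequences of joint continuity and the occupation formula, so they are derived
  without a probability space.\<close>

locale occupation =
  fixes T H :: real and b :: "real \<Rightarrow> real" and l :: "real \<Rightarrow> real \<Rightarrow> real"
  assumes H: "1/2 < H" "H < 1" and T: "0 < T"
    and b: "continuous_on UNIV b"
    and l: "continuous_on (UNIV \<times> {0..T}) (\<lambda>(x, t). l x t)"
    and occ: "\<And>t \<Phi>. t \<in> {0..T} \<Longrightarrow> \<Phi> \<in> borel_measurable borel \<Longrightarrow> (\<And>x. 0 \<le> \<Phi> x) \<Longrightarrow> bounded (range \<Phi>) \<Longrightarrow>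
      (LINT s:{0..t}|lborel. \<Phi> (b s)) = (LINT x|lborel. \<Phi> x * l x t)"
begin

lemma b_measurable [measurable]: "b \<in> borel_measurable borel"
  using b by (rule borel_measurable_continuous_onI)

text \<open>Freezing the time outside [0,T] makes the function continuous on the whole plane and
  gives exactly the integrator used in \<open>weighted_local_time\<close>.\<close>

definition lc :: "real \<Rightarrow> real \<Rightarrow> real" where
  "lc x t = l x (max 0 (min t T))"

lemma lc_eq: "t \<in> {0..T} \<Longrightarrow> lc x t = l x t"
  by (simp add: lc_def)

lemma lc_continuous: "continuous_on UNIV (\<lambda>(x, t). lc x t)"
  unfolding lc_def case_prod_unfold using T
  by (intro continuous_on_compose2[OF l, of UNIV "\<lambda>z. (fst z, max 0 (min (snd z) T))", unfolded case_prod_unfold fst_conv snd_conv] continuous_intros) auto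

lemma lc_continuous1: "continuous_on A (\<lambda>x. lc x t)"
  by (rule continuous_on_compose2[OF lc_continuous, of A "\<lambda>x. (x, t)", unfolded case_prod_conv]) (auto intro!: continuous_intros)

lemma lc_continuous2: "continuous_on A (\<lambda>t. lc x t)"
  by (rule continuous_on_compose2[OF lc_continuous, of A "\<lambda>t. (x, t)", unfolded case_prod_conv]) (auto intro!: continuous_intros)

lemma lc_measurable [measurable]: "(\<lambda>(x, t). lc x t) \<in> borel_measurable (borel \<Otimes>\<^sub>M borel)"
  using lc_continuous by (subst borel_prod) (rule borel_measurable_continuous_onI)

lemma l_average:
  assumes t: "t \<in> {0..T}"
  shows "(\<lambda>n. real (Suc n) * (LINT s:{0..t}|lborel. indicator {x..x + eps n} (b s))) \<longlonglongrightarrow> l x t"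
proof -
  have "(LINT s:{0..t}|lborel. indicator {x..x + eps n} (b s)) =
      (LINT y|lborel. indicator {x..x + eps n} y * lc y t)" for n
    unfolding lc_eq[OF t] by (rule occ[OF t]) (auto simp: bounded_iff intro!: exI[of _ 1] split: split_indicator)
  then show ?thesis using averages_tendsto[OF lc_continuous1[of UNIV t], of x] by (simp add: lc_eq[OF t])
qed

lemma path_integrable:
  fixes \<Phi> :: "real \<Rightarrow> real"
  assumes [measurable]: "\<Phi> \<in> borel_measurable borel" and "\<And>x. 0 \<le> \<Phi> x" "\<And>x. \<Phi> x \<le> K"
  shows "set_integrable lborel {0..t} (\<lambda>s. \<Phi> (b s))"
proof -
  have "set_integrable lborel {0..t} (\<lambda>_. K)" by (intro borel_integrable_atLeastAtMost' continuous_intros)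
  then show ?thesis
  proof (rule set_integrable_bound)
    show "set_borel_measurable lborel {0..t} (\<lambda>s. \<Phi> (b s))"
      unfolding set_borel_measurable_def by measurable
    have "norm (\<Phi> y) \<le> norm K" for y using assms(2)[of y] assms(3)[of y] by simp
    then show "AE s in lborel. s \<in> {0..t} \<longrightarrow> norm (\<Phi> (b s)) \<le> norm K" by simp
  qed
qed

text \<open>Monotonicity in time is inherited from occupation times through the window averages of
  \<open>l_average\<close>.\<close>

lemma l_mono:
  assumes st: "0 \<le> s" "s \<le> t" "t \<le> T"
  shows "l x s \<le> l x t"
proof (rule LIMSEQ_le[OF l_average l_average])
  show "\<exists>N. \<forall>n\<ge>N. real (Suc n) * (LINT s:{0..s}|lborel. indicator {x..x + eps n} (b s)) \<le>
      real (Suc n) * (LINT s:{0..t}|lborel. indicator {x..x + eps n} (b s))"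
  proof (intro exI allI impI mult_left_mono)
    fix n
    have "set_integrable lborel {0..u} (\<lambda>s. indicator {x..x + eps n} (b s) :: real)" for u
      by (rule path_integrable[where K=1]) (auto split: split_indicator)
    then show "(LINT s:{0..s}|lborel. indicator {x..x + eps n} (b s) :: real) \<le>
      (LINT s:{0..t}|lborel. indicator {x..x + eps n} (b s))"
      unfolding set_lebesgue_integral_def set_integrable_def using st
      by (intro integral_mono) (auto split: split_indicator)
  qed simp
qed (use st in auto)

lemma l_0: "l x 0 = 0"
proof -
  have "(LINT s:{0..0}|lborel. indicator {x..x + eps n} (b s) :: real) = 0" for n
  proof -
    have "AE s::real in lborel. s \<noteq> 0" by (rule AE_lborel_singleton)
    then show ?thesis unfolding set_lebesgue_integral_def
      by (intro integral_eq_zero_AE) (auto elim!: eventually_mono)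
  qed
  then show ?thesis using l_average[of 0 x] T by (simp add: LIMSEQ_const_iff)
qed

lemma l_nonneg: "t \<in> {0..T} \<Longrightarrow> 0 \<le> l x t"
  using l_mono[of 0 t x] l_0 by simp

text \<open>The Bochner integral of a nonintegrable function is 0 by convention. The occupation
  formula for the constant 1 gives the value t, so for t > 0 the function must be
  integrable.\<close>

lemma l_integrable:
  assumes t: "t \<in> {0..T}"
  shows "integrable lborel (\<lambda>x. l x t)"
proof (cases "t = 0")
  case True
  then show ?thesis by (simp add: l_0)
next
  case False
  have "(LINT s:{0..t}|lborel. (1::real)) = (LINT x|lborel. 1 * l x t)"
    by (rule occ[OF t]) auto
  moreover have "(LINT s:{0..t}|lborel. (1::real)) = t" using t by (simp add: set_lebesgue_integral_def)
  ultimately have "(LINT x|lborel. l x t) \<noteq> 0" using False by simp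
  then show ?thesis by (meson not_integrable_integral_eq)
qed

text \<open>The occupation formula with extended nonnegative integrals, the form in which the order
  of integration can be exchanged freely.\<close>

lemma occ_nn:
  assumes t: "t \<in> {0..T}" and \<Phi>m [measurable]: "\<Phi> \<in> borel_measurable borel" and \<Phi>: "\<And>x. 0 \<le> \<Phi> x" "\<And>x. \<Phi> x \<le> K"
  shows "(\<integral>\<^sup>+x. ennreal (\<Phi> x * l x t) \<partial>lborel) = (\<integral>\<^sup>+s. ennreal (indicator {0..t} s * \<Phi> (b s)) \<partial>lborel)"
proof -
  have bd: "bounded (range \<Phi>)" using \<Phi> by (intro boundedI[of _ K]) auto
  have [measurable]: "(\<lambda>x. l x t) \<in> borel_measurable borel" using l_integrable[OF t] by auto
  have "integrable lborel (\<lambda>x. \<Phi> x * l x t)"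
  proof (rule Bochner_Integration.integrable_bound)
    show "integrable lborel (\<lambda>x. K * l x t)" using l_integrable[OF t] by simp
    show "AE x in lborel. norm (\<Phi> x * l x t) \<le> norm (K * l x t)"
      using \<Phi> l_nonneg[OF t] order_trans[OF \<Phi>(1) \<Phi>(2)] by (intro AE_I2) (auto simp: abs_mult intro!: mult_right_mono)
  qed measurable
  then have "(\<integral>\<^sup>+x. ennreal (\<Phi> x * l x t) \<partial>lborel) = ennreal (LINT x|lborel. \<Phi> x * l x t)"
    using \<Phi> l_nonneg[OF t] by (intro nn_integral_eq_integral) auto
  also have "(LINT x|lborel. \<Phi> x * l x t) = (LINT s|lborel. indicator {0..t} s * \<Phi> (b s))"
    using occ[OF t \<Phi>m \<Phi>(1) bd] by (simp add: set_lebesgue_integral_def)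
  also have "ennreal \<dots> = (\<integral>\<^sup>+s. ennreal (indicator {0..t} s * \<Phi> (b s)) \<partial>lborel)"
    using path_integrable[OF \<Phi>m \<Phi>, of t] \<Phi>(1)
    by (intro nn_integral_eq_integral[symmetric]) (auto simp: set_integrable_def)
  finally show ?thesis .
qed

definition wl :: "real \<Rightarrow> real \<Rightarrow> real" where
  "wl t x = 2 * H * (LINT s:{0..t}|interval_measure (\<lambda>s. l x (max 0 (min s T))). s powr (2*H - 1))"

lemma lc_mono: "s \<le> t \<Longrightarrow> lc x s \<le> lc x t"
  unfolding lc_def using T by (intro l_mono) auto

lemma nn_powr:
  assumes "0 \<le> s"
  shows "(\<integral>\<^sup>+r. ennreal (indicator {0..s} r * ((2*H-1) * r powr (2*H-2))) \<partial>lborel) = ennreal (s powr (2*H-1))"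
proof -
  have p: "2*H - 2 > -1" using H by simp
  have "(\<integral>\<^sup>+r. ennreal (indicator {0..s} r * ((2*H-1) * r powr (2*H-2))) \<partial>lborel) =
     (\<integral>\<^sup>+r. ennreal (2*H-1) * ennreal (indicator {0..s} r * \<bar>r - 0\<bar> powr (2*H-2)) \<partial>lborel)"
    using H by (intro nn_integral_cong) (auto simp: ennreal_mult[symmetric] split: split_indicator)
  also have "\<dots> = ennreal (2*H-1) * ennreal ((sgn (s - 0) * \<bar>s - 0\<bar> powr (2*H-2+1) - sgn (0 - 0) * \<bar>0 - 0\<bar> powr (2*H-2+1)) / (2*H-2+1))"
    using assms by (subst nn_integral_cmult, measurable) (subst nn_integral_abs_powr[OF p], auto)
  also have "(sgn (s - 0) * \<bar>s - 0\<bar> powr (2*H-2+1) - sgn (0 - 0) * \<bar>0 - 0\<bar> powr (2*H-2+1)) / (2*H-2+1) = s powr (2*H-1) / (2*H-1)"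
    using assms by (cases "s = 0") auto
  also have "ennreal (2*H-1) * ennreal (s powr (2*H-1) / (2*H-1)) = ennreal (s powr (2*H-1))"
    using H by (simp add: ennreal_mult[symmetric])
  finally show ?thesis .
qed

abbreviation wl_kernel :: "real \<Rightarrow> real \<Rightarrow> real \<Rightarrow> real" where
  "wl_kernel t x r \<equiv> indicator {0..t} r * (2*H*(2*H-1) * r powr (2*H-2) * (lc x t - lc x r))"

text \<open>Integration by parts: \<open>s powr (2H - 1)\<close> is the integral of its derivative over \<open>[0,s]\<close>, and the
  order of integration is exchanged.\<close>

lemma wl_nn:
  assumes t: "t \<in> {0..T}"
  shows "ennreal (wl t x) = (\<integral>\<^sup>+r. ennreal (wl_kernel t x r) \<partial>lborel)"
    and "0 \<le> wl t x"
proof -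
  define F where "F s = lc x s" for s
  define \<mu> where "\<mu> = interval_measure F"
  have mono: "F s \<le> F s'" if "s \<le> s'" for s s' unfolding F_def by (rule lc_mono[OF that])
  have cont: "continuous (at_right s) F" for s
    unfolding F_def using lc_continuous2[of UNIV x]
    by (simp add: continuous_at_imp_continuous_within continuous_on_eq_continuous_at)
  have [measurable_cong]: "sets \<mu> = sets borel" by (simp add: \<mu>_def)
  interpret \<mu>: sigma_finite_measure \<mu> unfolding \<mu>_def by (rule sigma_finite_interval_measure[OF mono cont])
  interpret P: pair_sigma_finite lborel \<mu> ..
  have Fm [measurable]: "F \<in> borel_measurable borel"
    unfolding F_def using lc_continuous2 by (rule borel_measurable_continuous_onI)
  have Ioc: "emeasure \<mu> {r<..t} = ennreal (F t - F r)" if "r \<le> t" for r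
    unfolding \<mu>_def by (rule emeasure_interval_measure_Ioc[OF that mono cont])
  have z: "emeasure \<mu> {0} = 0"
  proof -
    have "emeasure \<mu> {0} \<le> emeasure \<mu> {-1<..0}"
      by (intro emeasure_mono) auto
    also have "\<dots> = ennreal (F 0 - F (-1))"
      unfolding \<mu>_def by (rule emeasure_interval_measure_Ioc[OF _ mono cont]) simp
    also have "F 0 - F (-1) = 0" using T by (simp add: F_def lc_def)
    finally show ?thesis by simp
  qed
  \<comment> \<open>Continuity of the integrator excludes atoms, so closed and half-open intervals
    have the same mass.\<close>
  have pt: "emeasure \<mu> {r} = 0" for r
  proof -
    have "emeasure \<mu> {r..r} = ennreal (F r - F r)"
      unfolding \<mu>_def
      by (rule emeasure_interval_measure_Icc[OF _ mono])
        (auto simp: F_def intro: lc_continuous2)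
    then show ?thesis by simp
  qed
  let ?S = "\<integral>\<^sup>+s. ennreal (indicator {0..t} s * s powr (2*H-1)) \<partial>\<mu>"
  let ?g = "\<lambda>s r. ennreal (indicator {0..t} s * (indicator {0..s} r * ((2*H-1) * r powr (2*H-2))))"
  have gm [measurable]: "(\<lambda>(r, s). ?g s r) \<in> borel_measurable (lborel \<Otimes>\<^sub>M \<mu>)"
  proof -
    have e: "indicator {0..s} r = (if 0 \<le> r \<and> r \<le> s then 1 else (0::real))" for s r :: real by (auto simp: indicator_def)
    have e2: "indicator {0..t} s = (if 0 \<le> s \<and> s \<le> t then 1 else (0::real))" for s :: real by (auto simp: indicator_def)
    show ?thesis unfolding e e2 by measurable
  qed
  have "?S = (\<integral>\<^sup>+s. \<integral>\<^sup>+r. ?g s r \<partial>lborel \<partial>\<mu>)"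
  proof (rule nn_integral_cong)
    fix s
    show "ennreal (indicator {0..t} s * s powr (2*H-1)) = (\<integral>\<^sup>+r. ?g s r \<partial>lborel)"
      using nn_powr[of s] by (cases "s \<in> {0..t}") auto
  qed
  also have "\<dots> = (\<integral>\<^sup>+r. \<integral>\<^sup>+s. ?g s r \<partial>\<mu> \<partial>lborel)"
    by (rule P.Fubini'[OF gm])
  also have "\<dots> = (\<integral>\<^sup>+r. ennreal (indicator {0..t} r * ((2*H-1) * r powr (2*H-2) * (lc x t - lc x r))) \<partial>lborel)"
  proof (rule nn_integral_cong)
    fix r :: real
    show "(\<integral>\<^sup>+s. ?g s r \<partial>\<mu>) = ennreal (indicator {0..t} r * ((2*H-1) * r powr (2*H-2) * (lc x t - lc x r)))"
    proof (cases "r \<in> {0..t}")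
      case True
      have "(\<integral>\<^sup>+s. ?g s r \<partial>\<mu>) = (\<integral>\<^sup>+s. ennreal ((2*H-1) * r powr (2*H-2)) * indicator {r..t} s \<partial>\<mu>)"
        using True H by (intro nn_integral_cong) (auto split: split_indicator)
      also have "\<dots> = ennreal ((2*H-1) * r powr (2*H-2)) * emeasure \<mu> {r..t}"
        by (rule nn_integral_cmult_indicator) simp
      also have "emeasure \<mu> {r..t} = emeasure \<mu> ({r} \<union> {r<..t})"
        using True by (intro arg_cong[where f="emeasure \<mu>"]) auto
      also have "\<dots> = ennreal (F t - F r)"
        using True pt[of r] Ioc[of r] by (subst plus_emeasure[symmetric]) auto
      finally show ?thesis using True H by (simp add: ennreal_mult[symmetric] F_def mono[unfolded F_def])
    qed (use order_trans in \<open>auto split: split_indicator intro!: nn_integral_zero'\<close>)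
  qed
  finally have A: "?S =
     (\<integral>\<^sup>+r. ennreal (indicator {0..t} r * ((2*H-1) * r powr (2*H-2) * (lc x t - lc x r))) \<partial>lborel)" .
  have fin: "?S < \<infinity>"
  proof -
    have "?S \<le> (\<integral>\<^sup>+s. ennreal (T powr (2*H-1)) * indicator {0..t} s \<partial>\<mu>)"
      using t H by (intro nn_integral_mono) (auto split: split_indicator intro!: ennreal_leI powr_mono2)
    also have "\<dots> = ennreal (T powr (2*H-1)) * emeasure \<mu> {0..t}" by (rule nn_integral_cmult_indicator) simp
    also have "emeasure \<mu> {0..t} = emeasure \<mu> ({0} \<union> {0<..t})"
      using t by (intro arg_cong[where f="emeasure \<mu>"]) auto
    also have "\<dots> = ennreal (F t - F 0)" using t pt[of 0] Ioc[of 0] by (subst plus_emeasure[symmetric]) auto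
    finally show ?thesis by (rule le_less_trans) (simp add: ennreal_mult_less_top)
  qed
  have wl: "wl t x = 2 * H * enn2real ?S"
    unfolding wl_def set_lebesgue_integral_def \<mu>_def F_def[abs_def] lc_def
    by (subst integral_eq_nn_integral) auto
  then show "0 \<le> wl t x" using H by simp
  have "ennreal (wl t x) = ennreal (2*H) * ?S"
    using fin H unfolding wl by (subst ennreal_mult) auto
  also have "\<dots> = (\<integral>\<^sup>+r. ennreal (2*H) * ennreal (indicator {0..t} r * ((2*H-1) * r powr (2*H-2) * (lc x t - lc x r))) \<partial>lborel)"
    unfolding A F_def[symmetric] by (rule nn_integral_cmult[symmetric]) measurable
  also have "\<dots> = (\<integral>\<^sup>+r. ennreal (wl_kernel t x r) \<partial>lborel)"
    using H by (intro nn_integral_cong) (auto simp: ennreal_mult'[symmetric] algebra_simps split: split_indicator)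
  finally show "ennreal (wl t x) = (\<integral>\<^sup>+r. ennreal (wl_kernel t x r) \<partial>lborel)" .
qed

lemma wl_eq:
  assumes t: "t \<in> {0..T}"
  shows "wl t x = (LINT r|lborel. wl_kernel t x r)"
proof -
  have [measurable]: "(\<lambda>r. lc x r) \<in> borel_measurable borel"
    using lc_continuous2 by (rule borel_measurable_continuous_onI)
  have nn: "0 \<le> wl_kernel t x r" for r
    using H by (auto split: split_indicator intro!: mult_nonneg_nonneg simp: lc_mono)
  show ?thesis
    by (subst integral_eq_nn_integral)
      (measurable, rule AE_I2[OF nn], simp only: wl_nn(1)[OF t, symmetric] enn2real_ennreal[OF wl_nn(2)[OF t]])
qed

lemma powr_integrable: "integrable lborel (\<lambda>r. indicator {0..t} r * r powr (2*H-2))" if "0 \<le> t"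
proof (rule integrableI_bounded)
  have "(\<integral>\<^sup>+r. ennreal (norm (indicator {0..t} r * r powr (2*H-2))) \<partial>lborel) = (\<integral>\<^sup>+r. ennreal (indicator {0..t} r * \<bar>r - 0\<bar> powr (2*H-2)) \<partial>lborel)"
    by (intro nn_integral_cong) (auto split: split_indicator)
  also have "\<dots> < \<infinity>" using H that by (subst nn_integral_abs_powr) auto
  finally show "(\<integral>\<^sup>+r. ennreal (norm (indicator {0..t} r * r powr (2*H-2))) \<partial>lborel) < \<infinity>" .
qed measurable

text \<open>After integration by parts the measure no longer depends on the level x, so dominated
  convergence applies. A convergent sequence of levels together with its limit is compact, which
  gives a uniform bound on the local time.\<close>

lemma wl_continuous:
  assumes t: "t \<in> {0..T}"
  shows "continuous_on UNIV (wl t)"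
proof -
  have "isCont (wl t) x" for x
    unfolding continuous_at_sequentially
  proof (intro allI impI)
    fix u :: "nat \<Rightarrow> real" assume u: "u \<longlonglongrightarrow> x"
    have "compact ((\<lambda>(x, s). lc x s) ` ((insert x (range u)) \<times> {0..T}))"
    proof (intro compact_continuous_image compact_Times)
      show "continuous_on (insert x (range u) \<times> {0..T}) (\<lambda>(x, s). lc x s)"
        using lc_continuous continuous_on_subset by blast
      show "compact (insert x (range u))" using u by (rule compact_sequence_with_limit)
    qed simp
    then have "bounded ((\<lambda>(x, s). lc x s) ` ((insert x (range u)) \<times> {0..T}))" by (rule compact_imp_bounded)
    then obtain C where C': "\<forall>z\<in>(\<lambda>(x, s). lc x s) ` ((insert x (range u)) \<times> {0..T}). norm z \<le> C"
      unfolding bounded_iff by blast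
    have C: "\<bar>lc (u n) s\<bar> \<le> C" if "s \<in> {0..T}" for n s
      using C' that by auto
    have [measurable]: "(\<lambda>r. lc y r) \<in> borel_measurable borel" for y
      using lc_continuous2 by (rule borel_measurable_continuous_onI)
    have "(\<lambda>n. LINT r|lborel. wl_kernel t (u n) r) \<longlonglongrightarrow>
       (LINT r|lborel. wl_kernel t x r)"
    proof (rule integral_dominated_convergence[where w="\<lambda>r. (2*H*(2*H-1) * (2*C)) * (indicator {0..t} r * r powr (2*H-2))"])
      show "integrable lborel (\<lambda>r. (2*H*(2*H-1) * (2*C)) * (indicator {0..t} r * r powr (2*H-2)))"
        using t by (intro integrable_mult_right powr_integrable) auto
      have "(\<lambda>n. lc (u n) s) \<longlonglongrightarrow> lc x s" for s
        using lc_continuous1[of UNIV s] u by (auto simp: continuous_on_eq_continuous_at intro: isCont_tendsto_compose)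
      then show "AE r in lborel. (\<lambda>n. wl_kernel t (u n) r) \<longlonglongrightarrow>
         wl_kernel t x r"
        by (intro AE_I2 tendsto_intros)
      fix n
      show "AE r in lborel. norm (wl_kernel t (u n) r) \<le> (2*H*(2*H-1) * (2*C)) * (indicator {0..t} r * r powr (2*H-2))"
      proof (rule AE_I2)
        fix r
        show "norm (wl_kernel t (u n) r) \<le> (2*H*(2*H-1) * (2*C)) * (indicator {0..t} r * r powr (2*H-2))"
        proof (cases "r \<in> {0..t}")
          case True
          have "\<bar>lc (u n) t - lc (u n) r\<bar> \<le> 2 * C" using C[of t n] C[of r n] t True by (auto simp: abs_le_iff)
          then have "(2*H*(2*H-1) * r powr (2*H-2)) * \<bar>lc (u n) t - lc (u n) r\<bar> \<le> (2*H*(2*H-1) * r powr (2*H-2)) * (2 * C)"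
            using H by (intro mult_left_mono) auto
          moreover have "norm (2*H*(2*H-1) * r powr (2*H-2) * (lc (u n) t - lc (u n) r)) = (2*H*(2*H-1) * r powr (2*H-2)) * \<bar>lc (u n) t - lc (u n) r\<bar>"
            unfolding real_norm_def abs_mult[of _ "_ - _"] using H by simp
          moreover have "(2*H*(2*H-1) * r powr (2*H-2)) * (2 * C) = (2*H*(2*H-1) * (2*C)) * r powr (2*H-2)" by simp
          ultimately show ?thesis using True by (simp only: indicator_simps mult_1)
        qed simp
      qed
    qed measurable
    then show "(wl t \<circ> u) \<longlonglongrightarrow> wl t x" by (simp add: o_def wl_eq[OF t])
  qed
  then show ?thesis by (simp add: continuous_at_imp_continuous_on)
qed

text \<open>The difference \<open>lc x t - lc x r\<close> is the occupation density of the times in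
  (r,t]. Exchanging the order of integration leaves, for each time s, the integral over r < s of the
  derivative weight, which is 2H * s powr (2H - 1).\<close>

lemma wl_occupation_nn:
  assumes t: "t \<in> {0..T}" and \<Phi>m [measurable]: "\<Phi> \<in> borel_measurable borel" and \<Phi>: "\<And>x. 0 \<le> \<Phi> x" "\<And>x. \<Phi> x \<le> K"
  shows "(\<integral>\<^sup>+x. ennreal (\<Phi> x * wl t x) \<partial>lborel) = (\<integral>\<^sup>+s. ennreal (indicator {0..t} s * (\<Phi> (b s) * (2*H * s powr (2*H-1)))) \<partial>lborel)"
proof -
  define c where "c r = 2*H*(2*H-1) * r powr (2*H-2)" for r
  have c0: "0 \<le> c r" for r using H by (simp add: c_def)
  have [measurable]: "c \<in> borel_measurable borel" unfolding c_def by measurable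
  have lm [measurable]: "(\<lambda>z. lc (fst z) (snd z)) \<in> borel_measurable (lborel \<Otimes>\<^sub>M lborel)"
    using lc_measurable by (simp add: case_prod_unfold cong: measurable_cong_sets)
  have lm1 [measurable]: "(\<lambda>x. lc x t) \<in> borel_measurable borel" for t
    using lc_continuous1 by (rule borel_measurable_continuous_onI)
  have lm2 [measurable]: "(\<lambda>r. lc x r) \<in> borel_measurable borel" for x
    using lc_continuous2 by (rule borel_measurable_continuous_onI)
  have "(\<integral>\<^sup>+x. ennreal (\<Phi> x * wl t x) \<partial>lborel) = (\<integral>\<^sup>+x. \<integral>\<^sup>+r. ennreal (\<Phi> x) * ennreal (indicator {0..t} r * (c r * (lc x t - lc x r))) \<partial>lborel \<partial>lborel)"
    using \<Phi>(1) wl_nn[OF t] by (intro nn_integral_cong) (simp add: ennreal_mult nn_integral_cmult c_def)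
  also have "\<dots> = (\<integral>\<^sup>+r. \<integral>\<^sup>+x. ennreal (\<Phi> x) * ennreal (indicator {0..t} r * (c r * (lc x t - lc x r))) \<partial>lborel \<partial>lborel)"
    by (rule lborel_pair.Fubini'[symmetric]) (simp add: case_prod_unfold)
  also have "\<dots> = (\<integral>\<^sup>+r. \<integral>\<^sup>+s. ennreal (indicator {0..t} r * c r) * ennreal (indicator {r<..t} s * \<Phi> (b s)) \<partial>lborel \<partial>lborel)"
  proof (rule nn_integral_cong)
    fix r :: real
    show "(\<integral>\<^sup>+x. ennreal (\<Phi> x) * ennreal (indicator {0..t} r * (c r * (lc x t - lc x r))) \<partial>lborel) =
      (\<integral>\<^sup>+s. ennreal (indicator {0..t} r * c r) * ennreal (indicator {r<..t} s * \<Phi> (b s)) \<partial>lborel)"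
    proof (cases "r \<in> {0..t}")
      case True
      then have rT: "r \<in> {0..T}" using t by auto
      have lt: "lc x t = l x t" "lc x r = l x r" for x using t rT by (auto simp: lc_eq)
      have A: "(\<integral>\<^sup>+x. ennreal (\<Phi> x * (l x t - l x r)) \<partial>lborel) + (\<integral>\<^sup>+x. ennreal (\<Phi> x * l x r) \<partial>lborel) = (\<integral>\<^sup>+x. ennreal (\<Phi> x * l x t) \<partial>lborel)"
      proof (subst nn_integral_add[symmetric])
        show "(\<lambda>x. ennreal (\<Phi> x * (l x t - l x r))) \<in> borel_measurable lborel" "(\<lambda>x. ennreal (\<Phi> x * l x r)) \<in> borel_measurable lborel"
          unfolding lt[symmetric] by measurable
        show "(\<integral>\<^sup>+x. ennreal (\<Phi> x * (l x t - l x r)) + ennreal (\<Phi> x * l x r) \<partial>lborel) = (\<integral>\<^sup>+x. ennreal (\<Phi> x * l x t) \<partial>lborel)"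
        proof (rule nn_integral_cong)
          fix x
          have "0 \<le> \<Phi> x * (l x t - l x r)" "0 \<le> \<Phi> x * l x r"
            using \<Phi>(1)[of x] l_nonneg[OF rT, of x] l_mono[of r t x] True t by auto
          then have "ennreal (\<Phi> x * (l x t - l x r)) + ennreal (\<Phi> x * l x r) = ennreal (\<Phi> x * (l x t - l x r) + \<Phi> x * l x r)"
            by (rule ennreal_plus[symmetric])
          then show "ennreal (\<Phi> x * (l x t - l x r)) + ennreal (\<Phi> x * l x r) = ennreal (\<Phi> x * l x t)"
            by (simp add: right_diff_distrib)
        qed
      qed
      have Bq: "(\<integral>\<^sup>+s. ennreal (indicator {r<..t} s * \<Phi> (b s)) \<partial>lborel) + (\<integral>\<^sup>+s. ennreal (indicator {0..r} s * \<Phi> (b s)) \<partial>lborel) = (\<integral>\<^sup>+s. ennreal (indicator {0..t} s * \<Phi> (b s)) \<partial>lborel)"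
        using True by (subst nn_integral_add[symmetric]) (auto intro!: nn_integral_cong split: split_indicator)
      have fin: "(\<integral>\<^sup>+s. ennreal (indicator {0..r} s * \<Phi> (b s)) \<partial>lborel) \<noteq> \<infinity>"
      proof -
        have "(\<integral>\<^sup>+s. ennreal (indicator {0..r} s * \<Phi> (b s)) \<partial>lborel) \<le> (\<integral>\<^sup>+s. ennreal K * indicator {0..r} s \<partial>lborel)"
          using \<Phi> by (intro nn_integral_mono) (auto split: split_indicator intro: ennreal_leI)
        also have "\<dots> = ennreal K * emeasure lborel {0..r}" by (rule nn_integral_cmult_indicator) simp
        also have "\<dots> < \<infinity>" using True by (simp add: ennreal_mult_less_top)
        finally show ?thesis by simp
      qed
      have "(\<integral>\<^sup>+x. ennreal (\<Phi> x * (l x t - l x r)) \<partial>lborel) = (\<integral>\<^sup>+s. ennreal (indicator {r<..t} s * \<Phi> (b s)) \<partial>lborel)"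
      proof -
        \<comment> \<open>Subtraction of extended nonnegative reals is avoided by cancelling the
          finite contribution of the times up to r.\<close>
        have cancel: "x + z = y + z \<Longrightarrow> z \<noteq> \<infinity> \<Longrightarrow> x = y" for x y z :: ennreal
          unfolding add.commute[of _ z] by (simp add: ennreal_add_left_cancel)
        show ?thesis
          by (rule cancel[OF A[unfolded occ_nn[OF t \<Phi>m \<Phi>] occ_nn[OF rT \<Phi>m \<Phi>], folded Bq] fin])
      qed
      then have "ennreal (c r) * (\<integral>\<^sup>+x. ennreal (\<Phi> x * (l x t - l x r)) \<partial>lborel) = ennreal (c r) * (\<integral>\<^sup>+s. ennreal (indicator {r<..t} s * \<Phi> (b s)) \<partial>lborel)"
        by simp
      moreover have "ennreal (c r) * (\<integral>\<^sup>+x. ennreal (\<Phi> x * (l x t - l x r)) \<partial>lborel) = (\<integral>\<^sup>+x. ennreal (\<Phi> x) * ennreal (indicator {0..t} r * (c r * (lc x t - lc x r))) \<partial>lborel)"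
      proof -
        have "ennreal (c r) * (\<integral>\<^sup>+x. ennreal (\<Phi> x * (lc x t - lc x r)) \<partial>lborel) = (\<integral>\<^sup>+x. ennreal (c r) * ennreal (\<Phi> x * (lc x t - lc x r)) \<partial>lborel)"
          by (rule nn_integral_cmult[symmetric]) measurable
        also have "\<dots> = (\<integral>\<^sup>+x. ennreal (\<Phi> x) * ennreal (indicator {0..t} r * (c r * (lc x t - lc x r))) \<partial>lborel)"
        proof (rule nn_integral_cong)
          fix x
          have d: "0 \<le> lc x t - lc x r" using lc_mono[of r t x] True by simp
          have "ennreal (c r) * ennreal (\<Phi> x * (lc x t - lc x r)) = ennreal (c r * (\<Phi> x * (lc x t - lc x r)))"
            using c0[of r] d \<Phi>(1)[of x] by (intro ennreal_mult[symmetric] mult_nonneg_nonneg)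
          also have "c r * (\<Phi> x * (lc x t - lc x r)) = \<Phi> x * (c r * (lc x t - lc x r))" by simp
          also have "ennreal \<dots> = ennreal (\<Phi> x) * ennreal (c r * (lc x t - lc x r))"
            using c0[of r] d \<Phi>(1)[of x] by (intro ennreal_mult mult_nonneg_nonneg)
          finally show "ennreal (c r) * ennreal (\<Phi> x * (lc x t - lc x r)) = ennreal (\<Phi> x) * ennreal (indicator {0..t} r * (c r * (lc x t - lc x r)))"
            using True by simp
        qed
        finally show ?thesis unfolding lt .
      qed
      moreover have "ennreal (c r) * (\<integral>\<^sup>+s. ennreal (indicator {r<..t} s * \<Phi> (b s)) \<partial>lborel) = (\<integral>\<^sup>+s. ennreal (indicator {0..t} r * c r) * ennreal (indicator {r<..t} s * \<Phi> (b s)) \<partial>lborel)"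
        using True by (subst nn_integral_cmult[symmetric]) auto
      ultimately show ?thesis by simp
    qed simp
  qed
  also have "\<dots> = (\<integral>\<^sup>+s. \<integral>\<^sup>+r. ennreal (indicator {0..t} r * c r) * ennreal (indicator {r<..t} s * \<Phi> (b s)) \<partial>lborel \<partial>lborel)"
  proof (rule lborel_pair.Fubini')
    have "indicator {r<..t} s = (if r < s \<and> s \<le> t then 1 else (0::real))" for r s by (auto simp: indicator_def)
    then show "(\<lambda>(s, r). ennreal (indicator {0..t} r * c r) * ennreal (indicator {r<..t} s * \<Phi> (b s))) \<in> borel_measurable (lborel \<Otimes>\<^sub>M lborel)"
      by simp
  qed
  also have "\<dots> = (\<integral>\<^sup>+s. ennreal (indicator {0..t} s * (\<Phi> (b s) * (2*H * s powr (2*H-1)))) \<partial>lborel)"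
  proof (rule nn_integral_cong)
    fix s :: real
    show "(\<integral>\<^sup>+r. ennreal (indicator {0..t} r * c r) * ennreal (indicator {r<..t} s * \<Phi> (b s)) \<partial>lborel) = ennreal (indicator {0..t} s * (\<Phi> (b s) * (2*H * s powr (2*H-1))))"
    proof (cases "s \<in> {0..t}")
      case True
      \<comment> \<open>The null set r = s is removed because s belongs to the closed interval [0,s]
        of r, while r = s violates the condition that s lie in (r,t].\<close>
      have "AE r in lborel. r \<noteq> s" by (rule AE_lborel_singleton)
      then have "(\<integral>\<^sup>+r. ennreal (indicator {0..t} r * c r) * ennreal (indicator {r<..t} s * \<Phi> (b s)) \<partial>lborel) =
          (\<integral>\<^sup>+r. ennreal (\<Phi> (b s) * (2*H)) * ennreal (indicator {0..s} r * ((2*H-1) * r powr (2*H-2))) \<partial>lborel)"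
      proof (intro nn_integral_cong_AE, eventually_elim)
        fix r :: real assume "r \<noteq> s"
        show "ennreal (indicator {0..t} r * c r) * ennreal (indicator {r<..t} s * \<Phi> (b s)) =
          ennreal (\<Phi> (b s) * (2*H)) * ennreal (indicator {0..s} r * ((2*H-1) * r powr (2*H-2)))"
        proof (cases "r \<in> {0..s}")
          case True
          then have "r \<in> {0..t}" "s \<in> {r<..t}" using \<open>s \<in> {0..t}\<close> \<open>r \<noteq> s\<close> by auto
          then show ?thesis using True \<Phi>(1)[of "b s"] H c0[of r]
            by (simp add: ennreal_mult[symmetric] c_def mult_ac)
        next
          case False
          then have "r \<notin> {0..t} \<or> s \<notin> {r<..t}" by auto
          then show ?thesis using False by auto
        qed
      qed
      also have "\<dots> = ennreal (\<Phi> (b s) * (2*H)) * ennreal (s powr (2*H-1))"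
        using True by (subst nn_integral_cmult, measurable) (subst nn_powr, auto)
      finally show ?thesis using True \<Phi>(1) H by (simp add: ennreal_mult[symmetric] mult_ac)
    next
      case False
      then have "r \<notin> {0..t} \<or> s \<notin> {r<..t}" for r by auto
      then have "ennreal (indicator {0..t} r * c r) * ennreal (indicator {r<..t} s * \<Phi> (b s)) = 0" for r
        by (metis ennreal_0 indicator_simps(2) mult_zero_left mult_zero_right)
      then show ?thesis using False by (simp only: nn_integral_const indicator_simps) simp
    qed
  qed
  finally show ?thesis .
qed

end

section \<open>Two-point estimate for the local time\<close>

text \<open>Interpolation between the bound 1 / \<sigma> for the size and
  \<open>1 / \<sigma>\<^sup>2\<close> for the slope of the density: which one is used depends on
  whether |u - w| reaches \<sigma>.\<close>

lemma normal_density_holder: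
  fixes \<alpha> u w \<sigma> :: real
  assumes \<sigma>: "\<sigma> > 0" and \<alpha>: "0 \<le> \<alpha>" "\<alpha> \<le> 1"
  shows "\<bar>normal_density 0 \<sigma> u - normal_density 0 \<sigma> w\<bar> \<le> (1 / \<sigma>) * (\<bar>u - w\<bar> / \<sigma>) powr \<alpha>"
proof -
  let ?p = "normal_density 0 \<sigma>"
  have pexp: "?p z \<le> (1 / \<sigma>) * exp (- (z\<^sup>2) / (2 * \<sigma>\<^sup>2))" for z
  proof -
    have "sqrt (1 * \<sigma>\<^sup>2) \<le> sqrt (2 * pi * \<sigma>\<^sup>2)" using pi_gt3 by (intro real_sqrt_le_mono mult_right_mono) auto
    then have "1 / sqrt (2 * pi * \<sigma>\<^sup>2) \<le> 1 / \<sigma>" using \<sigma> by (simp add: frac_le)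
    then show ?thesis unfolding normal_density_def using \<sigma> by (intro mult_mono) auto
  qed
  have p_le: "?p z \<le> 1 / \<sigma>" for z
  proof -
    have "(1 / \<sigma>) * exp (- (z\<^sup>2) / (2 * \<sigma>\<^sup>2)) \<le> (1 / \<sigma>) * 1" using \<sigma> by (intro mult_left_mono) auto
    then show ?thesis using pexp[of z] by linarith
  qed
  \<comment> \<open>With x = |z| / \<sigma> this rests on x \<le> 1 + x^2 / 2 \<le> exp (x^2 / 2);
    it bounds the derivative of the density.\<close>
  have zp: "\<bar>z\<bar> * ?p z \<le> 1" for z
  proof -
    define x where "x = \<bar>z\<bar> / \<sigma>"
    have "0 \<le> (x - 1)\<^sup>2" by simp
    then have "x \<le> 1 + x\<^sup>2 / 2" unfolding power2_diff by simp
    also have "\<dots> \<le> exp (x\<^sup>2 / 2)" by (rule exp_ge_add_one_self)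
    finally have "x * exp (- (x\<^sup>2 / 2)) \<le> 1"
      by (simp add: exp_minus divide_inverse[symmetric] divide_le_eq)
    moreover have "x\<^sup>2 / 2 = z\<^sup>2 / (2 * \<sigma>\<^sup>2)" by (simp add: x_def power_divide)
    ultimately have "x * exp (- (z\<^sup>2) / (2 * \<sigma>\<^sup>2)) \<le> 1" by simp
    moreover have "\<bar>z\<bar> * ?p z \<le> \<bar>z\<bar> * ((1 / \<sigma>) * exp (- (z\<^sup>2) / (2 * \<sigma>\<^sup>2)))"
      by (intro mult_left_mono pexp) simp
    ultimately show ?thesis by (simp add: x_def)
  qed
  have lip: "\<bar>?p u - ?p w\<bar> \<le> (1 / \<sigma>\<^sup>2) * \<bar>u - w\<bar>"
  proof -
    have "norm (?p u - ?p w) \<le> (1 / \<sigma>\<^sup>2) * norm (u - w)"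
    proof (rule field_differentiable_bound[of UNIV ?p "\<lambda>y. - (y / \<sigma>\<^sup>2) * ?p y"])
      show "(?p has_field_derivative - (z / \<sigma>\<^sup>2) * ?p z) (at z within UNIV)" for z
        using normal_density_deriv[OF \<sigma>, of z] by simp
      show "norm (- (z / \<sigma>\<^sup>2) * ?p z) \<le> 1 / \<sigma>\<^sup>2" for z
        using zp[of z] \<sigma> by (simp add: abs_mult divide_right_mono)
    qed auto
    then show ?thesis by simp
  qed
  have abs: "\<bar>?p u - ?p w\<bar> \<le> 1 / \<sigma>"
    using p_le[of u] p_le[of w] normal_density_nonneg[of 0 \<sigma> u] normal_density_nonneg[of 0 \<sigma> w] by linarith
  define q where "q = \<bar>u - w\<bar> / \<sigma>"
  have q0: "q \<ge> 0" using \<sigma> by (simp add: q_def)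
  show ?thesis
  proof (cases "q \<ge> 1")
    case True
    then have "1 \<le> q powr \<alpha>" using \<alpha> by (simp add: ge_one_powr_ge_zero)
    then have "(1 / \<sigma>) * 1 \<le> (1 / \<sigma>) * q powr \<alpha>" using \<sigma> by (intro mult_left_mono) auto
    then show ?thesis using abs by (simp add: q_def)
  next
    case False
    have "q \<le> q powr \<alpha>"
    proof (cases "q = 0")
      case False
      then have "q powr 1 \<le> q powr \<alpha>" using \<open>\<not> q \<ge> 1\<close> q0 \<alpha> by (intro powr_mono') auto
      then show ?thesis using q0 by simp
    qed simp
    then have "(1 / \<sigma>) * q \<le> (1 / \<sigma>) * q powr \<alpha>" using \<sigma> by (intro mult_left_mono) auto
    moreover have "(1 / \<sigma>\<^sup>2) * \<bar>u - w\<bar> = (1 / \<sigma>) * q" by (simp add: q_def power2_eq_square)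
    ultimately show ?thesis unfolding q_def[symmetric] using lip by linarith
  qed
qed

text \<open>Quantitative subadditivity: by concavity (M + m) powr p - M powr p decreases in M, so M
  = m is the worst case and leaves the gap 2 - 2 powr p.\<close>

lemma powr_concave_gap:
  fixes p m M :: real
  assumes p: "0 < p" "p < 1" and m: "0 < m" "m \<le> M"
  shows "(m + M) powr p \<le> m powr p + M powr p - (2 - 2 powr p) * m powr p"
proof -
  have "(M + m) powr p - M powr p \<le> (m + m) powr p - m powr p"
  proof (rule DERIV_nonpos_imp_nonincreasing[OF m(2)])
    fix x assume x: "m \<le> x" "x \<le> M"
    then have x0: "0 < x" using m by simp
    have "((\<lambda>x. (x + m) powr p - x powr p) has_real_derivative p * (x + m) powr (p - 1) - p * x powr (p - 1)) (at x)"
      using x0 m by (auto intro!: derivative_eq_intros)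
    moreover have "(x + m) powr (p - 1) \<le> x powr (p - 1)"
      using x0 m p by (intro powr_mono2') auto
    then have "p * (x + m) powr (p - 1) - p * x powr (p - 1) \<le> 0" using p by simp
    ultimately show "\<exists>y. ((\<lambda>x. (x + m) powr p - x powr p) has_real_derivative y) (at x) \<and> y \<le> 0" by blast
  qed
  moreover have "(m + m) powr p = 2 powr p * m powr p"
    using m by (simp add: powr_mult mult_2[symmetric])
  ultimately show ?thesis by (simp add: algebra_simps)
qed

text \<open>For p = H the left side is four times the Gram determinant of \<open>e s\<close> and
  \<open>e r\<close>. By Heron's formula it factors through the triangle with sides D, S, R. The
  critical factor is D - S + R, for which concavity of the power gives a lower bound proportional to
  the shorter of D and R.\<close>

lemma powr_H_gap:
  fixes s r p :: real
  assumes p: "0 < p" "p < 1" and rs: "0 < r" "r < s"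
  defines "D \<equiv> (s - r) powr p" and "S \<equiv> s powr p" and "R \<equiv> r powr p"
  shows "4 * S\<^sup>2 * R\<^sup>2 - (S\<^sup>2 + R\<^sup>2 - D\<^sup>2)\<^sup>2 \<ge> 4 * R\<^sup>2 * ((2 - 2 powr p) / 2 * D\<^sup>2)"
proof -
  define k where "k = 2 - 2 powr p"
  have "2 powr p \<le> 2 powr 1" using p by (intro powr_mono) auto
  then have k: "k \<ge> 0" by (simp add: k_def)
  have pos: "D > 0" "S > 0" "R > 0" using rs by (auto simp: D_def S_def R_def)
  have DS: "D \<le> S" "R \<le> S" unfolding D_def S_def R_def using rs p by (auto intro!: powr_mono2)
  have id: "4 * S\<^sup>2 * R\<^sup>2 - (S\<^sup>2 + R\<^sup>2 - D\<^sup>2)\<^sup>2 = ((D - S + R) * (D + S - R)) * ((S + R)\<^sup>2 - D\<^sup>2)"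
    by (simp add: power2_eq_square algebra_simps)
  have "D\<^sup>2 \<le> S\<^sup>2" using DS pos by (intro power_mono) auto
  then have f2: "2 * S * R \<le> (S + R)\<^sup>2 - D\<^sup>2"
    unfolding power2_sum using zero_le_power2[of R] by linarith
  have f3: "D \<le> D + S - R" using DS by simp
  define m where "m = min D R"
  have f1: "k * m \<le> D - S + R"
  proof (cases "s - r \<le> r")
    case True
    have "(s - r + r) powr p \<le> (s - r) powr p + r powr p - k * (s - r) powr p"
      unfolding k_def using rs True p by (intro powr_concave_gap) auto
    moreover have "D \<le> R" unfolding D_def R_def using True rs p by (intro powr_mono2) auto
    ultimately show ?thesis unfolding m_def by (simp add: D_def S_def R_def)
  next
    case False
    have "(r + (s - r)) powr p \<le> r powr p + (s - r) powr p - k * r powr p"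
      unfolding k_def using rs False p by (intro powr_concave_gap) auto
    moreover have "R \<le> D" unfolding D_def R_def using False rs p by (intro powr_mono2) auto
    ultimately show ?thesis unfolding m_def by (simp add: D_def S_def R_def)
  qed
  \<comment> \<open>S is the longest side, so S times the minimum of D and R is at least the product
    of D and R.\<close>
  have "m * S \<ge> R * D"
  proof (cases "D \<le> R")
    case True
    then show ?thesis unfolding m_def using DS pos by (simp add: mult.commute)
  next
    case False
    then show ?thesis unfolding m_def using DS pos by simp
  qed
  then have "(k * D * 2 * R) * (R * D) \<le> (k * D * 2 * R) * (m * S)"
    using k pos by (intro mult_left_mono) auto
  also have "\<dots> = (k * m) * D * (2 * S * R)" by (simp add: mult_ac)
  also have "\<dots> \<le> ((D - S + R) * (D + S - R)) * ((S + R)\<^sup>2 - D\<^sup>2)"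
  proof (intro mult_mono f1 f2 f3)
    have "0 \<le> k * m" using k pos by (simp add: m_def)
    then show "0 \<le> D - S + R" using f1 by linarith
    then show "0 \<le> (D - S + R) * (D + S - R)" using f3 pos by (intro mult_nonneg_nonneg) auto
  qed (use pos in auto)
  finally show ?thesis unfolding id k_def[symmetric] by (simp add: power2_eq_square mult_ac)
qed

section \<open>Local nondeterminism and the second moment of smoothed odd differences\<close>

context fbm_version
begin

text \<open>Half of (1 - H) / H, the exponent \<alpha> at which H * (1 + \<alpha>) reaches the
  critical value 1. The two-point estimate then has the singularity of order (1 + H) / 2 in s - r,
  which is integrable because H < 1.\<close>

definition hol :: real where "hol = (1 - H) / (2 * H)"
definition gapc :: real where "gapc = (2 - 2 powr H) / 2"

lemma hol: "0 < hol" "hol \<le> 1" "H * (1 + hol) = (1 + H) / 2"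
  using H by (auto simp: hol_def field_simps)

lemma gapc_pos: "gapc > 0"
proof -
  have "2 powr H < 2 powr 1" using H by (intro powr_less_mono) auto
  then show ?thesis by (simp add: gapc_def)
qed

text \<open>Local nondeterminism. \<rho> is the regression coefficient of X s on X r, and the
  residual variance is the Gram determinant divided by the variance of X r;
  \<open>powr_H_gap\<close> makes it comparable from below with the variance of the
  increment.\<close>

lemma residual:
  assumes rs: "0 < r" "r < s" "s \<le> T"
  obtains \<rho> where "inner (e s - \<rho> *\<^sub>R e r) (e r) = 0" "gapc * (s - r) powr (2*H) \<le> (norm (e s - \<rho> *\<^sub>R e r))\<^sup>2"
proof -
  define S R D where "S = s powr H" and "R = r powr H" and "D = (s - r) powr H"
  have sq: "x powr (2*H) = (x powr H)\<^sup>2" for x by (simp add: power2_eq_square powr_add[symmetric])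
  have R: "R > 0" using rs by (simp add: R_def)
  have ss: "inner (e s) (e s) = S\<^sup>2" "inner (e r) (e r) = R\<^sup>2" "inner (e s) (e r) = (S\<^sup>2 + R\<^sup>2 - D\<^sup>2) / 2"
    using rs by (auto simp: inner_e cov_def sq S_def R_def D_def)
  define \<rho> where "\<rho> = (S\<^sup>2 + R\<^sup>2 - D\<^sup>2) / 2 / R\<^sup>2"
  have \<rho>R: "\<rho> * R\<^sup>2 = (S\<^sup>2 + R\<^sup>2 - D\<^sup>2) / 2" using R by (simp add: \<rho>_def)
  show ?thesis
  proof (rule that[of \<rho>])
    show o: "inner (e s - \<rho> *\<^sub>R e r) (e r) = 0"
      by (simp add: inner_diff_left ss \<rho>R)
    have "(norm (e s - \<rho> *\<^sub>R e r))\<^sup>2 = inner (e s - \<rho> *\<^sub>R e r) (e s)"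
      unfolding power2_norm_eq_inner using o by (simp add: inner_diff_right)
    also have "\<dots> = S\<^sup>2 - \<rho> * ((S\<^sup>2 + R\<^sup>2 - D\<^sup>2) / 2)" by (simp add: inner_diff_left ss inner_commute[of "e r"])
    finally have n: "(norm (e s - \<rho> *\<^sub>R e r))\<^sup>2 = S\<^sup>2 - \<rho> * ((S\<^sup>2 + R\<^sup>2 - D\<^sup>2) / 2)" .
    have "4 * R\<^sup>2 * (gapc * D\<^sup>2) \<le> 4 * S\<^sup>2 * R\<^sup>2 - (S\<^sup>2 + R\<^sup>2 - D\<^sup>2)\<^sup>2"
      unfolding gapc_def S_def R_def D_def using rs H by (intro powr_H_gap) auto
    also have "\<dots> = 4 * R\<^sup>2 * (S\<^sup>2 - \<rho> * ((S\<^sup>2 + R\<^sup>2 - D\<^sup>2) / 2))"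
    proof -
      have "4 * R\<^sup>2 * (\<rho> * ((S\<^sup>2 + R\<^sup>2 - D\<^sup>2) / 2)) = 4 * (\<rho> * R\<^sup>2) * ((S\<^sup>2 + R\<^sup>2 - D\<^sup>2) / 2)" by simp
      also have "\<dots> = (S\<^sup>2 + R\<^sup>2 - D\<^sup>2)\<^sup>2" unfolding \<rho>R by (simp add: power2_eq_square)
      finally show ?thesis by (simp add: right_diff_distrib)
    qed
    finally show "gapc * (s - r) powr (2*H) \<le> (norm (e s - \<rho> *\<^sub>R e r))\<^sup>2"
      unfolding n sq D_def[symmetric] using R by simp
  qed
qed

text \<open>Difference quotient kernels: integrated against the occupation measure they approximate the
  difference of the weighted local time at \<open>a + y\<close> and \<open>a - y\<close>.\<close>

definition Kd :: "real \<Rightarrow> real \<Rightarrow> real \<Rightarrow> real" where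
  "Kd h y z = (indicator {y..y + h} z - indicator {-y..-y + h} z) / h"

lemma Kd_measurable [measurable]: "Kd h y \<in> borel_measurable borel"
  unfolding Kd_def[abs_def] by measurable

lemma Kd_le: "h > 0 \<Longrightarrow> \<bar>Kd h y z\<bar> \<le> 1 / h"
  unfolding Kd_def by (auto simp: abs_divide intro!: divide_right_mono split: split_indicator)

lemma Kd_nn_integral: "h > 0 \<Longrightarrow> (\<integral>\<^sup>+z. ennreal \<bar>Kd h y (z - a)\<bar> \<partial>lborel) \<le> 2"
proof -
  assume h: "h > 0"
  have "(\<integral>\<^sup>+z. ennreal \<bar>Kd h y (z - a)\<bar> \<partial>lborel) \<le>
      (\<integral>\<^sup>+z. ennreal (1/h) * indicator {a+y..a+y+h} z + ennreal (1/h) * indicator {a-y..a-y+h} z \<partial>lborel)"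
  proof (rule nn_integral_mono)
    fix z
    have "\<bar>Kd h y (z - a)\<bar> \<le> (1/h) * indicator {a+y..a+y+h} z + (1/h) * indicator {a-y..a-y+h} z"
      unfolding Kd_def using h by (auto simp: abs_divide diff_divide_distrib split: split_indicator)
    then have "ennreal \<bar>Kd h y (z - a)\<bar> \<le> ennreal ((1/h) * indicator {a+y..a+y+h} z + (1/h) * indicator {a-y..a-y+h} z)"
      by (rule ennreal_leI)
    also have "\<dots> = ennreal (1/h) * indicator {a+y..a+y+h} z + ennreal (1/h) * indicator {a-y..a-y+h} z"
      using h by (cases "z \<in> {a+y..a+y+h}"; cases "z \<in> {a-y..a-y+h}") (simp_all flip: ennreal_plus)
    finally show "ennreal \<bar>Kd h y (z - a)\<bar> \<le> ennreal (1/h) * indicator {a+y..a+y+h} z + ennreal (1/h) * indicator {a-y..a-y+h} z" .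
  qed
  also have "\<dots> = ennreal (1/h) * ennreal h + ennreal (1/h) * ennreal h"
    using h by (subst nn_integral_add) (auto simp: nn_integral_cmult_indicator)
  also have "\<dots> = 2" using h by (simp add: ennreal_mult[symmetric])
  finally show ?thesis .
qed

text \<open>After a translation both windows become [0,h], and the integrand is a difference of the
  density at points 2 * y apart. Division by h makes the bound independent of the window
  length.\<close>

lemma Kd_normal:
  assumes h: "h > 0" and y: "y \<ge> 0" and \<sigma>: "\<sigma> > 0"
  shows "\<bar>\<integral>z. normal_density 0 \<sigma> z * Kd h y (m + z) \<partial>lborel\<bar> \<le> (1 / \<sigma>) * (2 * y / \<sigma>) powr hol"
proof -
  let ?p = "normal_density 0 \<sigma>"
  have pc: "continuous_on A ?p" for A
    using normal_density_deriv[OF \<sigma>] by (meson DERIV_isCont continuous_at_imp_continuous_on)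
  have i: "integrable lborel (\<lambda>w. indicator {0..h} w * ?p (c + w))" for c
  proof -
    have "set_integrable lborel {0..h} (\<lambda>w. ?p (c + w))"
      by (intro borel_integrable_atLeastAtMost' continuous_on_compose2[OF pc[of UNIV]] continuous_intros) auto
    then show ?thesis by (simp add: set_integrable_def)
  qed
  have shift: "(\<integral>z. ?p z * indicator {c..c+h} (m + z) \<partial>lborel) = (\<integral>w. indicator {0..h} w * ?p ((c - m) + w) \<partial>lborel)" for c
    by (subst lborel_integral_real_affine[where c=1 and t="c - m"])
      (auto intro!: Bochner_Integration.integral_cong split: split_indicator)
  have iz: "integrable lborel (\<lambda>z. ?p z * indicator {c..c+h} (m + z))" for c
    by (rule Bochner_Integration.integrable_bound[OF integrable_normal_density[OF \<sigma>]])
      (auto split: split_indicator)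
  let ?d = "\<lambda>w. indicator {0..h} w * ?p ((y - m) + w) - indicator {0..h} w * ?p ((- y - m) + w)"
  have "(\<integral>z. ?p z * Kd h y (m + z) \<partial>lborel) = (\<integral>z. (?p z * indicator {y..y+h} (m + z) - ?p z * indicator {-y..-y+h} (m + z)) / h \<partial>lborel)"
    by (simp add: Kd_def right_diff_distrib)
  also have "\<dots> = ((\<integral>w. indicator {0..h} w * ?p ((y - m) + w) \<partial>lborel) - (\<integral>w. indicator {0..h} w * ?p ((- y - m) + w) \<partial>lborel)) / h"
    using iz[of y] iz[of "-y"] by (simp add: shift[symmetric])
  also have "\<dots> = (\<integral>w. ?d w \<partial>lborel) / h"
    using i by simp
  finally have eq: "(\<integral>z. ?p z * Kd h y (m + z) \<partial>lborel) = (\<integral>w. ?d w \<partial>lborel) / h" .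
  define Q where "Q = (1 / \<sigma>) * (2 * y / \<sigma>) powr hol"
  have Q: "Q \<ge> 0" using \<sigma> by (simp add: Q_def)
  have "\<bar>\<integral>w. ?d w \<partial>lborel\<bar> \<le>
     (\<integral>w. \<bar>?d w\<bar> \<partial>lborel)"
    by (rule integral_abs_bound)
  also have "\<dots> \<le> (\<integral>w. Q * indicator {0..h} w \<partial>lborel)"
  proof (rule integral_mono)
    show "integrable lborel (\<lambda>w. \<bar>?d w\<bar>)"
      by (intro integrable_abs Bochner_Integration.integrable_diff i)
    show "integrable lborel (\<lambda>w. Q * indicator {0..h} w)" using h by simp
    fix w
    have "\<bar>?p ((y - m) + w) - ?p ((- y - m) + w)\<bar> \<le> (1 / \<sigma>) * (\<bar>((y - m) + w) - ((- y - m) + w)\<bar> / \<sigma>) powr hol"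
      using hol by (intro normal_density_holder \<sigma>) auto
    also have "\<dots> = Q" using y by (simp add: Q_def)
    finally show "\<bar>?d w\<bar> \<le> Q * indicator {0..h} w"
      by (auto split: split_indicator)
  qed
  also have "\<dots> = Q * h" using h by simp
  finally show ?thesis unfolding eq Q_def[symmetric] using h by (simp add: abs_divide divide_le_eq)
qed

text \<open>Given X r, the value X s is Gaussian with deviation at least \<open>\<sigma>0\<close>,
  so \<open>Kd_normal\<close> bounds the conditional expectation of the second factor uniformly. The
  first factor contributes the mean of its modulus, at most 2 * r powr (-H) by the density
  bound.\<close>

lemma Kd_two_point:
  assumes rs: "0 < r" "r < s" "s \<le> T" and h: "h > 0" and y: "y \<ge> 0"
  shows "\<bar>expectation (\<lambda>\<omega>. Kd h y (X r \<omega> - a) * Kd h y (X s \<omega> - a))\<bar> \<le>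
    2 * gapc powr (- (1 + hol) / 2) * (2 * y) powr hol * (s - r) powr (- (1 + H) / 2) * r powr (-H)"
proof -
  obtain \<rho> where o: "inner (e s - \<rho> *\<^sub>R e r) (e r) = 0" and gap: "gapc * (s - r) powr (2*H) \<le> (norm (e s - \<rho> *\<^sub>R e r))\<^sup>2"
    using residual[OF rs] by blast
  define \<eta> where "\<eta> = e s - \<rho> *\<^sub>R e r"
  define \<sigma> where "\<sigma> = norm \<eta>"
  define \<sigma>0 where "\<sigma>0 = sqrt gapc * (s - r) powr H"
  have \<sigma>0: "\<sigma>0 > 0" using rs gapc_pos by (simp add: \<sigma>0_def)
  have "\<sigma>0\<^sup>2 = gapc * (s - r) powr (2*H)"
    using gapc_pos by (simp add: \<sigma>0_def power_mult_distrib power2_eq_square[of "_ powr _"] powr_add[symmetric])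
  then have "\<sigma>0\<^sup>2 \<le> \<sigma>\<^sup>2" using gap by (simp add: \<sigma>_def \<eta>_def)
  then have \<sigma>\<sigma>0: "\<sigma>0 \<le> \<sigma>" by (rule power2_le_imp_le) (simp add: \<sigma>_def)
  then have \<sigma>: "\<sigma> > 0" using \<sigma>0 by simp
  then have \<eta>0: "\<eta> \<noteq> 0" by (auto simp: \<sigma>_def)
  define Q where "Q = (1 / \<sigma>0) * (2 * y / \<sigma>0) powr hol"
  have Q0: "Q \<ge> 0" using \<sigma>0 by (simp add: Q_def)
  have QQ: "(1 / \<sigma>) * (2 * y / \<sigma>) powr hol \<le> Q"
    unfolding Q_def using \<sigma>\<sigma>0 \<sigma>0 y hol by (intro mult_mono powr_mono2 frac_le) auto
  let ?K = "Kd h y"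
  have ae: "AE \<omega> in M. ?K (X r \<omega> - a) * ?K (X s \<omega> - a) = ?K (W (e r) \<omega> - a) * ?K ((\<rho> * W (e r) \<omega> - a) + W \<eta> \<omega>)"
  proof -
    have "AE \<omega> in M. W (e r) \<omega> = X r \<omega>" "AE \<omega> in M. W (e s) \<omega> = X s \<omega>"
      using rs by (auto intro!: W_e_X)
    moreover have "AE \<omega> in M. W \<eta> \<omega> = W (e s) \<omega> - \<rho> * W (e r) \<omega>"
      using W_linear[of 1 "e s" "- \<rho>" "e r"] by (simp add: \<eta>_def)
    ultimately show ?thesis by eventually_elim (simp add: algebra_simps)
  qed
  define P where "P = distr M borel (W \<eta>)"
  \<comment> \<open>\<open>W_joint_distr\<close> speaks about sequences; the constant sequence turns
    it into a statement about a pair.\<close>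
  define R where "R = distr M seq_borel (\<lambda>\<omega> i::nat. W (e r) \<omega>)"
  have joint: "P \<Otimes>\<^sub>M R = distr M (borel \<Otimes>\<^sub>M seq_borel) (\<lambda>\<omega>. (W \<eta> \<omega>, \<lambda>i::nat. W (e r) \<omega>))"
    unfolding P_def R_def using o by (intro W_joint_distr) (simp add: \<eta>_def inner_commute)
  interpret P: prob_space P unfolding P_def by (rule prob_space_distr) simp
  interpret R: prob_space R unfolding R_def by (rule prob_space_distr) simp
  interpret PR: pair_prob_space P R ..
  let ?N = "\<lambda>x. \<integral>n. normal_density 0 \<sigma> n * ?K ((\<rho> * x 0 - a) + n) \<partial>lborel"
  define F :: "real \<times> (nat \<Rightarrow> real) \<Rightarrow> real" where "F = (\<lambda>(n, x). ?K (x 0 - a) * ?K ((\<rho> * x 0 - a) + n))"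
  have Fm [measurable]: "F \<in> borel_measurable (borel \<Otimes>\<^sub>M seq_borel)"
    unfolding F_def by measurable
  have Fm': "F \<in> borel_measurable (P \<Otimes>\<^sub>M R)"
    using Fm by (simp add: P_def R_def cong: measurable_cong_sets sets_pair_measure_cong)
  have Fb: "\<bar>F z\<bar> \<le> (1/h) * (1/h)" for z
    unfolding F_def case_prod_unfold abs_mult using h by (intro mult_mono Kd_le) auto
  have Fi: "integrable (P \<Otimes>\<^sub>M R) F"
    using Fb by (intro PR.P.integrable_const_bound[where B="(1/h) * (1/h)"] Fm') auto
  have "expectation (\<lambda>\<omega>. ?K (X r \<omega> - a) * ?K (X s \<omega> - a)) = expectation (\<lambda>\<omega>. F (W \<eta> \<omega>, \<lambda>i. W (e r) \<omega>))"
    using ae by (intro integral_cong_AE) (auto simp: F_def)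
  also have "\<dots> = (\<integral>z. F z \<partial>(P \<Otimes>\<^sub>M R))"
    unfolding joint by (subst integral_distr) auto
  also have "\<dots> = (\<integral>x. (\<integral>n. F (n, x) \<partial>P) \<partial>R)"
    using Fi by (subst PR.integral_snd[where f="\<lambda>n x. F (n, x)"]) simp_all
  also have "\<dots> = (\<integral>x. ?K (x 0 - a) * ?N x \<partial>R)"
  proof (rule Bochner_Integration.integral_cong[OF refl])
    fix x :: "nat \<Rightarrow> real"
    have "(\<integral>n. F (n, x) \<partial>P) = ?K (x 0 - a) * (\<integral>n. ?K ((\<rho> * x 0 - a) + n) \<partial>P)" by (simp add: F_def)
    also have "(\<integral>n. ?K ((\<rho> * x 0 - a) + n) \<partial>P) = ?N x"
      unfolding P_def W_distr[OF \<eta>0] \<sigma>_def by (subst integral_density) auto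
    finally show "(\<integral>n. F (n, x) \<partial>P) = ?K (x 0 - a) * ?N x" .
  qed
  finally have eq: "expectation (\<lambda>\<omega>. ?K (X r \<omega> - a) * ?K (X s \<omega> - a)) =
     (\<integral>x. ?K (x 0 - a) * ?N x \<partial>R)" .
  have Kx [measurable]: "(\<lambda>x. ?K (x 0 - a)) \<in> borel_measurable R"
    unfolding R_def by simp
  have Ki: "integrable R (\<lambda>x. Q * \<bar>?K (x 0 - a)\<bar>)"
    using Kd_le[OF h] by (intro integrable_mult_right integrable_abs R.integrable_const_bound[where B="1/h"]) auto
  have "\<bar>expectation (\<lambda>\<omega>. ?K (X r \<omega> - a) * ?K (X s \<omega> - a))\<bar> \<le> (\<integral>x. Q * \<bar>?K (x 0 - a)\<bar> \<partial>R)"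
    unfolding eq
  proof (rule integral_norm_bound_integral[where 'a=real, unfolded real_norm_def] | rule order_trans[OF integral_abs_bound])
    show "(\<integral>x. \<bar>?K (x 0 - a) * ?N x\<bar> \<partial>R) \<le> (\<integral>x. Q * \<bar>?K (x 0 - a)\<bar> \<partial>R)"
    proof (rule integral_mono')
      fix x :: "nat \<Rightarrow> real"
      have "\<bar>?N x\<bar> \<le> Q"
        using Kd_normal[OF h y \<sigma>, of "\<rho> * x 0 - a"] QQ by linarith
      then show "\<bar>?K (x 0 - a) * ?N x\<bar> \<le> Q * \<bar>?K (x 0 - a)\<bar>"
        unfolding abs_mult by (subst mult.commute) (intro mult_right_mono, auto)
    qed (use Ki Q0 in auto)
  qed
  also have "\<dots> = Q * (\<integral>x. \<bar>?K (x 0 - a)\<bar> \<partial>R)" by simp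
  also have "(\<integral>x. \<bar>?K (x 0 - a)\<bar> \<partial>R) = expectation (\<lambda>\<omega>. \<bar>?K (W (e r) \<omega> - a)\<bar>)"
    unfolding R_def by (subst integral_distr) auto
  also have "\<dots> = expectation (\<lambda>\<omega>. \<bar>?K (X r \<omega> - a)\<bar>)"
    using W_e_X[of r] rs by (intro integral_cong_AE) auto
  also have "\<dots> \<le> 2 * r powr (-H)"
  proof -
    have i: "integrable M (\<lambda>\<omega>. \<bar>?K (X r \<omega> - a)\<bar>)"
      using Kd_le[OF h] by (intro integrable_abs integrable_const_bound[where B="1/h"]) auto
    have "ennreal (expectation (\<lambda>\<omega>. \<bar>?K (X r \<omega> - a)\<bar>)) = (\<integral>\<^sup>+\<omega>. ennreal \<bar>?K (X r \<omega> - a)\<bar> \<partial>M)"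
      using i by (intro nn_integral_eq_integral[symmetric]) auto
    also have "\<dots> \<le> ennreal (r powr (-H)) * (\<integral>\<^sup>+z. ennreal \<bar>?K (z - a)\<bar> \<partial>lborel)"
      using rs by (intro X_density_le) auto
    also have "\<dots> \<le> ennreal (r powr (-H)) * 2" by (intro mult_left_mono Kd_nn_integral h) simp
    also have "\<dots> = ennreal (2 * r powr (-H))" by (simp add: ennreal_mult mult.commute)
    finally show ?thesis by (subst (asm) ennreal_le_iff) auto
  qed
  finally have "\<bar>expectation (\<lambda>\<omega>. ?K (X r \<omega> - a) * ?K (X s \<omega> - a))\<bar> \<le> Q * (2 * r powr (-H))"
    using Q0 by (simp add: mult_left_mono)
  also have "Q = gapc powr (- (1 + hol) / 2) * (2 * y) powr hol * (s - r) powr (- (1 + H) / 2)"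
  proof -
    have "Q = (2 * y) powr hol * \<sigma>0 powr (- (1 + hol))"
    proof -
      have "\<sigma>0 powr (- (1 + hol)) = 1 / \<sigma>0 powr (1 + hol)" by (rule powr_minus_divide)
      also have "\<sigma>0 powr (1 + hol) = \<sigma>0 * \<sigma>0 powr hol" using \<sigma>0 by (simp add: powr_add)
      finally have "\<sigma>0 powr (- (1 + hol)) = 1 / (\<sigma>0 * \<sigma>0 powr hol)" .
      moreover have "(2 * y / \<sigma>0) powr hol = (2 * y) powr hol / \<sigma>0 powr hol"
        using \<sigma>0 y by (intro powr_divide)
      ultimately show ?thesis unfolding Q_def by simp
    qed
    also have "\<sigma>0 powr (- (1 + hol)) = (sqrt gapc) powr (- (1 + hol)) * ((s - r) powr H) powr (- (1 + hol))"
      unfolding \<sigma>0_def by (rule powr_mult)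
    also have "(sqrt gapc) powr (- (1 + hol)) = gapc powr (- (1 + hol) / 2)"
      using gapc_pos by (simp add: powr_half_sqrt[symmetric] powr_powr)
    also have "((s - r) powr H) powr (- (1 + hol)) = (s - r) powr (- (1 + H) / 2)"
    proof -
      have "H * (- (1 + hol)) = - (1 + H) / 2" unfolding mult_minus_right hol(3) by (rule minus_divide_left)
      then show ?thesis unfolding powr_powr by (simp only:)
    qed
    finally show ?thesis by (simp add: mult_ac)
  qed
  finally show ?thesis by (simp add: mult_ac)
qed

definition wt :: "real \<Rightarrow> real \<Rightarrow> real" where
  "wt t s = indicator {0..t} s * (2*H * s powr (2*H-1))"

lemma wt_measurable [measurable]: "wt t \<in> borel_measurable borel"
  unfolding wt_def[abs_def] by measurable

lemma wt_bounds: "t \<le> T \<Longrightarrow> 0 \<le> wt t s \<and> wt t s \<le> CH * indicator {0..T} s"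
  unfolding wt_def CH_def using H by (auto split: split_indicator intro!: mult_left_mono powr_mono2)

text \<open>The two-point bound symmetrized in s and r, so that one majorant serves both orders of
  the two times.\<close>

abbreviation corr :: "real \<Rightarrow> real \<Rightarrow> real" where
  "corr s r \<equiv> \<bar>s - r\<bar> powr (- (1 + H) / 2) * (r powr (-H) + s powr (-H))"

definition CK :: ennreal where
  "CK = (\<integral>\<^sup>+s. \<integral>\<^sup>+r. ennreal (indicator {0..T} s * indicator {0..T} r * corr s r) \<partial>lborel \<partial>lborel)"

text \<open>Both singularities, of orders (1 + H) / 2 on the diagonal and H at time 0, are
  integrable because H < 1; by symmetry one of the two summands suffices.\<close>

lemma CK_finite: "CK < \<infinity>"
proof -
  define p where "p = - (1 + H) / 2"
  have p: "p > -1" using H by (simp add: p_def)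
  define F where "F s r = ennreal (indicator {0..T} s * s powr (-H)) * ennreal (indicator {0..T} r * \<bar>r - s\<bar> powr p)" for s r
  define KB where "KB = 2 * T powr (p+1) / (p+1)"
  have Fm: "(\<lambda>(s, r). F s r) \<in> borel_measurable (lborel \<Otimes>\<^sub>M lborel)"
    unfolding F_def by measurable
  have Fm1 [measurable]: "F s \<in> borel_measurable lborel" for s
    unfolding F_def by measurable
  have Fm2 [measurable]: "(\<lambda>s. F s r) \<in> borel_measurable lborel" for r
    unfolding F_def by measurable
  have inner_le: "(\<integral>\<^sup>+r. F s r \<partial>lborel) \<le> ennreal KB * ennreal (indicator {0..T} s * \<bar>s - 0\<bar> powr (-H))" for s
  proof (cases "s \<in> {0..T}")
    case True
    have "(\<integral>\<^sup>+r. ennreal (indicator {0..T} r * \<bar>r - s\<bar> powr p) \<partial>lborel) =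
        ennreal ((sgn (T - s) * \<bar>T - s\<bar> powr (p+1) - sgn (0 - s) * \<bar>0 - s\<bar> powr (p+1)) / (p+1))"
      using T by (intro nn_integral_abs_powr p) auto
    also have "\<dots> \<le> ennreal KB"
    proof (intro ennreal_leI)
      have "sgn (T - s) * \<bar>T - s\<bar> powr (p+1) \<le> T powr (p+1)"
        using True p by (cases "T = s") (auto simp: sgn_if intro!: powr_mono2)
      moreover have "- (sgn (0 - s) * \<bar>0 - s\<bar> powr (p+1)) \<le> T powr (p+1)"
        using True p by (cases "s = 0") (auto simp: sgn_if intro!: powr_mono2)
      ultimately have "sgn (T - s) * \<bar>T - s\<bar> powr (p+1) - sgn (0 - s) * \<bar>0 - s\<bar> powr (p+1) \<le> 2 * T powr (p+1)"
        by linarith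
      then show "(sgn (T - s) * \<bar>T - s\<bar> powr (p+1) - sgn (0 - s) * \<bar>0 - s\<bar> powr (p+1)) / (p+1) \<le> KB"
        unfolding KB_def using p by (intro divide_right_mono) auto
    qed
    finally have le: "(\<integral>\<^sup>+r. ennreal (indicator {0..T} r * \<bar>r - s\<bar> powr p) \<partial>lborel) \<le> ennreal KB" .
    have "(\<integral>\<^sup>+r. F s r \<partial>lborel) = ennreal (indicator {0..T} s * s powr (-H)) * (\<integral>\<^sup>+r. ennreal (indicator {0..T} r * \<bar>r - s\<bar> powr p) \<partial>lborel)"
      unfolding F_def by (rule nn_integral_cmult) measurable
    also have "\<dots> \<le> ennreal (indicator {0..T} s * s powr (-H)) * ennreal KB" by (intro mult_left_mono le) simp
    finally show ?thesis using True by (simp add: mult.commute)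
  qed (simp add: F_def)
  have half: "(\<integral>\<^sup>+s. \<integral>\<^sup>+r. F s r \<partial>lborel \<partial>lborel) < \<infinity>"
  proof -
    have "(\<integral>\<^sup>+s. \<integral>\<^sup>+r. F s r \<partial>lborel \<partial>lborel) \<le> (\<integral>\<^sup>+s. ennreal KB * ennreal (indicator {0..T} s * \<bar>s - 0\<bar> powr (-H)) \<partial>lborel)"
      by (intro nn_integral_mono inner_le)
    also have "\<dots> = ennreal KB * (\<integral>\<^sup>+s. ennreal (indicator {0..T} s * \<bar>s - 0\<bar> powr (-H)) \<partial>lborel)"
      by (rule nn_integral_cmult) measurable
    also have "\<dots> < \<infinity>" using T H by (subst nn_integral_abs_powr) (auto simp: ennreal_mult_less_top)
    finally show ?thesis .
  qed
  have swap: "(\<integral>\<^sup>+s. \<integral>\<^sup>+r. F r s \<partial>lborel \<partial>lborel) = (\<integral>\<^sup>+s. \<integral>\<^sup>+r. F s r \<partial>lborel \<partial>lborel)"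
    using lborel_pair.Fubini'[OF Fm] by simp
  have "CK = (\<integral>\<^sup>+s. \<integral>\<^sup>+r. F r s + F s r \<partial>lborel \<partial>lborel)"
    unfolding CK_def p_def[symmetric]
  proof (intro nn_integral_cong)
    fix s r :: real
    show "ennreal (indicator {0..T} s * indicator {0..T} r * (\<bar>s - r\<bar> powr p * (r powr (-H) + s powr (-H)))) = F r s + F s r"
      unfolding F_def by (cases "s \<in> {0..T}"; cases "r \<in> {0..T}")
        (simp_all add: ennreal_mult[symmetric] ennreal_plus[symmetric] abs_minus_commute algebra_simps del: ennreal_plus)
  qed
  also have "\<dots> = (\<integral>\<^sup>+s. (\<integral>\<^sup>+r. F r s \<partial>lborel) + (\<integral>\<^sup>+r. F s r \<partial>lborel) \<partial>lborel)"
    by (intro nn_integral_cong nn_integral_add Fm1 Fm2)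
  also have "\<dots> = (\<integral>\<^sup>+s. \<integral>\<^sup>+r. F r s \<partial>lborel \<partial>lborel) + (\<integral>\<^sup>+s. \<integral>\<^sup>+r. F s r \<partial>lborel \<partial>lborel)"
  proof (rule nn_integral_add)
    show "(\<lambda>s. \<integral>\<^sup>+r. F s r \<partial>lborel) \<in> borel_measurable lborel" unfolding F_def by measurable
    show "(\<lambda>s. \<integral>\<^sup>+r. F r s \<partial>lborel) \<in> borel_measurable lborel" unfolding F_def by measurable
  qed
  also have "\<dots> < \<infinity>" unfolding swap using half by simp
  finally show ?thesis .
qed

definition Ih :: "real \<Rightarrow> real \<Rightarrow> real \<Rightarrow> real \<Rightarrow> 'a \<Rightarrow> real" where
  "Ih t a h y \<omega> = (LINT s|lborel. wt t s * Kd h y (X s \<omega> - a))"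

definition A0 :: real where "A0 = 2 * gapc powr (- (1 + hol) / 2)"

lemma A0_nonneg: "A0 \<ge> 0" by (simp add: A0_def)

lemma Kd_two_point_sym:
  assumes s: "0 < s" "s \<le> T" and r: "0 < r" "r \<le> T" and sr: "s \<noteq> r" and h: "h > 0" and y: "y \<ge> 0"
  shows "\<bar>expectation (\<lambda>\<omega>. Kd h y (X s \<omega> - a) * Kd h y (X r \<omega> - a))\<bar> \<le>
    A0 * (2 * y) powr hol * corr s r"
proof -
  have gen: "\<bar>expectation (\<lambda>\<omega>. Kd h y (X r \<omega> - a) * Kd h y (X s \<omega> - a))\<bar> \<le>
    A0 * (2 * y) powr hol * corr s r"
    if "0 < r" "r < s" "s \<le> T" for r s
  proof -
    have "\<bar>expectation (\<lambda>\<omega>. Kd h y (X r \<omega> - a) * Kd h y (X s \<omega> - a))\<bar> \<le> A0 * (2 * y) powr hol * ((s - r) powr (- (1 + H) / 2) * r powr (-H))"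
      using Kd_two_point[OF that h y, of a] by (simp add: A0_def mult_ac)
    also have "\<dots> \<le> A0 * (2 * y) powr hol * corr s r"
      using that A0_nonneg by (intro mult_left_mono mult_nonneg_nonneg) auto
    finally show ?thesis .
  qed
  show ?thesis
  proof (cases "r < s")
    case True
    then show ?thesis using gen[of r s] s r by (simp add: mult.commute)
  next
    case False
    then have "s < r" using sr by simp
    then show ?thesis using gen[of s r] s r by (simp add: abs_minus_commute add.commute)
  qed
qed

text \<open>The square is opened by applying Fubini twice, against the integral itself and against
  the integrand at a fixed time. Moduli are taken only outside the expectation, since the smallness
  in y comes from cancellation inside it.\<close>

lemma Ih_second_moment:
  assumes t: "0 \<le> t" "t \<le> T" and h: "h > 0" and y: "y \<ge> 0"
  shows "L2sq M (Ih t a h y) \<le> ennreal (CH * CH * (A0 * (2 * y) powr hol)) * CK"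
proof -
  interpret LM: pair_sigma_finite lborel M ..
  define g where "g s \<omega> = wt t s * Kd h y (X s \<omega> - a)" for s \<omega>
  define Kb where "Kb = CH * (1 / h)"
  have Kb: "Kb \<ge> 0" using CH_pos h by (simp add: Kb_def)
  have gm: "(\<lambda>(s, \<omega>). g s \<omega>) \<in> borel_measurable (lborel \<Otimes>\<^sub>M M)" unfolding g_def by measurable
  have gm1 [measurable]: "g s \<in> borel_measurable M" for s unfolding g_def by measurable
  have gm2 [measurable]: "(\<lambda>s. g s \<omega>) \<in> borel_measurable borel" for \<omega> unfolding g_def by measurable
  have gb: "\<bar>g s \<omega>\<bar> \<le> Kb * indicator {0..T} s" for s \<omega>
  proof -
    have "\<bar>g s \<omega>\<bar> \<le> (CH * indicator {0..T} s) * (1 / h)"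
      unfolding g_def abs_mult using wt_bounds[OF t(2), of s] Kd_le[OF h, of y "X s \<omega> - a"] CH_pos by (intro mult_mono) auto
    then show ?thesis by (simp add: Kb_def mult_ac)
  qed
  have ind_i: "integrable lborel (\<lambda>s. Kb * indicator {0..T} s :: real)" using T by simp
  have gi: "integrable lborel (\<lambda>s. g s \<omega>)" for \<omega>
    by (rule Bochner_Integration.integrable_bound[OF ind_i]) (use gb Kb in \<open>auto simp: abs_mult\<close>)
  let ?I = "Ih t a h y"
  have I: "?I \<omega> = (LINT s|lborel. g s \<omega>)" for \<omega> by (simp add: Ih_def g_def)
  have Im [measurable]: "?I \<in> borel_measurable M"
  proof -
    have "(\<lambda>(\<omega>, s). g s \<omega>) \<in> borel_measurable (M \<Otimes>\<^sub>M lborel)" unfolding g_def by measurable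
    then show ?thesis unfolding I[abs_def] by (rule lborel.borel_measurable_lebesgue_integral)
  qed
  have Ib: "\<bar>?I \<omega>\<bar> \<le> Kb * T" for \<omega>
  proof -
    have "\<bar>?I \<omega>\<bar> \<le> (LINT s|lborel. \<bar>g s \<omega>\<bar>)" unfolding I by (rule integral_abs_bound)
    also have "\<dots> \<le> (LINT s|lborel. Kb * indicator {0..T} s)"
      using gi gb by (intro integral_mono ind_i integrable_abs) auto
    finally show ?thesis using T by simp
  qed
  \<comment> \<open>Joint integrability for Fubini: both factors are bounded and the time is
    confined to [0,T].\<close>
  have prod_i: "integrable (lborel \<Otimes>\<^sub>M M) (case_prod (\<lambda>s \<omega>. g s \<omega> * f \<omega>))"
    if [measurable]: "f \<in> borel_measurable M" and fb: "\<And>\<omega>. \<bar>f \<omega>\<bar> \<le> c" for f c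
  proof (rule integrableI_bounded)
    note gm[measurable]
    show "(\<lambda>(s, \<omega>). g s \<omega> * f \<omega>) \<in> borel_measurable (lborel \<Otimes>\<^sub>M M)" by measurable
    have "0 \<le> \<bar>f undefined\<bar>" by simp
    then have c: "c \<ge> 0" using fb[of undefined] by linarith
    have "(\<integral>\<^sup>+z. ennreal (norm (case z of (s, \<omega>) \<Rightarrow> g s \<omega> * f \<omega>)) \<partial>(lborel \<Otimes>\<^sub>M M)) \<le>
        (\<integral>\<^sup>+z. ennreal (Kb * c) * indicator ({0..T} \<times> space M) z \<partial>(lborel \<Otimes>\<^sub>M M))"
    proof (rule nn_integral_mono)
      fix z :: "real \<times> 'a" assume "z \<in> space (lborel \<Otimes>\<^sub>M M)"
      then obtain s \<omega> where z: "z = (s, \<omega>)" "\<omega> \<in> space M" by (auto simp: space_pair_measure)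
      have "\<bar>g s \<omega> * f \<omega>\<bar> \<le> (Kb * indicator {0..T} s) * c"
        unfolding abs_mult using gb fb Kb by (intro mult_mono) auto
      then show "ennreal (norm (case z of (s, \<omega>) \<Rightarrow> g s \<omega> * f \<omega>)) \<le> ennreal (Kb * c) * indicator ({0..T} \<times> space M) z"
        using z by (cases "s \<in> {0..T}") (auto simp: ennreal_leI)
    qed
    also have "\<dots> = ennreal (Kb * c) * (emeasure lborel {0..T} * emeasure M (space M))"
      by (subst nn_integral_cmult_indicator) (auto simp: emeasure_pair_measure_Times)
    also have "\<dots> < \<infinity>" using T by (simp add: emeasure_space_1 ennreal_mult_less_top)
    finally show "(\<integral>\<^sup>+z. ennreal (norm (case z of (s, \<omega>) \<Rightarrow> g s \<omega> * f \<omega>)) \<partial>(lborel \<Otimes>\<^sub>M M)) < \<infinity>" .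
  qed
  have EI: "expectation (\<lambda>\<omega>. ?I \<omega> * f \<omega>) = (LINT s|lborel. expectation (\<lambda>\<omega>. g s \<omega> * f \<omega>))"
    if "f \<in> borel_measurable M" "\<And>\<omega>. \<bar>f \<omega>\<bar> \<le> c" for f c
  proof -
    have "expectation (\<lambda>\<omega>. ?I \<omega> * f \<omega>) = expectation (\<lambda>\<omega>. LINT s|lborel. g s \<omega> * f \<omega>)"
      by (simp add: I)
    also have "\<dots> = (LINT s|lborel. expectation (\<lambda>\<omega>. g s \<omega> * f \<omega>))"
      by (rule LM.Fubini_integral[OF prod_i[OF that]])
    finally show ?thesis .
  qed
  \<comment> \<open>This holds for every F, since the integral of a nonintegrable function is 0 by
    convention.\<close>
  have norm_le: "ennreal \<bar>LINT s|lborel. F s\<bar> \<le> (\<integral>\<^sup>+s. ennreal \<bar>F s\<bar> \<partial>lborel)" for F :: "real \<Rightarrow> real"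
    using integral_norm_bound_ennreal[of lborel F] by (cases "integrable lborel F") (auto simp: not_integrable_integral_eq)
  let ?E = "\<lambda>r s. expectation (\<lambda>\<omega>. g r \<omega> * g s \<omega>)" and ?C = "CH * CH * (A0 * (2 * y) powr hol)"
  have "L2sq M (\<lambda>\<omega>. ?I \<omega>) = ennreal (expectation (\<lambda>\<omega>. (?I \<omega>)\<^sup>2))"
  proof (rule nn_integral_eq_integral)
    have "\<bar>?I \<omega>\<bar>\<^sup>2 \<le> (Kb * T)\<^sup>2" for \<omega> by (intro power_mono Ib) auto
    then show "integrable M (\<lambda>\<omega>. (?I \<omega>)\<^sup>2)" by (intro integrable_const_bound[where B="(Kb * T)\<^sup>2"]) auto
  qed auto
  also have "expectation (\<lambda>\<omega>. (?I \<omega>)\<^sup>2) = (LINT s|lborel. expectation (\<lambda>\<omega>. g s \<omega> * ?I \<omega>))"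
    unfolding power2_eq_square by (rule EI[OF Im Ib])
  also have "\<dots> = (LINT s|lborel. expectation (\<lambda>\<omega>. ?I \<omega> * g s \<omega>))" by (simp add: mult.commute)
  also have "\<dots> = (LINT s|lborel. LINT r|lborel. ?E r s)"
  proof (intro Bochner_Integration.integral_cong refl EI)
    fix s :: real and \<omega> :: 'a
    have "Kb * indicator {0..T} s \<le> Kb" using Kb by (auto split: split_indicator)
    then show "\<bar>g s \<omega>\<bar> \<le> Kb" using gb[of s \<omega>] by linarith
  qed simp
  also have "ennreal \<dots> \<le> ennreal \<bar>\<dots>\<bar>" by (intro ennreal_leI) simp
  also have "\<dots> \<le> (\<integral>\<^sup>+s. ennreal \<bar>LINT r|lborel. ?E r s\<bar> \<partial>lborel)" by (rule norm_le)
  also have "\<dots> \<le> (\<integral>\<^sup>+s. \<integral>\<^sup>+r. ennreal \<bar>?E r s\<bar> \<partial>lborel \<partial>lborel)"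
    by (intro nn_integral_mono norm_le)
  also have "\<dots> \<le> (\<integral>\<^sup>+s. \<integral>\<^sup>+r. ennreal ?C * ennreal (indicator {0..T} s * indicator {0..T} r * corr s r) \<partial>lborel \<partial>lborel)"
  proof (rule nn_integral_mono_AE)
    have "AE s::real in lborel. s \<noteq> 0" by (rule AE_lborel_singleton)
    then show "AE s in lborel. (\<integral>\<^sup>+r. ennreal \<bar>?E r s\<bar> \<partial>lborel) \<le>
       (\<integral>\<^sup>+r. ennreal ?C * ennreal (indicator {0..T} s * indicator {0..T} r * corr s r) \<partial>lborel)"
    proof eventually_elim
      case (elim s)
      show ?case
      proof (rule nn_integral_mono_AE)
        have "AE r::real in lborel. r \<noteq> 0" "AE r in lborel. r \<noteq> s" by (rule AE_lborel_singleton)+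
        then show "AE r in lborel. ennreal \<bar>?E r s\<bar> \<le>
          ennreal ?C * ennreal (indicator {0..T} s * indicator {0..T} r * corr s r)"
        proof eventually_elim
          case (elim r)
          have eq: "?E r s = (wt t r * wt t s) * expectation (\<lambda>\<omega>. Kd h y (X s \<omega> - a) * Kd h y (X r \<omega> - a))"
            unfolding g_def by (subst integral_mult_right_zero[symmetric]) (intro Bochner_Integration.integral_cong refl, simp add: mult_ac)
          show ?case
          proof (cases "s \<in> {0..T} \<and> r \<in> {0..T}")
            case True
            then have "\<bar>expectation (\<lambda>\<omega>. Kd h y (X s \<omega> - a) * Kd h y (X r \<omega> - a))\<bar> \<le>
               A0 * (2 * y) powr hol * corr s r"
              using elim \<open>s \<noteq> 0\<close> by (intro Kd_two_point_sym h y) auto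
            moreover have "\<bar>wt t r * wt t s\<bar> \<le> CH * CH"
              unfolding abs_mult using wt_bounds[OF t(2), of r] wt_bounds[OF t(2), of s] True CH_pos by (intro mult_mono) auto
            ultimately have "\<bar>?E r s\<bar> \<le> (CH * CH) * (A0 * (2 * y) powr hol * corr s r)"
              unfolding eq abs_mult[of "wt t r * wt t s"] using CH_pos by (intro mult_mono) auto
            then have "ennreal \<bar>?E r s\<bar> \<le> ennreal (?C * corr s r)"
              by (intro ennreal_leI) (simp add: mult.assoc)
            also have "\<dots> = ennreal ?C * ennreal (corr s r)"
              using CH_pos A0_nonneg by (intro ennreal_mult mult_nonneg_nonneg add_nonneg_nonneg) auto
            finally show ?thesis using True by (simp only: indicator_simps mult_1)
          next
            case False
            then have "wt t r * wt t s = 0" using t by (auto simp: wt_def split: split_indicator)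
            then have "?E r s = 0" unfolding eq by (simp only: mult_zero_left)
            then show ?thesis by simp
          qed
        qed
      qed
    qed
  qed
  also have "\<dots> = (\<integral>\<^sup>+s. ennreal ?C * (\<integral>\<^sup>+r. ennreal (indicator {0..T} s * indicator {0..T} r * corr s r) \<partial>lborel) \<partial>lborel)"
    by (intro nn_integral_cong nn_integral_cmult) measurable
  also have "\<dots> = ennreal ?C * CK"
    unfolding CK_def by (rule nn_integral_cmult) measurable
  finally show ?thesis .
qed

end

section \<open>The weighted local time of the process and its odd difference\<close>

locale fbm_local_time = fbm_version M H T B e W X
  for M :: "'a measure" and H T :: real and B :: "real \<Rightarrow> 'a \<Rightarrow> real"
    and e :: "real \<Rightarrow> 'h::{real_inner, complete_space, second_countable_topology}"
    and W :: "'h \<Rightarrow> 'a \<Rightarrow> real" and X :: "real \<Rightarrow> 'a \<Rightarrow> real" +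
  fixes L :: "real \<Rightarrow> real \<Rightarrow> 'a \<Rightarrow> real"
  assumes local_time: "joint_local_time M T B L"
begin

text \<open>Collects what holds only almost surely about a single sample path, so that the locale
  \<open>occupation\<close> can be instantiated at that sample point.\<close>

definition regular :: "'a \<Rightarrow> bool" where
  "regular \<omega> \<longleftrightarrow> occupation T H (\<lambda>s. X s \<omega>) (\<lambda>x t. L x t \<omega>)"

lemma regular_AE: "AE \<omega> in M. regular \<omega>"
proof -
  have "AE \<omega> in M. continuous_on (UNIV \<times> {0..T}) (\<lambda>(x, t). L x t \<omega>) \<and>
        (\<forall>t\<in>{0..T}. \<forall>\<Phi>::real \<Rightarrow> real.
           \<Phi> \<in> borel_measurable borel \<and> (\<forall>x. 0 \<le> \<Phi> x) \<and> bounded (range \<Phi>) \<longrightarrow>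
           (LINT s:{0..t}|lborel. \<Phi> (B s \<omega>)) = (LINT x|lborel. \<Phi> x * L x t \<omega>))"
    using local_time by (simp add: joint_local_time_def)
  then show ?thesis using X_B
  proof eventually_elim
    case (elim \<omega>)
    show ?case unfolding regular_def
    proof
      fix t and \<Phi> :: "real \<Rightarrow> real"
      assume t: "t \<in> {0..T}" and \<Phi>: "\<Phi> \<in> borel_measurable borel" "\<And>x. 0 \<le> \<Phi> x" "bounded (range \<Phi>)"
      have "(LINT s:{0..t}|lborel. \<Phi> (X s \<omega>)) = (LINT s:{0..t}|lborel. \<Phi> (B s \<omega>))"
        unfolding set_lebesgue_integral_def using elim(2) t
        by (intro Bochner_Integration.integral_cong) (auto split: split_indicator)
      then show "(LINT s:{0..t}|lborel. \<Phi> (X s \<omega>)) = (LINT x|lborel. \<Phi> x * L x t \<omega>)"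
        using elim(1) t \<Phi> by simp
    qed (use H T elim(1) X_cont in auto)
  qed
qed

abbreviation wlt :: "real \<Rightarrow> 'a \<Rightarrow> real \<Rightarrow> real" where
  "wlt t \<omega> x \<equiv> weighted_local_time T H L x t \<omega>"

lemma wlt_wl: "regular \<omega> \<Longrightarrow> weighted_local_time T H L x t \<omega> = occupation.wl T H (\<lambda>x t. L x t \<omega>) t x"
  unfolding regular_def by (simp add: occupation.wl_def weighted_local_time_def)

lemma wlt_continuous: "regular \<omega> \<Longrightarrow> t \<in> {0..T} \<Longrightarrow> continuous_on UNIV (wlt t \<omega>)"
  by (simp only: wlt_wl) (rule occupation.wl_continuous, simp_all add: regular_def)

lemma wlt_measurable: "regular \<omega> \<Longrightarrow> t \<in> {0..T} \<Longrightarrow> wlt t \<omega> \<in> borel_measurable borel"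
  using wlt_continuous by (intro borel_measurable_continuous_onI)

lemma wlt_nonneg: "regular \<omega> \<Longrightarrow> t \<in> {0..T} \<Longrightarrow> 0 \<le> wlt t \<omega> x"
  by (simp only: wlt_wl) (rule occupation.wl_nn(2), simp_all add: regular_def)

lemma wlt_occupation_nn:
  assumes "regular \<omega>" "t \<in> {0..T}" "\<Phi> \<in> borel_measurable borel" "\<And>x. 0 \<le> \<Phi> x" "\<And>x. \<Phi> x \<le> K"
  shows "(\<integral>\<^sup>+x. ennreal (\<Phi> x * wlt t \<omega> x) \<partial>lborel) = (\<integral>\<^sup>+s. ennreal (wt t s * \<Phi> (X s \<omega>)) \<partial>lborel)"
  unfolding wlt_wl[OF assms(1)]
  using occupation.wl_occupation_nn[OF assms(1)[unfolded regular_def] assms(2-5)] by (simp add: wt_def mult_ac)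

lemma wt_integrable: "t \<in> {0..T} \<Longrightarrow> integrable lborel (wt t)"
proof (rule Bochner_Integration.integrable_bound)
  show "integrable lborel (\<lambda>s. CH * indicator {0..T} s :: real)" using T by simp
  assume "t \<in> {0..T}"
  then show "AE s in lborel. norm (wt t s) \<le> norm (CH * indicator {0..T} s :: real)"
    using wt_bounds[of t] CH_pos by (intro AE_I2) (auto simp: abs_mult)
qed simp

lemma wt_integral: "t \<in> {0..T} \<Longrightarrow> (LINT s|lborel. wt t s) = t powr (2*H)"
proof -
  assume t: "t \<in> {0..T}"
  have "(\<integral>\<^sup>+s. ennreal (wt t s) \<partial>lborel) = (\<integral>\<^sup>+s. ennreal (2*H) * ennreal (indicator {0..t} s * \<bar>s - 0\<bar> powr (2*H-1)) \<partial>lborel)"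
    using H by (intro nn_integral_cong) (auto simp: wt_def ennreal_mult[symmetric] split: split_indicator)
  also have "\<dots> = ennreal (2*H) * ennreal (t powr (2*H) / (2*H))"
  proof -
    have "sgn t * t powr (2*H) = t powr (2*H)" using t by (cases "t = 0") auto
    then show ?thesis
      using t H by (subst nn_integral_cmult, measurable) (subst nn_integral_abs_powr, auto)
  qed
  also have "\<dots> = ennreal (t powr (2*H))" using H by (simp add: ennreal_mult[symmetric])
  finally show ?thesis using wt_bounds[of t] t by (subst integral_eq_nn_integral) auto
qed

lemma wlt_integrable:
  assumes "regular \<omega>" "t \<in> {0..T}"
  shows "integrable lborel (wlt t \<omega>)" "(LINT x|lborel. wlt t \<omega> x) = t powr (2*H)"
proof -
  have "(\<integral>\<^sup>+x. ennreal (wlt t \<omega> x) \<partial>lborel) = (\<integral>\<^sup>+s. ennreal (wt t s) \<partial>lborel)"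
    using wlt_occupation_nn[OF assms, of "\<lambda>_. 1" 1] by simp
  also have "\<dots> = ennreal (t powr (2*H))"
    using wt_bounds[of t] assms wt_integrable[OF assms(2)] wt_integral[OF assms(2)] by (subst nn_integral_eq_integral) auto
  finally have n: "(\<integral>\<^sup>+x. ennreal (wlt t \<omega> x) \<partial>lborel) = ennreal (t powr (2*H))" .
  have [measurable]: "wlt t \<omega> \<in> borel_measurable borel" using assms by (rule wlt_measurable)
  show "integrable lborel (wlt t \<omega>)"
    using n wlt_nonneg[OF assms] by (intro integrableI_bounded) auto
  show "(LINT x|lborel. wlt t \<omega> x) = t powr (2*H)"
    using n wlt_nonneg[OF assms] by (subst integral_eq_nn_integral) auto
qed

text \<open>Signed kernels are needed later, so the formula for nonnegative test functions is
  extended by splitting into positive and negative parts.\<close>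

lemma wlt_occupation:
  assumes \<omega>: "regular \<omega>" and t: "t \<in> {0..T}" and [measurable]: "\<Phi> \<in> borel_measurable borel" and b: "\<And>x. \<bar>\<Phi> x\<bar> \<le> K"
  shows "integrable lborel (\<lambda>x. \<Phi> x * wlt t \<omega> x)" "integrable lborel (\<lambda>s. wt t s * \<Phi> (X s \<omega>))"
    "(LINT x|lborel. \<Phi> x * wlt t \<omega> x) = (LINT s|lborel. wt t s * \<Phi> (X s \<omega>))"
proof -
  have [measurable]: "wlt t \<omega> \<in> borel_measurable borel" using \<omega> t by (rule wlt_measurable)
  have K: "K \<ge> 0" using b[of 0] by linarith
  have i1: "integrable lborel (\<lambda>x. \<Psi> x * wlt t \<omega> x)" and i2: "integrable lborel (\<lambda>s. wt t s * \<Psi> (X s \<omega>))"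
    if [measurable]: "\<Psi> \<in> borel_measurable borel" and "\<And>x. \<bar>\<Psi> x\<bar> \<le> K" for \<Psi>
  proof -
    show "integrable lborel (\<lambda>x. \<Psi> x * wlt t \<omega> x)"
      by (rule Bochner_Integration.integrable_bound[OF integrable_mult_right[OF wlt_integrable(1)[OF \<omega> t], of K]])
        (use that K in \<open>auto simp: abs_mult intro!: mult_right_mono\<close>)
    show "integrable lborel (\<lambda>s. wt t s * \<Psi> (X s \<omega>))"
      by (rule Bochner_Integration.integrable_bound[OF integrable_mult_left[OF wt_integrable[OF t], of K]])
        (use that K in \<open>auto simp: abs_mult intro!: mult_left_mono\<close>)
  qed
  show "integrable lborel (\<lambda>x. \<Phi> x * wlt t \<omega> x)" "integrable lborel (\<lambda>s. wt t s * \<Phi> (X s \<omega>))"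
    by (rule i1 i2, measurable, rule b)+
  have eq: "(LINT x|lborel. \<Psi> x * wlt t \<omega> x) = (LINT s|lborel. wt t s * \<Psi> (X s \<omega>))"
    if [measurable]: "\<Psi> \<in> borel_measurable borel" and "\<And>x. 0 \<le> \<Psi> x" "\<And>x. \<Psi> x \<le> K" for \<Psi>
    using wlt_occupation_nn[OF \<omega> t that] wlt_nonneg[OF \<omega> t] wt_bounds[of t] t that
    by (subst (1 2) integral_eq_nn_integral) auto
  define P where "P x = max 0 (\<Phi> x)" for x
  define N where "N x = max 0 (- \<Phi> x)" for x
  have PN: "\<Phi> x = P x - N x" "0 \<le> P x" "0 \<le> N x" "P x \<le> K" "N x \<le> K" for x
    using b[of x] K by (auto simp: P_def N_def)
  have [measurable]: "P \<in> borel_measurable borel" "N \<in> borel_measurable borel" unfolding P_def N_def by measurable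
  have "integrable lborel (\<lambda>x. P x * wlt t \<omega> x)" "integrable lborel (\<lambda>x. N x * wlt t \<omega> x)"
    "integrable lborel (\<lambda>s. wt t s * P (X s \<omega>))" "integrable lborel (\<lambda>s. wt t s * N (X s \<omega>))"
    by (intro i1 i2; use PN in auto)+
  then show "(LINT x|lborel. \<Phi> x * wlt t \<omega> x) = (LINT s|lborel. wt t s * \<Phi> (X s \<omega>))"
    unfolding PN(1) left_diff_distrib right_diff_distrib by (simp add: eq PN)
qed

definition WLn :: "real \<Rightarrow> nat \<Rightarrow> real \<Rightarrow> 'a \<Rightarrow> real" where
  "WLn t n x \<omega> = real (Suc n) * (LINT s|lborel. wt t s * indicator {x..x + eps n} (X s \<omega>))"

text \<open>A version jointly measurable in the level and the sample point, built from window
  averages of the path; \<open>L\<close> itself is measurable at each fixed level and time, and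
  continuous only almost surely.\<close>

definition WL :: "real \<Rightarrow> real \<Rightarrow> 'a \<Rightarrow> real" where
  "WL t x \<omega> = lim (\<lambda>n. WLn t n x \<omega>)"

lemma WLn_tendsto:
  assumes \<omega>: "regular \<omega>" and t: "t \<in> {0..T}"
  shows "(\<lambda>n. WLn t n x \<omega>) \<longlonglongrightarrow> weighted_local_time T H L x t \<omega>"
proof -
  have "(LINT y|lborel. indicator {x..x + eps n} y * wlt t \<omega> y) = (LINT s|lborel. wt t s * indicator {x..x + eps n} (X s \<omega>))" for n
    by (rule wlt_occupation(3)[OF \<omega> t, where K=1]) (auto split: split_indicator)
  then show ?thesis using averages_tendsto[OF wlt_continuous[OF \<omega> t], of x] by (simp add: WLn_def)
qed

lemma WL_eq: "regular \<omega> \<Longrightarrow> t \<in> {0..T} \<Longrightarrow> WL t x \<omega> = weighted_local_time T H L x t \<omega>"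
  unfolding WL_def by (rule limI) (rule WLn_tendsto)

lemma WL_measurable [measurable]: "(\<lambda>(x, \<omega>). WL t x \<omega>) \<in> borel_measurable (borel \<Otimes>\<^sub>M M)"
proof -
  have e: "indicator {x..x + h} z = (if x \<le> z \<and> z \<le> x + h then 1 else (0::real))" for x h z :: real
    by (auto simp: indicator_def)
  have "(\<lambda>z. WLn t n (fst z) (snd z)) \<in> borel_measurable (borel \<Otimes>\<^sub>M M)" for n
    unfolding WLn_def e by measurable
  then show ?thesis unfolding WL_def case_prod_unfold by measurable
qed

definition Dd :: "real \<Rightarrow> real \<Rightarrow> real \<Rightarrow> 'a \<Rightarrow> real" where
  "Dd t a y \<omega> = WL t (a + y) \<omega> - WL t (a - y) \<omega>"

lemma Dd_measurable [measurable]: "(\<lambda>(y, \<omega>). Dd t a y \<omega>) \<in> borel_measurable (borel \<Otimes>\<^sub>M M)"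
  unfolding Dd_def by measurable

lemma Dd_measurable_lborel [measurable]: "(\<lambda>(y, \<omega>). Dd t a y \<omega>) \<in> borel_measurable (lborel \<Otimes>\<^sub>M M)"
  using Dd_measurable by (simp cong: measurable_cong_sets)

lemma Dd_measurable_lborel' [measurable]: "(\<lambda>(\<omega>, y). Dd t a y \<omega>) \<in> borel_measurable (M \<Otimes>\<^sub>M lborel)"
  using measurable_compose[OF measurable_pair_swap' Dd_measurable_lborel] by (simp add: case_prod_unfold)

lemma Dd_measurable2 [measurable]: "\<omega> \<in> space M \<Longrightarrow> (\<lambda>y. Dd t a y \<omega>) \<in> borel_measurable borel"
  unfolding Dd_def[abs_def] by measurable

lemma Ih_tendsto:
  assumes \<omega>: "regular \<omega>" and t: "t \<in> {0..T}"
  shows "(\<lambda>n. Ih t a (eps n) y \<omega>) \<longlonglongrightarrow> Dd t a y \<omega>"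
proof -
  have i: "integrable lborel (\<lambda>s. wt t s * indicator {x..x + eps n} (X s \<omega>))" for x n
    by (rule wlt_occupation(2)[OF \<omega> t, where K=1]) (auto split: split_indicator)
  have "Ih t a (eps n) y \<omega> = WLn t n (a + y) \<omega> - WLn t n (a - y) \<omega>" for n
  proof -
    have "Ih t a (eps n) y \<omega> = (LINT s|lborel. real (Suc n) * (wt t s * indicator {a + y..a + y + eps n} (X s \<omega>)) -
        real (Suc n) * (wt t s * indicator {a - y..a - y + eps n} (X s \<omega>)))"
      unfolding Ih_def
    proof (intro Bochner_Integration.integral_cong refl)
      fix s
      have "indicator {y..y + eps n} (X s \<omega> - a) = (indicator {a + y..a + y + eps n} (X s \<omega>) :: real)"
        "indicator {-y..-y + eps n} (X s \<omega> - a) = (indicator {a - y..a - y + eps n} (X s \<omega>) :: real)"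
        by (auto split: split_indicator)
      then show "wt t s * Kd (eps n) y (X s \<omega> - a) = real (Suc n) * (wt t s * indicator {a + y..a + y + eps n} (X s \<omega>)) -
        real (Suc n) * (wt t s * indicator {a - y..a - y + eps n} (X s \<omega>))"
        unfolding Kd_def by (simp only:) (simp add: algebra_simps del: of_nat_Suc)
    qed
    also have "\<dots> = WLn t n (a + y) \<omega> - WLn t n (a - y) \<omega>"
      unfolding WLn_def by (subst Bochner_Integration.integral_diff) (auto intro!: i integrable_mult_right simp del: of_nat_Suc)
    finally show ?thesis .
  qed
  moreover have "(\<lambda>n. WLn t n (a + y) \<omega> - WLn t n (a - y) \<omega>) \<longlonglongrightarrow> Dd t a y \<omega>"
    unfolding Dd_def WL_eq[OF \<omega> t] by (intro tendsto_diff WLn_tendsto \<omega> t)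
  ultimately show ?thesis by (simp only:)
qed

lemma Ih_measurable [measurable]: "Ih t a h y \<in> borel_measurable M"
proof -
  have "(\<lambda>(\<omega>, s). wt t s * Kd h y (X s \<omega> - a)) \<in> borel_measurable (M \<Otimes>\<^sub>M lborel)" by measurable
  then show ?thesis unfolding Ih_def[abs_def] by (rule lborel.borel_measurable_lebesgue_integral)
qed

definition CD :: real where "CD = CH * CH * (A0 * 2 powr hol) * enn2real CK"

lemma CD_nonneg: "CD \<ge> 0" using CH_pos A0_nonneg by (simp add: CD_def)

text \<open>The bound for \<open>Ih\<close> is uniform in the window length, so Fatou's lemma
  transfers it to the limit.\<close>

lemma Dd_second_moment:
  assumes t: "t \<in> {0..T}" and y: "y \<ge> 0"
  shows "L2sq M (Dd t a y) \<le> ennreal (CD * y powr hol)"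
proof -
  have "L2sq M (Dd t a y) = (\<integral>\<^sup>+\<omega>. liminf (\<lambda>n. ennreal ((Ih t a (eps n) y \<omega>)\<^sup>2)) \<partial>M)"
  proof (rule nn_integral_cong_AE)
    show "AE \<omega> in M. ennreal ((Dd t a y \<omega>)\<^sup>2) = liminf (\<lambda>n. ennreal ((Ih t a (eps n) y \<omega>)\<^sup>2))"
      using regular_AE
    proof eventually_elim
      case (elim \<omega>)
      have "(\<lambda>n. ennreal ((Ih t a (eps n) y \<omega>)\<^sup>2)) \<longlonglongrightarrow> ennreal ((Dd t a y \<omega>)\<^sup>2)"
        by (intro tendsto_intros Ih_tendsto elim t)
      then show ?case by (intro lim_imp_Liminf[symmetric]) auto
    qed
  qed
  also have "\<dots> \<le> liminf (\<lambda>n. \<integral>\<^sup>+\<omega>. ennreal ((Ih t a (eps n) y \<omega>)\<^sup>2) \<partial>M)"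
    by (rule nn_integral_liminf) measurable
  also have "\<dots> \<le> ennreal (CH * CH * (A0 * (2 * y) powr hol)) * CK"
    using t y by (intro Liminf_le always_eventually allI Ih_second_moment) auto
  also have "CK = ennreal (enn2real CK)" using CK_finite by simp
  also have "ennreal (CH * CH * (A0 * (2 * y) powr hol)) * ennreal (enn2real CK) = ennreal (CH * CH * (A0 * (2 * y) powr hol) * enn2real CK)"
    using CH_pos A0_nonneg by (intro ennreal_mult[symmetric]) auto
  also have "CH * CH * (A0 * (2 * y) powr hol) * enn2real CK = CD * y powr hol"
    unfolding CD_def using y by (simp add: powr_mult)
  finally show ?thesis .
qed

definition Q :: "real \<Rightarrow> real \<Rightarrow> 'a \<Rightarrow> ennreal" where
  "Q t a \<omega> = (\<integral>\<^sup>+y. ennreal (indicator {0..1} y * (\<bar>Dd t a y \<omega>\<bar> / y)) \<partial>lborel)"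

lemma Q_measurable [measurable]: "Q t a \<in> borel_measurable M"
  unfolding Q_def[abs_def] by measurable

text \<open>Cauchy-Schwarz with 1 / y = y powr (p/2) * y powr (q/2). As p > -1, the first factor is
  square integrable near 0; as q + hol = p, the second moment of the odd difference turns the other
  factor into the same integral.\<close>

lemma Q_second_moment:
  assumes t: "t \<in> {0..T}"
  shows "(\<integral>\<^sup>+\<omega>. (Q t a \<omega>)\<^sup>2 \<partial>M) < \<infinity>"
proof -
  interpret LM: pair_sigma_finite lborel M ..
  define p where "p = -1 + hol / 2"
  define q where "q = - (1 + hol / 2)"
  have p: "p > -1" using hol by (simp add: p_def)
  define f where "f y = ennreal (indicator {0..1} y * y powr (p/2))" for y
  define g where "g y \<omega> = ennreal (indicator {0..1} y * (\<bar>Dd t a y \<omega>\<bar> * y powr (q/2)))" for y \<omega>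
  have fm [measurable]: "f \<in> borel_measurable lborel" unfolding f_def by measurable
  have gm [measurable]: "(\<lambda>(y, \<omega>). g y \<omega>) \<in> borel_measurable (lborel \<Otimes>\<^sub>M M)" unfolding g_def by measurable
  have gm1: "(\<lambda>y. g y \<omega>) \<in> borel_measurable lborel" if "\<omega> \<in> space M" for \<omega>
    using that unfolding g_def by measurable
  have sqp: "(y powr (r/2))\<^sup>2 = y powr r" for y r :: real by (simp add: power2_eq_square powr_add[symmetric])
  have f2: "(\<integral>\<^sup>+y. (f y)\<^sup>2 \<partial>lborel) = ennreal (1 / (p+1))"
  proof -
    have "(\<integral>\<^sup>+y. (f y)\<^sup>2 \<partial>lborel) = (\<integral>\<^sup>+y. ennreal (indicator {0..1} y * \<bar>y - 0\<bar> powr p) \<partial>lborel)"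
      by (intro nn_integral_cong) (auto simp: f_def ennreal_power sqp split: split_indicator)
    then show ?thesis using nn_integral_abs_powr[OF p, of 0 1 0] by simp
  qed
  have Qle: "(Q t a \<omega>)\<^sup>2 \<le> ennreal (1 / (p+1)) * (\<integral>\<^sup>+y. (g y \<omega>)\<^sup>2 \<partial>lborel)" if "\<omega> \<in> space M" for \<omega>
  proof -
    have "Q t a \<omega> = (\<integral>\<^sup>+y. f y * g y \<omega> \<partial>lborel)"
      unfolding Q_def
    proof (intro nn_integral_cong)
      fix y :: real
      show "ennreal (indicator {0..1} y * (\<bar>Dd t a y \<omega>\<bar> / y)) = f y * g y \<omega>"
      proof (cases "y \<in> {0<..1}")
        case True
        have "p/2 + q/2 = -1" by (simp add: p_def q_def field_simps)
        then have "y powr (p/2) * y powr (q/2) = 1 / y"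
          using True by (simp add: powr_add[symmetric] powr_minus_divide)
        then have "y powr (p/2) * (\<bar>Dd t a y \<omega>\<bar> * y powr (q/2)) = \<bar>Dd t a y \<omega>\<bar> / y"
          by (metis (no_types, lifting) mult.left_commute mult.right_neutral times_divide_eq_right)
        then show ?thesis using True by (simp add: f_def g_def ennreal_mult[symmetric])
      next
        case False
        then show ?thesis by (cases "y = 0") (auto simp: f_def g_def split: split_indicator)
      qed
    qed
    then show ?thesis using Cauchy_Schwarz_nn_integral[OF fm gm1[OF that]] f2 by simp
  qed
  have "(\<integral>\<^sup>+\<omega>. (Q t a \<omega>)\<^sup>2 \<partial>M) \<le> (\<integral>\<^sup>+\<omega>. ennreal (1 / (p+1)) * (\<integral>\<^sup>+y. (g y \<omega>)\<^sup>2 \<partial>lborel) \<partial>M)"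
    by (intro nn_integral_mono Qle)
  also have "\<dots> = ennreal (1 / (p+1)) * (\<integral>\<^sup>+\<omega>. \<integral>\<^sup>+y. (g y \<omega>)\<^sup>2 \<partial>lborel \<partial>M)"
    by (rule nn_integral_cmult) (unfold g_def, measurable)
  also have "(\<integral>\<^sup>+\<omega>. \<integral>\<^sup>+y. (g y \<omega>)\<^sup>2 \<partial>lborel \<partial>M) = (\<integral>\<^sup>+y. \<integral>\<^sup>+\<omega>. (g y \<omega>)\<^sup>2 \<partial>M \<partial>lborel)"
    by (rule LM.Fubini') measurable
  also have "\<dots> \<le> (\<integral>\<^sup>+y. ennreal CD * ennreal (indicator {0..1} y * \<bar>y - 0\<bar> powr p) \<partial>lborel)"
  proof (rule nn_integral_mono)
    fix y :: real
    show "(\<integral>\<^sup>+\<omega>. (g y \<omega>)\<^sup>2 \<partial>M) \<le> ennreal CD * ennreal (indicator {0..1} y * \<bar>y - 0\<bar> powr p)"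
    proof (cases "y \<in> {0..1}")
      case True
      have "(\<integral>\<^sup>+\<omega>. (g y \<omega>)\<^sup>2 \<partial>M) = (\<integral>\<^sup>+\<omega>. ennreal (y powr q) * ennreal ((Dd t a y \<omega>)\<^sup>2) \<partial>M)"
        using True by (intro nn_integral_cong) (simp add: g_def ennreal_power power_mult_distrib sqp ennreal_mult[symmetric] mult.commute)
      also have "\<dots> = ennreal (y powr q) * L2sq M (Dd t a y)"
        by (rule nn_integral_cmult) measurable
      also have "\<dots> \<le> ennreal (y powr q) * ennreal (CD * y powr hol)"
        using True by (intro mult_left_mono Dd_second_moment t) auto
      also have "\<dots> = ennreal CD * ennreal (y powr q * y powr hol)"
        using CD_nonneg by (simp add: ennreal_mult mult_ac)
      also have "y powr q * y powr hol = y powr p"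
        by (simp add: powr_add[symmetric] p_def q_def)
      finally show ?thesis using True by simp
    qed (simp add: g_def)
  qed
  also have "\<dots> = ennreal CD * ennreal (1 / (p+1))"
    using nn_integral_abs_powr[OF p, of 0 1 0] by (subst nn_integral_cmult) auto
  finally have "(\<integral>\<^sup>+\<omega>. (Q t a \<omega>)\<^sup>2 \<partial>M) \<le> ennreal (1 / (p+1)) * (ennreal CD * ennreal (1 / (p+1)))"
    by (simp add: mult_left_mono)
  also have "\<dots> < \<infinity>" by (simp add: ennreal_mult_less_top)
  finally show ?thesis .
qed

lemma Q_AE_finite: "t \<in> {0..T} \<Longrightarrow> AE \<omega> in M. Q t a \<omega> < \<infinity>"
proof -
  assume t: "t \<in> {0..T}"
  have "(\<integral>\<^sup>+\<omega>. (Q t a \<omega>)\<^sup>2 \<partial>M) \<noteq> \<infinity>" using Q_second_moment[OF t, of a] by auto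
  then have "AE \<omega> in M. (Q t a \<omega>)\<^sup>2 \<noteq> \<infinity>" by (intro nn_integral_PInf_AE) auto
  then show ?thesis by eventually_elim (auto simp: less_top power2_eq_square ennreal_mult_eq_top_iff)
qed

lemma Q_AE_space: "t \<in> {0..T} \<Longrightarrow> AE \<omega> in M. \<omega> \<in> space M \<and> regular \<omega> \<and> Q t a \<omega> < \<infinity>"
  using Q_AE_finite[of t a] regular_AE AE_space by (auto elim: AE_mp)

section \<open>Principal values\<close>

text \<open>Within distance 1 of a the cancellation in the odd difference is needed; beyond it the
  kernel is at most 1 and the two local times themselves serve as majorant, each of total mass t
  powr (2H).\<close>

definition dom :: "real \<Rightarrow> real \<Rightarrow> 'a \<Rightarrow> real \<Rightarrow> real" where
  "dom t a \<omega> y = indicator {0..1} y * (\<bar>Dd t a y \<omega>\<bar> / y) + (WL t (a + y) \<omega> + WL t (a - y) \<omega>)"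

lemma dom_props:
  assumes t: "t \<in> {0..T}" and \<omega>: "\<omega> \<in> space M" "regular \<omega>" "Q t a \<omega> < \<infinity>"
  shows "integrable lborel (dom t a \<omega>)" "(LINT y|lborel. dom t a \<omega> y) = enn2real (Q t a \<omega>) + 2 * t powr (2*H)"
    and "\<And>k y. \<bar>k\<bar> \<le> 1 / \<bar>y\<bar> \<Longrightarrow> \<bar>indicator {0..} y * (Dd t a y \<omega> * k)\<bar> \<le> dom t a \<omega> y"
proof -
  note wi = wlt_integrable[OF \<omega>(2) t]
  have [measurable]: "(\<lambda>y. Dd t a y \<omega>) \<in> borel_measurable borel" using \<omega>(1) by measurable
  have i1: "integrable lborel (\<lambda>y. indicator {0..1} y * (\<bar>Dd t a y \<omega>\<bar> / y))"
    using \<omega>(3) by (intro integrableI_nonneg) (auto simp: Q_def split: split_indicator)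
  have v1: "(LINT y|lborel. indicator {0..1} y * (\<bar>Dd t a y \<omega>\<bar> / y)) = enn2real (Q t a \<omega>)"
    unfolding Q_def by (subst integral_eq_nn_integral) (auto split: split_indicator)
  have i2: "integrable lborel (\<lambda>y. WL t (a + y) \<omega>)" "(LINT y|lborel. WL t (a + y) \<omega>) = t powr (2*H)"
    using lborel_integrable_real_affine[OF wi(1), of 1 a] lborel_integral_real_affine[of 1 "wlt t \<omega>" a] wi(2)
    by (simp_all add: WL_eq[OF \<omega>(2) t])
  have i3: "integrable lborel (\<lambda>y. WL t (a - y) \<omega>)" "(LINT y|lborel. WL t (a - y) \<omega>) = t powr (2*H)"
    using lborel_integrable_real_affine[OF wi(1), of "-1" a] lborel_integral_real_affine[of "-1" "wlt t \<omega>" a] wi(2)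
    by (simp_all add: WL_eq[OF \<omega>(2) t])
  show "integrable lborel (dom t a \<omega>)" unfolding dom_def[abs_def] by (intro Bochner_Integration.integrable_add i1 i2 i3)
  show "(LINT y|lborel. dom t a \<omega> y) = enn2real (Q t a \<omega>) + 2 * t powr (2*H)"
    unfolding dom_def using i1 i2 i3 v1 by simp
  fix k y :: real assume k: "\<bar>k\<bar> \<le> 1 / \<bar>y\<bar>"
  have w0: "0 \<le> WL t x \<omega>" for x unfolding WL_eq[OF \<omega>(2) t] by (rule wlt_nonneg[OF \<omega>(2) t])
  have D: "\<bar>Dd t a y \<omega>\<bar> \<le> WL t (a + y) \<omega> + WL t (a - y) \<omega>"
    unfolding Dd_def using w0[of "a+y"] w0[of "a-y"] by linarith
  have m: "\<bar>Dd t a y \<omega> * k\<bar> \<le> \<bar>Dd t a y \<omega>\<bar> * (1 / \<bar>y\<bar>)" unfolding abs_mult by (intro mult_left_mono k) simp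
  consider "y < 0" | "0 \<le> y" "y \<le> 1" | "1 < y" by linarith
  then show "\<bar>indicator {0..} y * (Dd t a y \<omega> * k)\<bar> \<le> dom t a \<omega> y"
  proof cases
    case 1
    then show ?thesis using w0[of "a+y"] w0[of "a-y"] by (simp add: dom_def)
  next
    case 2
    then show ?thesis using m w0[of "a+y"] w0[of "a-y"] by (simp add: dom_def)
  next
    case 3
    then have "\<bar>Dd t a y \<omega>\<bar> * (1 / \<bar>y\<bar>) \<le> \<bar>Dd t a y \<omega>\<bar> * 1" by (intro mult_left_mono) auto
    then show ?thesis using m D 3 by (simp add: dom_def)
  qed
qed

text \<open>The principal value folded at a: where \<open>Q\<close> is finite this is an absolutely
  convergent integral, free of any truncation.\<close>

definition Cc :: "real \<Rightarrow> real \<Rightarrow> 'a \<Rightarrow> real" where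
  "Cc t a \<omega> = (LINT y|lborel. indicator {0..} y * (Dd t a y \<omega> * (1 / y)))"

lemma Cc_measurable [measurable]: "Cc t a \<in> borel_measurable M"
proof -
  have "(\<lambda>(\<omega>, y). indicator {0..} y * (Dd t a y \<omega> * (1 / y))) \<in> borel_measurable (M \<Otimes>\<^sub>M lborel)" by measurable
  then show ?thesis unfolding Cc_def[abs_def] by (rule lborel.borel_measurable_lebesgue_integral)
qed

abbreviation Dint :: "real \<Rightarrow> real \<Rightarrow> (real \<Rightarrow> real) \<Rightarrow> 'a \<Rightarrow> real" where
  "Dint t a k \<omega> \<equiv> LINT y|lborel. indicator {0..} y * (Dd t a y \<omega> * k y)"

text \<open>The bound does not depend on the kernel and has a finite second moment, which supplies
  the majorants for all later passages to the limit.\<close>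

lemma kernel_integral_bound:
  assumes t: "t \<in> {0..T}" and \<omega>: "\<omega> \<in> space M" "regular \<omega>" "Q t a \<omega> < \<infinity>"
    and [measurable]: "k \<in> borel_measurable borel" and k: "\<And>z. \<bar>k z\<bar> \<le> 1 / \<bar>z\<bar>"
  shows "\<bar>Dint t a k \<omega>\<bar> \<le> enn2real (Q t a \<omega>) + 2 * t powr (2*H)"
proof -
  note d = dom_props[OF t \<omega>]
  have [measurable]: "(\<lambda>y. Dd t a y \<omega>) \<in> borel_measurable borel" using \<omega>(1) by measurable
  have i: "integrable lborel (\<lambda>y. indicator {0..} y * (Dd t a y \<omega> * k y))"
    by (rule Bochner_Integration.integrable_bound[OF d(1)])
      (measurable, unfold real_norm_def, intro AE_I2 order_trans[OF d(3)[OF k] abs_ge_self])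
  have "\<bar>Dint t a k \<omega>\<bar> \<le> (LINT y|lborel. \<bar>indicator {0..} y * (Dd t a y \<omega> * k y)\<bar>)"
    by (rule integral_abs_bound)
  also have "\<dots> \<le> (LINT y|lborel. dom t a \<omega> y)"
    by (intro integral_mono integrable_abs i d k)
  finally show ?thesis by (simp only: d(2))
qed

text \<open>Reflection of the negative half line at a; oddness turns the sum of the two halves into
  the difference of the local times, and it forces k 0 = 0, which settles the origin.\<close>

lemma odd_kernel:
  assumes t: "t \<in> {0..T}" and \<omega>: "regular \<omega>"
    and km [measurable]: "k \<in> borel_measurable borel" and k: "\<And>z. \<bar>k z\<bar> \<le> K" and odd: "\<And>z. k (- z) = - k z"
  shows "(LINT x|lborel. k (x - a) * wlt t \<omega> x) = (Dint t a k \<omega>)"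
proof -
  note wi = wlt_integrable[OF \<omega> t]
  have wm [measurable]: "wlt t \<omega> \<in> borel_measurable borel" by (rule wlt_measurable[OF \<omega> t])
  have i: "integrable lborel (\<lambda>z. g z * wlt t \<omega> (a + c * z))" if [measurable]: "g \<in> borel_measurable borel" and "\<And>z. \<bar>g z\<bar> \<le> K" and "c \<noteq> 0" for g c
  proof (rule Bochner_Integration.integrable_bound)
    show "integrable lborel (\<lambda>z. K * wlt t \<omega> (a + c * z))"
      by (intro integrable_mult_right lborel_integrable_real_affine wi that)
    show "AE z in lborel. norm (g z * wlt t \<omega> (a + c * z)) \<le> norm (K * wlt t \<omega> (a + c * z))"
      using that(2) by (intro AE_I2) (auto simp: abs_mult intro!: mult_right_mono intro: order_trans[OF _ abs_ge_self])
  qed measurable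
  have k0: "k 0 = 0" using odd[of 0] by simp
  have K: "0 \<le> K" using k[of 0] k0 by simp
  have b1: "\<bar>indicator A z * k z\<bar> \<le> K" for A z using k[of z] K by (auto split: split_indicator)
  have "(LINT x|lborel. k (x - a) * wlt t \<omega> x) = (LINT z|lborel. k z * wlt t \<omega> (a + z))"
    using lborel_integral_real_affine[of 1 "\<lambda>x. k (x - a) * wlt t \<omega> x" a] by simp
  also have "\<dots> = (LINT z|lborel. (indicator {0..} z * k z) * wlt t \<omega> (a + 1 * z) + (indicator {..<0} z * k z) * wlt t \<omega> (a + 1 * z))"
    by (intro Bochner_Integration.integral_cong) (auto split: split_indicator)
  also have "\<dots> = (LINT z|lborel. (indicator {0..} z * k z) * wlt t \<omega> (a + 1 * z)) + (LINT z|lborel. (indicator {..<0} z * k z) * wlt t \<omega> (a + 1 * z))"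
    by (intro Bochner_Integration.integral_add i b1) auto
  also have "(LINT z|lborel. (indicator {..<0} z * k z) * wlt t \<omega> (a + 1 * z)) = (LINT z|lborel. (indicator {..<0} (- z) * k (- z)) * wlt t \<omega> (a + (-1) * z))"
    using lborel_integral_real_affine[of "-1" "\<lambda>z. (indicator {..<0} z * k z) * wlt t \<omega> (a + 1 * z)" 0] by simp
  also have "\<dots> = (LINT z|lborel. - ((indicator {0..} z * k z) * wlt t \<omega> (a + (-1) * z)))"
  proof (intro Bochner_Integration.integral_cong refl)
    fix z :: real
    show "(indicator {..<0} (- z) * k (- z)) * wlt t \<omega> (a + (-1) * z) = - ((indicator {0..} z * k z) * wlt t \<omega> (a + (-1) * z))"
      by (cases "z = 0") (simp_all add: k0 odd split: split_indicator)
  qed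
  also have "\<dots> = - (LINT z|lborel. (indicator {0..} z * k z) * wlt t \<omega> (a + (-1) * z))" by simp
  also have "(LINT z|lborel. (indicator {0..} z * k z) * wlt t \<omega> (a + 1 * z)) + \<dots> =
     (LINT z|lborel. (indicator {0..} z * k z) * wlt t \<omega> (a + 1 * z) - (indicator {0..} z * k z) * wlt t \<omega> (a + (-1) * z))"
  proof -
    have "integrable lborel (\<lambda>z. (indicator {0..} z * k z) * wlt t \<omega> (a + c * z))" if "c \<noteq> 0" for c
      by (rule i[OF _ b1 that]) measurable
    from Bochner_Integration.integral_diff[OF this[of 1] this[of "-1"]] show ?thesis by simp
  qed
  also have "\<dots> = (Dint t a k \<omega>)"
    by (intro Bochner_Integration.integral_cong refl) (simp add: Dd_def WL_eq[OF \<omega> t] algebra_simps)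
  finally show ?thesis .
qed

text \<open>Measurable kernels below 1 / |z| that tend to 1 / z on the positive half line share the
  majorant \<open>dom\<close>. This is why the Ito correction and the truncated integrals have the
  same limit.\<close>

lemma kernel_integral_tendsto:
  assumes t: "t \<in> {0..T}" and \<omega>: "\<omega> \<in> space M" "regular \<omega>" "Q t a \<omega> < \<infinity>"
    and km: "\<And>n. k n \<in> borel_measurable borel" and k: "\<And>n z. \<bar>k n z\<bar> \<le> 1 / \<bar>z\<bar>"
    and lim: "\<And>z. z > 0 \<Longrightarrow> (\<lambda>n. k n z) \<longlonglongrightarrow> 1 / z"
  shows "(\<lambda>n. Dint t a (k n) \<omega>) \<longlonglongrightarrow> Cc t a \<omega>"
  unfolding Cc_def
proof (rule integral_dominated_convergence[where w="dom t a \<omega>"])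
  note d = dom_props[OF t \<omega>]
  have Dm [measurable]: "(\<lambda>y. Dd t a y \<omega>) \<in> borel_measurable borel" using \<omega>(1) by measurable
  note km[measurable]
  show "integrable lborel (dom t a \<omega>)" by (rule d)
  show "AE y in lborel. norm (indicator {0..} y * (Dd t a y \<omega> * k n y)) \<le> dom t a \<omega> y" for n
    unfolding real_norm_def by (intro AE_I2 d k)
  have "AE y::real in lborel. y \<noteq> 0" by (rule AE_lborel_singleton)
  then show "AE y in lborel. (\<lambda>n. indicator {0..} y * (Dd t a y \<omega> * k n y)) \<longlonglongrightarrow> indicator {0..} y * (Dd t a y \<omega> * (1 / y))"
  proof eventually_elim
    case (elim y)
    show ?case
    proof (cases "y > 0")
      case True
      then show ?thesis by (intro tendsto_mult tendsto_const lim)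
    next
      case False
      then have "indicator {0..} y = (0::real)" using elim by simp
      then show ?thesis by (simp only: mult_zero_left tendsto_const)
    qed
  qed
  have [measurable]: "(\<lambda>y::real. 1 / y) \<in> borel_measurable borel" by (intro borel_measurable_divide) auto
  show "(\<lambda>y. indicator {0..} y * (Dd t a y \<omega> * (1 / y))) \<in> borel_measurable lborel"
    by (intro borel_measurable_times) measurable
  show "(\<lambda>y. indicator {0..} y * (Dd t a y \<omega> * k n y)) \<in> borel_measurable lborel" for n
    by (intro borel_measurable_times) (use Dm km in \<open>auto intro: borel_measurable_indicator\<close>)
qed

definition ktrunc :: "real \<Rightarrow> real \<Rightarrow> real" where
  "ktrunc \<epsilon> z = (if \<epsilon> \<le> \<bar>z\<bar> then 1 / z else 0)"

definition kreg :: "real \<Rightarrow> real \<Rightarrow> real" where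
  "kreg \<epsilon> z = z / (z\<^sup>2 + \<epsilon>\<^sup>2)"

lemma ktrunc_measurable [measurable]: "ktrunc \<epsilon> \<in> borel_measurable borel"
  unfolding ktrunc_def[abs_def] by measurable

lemma kreg_measurable [measurable]: "kreg \<epsilon> \<in> borel_measurable borel"
  unfolding kreg_def[abs_def] by measurable

lemma ktrunc_props:
  assumes "\<epsilon> > 0"
  shows "\<bar>ktrunc \<epsilon> z\<bar> \<le> 1 / \<epsilon>" "\<bar>ktrunc \<epsilon> z\<bar> \<le> 1 / \<bar>z\<bar>" "ktrunc \<epsilon> (- z) = - ktrunc \<epsilon> z"
  using assms by (auto simp: ktrunc_def abs_divide intro!: divide_left_mono)

lemma kreg_props:
  assumes "\<epsilon> > 0"
  shows "\<bar>kreg \<epsilon> z\<bar> \<le> 1 / \<epsilon>" "\<bar>kreg \<epsilon> z\<bar> \<le> 1 / \<bar>z\<bar>" "kreg \<epsilon> (- z) = - kreg \<epsilon> z"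
proof -
  show "\<bar>kreg \<epsilon> z\<bar> \<le> 1 / \<epsilon>" unfolding kreg_def by (rule ell_deriv_bound[OF assms])
  show "kreg \<epsilon> (- z) = - kreg \<epsilon> z" by (simp add: kreg_def)
  show "\<bar>kreg \<epsilon> z\<bar> \<le> 1 / \<bar>z\<bar>"
  proof (cases "z = 0")
    case False
    have "\<bar>kreg \<epsilon> z\<bar> = \<bar>z\<bar> / (z\<^sup>2 + \<epsilon>\<^sup>2)" unfolding kreg_def abs_divide by (simp add: abs_of_nonneg)
    also have "\<dots> \<le> \<bar>z\<bar> / z\<^sup>2" using False assms by (intro divide_left_mono) (auto intro!: mult_pos_pos add_pos_pos)
    also have "\<dots> = 1 / \<bar>z\<bar>" by (simp add: power2_eq_square abs_mult_self_eq[symmetric, of z] del: abs_mult_self_eq)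
    finally show ?thesis .
  qed (simp add: kreg_def)
qed

lemma truncated_integral_kernel:
  assumes t: "t \<in> {0..T}" and \<omega>: "regular \<omega>" and \<epsilon>: "\<epsilon> > 0"
  shows "truncated_integral (wlt t \<omega>) a \<epsilon> = (Dint t a (ktrunc \<epsilon>) \<omega>)"
    and "set_integrable lborel {x. \<epsilon> \<le> \<bar>x - a\<bar>} (\<lambda>x. wlt t \<omega> x / (x - a))"
proof -
  have e: "indicator {x. \<epsilon> \<le> \<bar>x - a\<bar>} x *\<^sub>R (wlt t \<omega> x / (x - a)) = ktrunc \<epsilon> (x - a) * wlt t \<omega> x" for x
    by (auto simp: ktrunc_def split: split_indicator)
  show "truncated_integral (wlt t \<omega>) a \<epsilon> = (Dint t a (ktrunc \<epsilon>) \<omega>)"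
    unfolding truncated_integral_def set_lebesgue_integral_def e
    by (rule odd_kernel[OF t \<omega> ktrunc_measurable ktrunc_props(1)[OF \<epsilon>] ktrunc_props(3)[OF \<epsilon>]])
  show "set_integrable lborel {x. \<epsilon> \<le> \<bar>x - a\<bar>} (\<lambda>x. wlt t \<omega> x / (x - a))"
    unfolding set_integrable_def e
    by (rule wlt_occupation(1)[OF \<omega> t, of "\<lambda>x. ktrunc \<epsilon> (x - a)" "1 / \<epsilon>"]) (use ktrunc_props(1)[OF \<epsilon>] in auto)
qed

lemma ktrunc_tendsto: "(\<And>n. 0 < u n) \<Longrightarrow> u \<longlonglongrightarrow> 0 \<Longrightarrow> z > 0 \<Longrightarrow> (\<lambda>n. ktrunc (u n) z) \<longlonglongrightarrow> 1 / z"
proof -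
  assume u: "u \<longlonglongrightarrow> 0" and z: "z > 0"
  have "\<forall>\<^sub>F n in sequentially. u n < z" using u z by (rule order_tendstoD)
  then have "\<forall>\<^sub>F n in sequentially. ktrunc (u n) z = 1 / z"
    by eventually_elim (use z in \<open>simp add: ktrunc_def\<close>)
  then show ?thesis by (rule tendsto_eventually)
qed

lemma truncated_tendsto:
  assumes t: "t \<in> {0..T}" and \<omega>: "\<omega> \<in> space M" "regular \<omega>" "Q t a \<omega> < \<infinity>"
  shows "(truncated_integral (wlt t \<omega>) a \<longlongrightarrow> Cc t a \<omega>) (at_right 0)"
proof (rule tendsto_at_right_sequentially[of 0 1])
  fix u :: "nat \<Rightarrow> real" assume u: "\<And>n. 0 < u n" "u \<longlonglongrightarrow> 0"
  show "(\<lambda>n. truncated_integral (wlt t \<omega>) a (u n)) \<longlonglongrightarrow> Cc t a \<omega>"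
    unfolding truncated_integral_kernel(1)[OF t \<omega>(2) u(1)]
    by (rule kernel_integral_tendsto[OF t \<omega> ktrunc_measurable ktrunc_props(2)[OF u(1)] ktrunc_tendsto[OF u]])
qed simp

lemma regularized_tendsto:
  assumes t: "t \<in> {0..T}" and \<omega>: "\<omega> \<in> space M" "regular \<omega>" "Q t a \<omega> < \<infinity>"
  shows "(\<lambda>n. LINT y|lborel. indicator {0..} y * (Dd t a y \<omega> * kreg (eps n) y)) \<longlonglongrightarrow> Cc t a \<omega>"
proof (rule kernel_integral_tendsto[OF t \<omega> kreg_measurable])
  show "\<bar>kreg (eps n) z\<bar> \<le> 1 / \<bar>z\<bar>" for n z by (rule kreg_props(2)) simp
  fix z :: real assume z: "z > 0"
  have "(\<lambda>n. kreg (eps n) z) \<longlonglongrightarrow> z / (z\<^sup>2 + 0\<^sup>2)"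
    unfolding kreg_def using z by (intro tendsto_intros LIMSEQ_Suc[OF lim_1_over_n]) auto
  moreover have "z / (z\<^sup>2 + 0\<^sup>2) = 1 / z" using z by (simp add: power2_eq_square)
  ultimately show "(\<lambda>n. kreg (eps n) z) \<longlonglongrightarrow> 1 / z" by (simp only:)
qed

text \<open>The origin of the factor 1/2 in Yamada's formula: the Ito correction weighs time with H
  * s powr (2H - 1), half of the density \<open>wt\<close> behind the weighted local time.\<close>

lemma Zeps_kernel:
  assumes t: "t \<in> {0..T}" and \<omega>: "regular \<omega>" and \<epsilon>: "\<epsilon> > 0"
  shows "Zeps t a \<epsilon> \<omega> = Fell \<epsilon> (X t \<omega> - a) - Fell \<epsilon> (X 0 \<omega> - a) -
    (Dint t a (kreg \<epsilon>) \<omega>) / 2"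
proof -
  have c: "continuous_on {0..t} (\<lambda>s. kreg \<epsilon> (X s \<omega> - a) * s powr (2*H-1))"
    unfolding kreg_def using H
    by (intro continuous_on_mult continuous_on_compose2[OF ell_deriv_continuous[OF \<epsilon>, of UNIV]] continuous_intros X_cont' continuous_on_powr') auto
  have "H * integral {0..t} (\<lambda>s. kreg \<epsilon> (X s \<omega> - a) * s powr (2*H-1)) = H * (LINT s|lborel. indicator {0..t} s * (kreg \<epsilon> (X s \<omega> - a) * s powr (2*H-1)))"
    using set_borel_integral_eq_integral(2)[OF borel_integrable_atLeastAtMost'[OF c]] by (simp add: set_lebesgue_integral_def)
  also have "\<dots> = (LINT s|lborel. wt t s * kreg \<epsilon> (X s \<omega> - a)) / 2"
    by (subst Bochner_Integration.integral_divide_zero[symmetric], subst integral_mult_right_zero[symmetric])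
      (intro Bochner_Integration.integral_cong refl, simp add: wt_def)
  also have "(LINT s|lborel. wt t s * kreg \<epsilon> (X s \<omega> - a)) = (LINT x|lborel. kreg \<epsilon> (x - a) * wlt t \<omega> x)"
    by (rule wlt_occupation(3)[OF \<omega> t, of "\<lambda>x. kreg \<epsilon> (x - a)" "1 / \<epsilon>", symmetric]) (use kreg_props(1)[OF \<epsilon>] in auto)
  also have "\<dots> = (Dint t a (kreg \<epsilon>) \<omega>)"
    by (rule odd_kernel[OF t \<omega> kreg_measurable kreg_props(1)[OF \<epsilon>] kreg_props(3)[OF \<epsilon>]])
  finally show ?thesis unfolding Zeps_def kreg_def by simp
qed

end

section \<open>Uniqueness of the divergence\<close>

text \<open>The completion contains every subset of the space that agrees almost everywhere with a
  measurable set.\<close>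

lemma AE_eq_measurable_completion:
  fixes f :: "'a \<Rightarrow> real"
  assumes f: "f \<in> borel_measurable M" and ae: "AE x in M. g x = f x"
  shows "g \<in> borel_measurable (completion M)"
proof (rule measurableI)
  fix S :: "real set" assume S: "S \<in> sets borel"
  have A: "f -` S \<inter> space M \<in> sets (completion M)"
    using measurable_sets[OF measurable_completion[OF f] S] by simp
  have "AE x in completion M. x \<in> f -` S \<inter> space M \<longleftrightarrow> x \<in> g -` S \<inter> space (completion M)"
    using AE_completion[OF ae] by eventually_elim simp
  from completion.in_sets_AE[OF this A] show "g -` S \<inter> space (completion M) \<in> sets (completion M)"
    by auto
qed simp

lemma nn_integral_square_add:
  assumes [measurable]: "f \<in> borel_measurable M" "g \<in> borel_measurable M"
    and "L2sq M f < \<infinity>" "L2sq M g < \<infinity>"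
  shows "L2sq M (\<lambda>\<omega>. f \<omega> + g \<omega>) < \<infinity>"
proof -
  have sq: "(x + y)\<^sup>2 \<le> 2 * x\<^sup>2 + 2 * y\<^sup>2" for x y :: real
    using zero_le_power2[of "x - y"] by (simp add: power2_sum power2_diff)
  have "L2sq M (\<lambda>\<omega>. f \<omega> + g \<omega>) \<le> (\<integral>\<^sup>+\<omega>. 2 * ennreal ((f \<omega>)\<^sup>2) + 2 * ennreal ((g \<omega>)\<^sup>2) \<partial>M)"
  proof (rule nn_integral_mono)
    fix \<omega>
    have "ennreal ((f \<omega> + g \<omega>)\<^sup>2) \<le> ennreal (2 * (f \<omega>)\<^sup>2 + 2 * (g \<omega>)\<^sup>2)" by (intro ennreal_leI sq)
    then show "ennreal ((f \<omega> + g \<omega>)\<^sup>2) \<le> 2 * ennreal ((f \<omega>)\<^sup>2) + 2 * ennreal ((g \<omega>)\<^sup>2)"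
      by (simp add: ennreal_plus ennreal_mult)
  qed
  also have "\<dots> = 2 * L2sq M f + 2 * L2sq M g"
    by (simp add: nn_integral_add nn_integral_cmult)
  also have "\<dots> < \<infinity>" using assms(3,4) by (simp add: ennreal_mult_less_top)
  finally show ?thesis .
qed

text \<open>The variables of interest are only almost surely equal to measurable ones, so the
  hypotheses speak about measurable versions X' and Y'. The limit is dominated convergence along
  sequences tending to 0 from the right.\<close>

lemma L2_limit_at_zeroI:
  assumes M: "sigma_finite_measure M"
    and X'm: "\<And>\<epsilon>. X' \<epsilon> \<in> borel_measurable M" and Y'm: "Y' \<in> borel_measurable M" and bm: "b \<in> borel_measurable M"
    and X: "\<And>\<epsilon>. \<epsilon> > 0 \<Longrightarrow> AE \<omega> in M. X \<epsilon> \<omega> = X' \<epsilon> \<omega>" and Y: "AE \<omega> in M. Y \<omega> = Y' \<omega>"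
    and bnd: "\<And>\<epsilon>. \<epsilon> > 0 \<Longrightarrow> AE \<omega> in M. \<bar>X' \<epsilon> \<omega>\<bar> \<le> b \<omega>"
    and lim: "AE \<omega> in M. ((\<lambda>\<epsilon>. X' \<epsilon> \<omega>) \<longlongrightarrow> Y' \<omega>) (at_right 0)"
    and b: "L2sq M b < \<infinity>"
  shows "L2_limit_at_zero M X Y"
proof -
  note [measurable] = X'm Y'm bm
  have lims: "AE \<omega> in M. (\<lambda>n. X' (u n) \<omega>) \<longlonglongrightarrow> Y' \<omega>" if "\<And>n. 0 < u n" "u \<longlonglongrightarrow> 0" for u
  proof -
    have u: "filterlim u (at_right 0) sequentially"
      unfolding filterlim_at using that by (auto intro!: always_eventually simp: less_imp_neq[symmetric])
    show ?thesis using lim by eventually_elim (rule filterlim_compose[OF _ u])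
  qed
  have bs: "AE \<omega> in M. \<forall>n. \<bar>X' (u n) \<omega>\<bar> \<le> b \<omega>" if "\<And>n. 0 < u n" for u :: "nat \<Rightarrow> real"
    unfolding AE_all_countable using bnd[OF that] by blast
  have inv: "(\<lambda>n. eps n) \<longlonglongrightarrow> 0" by (rule LIMSEQ_Suc[OF lim_1_over_n])
  have pos: "0 < eps n" for n by simp
  have Yb: "AE \<omega> in M. \<bar>Y' \<omega>\<bar> \<le> b \<omega>"
    using lims[of "\<lambda>n. eps n", OF pos inv] bs[of "\<lambda>n. eps n", OF pos]
  proof eventually_elim
    case (elim \<omega>)
    then show ?case by (intro LIMSEQ_le_const2[OF tendsto_rabs[OF elim(1)]]) auto
  qed
  have sq: "square_integrable M Z" if Z: "AE \<omega> in M. Z \<omega> = Z' \<omega>" "AE \<omega> in M. \<bar>Z' \<omega>\<bar> \<le> b \<omega>" and Zm: "Z' \<in> borel_measurable M" for Z Z'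
  proof -
    have "(\<integral>\<^sup>+\<omega>. ennreal ((Z \<omega>)\<^sup>2) \<partial>completion M) \<le> L2sq M b"
      unfolding nn_integral_completion
    proof (rule nn_integral_mono_AE)
      show "AE \<omega> in M. ennreal ((Z \<omega>)\<^sup>2) \<le> ennreal ((b \<omega>)\<^sup>2)"
        using Z
      proof eventually_elim
        case (elim \<omega>)
        then have "\<bar>Z \<omega>\<bar> \<le> \<bar>b \<omega>\<bar>" by simp
        then show ?case by (intro ennreal_leI) (simp add: abs_le_square_iff)
      qed
    qed
    with b AE_eq_measurable_completion[OF Zm Z(1)] show ?thesis
      unfolding square_integrable_def using le_less_trans by blast
  qed
  have "((\<lambda>\<epsilon>. \<integral>\<^sup>+\<omega>. ennreal ((X \<epsilon> \<omega> - Y \<omega>)\<^sup>2) \<partial>completion M) \<longlongrightarrow> 0) (at_right 0)"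
  proof (rule tendsto_at_right_sequentially[of 0 1])
    fix u :: "nat \<Rightarrow> real" assume u: "\<And>n. 0 < u n" "u \<longlonglongrightarrow> 0"
    have "(\<lambda>n. \<integral>\<^sup>+\<omega>. ennreal ((X' (u n) \<omega> - Y' \<omega>)\<^sup>2) \<partial>M) \<longlonglongrightarrow> (\<integral>\<^sup>+\<omega>. 0 \<partial>M)"
    proof (rule nn_integral_dominated_convergence[where w="\<lambda>\<omega>. 4 * ennreal ((b \<omega>)\<^sup>2)"])
      show "AE \<omega> in M. ennreal ((X' (u n) \<omega> - Y' \<omega>)\<^sup>2) \<le> 4 * ennreal ((b \<omega>)\<^sup>2)" for n
        using bnd[OF u(1), of n] Yb
      proof eventually_elim
        case (elim \<omega>)
        then have "\<bar>X' (u n) \<omega> - Y' \<omega>\<bar> \<le> \<bar>2 * b \<omega>\<bar>" by linarith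
        then have "(X' (u n) \<omega> - Y' \<omega>)\<^sup>2 \<le> 4 * (b \<omega>)\<^sup>2" by (simp add: abs_le_square_iff power_mult_distrib)
        then have "ennreal ((X' (u n) \<omega> - Y' \<omega>)\<^sup>2) \<le> ennreal (4 * (b \<omega>)\<^sup>2)" by (rule ennreal_leI)
        then show ?case by (simp add: ennreal_mult)
      qed
      show "(\<integral>\<^sup>+\<omega>. 4 * ennreal ((b \<omega>)\<^sup>2) \<partial>M) < \<infinity>"
        using b by (subst nn_integral_cmult) (auto simp: ennreal_mult_less_top)
      show "AE \<omega> in M. (\<lambda>n. ennreal ((X' (u n) \<omega> - Y' \<omega>)\<^sup>2)) \<longlonglongrightarrow> 0"
        using lims[OF u]
      proof eventually_elim
        case (elim \<omega>)
        have "(\<lambda>n. ennreal ((X' (u n) \<omega> - Y' \<omega>)\<^sup>2)) \<longlonglongrightarrow> ennreal ((Y' \<omega> - Y' \<omega>)\<^sup>2)"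
          by (intro tendsto_intros elim)
        then show ?case by simp
      qed
    qed measurable
    moreover have "(\<integral>\<^sup>+\<omega>. ennreal ((X (u n) \<omega> - Y \<omega>)\<^sup>2) \<partial>completion M) = L2sq M (\<lambda>\<omega>. X' (u n) \<omega> - Y' \<omega>)" for n
      unfolding nn_integral_completion
    proof (rule nn_integral_cong_AE)
      show "AE \<omega> in M. ennreal ((X (u n) \<omega> - Y \<omega>)\<^sup>2) = ennreal ((X' (u n) \<omega> - Y' \<omega>)\<^sup>2)"
        using X[OF u(1), of n] Y by eventually_elim simp
    qed
    ultimately show "(\<lambda>n. \<integral>\<^sup>+\<omega>. ennreal ((X (u n) \<omega> - Y \<omega>)\<^sup>2) \<partial>completion M) \<longlonglongrightarrow> 0" by simp
  qed simp
  then show ?thesis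
    unfolding L2_limit_at_zero_def using sq[OF Y Yb Y'm] sq[OF X bnd X'm] by blast
qed

text \<open>Differentiation multiplies by a coefficient and shifts the phase by a quarter turn, so
  multiples of such cosines are closed under all partial derivatives.\<close>

lemma partial_deriv_cos_linear:
  assumes j: "j < n"
  shows "((\<lambda>s. C * cos ((\<Sum>i<n. l i * (x(j := s)) i) + c)) has_real_derivative
     (C * l j) * cos ((\<Sum>i<n. l i * (x(j := s)) i) + (c + pi / 2))) (at s)" (is ?A)
    and "partial_deriv j (\<lambda>x. C * cos ((\<Sum>i<n. l i * x i) + c)) =
     (\<lambda>x. (C * l j) * cos ((\<Sum>i<n. l i * x i) + (c + pi / 2)))"
proof -
  have S: "(\<Sum>i<n. l i * (x(j := s)) i) = (\<Sum>i<n. l i * x i) + l j * (s - x j)" for x s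
  proof -
    have "(\<Sum>i<n. l i * (x(j := s)) i) = (\<Sum>i<n. l i * x i + (if i = j then l j * (s - x j) else 0))"
      by (intro sum.cong refl) (auto simp: algebra_simps)
    then show ?thesis using j by (simp add: sum.distrib)
  qed
  have shift: "cos (y + (c + pi / 2)) = - sin (y + c)" for y
    using cos_add[of "y + c" "pi / 2"] by (simp add: add.assoc)
  have D: "((\<lambda>s. C * cos ((\<Sum>i<n. l i * (x(j := s)) i) + c)) has_real_derivative
     (C * l j) * cos ((\<Sum>i<n. l i * (x(j := s)) i) + (c + pi / 2))) (at s)" for x s
    unfolding S shift by (auto intro!: derivative_eq_intros)
  show ?A by (rule D)
  show "partial_deriv j (\<lambda>x. C * cos ((\<Sum>i<n. l i * x i) + c)) =
     (\<lambda>x. (C * l j) * cos ((\<Sum>i<n. l i * x i) + (c + pi / 2)))"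
  proof
    fix x :: "nat \<Rightarrow> real"
    show "partial_deriv j (\<lambda>x. C * cos ((\<Sum>i<n. l i * x i) + c)) x = (C * l j) * cos ((\<Sum>i<n. l i * x i) + (c + pi / 2))"
      unfolding partial_deriv_def using DERIV_imp_deriv[OF D[of x "x j"]] by simp
  qed
qed

lemma Cb_infinity_cos_linear: "Cb_infinity n (\<lambda>x. cos ((\<Sum>i<n. l i * x i) + c))"
proof -
  have iter: "\<exists>C c'. foldr partial_deriv js (\<lambda>x. cos ((\<Sum>i<n. l i * x i) + c)) = (\<lambda>x. C * cos ((\<Sum>i<n. l i * x i) + c'))"
    if "set js \<subseteq> {..<n}" for js
    using that
  proof (induction js)
    case Nil
    show ?case by (intro exI[of _ 1] exI[of _ c]) simp
  next
    case (Cons j js)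
    then obtain C c' where IH: "foldr partial_deriv js (\<lambda>x. cos ((\<Sum>i<n. l i * x i) + c)) = (\<lambda>x. C * cos ((\<Sum>i<n. l i * x i) + c'))"
      by auto
    have "foldr partial_deriv (j # js) (\<lambda>x. cos ((\<Sum>i<n. l i * x i) + c)) = (\<lambda>x. (C * l j) * cos ((\<Sum>i<n. l i * x i) + (c' + pi / 2)))"
      using Cons.prems partial_deriv_cos_linear(2)[of j n C l c'] by (simp add: IH)
    then show ?case by blast
  qed
  show ?thesis
    unfolding Cb_infinity_def Let_def
  proof (intro conjI allI impI)
    fix x y :: "nat \<Rightarrow> real" assume "\<forall>i<n. x i = y i"
    then show "cos ((\<Sum>i<n. l i * x i) + c) = cos ((\<Sum>i<n. l i * y i) + c)" by simp
  next
    fix js :: "nat list" assume "set js \<subseteq> {..<n}"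
    then obtain C c' where eq: "foldr partial_deriv js (\<lambda>x. cos ((\<Sum>i<n. l i * x i) + c)) = (\<lambda>x. C * cos ((\<Sum>i<n. l i * x i) + c'))"
      using iter by blast
    show "continuous_on UNIV (foldr partial_deriv js (\<lambda>x. cos ((\<Sum>i<n. l i * x i) + c)))"
      unfolding eq by (intro continuous_intros continuous_on_product_coordinates)
    show "bounded (range (foldr partial_deriv js (\<lambda>x. cos ((\<Sum>i<n. l i * x i) + c))))"
      unfolding eq bounded_iff by (intro exI[of _ "\<bar>C\<bar>"]) (auto simp: abs_mult intro!: mult_left_le)
    fix i x assume "i < n"
    then show "(\<lambda>s. foldr partial_deriv js (\<lambda>x. cos ((\<Sum>i<n. l i * x i) + c)) (x(i := s))) differentiable at (x i)"
      unfolding eq unfolding real_differentiable_def by (intro exI) (rule partial_deriv_cos_linear(1))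
  qed
qed

lemma (in prob_space) expectation_Cauchy_Schwarz:
  assumes [measurable]: "F \<in> borel_measurable M" "G \<in> borel_measurable M"
    and F: "integrable M (\<lambda>\<omega>. (F \<omega>)\<^sup>2)" and G: "integrable M (\<lambda>\<omega>. (G \<omega>)\<^sup>2)"
  shows "\<bar>expectation (\<lambda>\<omega>. F \<omega> * G \<omega>)\<bar> \<le> sqrt (expectation (\<lambda>\<omega>. (F \<omega>)\<^sup>2)) * sqrt (expectation (\<lambda>\<omega>. (G \<omega>)\<^sup>2))"
proof -
  let ?x = "expectation (\<lambda>\<omega>. F \<omega> * G \<omega>)" and ?f = "expectation (\<lambda>\<omega>. (F \<omega>)\<^sup>2)" and ?g = "expectation (\<lambda>\<omega>. (G \<omega>)\<^sup>2)"
  have nn: "0 \<le> ?f" "0 \<le> ?g" by (simp_all add: integral_nonneg_AE)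
  have "ennreal \<bar>?x\<bar> \<le> (\<integral>\<^sup>+\<omega>. ennreal \<bar>F \<omega>\<bar> * ennreal \<bar>G \<omega>\<bar> \<partial>M)"
  proof (cases "integrable M (\<lambda>\<omega>. F \<omega> * G \<omega>)")
    case True
    have "ennreal (norm ?x) \<le> (\<integral>\<^sup>+\<omega>. ennreal (norm (F \<omega> * G \<omega>)) \<partial>M)"
      by (rule integral_norm_bound_ennreal[OF True])
    then show ?thesis by (simp add: abs_mult ennreal_mult)
  qed (simp add: not_integrable_integral_eq)
  then have "(ennreal \<bar>?x\<bar>)\<^sup>2 \<le> (\<integral>\<^sup>+\<omega>. ennreal \<bar>F \<omega>\<bar> * ennreal \<bar>G \<omega>\<bar> \<partial>M)\<^sup>2" by (rule power_mono) simp
  also have "\<dots> \<le> (\<integral>\<^sup>+\<omega>. (ennreal \<bar>F \<omega>\<bar>)\<^sup>2 \<partial>M) * (\<integral>\<^sup>+\<omega>. (ennreal \<bar>G \<omega>\<bar>)\<^sup>2 \<partial>M)"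
    by (rule Cauchy_Schwarz_nn_integral) measurable
  also have "\<dots> = ennreal ?f * ennreal ?g"
    using nn_integral_eq_integral[OF F] nn_integral_eq_integral[OF G] by (simp add: ennreal_power)
  finally have "ennreal (\<bar>?x\<bar>\<^sup>2) \<le> ennreal (?f * ?g)" using nn by (simp add: ennreal_power ennreal_mult)
  then have "?x\<^sup>2 \<le> ?f * ?g" using nn by (subst (asm) ennreal_le_iff) auto
  then have "sqrt (?x\<^sup>2) \<le> sqrt (?f * ?g)" by (rule real_sqrt_le_mono)
  then show ?thesis by (simp add: real_sqrt_mult)
qed

section \<open>Variables determined by the path\<close>

context fbm_setup
begin

abbreviation "GA \<equiv> generated_algebra M T B"

lemma space_GA [simp]: "space GA = space M"
  unfolding generated_algebra_def by (rule space_measure_of) auto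

lemma sets_GA: "sets GA = sigma_sets (space M) {B s -` A \<inter> space M | s A. s \<in> {0..T} \<and> A \<in> sets borel}"
  unfolding generated_algebra_def by (rule sets_measure_of) auto

lemma B_GA: "s \<in> {0..T} \<Longrightarrow> B s \<in> borel_measurable GA"
  by (rule measurableI) (auto simp: sets_GA intro!: sigma_sets.Basic)

lemma subalgebra_GA: "subalgebra M GA"
  unfolding subalgebra_def sets_GA
  by (auto intro!: sets.sigma_sets_subset measurable_sets[OF B_measurable])

lemma GA_measurable: "f \<in> borel_measurable GA \<Longrightarrow> f \<in> borel_measurable M"
  by (rule measurable_from_subalg[OF subalgebra_GA])

text \<open>The generated algebra is the pull-back of the product algebra under the map sending a
  sample point to its path.\<close>

lemma GA_sets_cylinder:
  assumes "A \<in> sets GA"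
  obtains S where "S \<in> sets (PiM {0..T} (\<lambda>_. borel))" "A = {\<omega> \<in> space M. (\<lambda>s\<in>{0..T}. B s \<omega>) \<in> S}"
proof -
  let ?f = "\<lambda>\<omega>. \<lambda>s\<in>{0..T}. B s \<omega>" and ?P = "PiM {0..T} (\<lambda>_. borel :: real measure)"
  have f: "?f \<in> space M \<rightarrow> space ?P" by (auto simp: space_PiM)
  have "sets GA \<subseteq> sets (vimage_algebra (space M) ?f ?P)"
    unfolding sets_GA
  proof (rule sets.sigma_sets_subset', safe)
    fix s and A :: "real set" assume s: "s \<in> {0..T}" and A: "A \<in> sets borel"
    have "(\<lambda>g. g s) -` A \<inter> space ?P \<in> sets ?P"
      using s A by (intro measurable_sets[OF measurable_component_singleton]) auto
    moreover have "B s -` A \<inter> space M = ?f -` ((\<lambda>g. g s) -` A \<inter> space ?P) \<inter> space M"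
      using f s by auto
    ultimately show "B s -` A \<inter> space M \<in> sets (vimage_algebra (space M) ?f ?P)"
      unfolding sets_vimage_algebra2[OF f] by blast
  qed (simp add: sets.top[of "vimage_algebra (space M) ?f ?P", unfolded space_vimage_algebra])
  with assms obtain S where "S \<in> sets ?P" "A = ?f -` S \<inter> space M"
    unfolding sets_vimage_algebra2[OF f] by blast
  then show thesis by (intro that[of S]) auto
qed

text \<open>A cosine of a finite combination of B is almost surely a smooth functional of elements
  \<open>e s\<close>, which supplies the Fourier hypothesis on cylinders. The sets where V is
  positive or negative lie in the generated algebra, hence are cylinders, and testing V on them
  gives the claim.\<close>

lemma GA_orthogonal_eq_0:
  assumes Vm: "V \<in> borel_measurable GA" and V2: "integrable M (\<lambda>\<omega>. (V \<omega>)\<^sup>2)"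
    and orth: "\<And>n f \<phi>. Cb_infinity n f \<Longrightarrow> expectation (\<lambda>\<omega>. smooth_functional W f \<phi> \<omega> * V \<omega>) = 0"
  shows "AE \<omega> in M. V \<omega> = 0"
proof -
  note [measurable] = GA_measurable[OF Vm]
  have V: "integrable M V" by (rule square_integrable_imp_integrable[OF _ V2]) simp
  have fourier: "expectation (\<lambda>\<omega>. V \<omega> * cos ((\<Sum>i\<in>J. l i * B i \<omega>) + c)) = 0"
    if J: "finite J" "J \<subseteq> {0..T}" for J l c
  proof -
    define n where "n = card J"
    obtain f where f: "bij_betw f {0..<n} J" using ex_bij_betw_nat_finite[OF J(1)] unfolding n_def by blast
    have fT: "f i \<in> {0..T}" if "i < n" for i using bij_betwE[OF f] J(2) that by (metis atLeast0LessThan lessThan_iff subsetD)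
    note [measurable] = B_measurable[OF subsetD[OF J(2)]]
    have "AE \<omega> in M. \<forall>i\<in>{..<n}. W (e (f i)) \<omega> = B (f i) \<omega>"
      by (rule AE_finite_allI) (auto intro!: W_e fT)
    then have "AE \<omega> in M. V \<omega> * cos ((\<Sum>i\<in>J. l i * B i \<omega>) + c) =
        smooth_functional W (\<lambda>x. cos ((\<Sum>i<n. l (f i) * x i) + c)) (\<lambda>i. e (f i)) \<omega> * V \<omega>"
    proof eventually_elim
      case (elim \<omega>)
      have "(\<Sum>i\<in>J. l i * B i \<omega>) = (\<Sum>i\<in>{0..<n}. l (f i) * B (f i) \<omega>)"
        by (rule sum.reindex_bij_betw[OF f, symmetric])
      also have "\<dots> = (\<Sum>i<n. l (f i) * W (e (f i)) \<omega>)"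
        unfolding atLeast0LessThan by (intro sum.cong refl) (simp add: elim)
      finally show ?case by (simp add: smooth_functional_def)
    qed
    then have "expectation (\<lambda>\<omega>. V \<omega> * cos ((\<Sum>i\<in>J. l i * B i \<omega>) + c)) =
        expectation (\<lambda>\<omega>. smooth_functional W (\<lambda>x. cos ((\<Sum>i<n. l (f i) * x i) + c)) (\<lambda>i. e (f i)) \<omega> * V \<omega>)"
      by (intro integral_cong_AE) (auto simp: smooth_functional_def)
    then show ?thesis using orth[OF Cb_infinity_cos_linear] by simp
  qed
  have zero: "expectation (\<lambda>\<omega>. V \<omega> * indicator A \<omega>) = 0" if A: "A \<in> sets GA" for A
  proof -
    obtain S where S: "S \<in> sets (PiM {0..T} (\<lambda>_. borel))" "A = {\<omega> \<in> space M. (\<lambda>s\<in>{0..T}. B s \<omega>) \<in> S}"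
      using GA_sets_cylinder[OF A] .
    have "expectation (\<lambda>\<omega>. V \<omega> * indicator S (\<lambda>s\<in>{0..T}. B s \<omega>)) = 0"
      by (rule integral_times_cylinder_eq_0_if_fourier[OF B_measurable V fourier S(1)])
    moreover have "expectation (\<lambda>\<omega>. V \<omega> * indicator A \<omega>) = expectation (\<lambda>\<omega>. V \<omega> * indicator S (\<lambda>s\<in>{0..T}. B s \<omega>))"
      by (intro Bochner_Integration.integral_cong refl) (auto simp: S(2) indicator_def)
    ultimately show ?thesis by simp
  qed
  \<comment> \<open>The sign s treats the positive and the negative set alike; it makes the
    restricted variable nonnegative, so that a vanishing mean forces it to vanish.\<close>
  have half: "AE \<omega> in M. V \<omega> * indicator {\<omega> \<in> space M. 0 < s * V \<omega>} \<omega> = 0" if s: "s = 1 \<or> s = -1" for s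
  proof -
    have A: "{\<omega> \<in> space M. 0 < s * V \<omega>} \<in> sets GA"
      using Vm measurable_sets[OF borel_measurable_times[OF borel_measurable_const[of s] Vm], of "{0<..}"]
      by (simp add: vimage_def Int_def conj_commute)
    have [measurable]: "{\<omega> \<in> space M. 0 < s * V \<omega>} \<in> sets M" by measurable
    let ?V = "\<lambda>\<omega>. V \<omega> * indicator {\<omega> \<in> space M. 0 < s * V \<omega>} \<omega>"
    have i: "integrable M (\<lambda>\<omega>. s * ?V \<omega>)" using V by (intro integrable_mult_right integrable_real_mult_indicator) auto
    have nn: "AE \<omega> in M. 0 \<le> s * ?V \<omega>" by (auto split: split_indicator)
    have "expectation (\<lambda>\<omega>. s * ?V \<omega>) = 0" using zero[OF A] by simp
    then have "AE \<omega> in M. s * ?V \<omega> = 0" using integral_nonneg_eq_0_iff_AE[OF i nn] by blast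
    then show ?thesis by eventually_elim (use s in auto)
  qed
  show ?thesis
    using half[OF disjI1[OF refl]] half[OF disjI2[OF refl]] AE_space
  proof eventually_elim
    case (elim \<omega>)
    then show ?case by (cases "V \<omega>" "0::real" rule: linorder_cases) auto
  qed
qed

lemma inner_e_eqD:
  assumes "\<And>r. r \<in> {0..T} \<Longrightarrow> inner u (e r) = inner v (e r)"
  shows "u = v"
proof -
  have "closed {x. inner (u - v) x = 0}" by (rule closed_hyperplane)
  moreover have "span (e ` {0..T}) \<subseteq> {x. inner (u - v) x = 0}"
    using assms by (intro span_minimal) (auto simp: subspace_def inner_add_right inner_diff_left)
  ultimately have "closure (span (e ` {0..T})) \<subseteq> {x. inner (u - v) x = 0}" by (rule closure_minimal[rotated])
  then have "u - v \<in> {x. inner (u - v) x = 0}" using indicators unfolding indicator_completion_def by blast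
  then show ?thesis by simp
qed

lemma process_element_unique:
  assumes "process_element M T H e v t u" "process_element M T H e v t u'"
  shows "AE \<omega> in M. u \<omega> = u' \<omega>"
  using assms unfolding process_element_def
proof eventually_elim
  case (elim \<omega>)
  then show ?case by (intro inner_e_eqD) (simp add: represents_def)
qed

text \<open>The generated algebra is not completed and X agrees with B only almost surely, so
  measurability with respect to the path is carried along up to null sets; a genuinely measurable
  representative is chosen at the end.\<close>

definition AG :: "('a \<Rightarrow> real) \<Rightarrow> bool" where
  "AG Y \<longleftrightarrow> (\<exists>Y'\<in>borel_measurable GA. AE \<omega> in M. Y \<omega> = Y' \<omega>)"

lemma AG_compose: "h \<in> borel_measurable borel \<Longrightarrow> AG Y \<Longrightarrow> AG (\<lambda>\<omega>. h (Y \<omega>))"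
proof -
  assume h: "h \<in> borel_measurable borel" and "AG Y"
  then obtain Y' where Y': "Y' \<in> borel_measurable GA" "AE \<omega> in M. Y \<omega> = Y' \<omega>" unfolding AG_def by blast
  from Y'(2) have "AE \<omega> in M. h (Y \<omega>) = h (Y' \<omega>)" by eventually_elim simp
  then show ?thesis unfolding AG_def by (rule bexI[OF _ measurable_compose[OF Y'(1) h]])
qed

lemma AG_diff: "AG Y \<Longrightarrow> AG Z \<Longrightarrow> AG (\<lambda>\<omega>. Y \<omega> - Z \<omega>)"
proof -
  assume "AG Y" "AG Z"
  then obtain Y' Z' where Y': "Y' \<in> borel_measurable GA" "AE \<omega> in M. Y \<omega> = Y' \<omega>" "Z' \<in> borel_measurable GA" "AE \<omega> in M. Z \<omega> = Z' \<omega>"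
    unfolding AG_def by blast
  from Y'(2,4) have "AE \<omega> in M. Y \<omega> - Z \<omega> = Y' \<omega> - Z' \<omega>" by eventually_elim simp
  then show ?thesis unfolding AG_def by (rule bexI[OF _ borel_measurable_diff[OF Y'(1,3)]])
qed

lemma AG_sum: "(\<And>k. k < (n::nat) \<Longrightarrow> AG (Y k)) \<Longrightarrow> AG (\<lambda>\<omega>. \<Sum>k<n. Y k \<omega>)"
proof (induction n)
  case 0
  then show ?case by (auto simp: AG_def intro!: bexI[of _ "\<lambda>_. 0"])
next
  case (Suc n)
  have "AG (\<lambda>\<omega>. - Y n \<omega>)" by (rule AG_compose[of uminus]) (auto intro!: Suc.prems)
  then have "AG (\<lambda>\<omega>. (\<Sum>k<n. Y k \<omega>) - (- Y n \<omega>))" using Suc by (intro AG_diff) auto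
  then show ?case by simp
qed

lemma AG_lim:
  assumes Y: "\<And>n. AG (Y n)" and lim: "AE \<omega> in M. (\<lambda>n. Y n \<omega>) \<longlonglongrightarrow> Z \<omega>"
  shows "AG Z"
proof -
  from Y obtain Y' where Y': "\<And>n. Y' n \<in> borel_measurable GA" "\<And>n. AE \<omega> in M. Y n \<omega> = Y' n \<omega>"
    unfolding AG_def by metis
  have "AE \<omega> in M. \<forall>n. Y n \<omega> = Y' n \<omega>" unfolding AE_all_countable using Y'(2) by blast
  with lim have "AE \<omega> in M. Z \<omega> = lim (\<lambda>n. Y' n \<omega>)"
  proof eventually_elim
    case (elim \<omega>)
    then show ?case by (simp add: limI)
  qed
  then show ?thesis unfolding AG_def by (rule bexI[OF _ borel_measurable_lim_metric[OF Y'(1)]])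
qed

end

context fbm_version
begin

lemma AG_X: "s \<in> {0..T} \<Longrightarrow> AG (X s)"
  unfolding AG_def using X_B by (intro bexI[OF _ B_GA], eventually_elim) auto

abbreviation Zsum :: "real \<Rightarrow> real \<Rightarrow> real \<Rightarrow> nat \<Rightarrow> 'a \<Rightarrow> real" where
  "Zsum t a \<epsilon> n \<omega> \<equiv> Fell \<epsilon> (X t \<omega> - a) - Fell \<epsilon> (X 0 \<omega> - a) -
      (\<Sum>k<Suc n. (X (t * real (Suc k) / real (Suc n)) \<omega> - a) / ((X (t * real (Suc k) / real (Suc n)) \<omega> - a)\<^sup>2 + \<epsilon>\<^sup>2) *
        (\<bar>t * real (Suc k) / real (Suc n)\<bar> powr (2*H) / 2 - \<bar>t * real k / real (Suc n)\<bar> powr (2*H) / 2))"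

text \<open>Riemann sums involve X at finitely many times only, which exhibits \<open>Zeps\<close>
  as a limit of variables measurable with respect to the path.\<close>

lemma Zeps_riemann:
  assumes t: "0 \<le> t" and \<epsilon>: "\<epsilon> > 0"
  shows "(\<lambda>n. Zsum t a \<epsilon> n \<omega>) \<longlonglongrightarrow> Zeps t a \<epsilon> \<omega>"
proof -
  have c: "continuous_on {0..t} (\<lambda>s. (X s \<omega> - a) / ((X s \<omega> - a)\<^sup>2 + \<epsilon>\<^sup>2))"
    by (intro continuous_on_compose2[OF ell_deriv_continuous[OF \<epsilon>, of UNIV]] continuous_intros X_cont') auto
  have "integral {0..t} (\<lambda>s. (X s \<omega> - a) / ((X s \<omega> - a)\<^sup>2 + \<epsilon>\<^sup>2) * (H * s powr (2*H-1))) =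
    H * integral {0..t} (\<lambda>s. (X s \<omega> - a) / ((X s \<omega> - a)\<^sup>2 + \<epsilon>\<^sup>2) * s powr (2*H-1))"
    by (subst integral_mult_right[symmetric]) (simp add: mult_ac)
  then show ?thesis
    using tendsto_diff[OF tendsto_const[of "Fell \<epsilon> (X t \<omega> - a) - Fell \<epsilon> (X 0 \<omega> - a)"] weighted_riemann_sum_tendsto[OF t c]]
    unfolding Zeps_def by simp
qed

lemma Fell_measurable [measurable]: "Fell \<epsilon> \<in> borel_measurable borel"
  unfolding Fell_def[abs_def] by measurable

lemma Zeps_measurable [measurable]: "0 \<le> t \<Longrightarrow> \<epsilon> > 0 \<Longrightarrow> Zeps t a \<epsilon> \<in> borel_measurable M"
  by (rule borel_measurable_LIMSEQ_metric[OF _ Zeps_riemann]) measurable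

lemma AG_Zeps:
  assumes t: "0 \<le> t" "t \<le> T" and \<epsilon>: "\<epsilon> > 0"
  shows "AG (Zeps t a \<epsilon>)"
proof (rule AG_lim)
  show "AE \<omega> in M. (\<lambda>n. Zsum t a \<epsilon> n \<omega>) \<longlonglongrightarrow> Zeps t a \<epsilon> \<omega>"
    by (intro AE_I2 Zeps_riemann t \<epsilon>)
  have grid: "t * real (Suc k) / real (Suc n) \<in> {0..T}" if "k < Suc n" for k n
  proof -
    have "t * (real (Suc k) / real (Suc n)) \<le> t * 1" using that t by (intro mult_left_mono) auto
    then show ?thesis using t by simp
  qed
  show "AG (\<lambda>\<omega>. Zsum t a \<epsilon> n \<omega>)" for n
  proof (intro AG_diff AG_sum)
    show "AG (\<lambda>\<omega>. Fell \<epsilon> (X t \<omega> - a))" by (rule AG_compose[of "\<lambda>x. Fell \<epsilon> (x - a)"]) (use t in \<open>auto intro!: AG_X\<close>)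
    show "AG (\<lambda>\<omega>. Fell \<epsilon> (X 0 \<omega> - a))" by (rule AG_compose[of "\<lambda>x. Fell \<epsilon> (x - a)"]) (use T in \<open>auto intro!: AG_X\<close>)
    fix k assume "k < Suc n"
    then show "AG (\<lambda>\<omega>. (X (t * real (Suc k) / real (Suc n)) \<omega> - a) / ((X (t * real (Suc k) / real (Suc n)) \<omega> - a)\<^sup>2 + \<epsilon>\<^sup>2) *
        (\<bar>t * real (Suc k) / real (Suc n)\<bar> powr (2*H) / 2 - \<bar>t * real k / real (Suc n)\<bar> powr (2*H) / 2))"
      by (intro AG_compose[of "\<lambda>x. (x - a) / ((x - a)\<^sup>2 + \<epsilon>\<^sup>2) *
        (\<bar>t * real (Suc k) / real (Suc n)\<bar> powr (2*H) / 2 - \<bar>t * real k / real (Suc n)\<bar> powr (2*H) / 2)" "X (t * real (Suc k) / real (Suc n))"] AG_X grid) measurable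
  qed
qed

text \<open>The majorant \<open>wdom\<close> of \<open>Zeps\<close> grows quadratically in X t and
  has to be square integrable.\<close>

lemma X_fourth_moment:
  assumes t: "t \<in> {0..T}"
  shows "(\<integral>\<^sup>+\<omega>. ennreal ((X t \<omega>)^4) \<partial>M) < \<infinity>"
proof (cases "e t = 0")
  case True
  then have "AE \<omega> in M. X t \<omega> = 0" using W_e_X[OF t] W_0 by (auto elim: eventually_elim2)
  then have "AE \<omega> in M. ennreal ((X t \<omega>)^4) = 0" by eventually_elim simp
  then have "(\<integral>\<^sup>+\<omega>. ennreal ((X t \<omega>)^4) \<partial>M) = (\<integral>\<^sup>+\<omega>. 0 \<partial>M)" by (rule nn_integral_cong_AE)
  then show ?thesis by simp
next
  case False
  let ?\<sigma> = "norm (e t)"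
  have "AE \<omega> in M. ennreal ((X t \<omega>)^4) = ennreal ((W (e t) \<omega>)^4)" using W_e_X[OF t] by eventually_elim simp
  then have "(\<integral>\<^sup>+\<omega>. ennreal ((X t \<omega>)^4) \<partial>M) = (\<integral>\<^sup>+\<omega>. ennreal ((W (e t) \<omega>)^4) \<partial>M)" by (rule nn_integral_cong_AE)
  also have "\<dots> = (\<integral>\<^sup>+x. ennreal (x^4) \<partial>distr M borel (W (e t)))" by (subst nn_integral_distr) auto
  also have "\<dots> = (\<integral>\<^sup>+x. ennreal (normal_density 0 ?\<sigma> x * (x - 0)^4) \<partial>lborel)"
    unfolding W_distr[OF False] by (subst nn_integral_density) (auto simp: ennreal_mult)
  also have "\<dots> < \<infinity>"
    by (subst nn_integral_eq_integral[OF integrable_normal_moment[where \<mu>=0 and k=4]]) (auto simp: False)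
  finally show ?thesis .
qed

end

lemma log_primitive_measurable [measurable]: "log_primitive \<in> borel_measurable borel"
  unfolding log_primitive_def[abs_def] by measurable

lemma log_primitive_bound: "\<bar>log_primitive x\<bar> \<le> x\<^sup>2 + 3"
  using Fell_diff[of 1 x] Fell_quadratic[of 1 x] by (simp add: ell_def power2_eq_square)

section \<open>Identification of the divergence and passage to the principal value\<close>

context fbm_local_time
begin

text \<open>Yamada's formula solved for the Skorohod integral, with \<open>Cc\<close> in place of
  the principal value.\<close>

definition Zlim :: "real \<Rightarrow> real \<Rightarrow> 'a \<Rightarrow> real" where
  "Zlim t a \<omega> = log_primitive (X t \<omega> - a) - log_primitive (- a) - Cc t a \<omega> / 2"

text \<open>The constant 9 consists of 3 from \<open>log_primitive_bound\<close> and 3 from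
  \<open>Fell_diff\<close> at each of the two boundary points. The remaining terms are the square of
  X t - a, bounded by twice the two squares, and half the bound of
  \<open>kernel_integral_bound\<close>.\<close>

definition wdom :: "real \<Rightarrow> real \<Rightarrow> 'a \<Rightarrow> real" where
  "wdom t a \<omega> = 2 * (X t \<omega>)\<^sup>2 + (enn2real (Q t a \<omega>) / 2 + (2 * a\<^sup>2 + 9 + \<bar>log_primitive (- a)\<bar> + t powr (2*H)))"

lemma Zlim_measurable [measurable]: "Zlim t a \<in> borel_measurable M"
  unfolding Zlim_def[abs_def] by measurable

lemma wdom_measurable [measurable]: "wdom t a \<in> borel_measurable M"
  unfolding wdom_def[abs_def] by measurable

lemma Q_bound_L2:
  assumes t: "t \<in> {0..T}"
  shows "L2sq M (\<lambda>\<omega>. enn2real (Q t a \<omega>) / 2 + c) < \<infinity>"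
proof (rule nn_integral_square_add)
  have "L2sq M (\<lambda>\<omega>. enn2real (Q t a \<omega>) / 2) \<le> (\<integral>\<^sup>+\<omega>. (Q t a \<omega>)\<^sup>2 \<partial>M)"
  proof (rule nn_integral_mono)
    fix \<omega>
    have "(enn2real (Q t a \<omega>) / 2)\<^sup>2 \<le> (enn2real (Q t a \<omega>))\<^sup>2" by (intro power_mono) auto
    then have "ennreal ((enn2real (Q t a \<omega>) / 2)\<^sup>2) \<le> (ennreal (enn2real (Q t a \<omega>)))\<^sup>2"
      by (simp add: ennreal_power ennreal_leI)
    also have "\<dots> \<le> (Q t a \<omega>)\<^sup>2" by (intro power_mono) (cases "Q t a \<omega>", auto)
    finally show "ennreal ((enn2real (Q t a \<omega>) / 2)\<^sup>2) \<le> (Q t a \<omega>)\<^sup>2" .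
  qed
  with Q_second_moment[OF t] show "L2sq M (\<lambda>\<omega>. enn2real (Q t a \<omega>) / 2) < \<infinity>"
    by (rule le_less_trans[rotated])
  show "(\<integral>\<^sup>+\<omega>. ennreal (c\<^sup>2) \<partial>M) < \<infinity>" by (simp add: emeasure_space_1)
qed measurable

lemma wdom_L2:
  assumes t: "t \<in> {0..T}"
  shows "L2sq M (wdom t a) < \<infinity>"
  unfolding wdom_def
proof (rule nn_integral_square_add[OF _ _ _ Q_bound_L2[OF t]])
  have "L2sq M (\<lambda>\<omega>. 2 * (X t \<omega>)\<^sup>2) = (\<integral>\<^sup>+\<omega>. 4 * ennreal ((X t \<omega>)^4) \<partial>M)"
    by (intro nn_integral_cong) (simp add: power_mult_distrib ennreal_mult flip: power_mult)
  also have "\<dots> < \<infinity>"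
    using X_fourth_moment[OF t] by (subst nn_integral_cmult) (auto simp: ennreal_mult_less_top)
  finally show "L2sq M (\<lambda>\<omega>. 2 * (X t \<omega>)\<^sup>2) < \<infinity>" .
qed measurable

lemma wdom_integrable:
  assumes t: "t \<in> {0..T}"
  shows "integrable M (\<lambda>\<omega>. (wdom t a \<omega>)\<^sup>2)" "integrable M (wdom t a)"
proof -
  show i: "integrable M (\<lambda>\<omega>. (wdom t a \<omega>)\<^sup>2)"
    using wdom_L2[OF t] by (intro integrableI_bounded) auto
  show "integrable M (wdom t a)" by (rule square_integrable_imp_integrable[OF _ i]) simp
qed

lemma Zeps_bound:
  assumes t: "t \<in> {0..T}" and \<epsilon>: "0 < \<epsilon>" "\<epsilon> \<le> 1"
  shows "AE \<omega> in M. \<bar>Zeps t a \<epsilon> \<omega>\<bar> \<le> wdom t a \<omega>"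
  using Q_AE_space[OF t, of a] X_0
proof eventually_elim
  case (elim \<omega>)
  let ?I = "Dint t a (kreg \<epsilon>) \<omega>"
  have Z: "Zeps t a \<epsilon> \<omega> = Fell \<epsilon> (X t \<omega> - a) - Fell \<epsilon> (- a) - ?I / 2"
    using Zeps_kernel[OF t _ \<epsilon>(1), of \<omega> a] elim by simp
  have I: "\<bar>?I\<bar> \<le> enn2real (Q t a \<omega>) + 2 * t powr (2*H)"
    by (rule kernel_integral_bound[OF t _ _ _ kreg_measurable kreg_props(2)[OF \<epsilon>(1)]]) (use elim in auto)
  have "\<bar>log_primitive (X t \<omega> - a)\<bar> \<le> (X t \<omega> - a)\<^sup>2 + 3" by (rule log_primitive_bound)
  moreover have "(X t \<omega> - a)\<^sup>2 \<le> 2 * (X t \<omega>)\<^sup>2 + 2 * a\<^sup>2"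
    using zero_le_power2[of "X t \<omega> + a"] by (simp add: power2_sum power2_diff)
  ultimately show ?case
    using Fell_diff[OF \<epsilon>(1), of "X t \<omega> - a"] Fell_diff[OF \<epsilon>(1), of "- a"] I \<epsilon>(2) unfolding Z wdom_def by (auto simp: abs_if split: if_splits)
qed

lemma Fell_tendsto: "(\<lambda>k. Fell (eps k) x) \<longlonglongrightarrow> log_primitive x"
proof (rule LIM_zero_cancel, rule tendsto_0_squeeze)
  show "\<bar>Fell (eps k) x - log_primitive x\<bar> \<le> 3 * eps k" for k by (rule Fell_diff) simp
  show "(\<lambda>k. 3 * eps k) \<longlonglongrightarrow> 0" by (rule tendsto_mult_right_zero[OF LIMSEQ_Suc[OF lim_1_over_n]])
qed

lemma Zeps_tendsto:
  assumes t: "t \<in> {0..T}"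
  shows "AE \<omega> in M. (\<lambda>k. Zeps t a (eps k) \<omega>) \<longlonglongrightarrow> Zlim t a \<omega>"
  using Q_AE_space[OF t, of a] X_0
proof eventually_elim
  case (elim \<omega>)
  have Z: "Zeps t a (eps k) \<omega> = Fell (eps k) (X t \<omega> - a) - Fell (eps k) (- a) -
      (LINT y|lborel. indicator {0..} y * (Dd t a y \<omega> * kreg (eps k) y)) / 2" for k
    using Zeps_kernel[OF t _ , of \<omega> "eps k" a] elim by simp
  show ?case
    unfolding Z Zlim_def by (intro tendsto_diff tendsto_divide tendsto_const Fell_tendsto regularized_tendsto[OF t]) (use elim in auto)
qed

lemma Zlim_bound:
  assumes t: "t \<in> {0..T}"
  shows "AE \<omega> in M. \<bar>Zlim t a \<omega>\<bar> \<le> wdom t a \<omega>"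
proof -
  have "AE \<omega> in M. \<forall>k. \<bar>Zeps t a (eps k) \<omega>\<bar> \<le> wdom t a \<omega>"
    unfolding AE_all_countable by (intro allI Zeps_bound t) auto
  with Zeps_tendsto[OF t, of a] show ?thesis
  proof eventually_elim
    case (elim \<omega>)
    then show ?case by (intro LIMSEQ_le_const2[OF tendsto_rabs[OF elim(1)]]) blast
  qed
qed

lemma Zlim_duality:
  assumes t: "t \<in> {0..T}" and g: "Cb_infinity n g"
  shows "expectation (\<lambda>\<omega>. smooth_functional W g \<phi> \<omega> * Zlim t a \<omega>) =
    expectation (\<lambda>\<omega>. inner (malliavin_deriv W n g \<phi> \<omega>) (ulog t a \<omega>))"
proof (rule duality_limit[OF _ _ g _ Zlim_measurable Zeps_tendsto[OF t] wdom_integrable(2)[OF t]])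
  show "AE \<omega> in M. \<bar>Zeps t a (eps k) \<omega>\<bar> \<le> wdom t a \<omega>" for k by (intro Zeps_bound t) auto
  show "Zeps t a (eps k) \<in> borel_measurable M" for k using t by (intro Zeps_measurable) auto
qed (use t in auto)

lemma AG_Zlim: "t \<in> {0..T} \<Longrightarrow> AG (Zlim t a)"
  by (rule AG_lim[OF _ Zeps_tendsto]) (auto intro!: AG_Zeps)

text \<open>Membership in the domain asks for a bound by the L2 norm of the functional. Once the
  duality with Z is known, this is the Cauchy-Schwarz inequality with the L2 norm of Z as
  constant.\<close>

lemma Zlim_divergence:
  assumes t: "t \<in> {0..T}"
  obtains Z where "AE \<omega> in M. Z \<omega> = Zlim t a \<omega>" "is_divergence M T B W (ulog t a) Z"
    "ulog t a \<in> divergence_domain M W"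
proof -
  obtain Z where Zg: "Z \<in> borel_measurable GA" and Z: "AE \<omega> in M. Zlim t a \<omega> = Z \<omega>"
    using AG_Zlim[OF t, of a] by (auto simp: AG_def)
  note [measurable] = GA_measurable[OF Zg]
  have Z2: "integrable M (\<lambda>\<omega>. (Z \<omega>)\<^sup>2)"
  proof (rule Bochner_Integration.integrable_bound[OF wdom_integrable(1)[OF t, of a]])
    show "AE \<omega> in M. norm ((Z \<omega>)\<^sup>2) \<le> norm ((wdom t a \<omega>)\<^sup>2)"
      using Z Zlim_bound[OF t, of a]
    proof eventually_elim
      case (elim \<omega>)
      then have "\<bar>Z \<omega>\<bar> \<le> \<bar>wdom t a \<omega>\<bar>" by simp
      then show ?case by (simp add: abs_le_square_iff)
    qed
  qed measurable
  have dual: "expectation (\<lambda>\<omega>. smooth_functional W f \<phi> \<omega> * Z \<omega>) =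
      expectation (\<lambda>\<omega>. inner (malliavin_deriv W n f \<phi> \<omega>) (ulog t a \<omega>))" if f: "Cb_infinity n f" for n f \<phi>
  proof -
    note [measurable] = smooth_functional_measurable[OF f, of \<phi>]
    have "expectation (\<lambda>\<omega>. smooth_functional W f \<phi> \<omega> * Z \<omega>) = expectation (\<lambda>\<omega>. smooth_functional W f \<phi> \<omega> * Zlim t a \<omega>)"
    proof (rule integral_cong_AE)
      show "AE \<omega> in M. smooth_functional W f \<phi> \<omega> * Z \<omega> = smooth_functional W f \<phi> \<omega> * Zlim t a \<omega>"
        using Z by eventually_elim simp
    qed measurable
    then show ?thesis using Zlim_duality[OF t f] by simp
  qed
  have "is_divergence M T B W (ulog t a) Z"
    unfolding is_divergence_def using Zg Z2 dual by blast
  moreover have "ulog t a \<in> divergence_domain M W"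
  proof -
    have "\<bar>expectation (\<lambda>\<omega>. inner (malliavin_deriv W n f \<phi> \<omega>) (ulog t a \<omega>))\<bar>
        \<le> sqrt (expectation (\<lambda>\<omega>. (Z \<omega>)\<^sup>2)) * sqrt (expectation (\<lambda>\<omega>. (smooth_functional W f \<phi> \<omega>)\<^sup>2))"
      if f: "Cb_infinity n f" for n f \<phi>
    proof -
      note Fm [measurable] = smooth_functional_measurable[OF f, of \<phi>]
      obtain K where K: "K \<ge> 0" "\<And>x. \<bar>f x\<bar> \<le> K" using Cb_infinity_bound[OF f] by metis
      have "integrable M (\<lambda>\<omega>. (smooth_functional W f \<phi> \<omega>)\<^sup>2)"
      proof (rule integrable_const_bound[where B="K\<^sup>2"])
        show "AE \<omega> in M. norm ((smooth_functional W f \<phi> \<omega>)\<^sup>2) \<le> K\<^sup>2"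
          using K by (intro AE_I2) (auto simp: smooth_functional_def abs_le_square_iff[symmetric])
      qed measurable
      from expectation_Cauchy_Schwarz[OF Fm GA_measurable[OF Zg] this Z2] show ?thesis
        unfolding dual[OF f] by (simp add: mult.commute)
    qed
    then show ?thesis
      unfolding divergence_domain_def using t ulog_measurable[of t a] ulog_square_integrable[of t a] by auto
  qed
  moreover have "AE \<omega> in M. Z \<omega> = Zlim t a \<omega>" using Z by eventually_elim simp
  ultimately show thesis using that by blast
qed

abbreviation log_B :: "real \<Rightarrow> real \<Rightarrow> 'a \<Rightarrow> real" where
  "log_B a \<equiv> \<lambda>s \<omega>. ln \<bar>B s \<omega> - a\<bar>"

text \<open>The integral is defined by a choice, so every admissible choice must agree almost surely
  with the candidate: the integrand element is determined by its inner products with the indicators,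
  and two divergences of the same element differ by a variable orthogonal to all smooth
  functionals.\<close>

lemma skorohod_integral_log:
  assumes t: "t \<in> {0..T}"
  shows "skorohod_integrable M T H e W (log_B a) t" (is ?integrable)
    and "AE \<omega> in M. skorohod_integral M T H B e W (log_B a) t \<omega> = Zlim t a \<omega>" (is ?integral)
proof -
  obtain Z where Z: "AE \<omega> in M. Z \<omega> = Zlim t a \<omega>" "is_divergence M T B W (ulog t a) Z"
    "ulog t a \<in> divergence_domain M W" using Zlim_divergence[OF t] .
  have p: "process_element M T H e (log_B a) t (ulog t a)"
    using t by (intro process_element_ulog) auto
  show ?integrable unfolding skorohod_integrable_def using Z(3) p by blast
  define Z' where "Z' = skorohod_integral M T H B e W (log_B a) t"
  have "\<exists>u\<in>divergence_domain M W. process_element M T H e (log_B a) t u \<and> is_divergence M T B W u Z'"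
    unfolding Z'_def skorohod_integral_def
    by (rule someI[where P="\<lambda>Z. \<exists>u\<in>divergence_domain M W. process_element M T H e (log_B a) t u \<and> is_divergence M T B W u Z" and x=Z])
      (intro bexI[where x="ulog t a"] conjI p Z)
  then obtain u where u: "u \<in> divergence_domain M W" "process_element M T H e (log_B a) t u"
      "is_divergence M T B W u Z'" by blast
  have um [measurable]: "u \<in> borel_measurable M" "ulog t a \<in> borel_measurable M"
    using u(1) Z(3) by (auto simp: divergence_domain_def)
  note d = Z(2)[unfolded is_divergence_def] u(3)[unfolded is_divergence_def]
  have m: "Z \<in> borel_measurable GA" "Z' \<in> borel_measurable GA" using d by auto
  note [measurable] = m[THEN GA_measurable]
  have fin: "L2sq M Y < \<infinity>" if "integrable M (\<lambda>\<omega>. (Y \<omega>)\<^sup>2)" for Y :: "'a \<Rightarrow> real"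
    using integrableD(2)[OF that] by (simp add: less_top)
  have "AE \<omega> in M. Z' \<omega> - Z \<omega> = 0"
  proof (rule GA_orthogonal_eq_0)
    show "(\<lambda>\<omega>. Z' \<omega> - Z \<omega>) \<in> borel_measurable GA" using m by simp
    have "L2sq M (\<lambda>\<omega>. Z' \<omega> + - Z \<omega>) < \<infinity>"
      using fin[of Z] fin[of Z'] d by (intro nn_integral_square_add) auto
    then show "integrable M (\<lambda>\<omega>. (Z' \<omega> - Z \<omega>)\<^sup>2)" by (intro integrableI_bounded) auto
    fix n f and \<phi> :: "nat \<Rightarrow> 'h" assume f: "Cb_infinity n f"
    note [measurable] = smooth_functional_measurable[OF f, of \<phi>] malliavin_deriv_measurable[OF f, of \<phi>]
    obtain K where K: "K \<ge> 0" "\<And>x. \<bar>f x\<bar> \<le> K" using Cb_infinity_bound[OF f] by metis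
    have i: "integrable M (\<lambda>\<omega>. smooth_functional W f \<phi> \<omega> * Y \<omega>)"
      if [measurable]: "Y \<in> borel_measurable M" and Y2: "integrable M (\<lambda>\<omega>. (Y \<omega>)\<^sup>2)" for Y
    proof (rule Bochner_Integration.integrable_bound)
      have "integrable M Y" by (rule square_integrable_imp_integrable[OF _ Y2]) simp
      then show "integrable M (\<lambda>\<omega>. K * Y \<omega>)" by simp
      show "AE \<omega> in M. norm (smooth_functional W f \<phi> \<omega> * Y \<omega>) \<le> norm (K * Y \<omega>)"
        using K by (intro AE_I2) (auto simp: smooth_functional_def abs_mult intro!: mult_right_mono)
    qed measurable
    have "expectation (\<lambda>\<omega>. smooth_functional W f \<phi> \<omega> * (Z' \<omega> - Z \<omega>)) =
        expectation (\<lambda>\<omega>. smooth_functional W f \<phi> \<omega> * Z' \<omega>) - expectation (\<lambda>\<omega>. smooth_functional W f \<phi> \<omega> * Z \<omega>)"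
      unfolding right_diff_distrib using d by (intro Bochner_Integration.integral_diff i) auto
    also have "\<dots> = expectation (\<lambda>\<omega>. inner (malliavin_deriv W n f \<phi> \<omega>) (u \<omega>)) -
        expectation (\<lambda>\<omega>. inner (malliavin_deriv W n f \<phi> \<omega>) (ulog t a \<omega>))"
      using d f by simp
    also have "expectation (\<lambda>\<omega>. inner (malliavin_deriv W n f \<phi> \<omega>) (u \<omega>)) =
        expectation (\<lambda>\<omega>. inner (malliavin_deriv W n f \<phi> \<omega>) (ulog t a \<omega>))"
    proof (rule integral_cong_AE)
      show "AE \<omega> in M. inner (malliavin_deriv W n f \<phi> \<omega>) (u \<omega>) = inner (malliavin_deriv W n f \<phi> \<omega>) (ulog t a \<omega>)"
        using process_element_unique[OF u(2) p] by eventually_elim simp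
    qed measurable
    finally show "expectation (\<lambda>\<omega>. smooth_functional W f \<phi> \<omega> * (Z' \<omega> - Z \<omega>)) = 0" by simp
  qed
  with Z(1) show ?integral unfolding Z'_def[symmetric] by eventually_elim simp
qed

text \<open>The boundary terms cancel against those of \<open>Zlim\<close>, and the factor 2 of the
  functional cancels the 1/2 in front of \<open>Cc\<close>.\<close>

lemma yamada_functional_eq:
  assumes t: "t \<in> {0..T}"
  shows "AE \<omega> in M. yamada_functional M T H B e W t a \<omega> = Cc t a \<omega>"
  using skorohod_integral_log(2)[OF t, of a] X_B
proof eventually_elim
  case (elim \<omega>)
  then show ?case using t by (simp add: yamada_functional_def Zlim_def)
qed

lemma pv_weighted_local_time:
  assumes t: "t \<in> {0..T}"
  shows "AE \<omega> in M. pv_exists (wlt t \<omega>) a \<and>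
    pv_integral (wlt t \<omega>) a = Cc t a \<omega> \<and>
    pi * hilbert_transform (wlt t \<omega>) a = Cc t a \<omega>"
  using Q_AE_space[OF t, of a]
proof eventually_elim
  case (elim \<omega>)
  then have lim: "(truncated_integral (wlt t \<omega>) a \<longlongrightarrow> Cc t a \<omega>) (at_right 0)"
    by (intro truncated_tendsto t) auto
  then have "Lim (at_right 0) (truncated_integral (wlt t \<omega>) a) = Cc t a \<omega>"
    by (intro tendsto_Lim) auto
  moreover have "pv_exists (wlt t \<omega>) a"
    unfolding pv_exists_def using lim truncated_integral_kernel(2)[OF t] elim by blast
  ultimately show ?case by (simp add: pv_integral_def hilbert_transform_def)
qed

lemma yamada_functional_pv:
  assumes t: "t \<in> {0..T}"
  shows "AE \<omega> in M. pv_exists (wlt t \<omega>) a \<and>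
    yamada_functional M T H B e W t a \<omega> = pv_integral (wlt t \<omega>) a \<and>
    yamada_functional M T H B e W t a \<omega> = pi * hilbert_transform (wlt t \<omega>) a"
  using yamada_functional_eq[OF t, of a] pv_weighted_local_time[OF t, of a] by eventually_elim simp

lemma L2_limit_truncated:
  assumes t: "t \<in> {0..T}"
  shows "L2_limit_at_zero M (\<lambda>\<epsilon> \<omega>. truncated_integral (wlt t \<omega>) a \<epsilon>)
    (yamada_functional M T H B e W t a)"
proof (rule L2_limit_at_zeroI[OF sigma_finite_measure_axioms _ Cc_measurable _ _ yamada_functional_eq[OF t]])
  let ?X = "\<lambda>\<epsilon> \<omega>. Dint t a (ktrunc \<epsilon>) \<omega>"
  \<comment> \<open>Written as twice a sum so that \<open>Q_bound_L2\<close> applies to the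
    sum.\<close>
  let ?b = "\<lambda>\<omega>. 2 * (enn2real (Q t a \<omega>) / 2 + t powr (2*H))"
  show "?X \<epsilon> \<in> borel_measurable M" for \<epsilon>
  proof -
    have "(\<lambda>(\<omega>, y). indicator {0..} y * (Dd t a y \<omega> * ktrunc \<epsilon> y)) \<in> borel_measurable (M \<Otimes>\<^sub>M lborel)" by measurable
    then show ?thesis by (rule lborel.borel_measurable_lebesgue_integral)
  qed
  show "?b \<in> borel_measurable M" by measurable
  show "AE \<omega> in M. truncated_integral (wlt t \<omega>) a \<epsilon> = ?X \<epsilon> \<omega>" if "\<epsilon> > 0" for \<epsilon>
    using regular_AE by eventually_elim (rule truncated_integral_kernel(1)[OF t _ that])
  show "AE \<omega> in M. \<bar>?X \<epsilon> \<omega>\<bar> \<le> ?b \<omega>" if "\<epsilon> > 0" for \<epsilon>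
    using Q_AE_space[OF t, of a]
  proof eventually_elim
    case (elim \<omega>)
    then show ?case using kernel_integral_bound[OF t _ _ _ ktrunc_measurable ktrunc_props(2)[OF that], of \<omega> a] by simp
  qed
  show "AE \<omega> in M. ((\<lambda>\<epsilon>. ?X \<epsilon> \<omega>) \<longlongrightarrow> Cc t a \<omega>) (at_right 0)"
    using Q_AE_space[OF t, of a]
  proof eventually_elim
    case (elim \<omega>)
    then have "(truncated_integral (wlt t \<omega>) a \<longlongrightarrow> Cc t a \<omega>) (at_right 0)"
      by (intro truncated_tendsto t) auto
    moreover have "\<forall>\<^sub>F \<epsilon> in at_right 0. truncated_integral (wlt t \<omega>) a \<epsilon> = ?X \<epsilon> \<omega>"
      using elim by (auto simp: eventually_at_filter intro!: always_eventually truncated_integral_kernel(1)[OF t])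
    ultimately show ?case by (rule Lim_transform_eventually)
  qed
  have "L2sq M (\<lambda>\<omega>. ?b \<omega>) = (\<integral>\<^sup>+\<omega>. 4 * ennreal ((enn2real (Q t a \<omega>) / 2 + t powr (2*H))\<^sup>2) \<partial>M)"
    by (intro nn_integral_cong) (simp add: power_mult_distrib ennreal_mult del: distrib_left_numeral)
  also have "\<dots> < \<infinity>"
    using Q_bound_L2[OF t, of a "t powr (2*H)"] by (subst nn_integral_cmult) (auto simp: ennreal_mult_less_top)
  finally show "L2sq M (\<lambda>\<omega>. ?b \<omega>) < \<infinity>" .
qed

lemma yamada_formula:
  assumes t: "t \<in> {0..T}"
  shows "AE \<omega> in M. (B t \<omega> - a) * ln \<bar>B t \<omega> - a\<bar> - (B t \<omega> - a) =
        - a * ln \<bar>a\<bar> + a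
        + skorohod_integral M T H B e W (\<lambda>s \<omega>. ln \<bar>B s \<omega> - a\<bar>) t \<omega>
        + 1/2 * pv_integral (wlt t \<omega>) a"
  using skorohod_integral_log(2)[OF t, of a] X_B pv_weighted_local_time[OF t, of a]
proof eventually_elim
  case (elim \<omega>)
  then show ?case using t by (simp add: Zlim_def log_primitive_def)
qed

end

text \<open>Paths are continuous only almost surely and only on [0,T]. They are frozen outside the
  interval and replaced by 0 on a null set containing the exceptional paths, so that Riemann sums
  and occupation integrals converge and are measurable at every sample point.\<close>

lemma (in fbm_setup) continuous_version:
  obtains X where "\<And>s. X s \<in> borel_measurable M" "\<And>\<omega>. continuous_on UNIV (\<lambda>s. X s \<omega>)"
    "AE \<omega> in M. \<forall>s\<in>{0..T}. X s \<omega> = B s \<omega>"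
proof -
  obtain N where N: "\<And>\<omega>. \<omega> \<in> space M - N \<Longrightarrow> continuous_on {0..T} (\<lambda>t. B t \<omega>)" "N \<in> null_sets M"
    using AE_E3[OF B_continuous] by blast
  define X where "X s \<omega> = (if \<omega> \<in> space M - N then B (max 0 (min s T)) \<omega> else 0)" for s \<omega>
  have r: "max 0 (min s T) \<in> {0..T}" for s using T by auto
  show thesis
  proof (rule that[of X])
    fix s
    have "{\<omega> \<in> space M. \<omega> \<in> space M - N} = space M - N" by auto
    with N(2) show "X s \<in> borel_measurable M"
      unfolding X_def[abs_def] using B_measurable[OF r, of s] by (intro measurable_If) auto
  next
    fix \<omega>
    show "continuous_on UNIV (\<lambda>s. X s \<omega>)"
    proof (cases "\<omega> \<in> space M - N")
      case True
      have "continuous_on UNIV (\<lambda>s. B (max 0 (min s T)) \<omega>)"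
        by (rule continuous_on_compose2[OF N(1)[OF True]]) (auto intro!: continuous_intros r simp del: atLeastAtMost_iff)
      with True show ?thesis by (simp add: X_def)
    next
      case False
      then have "(\<lambda>s. X s \<omega>) = (\<lambda>s. 0)" unfolding X_def by (intro ext if_not_P)
      then show ?thesis by (simp only: continuous_on_const)
    qed
  next
    show "AE \<omega> in M. \<forall>s\<in>{0..T}. X s \<omega> = B s \<omega>"
      using AE_not_in[OF N(2)] AE_space by eventually_elim (auto simp: X_def)
  qed
qed

theorem mainTheorem6:
  fixes M :: "'a measure"
    and H T :: real
    and B :: "real \<Rightarrow> 'a \<Rightarrow> real"
    and e :: "real \<Rightarrow> 'h::{real_inner, complete_space, second_countable_topology}"
    and W :: "'h \<Rightarrow> 'a \<Rightarrow> real"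
    and L :: "real \<Rightarrow> real \<Rightarrow> 'a \<Rightarrow> real"
  assumes "prob_space M"
    and "1/2 < H" and "H < 1" and "0 < T"
    and "fractional_brownian_motion M T H B"
    and "indicator_completion M T B e"
    and "isometric_extension M T B e W"
    and "joint_local_time M T B L"
  shows "\<forall>t\<in>{0..T}. \<forall>a::real.
    skorohod_integrable M T H e W (\<lambda>s \<omega>. ln \<bar>B s \<omega> - a\<bar>) t \<and>
    L2_limit_at_zero M
      (\<lambda>\<epsilon> \<omega>. truncated_integral (\<lambda>x. weighted_local_time T H L x t \<omega>) a \<epsilon>)
      (yamada_functional M T H B e W t a) \<and>
    (AE \<omega> in M.
      pv_exists (\<lambda>x. weighted_local_time T H L x t \<omega>) a \<and>
      yamada_functional M T H B e W t a \<omega> =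
        pv_integral (\<lambda>x. weighted_local_time T H L x t \<omega>) a \<and>
      yamada_functional M T H B e W t a \<omega> =
        pi * hilbert_transform (\<lambda>x. weighted_local_time T H L x t \<omega>) a) \<and>
    (AE \<omega> in M.
      (B t \<omega> - a) * ln \<bar>B t \<omega> - a\<bar> - (B t \<omega> - a) =
        - a * ln \<bar>a\<bar> + a
        + skorohod_integral M T H B e W (\<lambda>s \<omega>. ln \<bar>B s \<omega> - a\<bar>) t \<omega>
        + 1/2 * pv_integral (\<lambda>x. weighted_local_time T H L x t \<omega>) a)"
proof -
  interpret prob_space M by fact
  interpret fbm_setup M H T B e W by unfold_locales fact+
  obtain X where X: "\<And>s. X s \<in> borel_measurable M" "\<And>\<omega>. continuous_on UNIV (\<lambda>s. X s \<omega>)"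
    "AE \<omega> in M. \<forall>s\<in>{0..T}. X s \<omega> = B s \<omega>" using continuous_version by blast
  interpret fbm_local_time M H T B e W X L by unfold_locales fact+
  show ?thesis
    by (intro ballI allI conjI skorohod_integral_log(1) L2_limit_truncated yamada_functional_pv yamada_formula)
qed

end
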